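(* Let $K=\mathbf Q(\sqrt{-d})$ ($d$ squarefree positive) have odd class number $h$ and discriminant $D$, and let $f^k_\alpha$ be as in the context. Fix $k\ge 2$ with $k\equiv 1\pmod h$ and $\alpha\in\mathbf Q^\times$. (a) If $d\ne 1$ and $k$ is even: $\delta_2(f^k_\alpha)=\tfrac34$ if $D(\alpha)\in\{1,D\}$; $=\tfrac14$ if $D(\alpha)\in\{-4,4d\}$; $=\tfrac12$ otherwise. (b) If $d\ne 1$ and $k$ is odd: $\delta_2(f^k_\alpha)=1$ if $D(\alpha)\in\{1,D\}$; $=\tfrac12$ if $D(\alpha)\in\{-4,4d\}$; $=\tfrac34$ otherwise. (c) If $d=1$: $\delta_2(f^k_\alpha)=1$ if $D(\alpha)\in\{1,-4\}$; $=\tfrac12$ if $D(\alpha)\in\{\pm 8\}$; $=\tfrac34$ otherwise.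
   Context: $D(\alpha)$ is the discriminant of $\mathbf Q(\sqrt\alpha)$ over $\mathbf Q$ (with $D(\alpha)=1$ if $\alpha$ is a square). For a newform $f=\sum a_nq^n$ with rational coefficients and $m\ge2$, $\delta_m(f)$ is the Dirichlet density of $\{p\equiv 1\pmod m: a_p \text{ is a nonzero } m\text{-th power mod } p\}$ divided by the Dirichlet density of $\{p\equiv 1\pmod m: a_p\not\equiv 0\pmod p\}$. Notation: $\mathcal O$ ring of integers of $K$, $w=\#\mathcal O^\times$; $\varepsilon=2$ if $d=1$, $-1$ if $d\equiv 3\pmod 8$, $1$ if $d\equiv 7\pmod 8$ or $d=2$; $(x/\mathfrak q)_w$ is the $w$-th power residue symbol in $K$. $\psi$ is the Hecke character of $K$ with values in $K^\times$, unramified away from $D$, whose value at each prime $\mathfrak q$ of $\mathcal O$ prime to $D$ is: if $d>3$, the unique generator of $\mathfrak q^h$ which is a square modulo $\sqrt{-d}$; if $d=1$, the unique generator of $\mathfrak q$ congruent to $1$ mod $2+2i$; if $d=3$, the unique generator congruent to $1$ mod $3$; if $d=2$, the unique generator congruent modulo $4\sqrt{-2}$ to one of $1,3,5+\sqrt{-2},7+\sqrt{-2},5+2\sqrt{-2},7+2\sqrt{-2},5+3\sqrt{-2},7+3\sqrt{-2}$. $\psi^k_\alpha$ is the Hecke character unramified away from $D$ and $\alpha$ with $\psi^k_\alpha(\mathfrak q)=\psi(\mathfrak q)^{(k-1)/h}(\varepsilon/\mathfrak q)_w^{(k-1)/h}(\alpha/\mathfrak q)_w$ for primes $\mathfrak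 q$ prime to $D\alpha$. The series $g^k_\alpha=\sum_{(\mathfrak a,D)=(\mathfrak a,\alpha)=1}\psi^k_\alpha(\mathfrak a)q^{N\mathfrak a}$ is a weight $k$ cusp form and eigenform for $T_n$, $n$ prime to $D\alpha$; $f^k_\alpha$ is the associated normalized newform (same coefficients at $n$ prime to $D\alpha$), which has rational coefficients. *)

theory Defs
  imports
    "HOL-Analysis.Analysis"
    "HOL-Algebra.Algebra"
    "HOL-Number_Theory.Number_Theory"
    "HOL-Computational_Algebra.Computational_Algebra"
begin

section \<open>Quadratic fields inside the complex numbers\<close>

definition quad_elem :: "rat \<Rightarrow> rat \<Rightarrow> rat \<Rightarrow> complex" where
  "quad_elem \<alpha> x y = of_rat x + of_rat y * csqrt (of_rat \<alpha>)"

definition quad_field :: "rat \<Rightarrow> complex set" where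
  "quad_field \<alpha> = {quad_elem \<alpha> x y | x y. True}"

definition quad_integers :: "rat \<Rightarrow> complex set" where
  "quad_integers \<alpha> = {z \<in> quad_field \<alpha>. algebraic_int z}"

definition quad_integral_basis :: "rat \<Rightarrow> complex \<Rightarrow> complex \<Rightarrow> bool" where
  "quad_integral_basis \<alpha> u v \<longleftrightarrow> u \<in> quad_integers \<alpha> \<and> v \<in> quad_integers \<alpha> \<and>
     (\<forall>z\<in>quad_integers \<alpha>. \<exists>!c :: int \<times> int. z = of_int (fst c) * u + of_int (snd c) * v)"

text \<open>The discriminant is the squared determinant of the two embeddings applied to an integral
  basis; the second embedding negates the coefficient of the square root.\<close>

definition quad_disc :: "rat \<Rightarrow> int" where
  "quad_disc \<alpha> = (if \<exists>r. \<alpha> = r\<^sup>2 then 1 else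
     (THE D. \<exists>x1 y1 x2 y2.
        quad_integral_basis \<alpha> (quad_elem \<alpha> x1 y1) (quad_elem \<alpha> x2 y2) \<and>
        of_int D = (quad_elem \<alpha> x1 y1 * quad_elem \<alpha> x2 (- y2)
                    - quad_elem \<alpha> x2 y2 * quad_elem \<alpha> x1 (- y1))\<^sup>2))"


section \<open>The imaginary quadratic field of \<open>-d\<close>\<close>

text \<open>Here \<open>K\<close> is the field generated by \<open>\<i> * sqrt d\<close>, with its inclusion in the complex numbers.\<close>

definition OK :: "nat \<Rightarrow> complex ring" where
  "OK d = \<lparr>carrier = quad_integers (- of_nat d), monoid.mult = (*), one = 1,
           ring.zero = 0, ring.add = (+)\<rparr>"

definition sqrt_neg :: "nat \<Rightarrow> complex" where
  "sqrt_neg d = \<i> * of_real (sqrt (real d))"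

definition disc_K :: "nat \<Rightarrow> int" where
  "disc_K d = quad_disc (- of_nat d)"

definition num_units :: "nat \<Rightarrow> nat" where
  "num_units d = card (Units (OK d))"

definition nz_ideals :: "nat \<Rightarrow> complex set set" where
  "nz_ideals d = {I. ideal I (OK d) \<and> I \<noteq> {0}}"

definition nz_primes :: "nat \<Rightarrow> complex set set" where
  "nz_primes d = {Q. primeideal Q (OK d) \<and> Q \<noteq> {0}}"

definition ideal_norm :: "nat \<Rightarrow> complex set \<Rightarrow> nat" where
  "ideal_norm d I = card (carrier (OK d Quot I))"

definition ideal_class_rel :: "nat \<Rightarrow> (complex set \<times> complex set) set" where
  "ideal_class_rel d = {(I, J). I \<in> nz_ideals d \<and> J \<in> nz_ideals d \<and>
     (\<exists>a\<in>carrier (OK d) - {0}. \<exists>b\<in>carrier (OK d) - {0}.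
        ideal_prod (OK d) (cgenideal (OK d) a) I = ideal_prod (OK d) (cgenideal (OK d) b) J)}"

definition class_number :: "nat \<Rightarrow> nat" where
  "class_number d = card (nz_ideals d // ideal_class_rel d)"

definition ideals_coprime :: "nat \<Rightarrow> complex set \<Rightarrow> complex set \<Rightarrow> bool" where
  "ideals_coprime d I J \<longleftrightarrow> I <+>\<^bsub>OK d\<^esub> J = carrier (OK d)"

definition ideal_prime_to :: "nat \<Rightarrow> complex set \<Rightarrow> int \<Rightarrow> bool" where
  "ideal_prime_to d I n \<longleftrightarrow> ideals_coprime d I (cgenideal (OK d) (of_int n))"

text \<open>Being prime to a nonzero rational means being prime to its numerator and its denominator.\<close>

definition num_den :: "rat \<Rightarrow> int" where
  "num_den \<alpha> = fst (quotient_of \<alpha>) * snd (quotient_of \<alpha>)"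


section \<open>Power residue symbols and Hecke characters\<close>

text \<open>The symbol \<open>(x/Q)\<close> of order \<open>w\<close>, for \<open>Q\<close> prime to \<open>w\<close> and \<open>x\<close> a unit at \<open>Q\<close>, is the
  \<open>w\<close>-th root of unity congruent to \<open>x ^ ((N Q - 1) / w)\<close> modulo \<open>Q\<close>. Writing \<open>x = a / b\<close> with
  \<open>a\<close>, \<open>b\<close> outside \<open>Q\<close> avoids working in the local ring.\<close>

definition power_residue :: "nat \<Rightarrow> nat \<Rightarrow> complex \<Rightarrow> complex set \<Rightarrow> complex" where
  "power_residue d w x Q = (THE \<zeta>. \<zeta> \<in> carrier (OK d) \<and> \<zeta> ^ w = 1 \<and>
     (\<exists>a\<in>carrier (OK d) - Q. \<exists>b\<in>carrier (OK d) - Q. x = a / b \<and>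
        a ^ ((ideal_norm d Q - 1) div w) - \<zeta> * b ^ ((ideal_norm d Q - 1) div w) \<in> Q))"

text \<open>A Hecke character modulo \<open>M\<close>, as a function on nonzero integral ideals (extended by 0 to
  those not prime to \<open>M\<close>). The infinity type \<open>\<phi>\<close> is any continuous character of the
  multiplicative group of the completion at the unique archimedean place.\<close>

definition hecke_character_mod ::
    "nat \<Rightarrow> complex set \<Rightarrow> (complex set \<Rightarrow> complex) \<Rightarrow> bool" where
  "hecke_character_mod d M \<rho> \<longleftrightarrow> M \<in> nz_ideals d \<and> \<rho> (carrier (OK d)) = 1 \<and>
     (\<forall>I\<in>nz_ideals d. \<forall>J\<in>nz_ideals d. \<rho> (ideal_prod (OK d) I J) = \<rho> I * \<rho> J) \<and>
     (\<forall>I\<in>nz_ideals d. \<rho> I \<noteq> 0 \<longleftrightarrow> ideals_coprime d I M) \<and>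
     (\<exists>\<phi> :: complex \<Rightarrow> complex. continuous_on (- {0}) \<phi> \<and> (\<forall>x. x \<noteq> 0 \<longrightarrow> \<phi> x \<noteq> 0) \<and>
        (\<forall>x y. x \<noteq> 0 \<longrightarrow> y \<noteq> 0 \<longrightarrow> \<phi> (x * y) = \<phi> x * \<phi> y) \<and>
        (\<forall>x\<in>carrier (OK d) - {0}. x - 1 \<in> M \<longrightarrow> \<rho> (cgenideal (OK d) x) = \<phi> x))"

text \<open>Primitive characters: \<open>M\<close> is the conductor, so \<open>\<rho> Q = 0\<close> exactly at the ramified primes, and
  \<open>\<rho>\<close> is determined by its values at all but finitely many primes.\<close>

definition hecke_character :: "nat \<Rightarrow> (complex set \<Rightarrow> complex) \<Rightarrow> bool" where
  "hecke_character d \<rho> \<longleftrightarrow> (\<exists>M. hecke_character_mod d M \<rho> \<and>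
     (\<forall>M' \<rho>'. M \<subseteq> M' \<longrightarrow> hecke_character_mod d M' \<rho>' \<longrightarrow>
        (\<forall>I\<in>nz_ideals d. ideals_coprime d I M \<longrightarrow> \<rho>' I = \<rho> I) \<longrightarrow> M' = M))"

definition hecke_unramified_at :: "(complex set \<Rightarrow> complex) \<Rightarrow> complex set \<Rightarrow> bool" where
  "hecke_unramified_at \<rho> Q \<longleftrightarrow> \<rho> Q \<noteq> 0"

definition cong_OK :: "nat \<Rightarrow> complex \<Rightarrow> complex \<Rightarrow> complex \<Rightarrow> bool" where
  "cong_OK d m x y \<longleftrightarrow> x - y \<in> cgenideal (OK d) m"

definition psi_generator :: "nat \<Rightarrow> complex set \<Rightarrow> complex \<Rightarrow> bool" where
  "psi_generator d Q x \<longleftrightarrow> x \<in> carrier (OK d) \<and>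
     (if d = 1 then cgenideal (OK d) x = Q \<and> cong_OK d (2 + 2 * \<i>) x 1
      else if d = 2 then cgenideal (OK d) x = Q \<and>
        (\<exists>r\<in>{1, 3, 5 + sqrt_neg 2, 7 + sqrt_neg 2, 5 + 2 * sqrt_neg 2, 7 + 2 * sqrt_neg 2,
             5 + 3 * sqrt_neg 2, 7 + 3 * sqrt_neg 2}. cong_OK d (4 * sqrt_neg 2) x r)
      else if d = 3 then cgenideal (OK d) x = Q \<and> cong_OK d 3 x 1
      else cgenideal (OK d) x = Q [^]\<^bsub>ideals_set (OK d)\<^esub> class_number d \<and>
        (\<exists>y\<in>carrier (OK d). cong_OK d (sqrt_neg d) x (y\<^sup>2)))"

definition is_psi :: "nat \<Rightarrow> (complex set \<Rightarrow> complex) \<Rightarrow> bool" where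
  "is_psi d \<psi> \<longleftrightarrow> hecke_character d \<psi> \<and>
     (\<forall>Q\<in>nz_primes d. ideal_prime_to d Q (disc_K d) \<longrightarrow>
        hecke_unramified_at \<psi> Q \<and> psi_generator d Q (\<psi> Q))"

text \<open>Odd class number forces \<open>d = 1\<close>, \<open>d = 2\<close> or \<open>d mod 4 = 3\<close>.\<close>

definition eps :: "nat \<Rightarrow> complex" where
  "eps d = (if d = 1 then 2 else if d mod 8 = 3 then - 1 else 1)"

text \<open>The power residue symbols only make sense at primes not dividing \<open>num_units d\<close>, so the formula
  is imposed away from these as well. The remaining values, at primes above 2 not dividing
  \<open>disc_K d * num_den \<alpha>\<close>, are those of the unique primitive character with this property; it may be
  ramified there, for instance for \<open>d = 7\<close> and \<open>\<alpha> = -1\<close>.\<close>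

definition is_psi_twist ::
    "nat \<Rightarrow> nat \<Rightarrow> rat \<Rightarrow> (complex set \<Rightarrow> complex) \<Rightarrow> (complex set \<Rightarrow> complex) \<Rightarrow> bool" where
  "is_psi_twist d k \<alpha> \<psi> \<rho> \<longleftrightarrow> hecke_character d \<rho> \<and>
     (\<forall>Q\<in>nz_primes d. ideal_prime_to d Q (disc_K d * num_den \<alpha>) \<and>
          ideal_prime_to d Q (int (num_units d)) \<longrightarrow>
        hecke_unramified_at \<rho> Q \<and>
        \<rho> Q = \<psi> Q ^ ((k - 1) div class_number d)
              * power_residue d (num_units d) (eps d) Q ^ ((k - 1) div class_number d)
              * power_residue d (num_units d) (of_rat \<alpha>) Q)"

text \<open>The \<open>n\<close>-th coefficient of \<open>g\<close>.\<close>

definition g_coeff :: "nat \<Rightarrow> rat \<Rightarrow> (complex set \<Rightarrow> complex) \<Rightarrow> nat \<Rightarrow> complex" where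
  "g_coeff d \<alpha> \<rho> n = (\<Sum>I | I \<in> nz_ideals d \<and> ideal_prime_to d I (disc_K d) \<and>
     ideal_prime_to d I (num_den \<alpha>) \<and> ideal_norm d I = n. \<rho> I)"


section \<open>Newforms\<close>

definition upper_half_plane :: "complex set" where
  "upper_half_plane = {z. Im z > 0}"

definition SL2Z :: "(int^2^2) set" where
  "SL2Z = {A. det A = 1}"

definition Gamma0 :: "nat \<Rightarrow> (int^2^2) set" where
  "Gamma0 N = {A \<in> SL2Z. [A $ 2 $ 1 = 0] (mod int N)}"

definition Gamma1 :: "nat \<Rightarrow> (int^2^2) set" where
  "Gamma1 N = {A \<in> Gamma0 N. [A $ 1 $ 1 = 1] (mod int N) \<and> [A $ 2 $ 2 = 1] (mod int N)}"

definition slash :: "nat \<Rightarrow> (complex \<Rightarrow> complex) \<Rightarrow> int^2^2 \<Rightarrow> complex \<Rightarrow> complex" where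
  "slash k f A z =
     f ((of_int (A $ 1 $ 1) * z + of_int (A $ 1 $ 2)) / (of_int (A $ 2 $ 1) * z + of_int (A $ 2 $ 2)))
     / (of_int (A $ 2 $ 1) * z + of_int (A $ 2 $ 2)) ^ k"

definition cusp_form :: "nat \<Rightarrow> nat \<Rightarrow> (complex \<Rightarrow> complex) \<Rightarrow> bool" where
  "cusp_form k N f \<longleftrightarrow> f holomorphic_on upper_half_plane \<and>
     (\<forall>A\<in>Gamma1 N. \<forall>z\<in>upper_half_plane. slash k f A z = f z) \<and>
     (\<forall>A\<in>SL2Z. (slash k f A \<longlongrightarrow> 0) (filtercomap Im at_top))"

definition q_expansion :: "(complex \<Rightarrow> complex) \<Rightarrow> (nat \<Rightarrow> complex) \<Rightarrow> bool" where
  "q_expansion f a \<longleftrightarrow>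
     (\<forall>z\<in>upper_half_plane. (\<lambda>n. a n * exp (2 * of_real pi * \<i> * of_nat n * z)) sums f z)"

text \<open>The Petersson product on cusp forms for \<open>Gamma1 N\<close>, up to a positive factor: a fundamental
  domain for \<open>Gamma1 N\<close> is covered by translates of the standard one for \<open>SL2Z\<close>, one for each right
  coset; the choice of representative does not matter.\<close>

definition SL2Z_domain :: "complex set" where
  "SL2Z_domain = {z \<in> upper_half_plane. \<bar>Re z\<bar> \<le> 1 / 2 \<and> norm z \<ge> 1}"

definition petersson ::
    "nat \<Rightarrow> nat \<Rightarrow> (complex \<Rightarrow> complex) \<Rightarrow> (complex \<Rightarrow> complex) \<Rightarrow> complex" where
  "petersson k N f g =
     (\<Sum>C\<in>{{B ** A | B. B \<in> Gamma1 N} | A. A \<in> SL2Z}.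
        let A = (SOME A. A \<in> C) in
        set_lebesgue_integral lborel SL2Z_domain
          (\<lambda>z. slash k f A z * cnj (slash k g A z) * of_real (Im z ^ k / Im z ^ 2)))"

definition new_subspace :: "nat \<Rightarrow> nat \<Rightarrow> (complex \<Rightarrow> complex) set" where
  "new_subspace k N = {f. cusp_form k N f \<and>
     (\<forall>M e g. M dvd N \<and> M < N \<and> e dvd N div M \<and> cusp_form k M g \<longrightarrow>
        petersson k N f (\<lambda>z. g (of_nat e * z)) = 0)}"

definition diamond :: "nat \<Rightarrow> nat \<Rightarrow> nat \<Rightarrow> (complex \<Rightarrow> complex) \<Rightarrow> complex \<Rightarrow> complex" where
  "diamond k N n f = slash k f (SOME A. A \<in> Gamma0 N \<and> [A $ 2 $ 2 = int n] (mod int N))"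

text \<open>The operator \<open>T n\<close>, from the representatives with rows \<open>(r, b)\<close> and \<open>(0, n div r)\<close>.\<close>

definition hecke_T :: "nat \<Rightarrow> nat \<Rightarrow> nat \<Rightarrow> (complex \<Rightarrow> complex) \<Rightarrow> complex \<Rightarrow> complex" where
  "hecke_T k N n f z = of_nat n ^ (k - 1) *
     (\<Sum>r | r dvd n \<and> coprime r N. \<Sum>b<n div r.
        diamond k N r f ((of_nat r * z + of_nat b) / of_nat (n div r)) / of_nat (n div r) ^ k)"

definition is_eigenvector ::
    "((complex \<Rightarrow> complex) \<Rightarrow> complex \<Rightarrow> complex) \<Rightarrow> (complex \<Rightarrow> complex) \<Rightarrow> bool" where
  "is_eigenvector T f \<longleftrightarrow> (\<exists>c. \<forall>z\<in>upper_half_plane. T f z = c * f z)"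

definition newform :: "nat \<Rightarrow> nat \<Rightarrow> (complex \<Rightarrow> complex) \<Rightarrow> (nat \<Rightarrow> complex) \<Rightarrow> bool" where
  "newform k N f a \<longleftrightarrow> N > 0 \<and> f \<in> new_subspace k N \<and> q_expansion f a \<and> a 1 = 1 \<and>
     (\<forall>n. coprime n N \<longrightarrow> is_eigenvector (diamond k N n) f) \<and>
     (\<forall>n>0. is_eigenvector (hecke_T k N n) f)"

definition is_f_alpha ::
    "nat \<Rightarrow> nat \<Rightarrow> rat \<Rightarrow> nat \<Rightarrow> (complex \<Rightarrow> complex) \<Rightarrow> (nat \<Rightarrow> complex) \<Rightarrow> bool" where
  "is_f_alpha d k \<alpha> N f a \<longleftrightarrow> newform k N f a \<and>
     (\<exists>\<psi> \<rho>. is_psi d \<psi> \<and> is_psi_twist d k \<alpha> \<psi> \<rho> \<and>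
        (\<forall>n>0. coprime (int n) (disc_K d * num_den \<alpha>) \<longrightarrow> a n = g_coeff d \<alpha> \<rho> n))"


section \<open>Densities\<close>

definition has_dirichlet_density :: "nat set \<Rightarrow> real \<Rightarrow> bool" where
  "has_dirichlet_density S \<delta> \<longleftrightarrow>
     ((\<lambda>s. (\<Sum>\<^sub>\<infinity>p\<in>S. real p powr - s) / (\<Sum>\<^sub>\<infinity>p\<in>{p. Factorial_Ring.prime p}. real p powr - s))
        \<longlongrightarrow> \<delta>) (at_right 1)"

text \<open>The coefficients of a newform are algebraic integers, so rational ones are integers.\<close>

definition nonzero_mod :: "complex \<Rightarrow> nat \<Rightarrow> bool" where
  "nonzero_mod x p \<longleftrightarrow> (\<exists>c::int. x = of_int c \<and> \<not> int p dvd c)"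

definition nonzero_power_mod :: "nat \<Rightarrow> complex \<Rightarrow> nat \<Rightarrow> bool" where
  "nonzero_power_mod m x p \<longleftrightarrow>
     (\<exists>c::int. x = of_int c \<and> \<not> int p dvd c \<and> (\<exists>y::int. [y ^ m = c] (mod int p)))"

text \<open>\<open>has_delta m a \<delta>\<close>: both densities exist and their quotient is \<open>\<delta>\<close>.\<close>

definition has_delta :: "nat \<Rightarrow> (nat \<Rightarrow> complex) \<Rightarrow> real \<Rightarrow> bool" where
  "has_delta m a \<delta> \<longleftrightarrow> (\<exists>A B.
     has_dirichlet_density {p. Factorial_Ring.prime p \<and> [p = 1] (mod m) \<and> nonzero_power_mod m (a p) p} A \<and>
     has_dirichlet_density {p. Factorial_Ring.prime p \<and> [p = 1] (mod m) \<and> nonzero_mod (a p) p} B \<and>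
     B \<noteq> 0 \<and> \<delta> = A / B)"

end

theory Submission
  imports Defs
begin

text \<open>For a prime \<open>p = Q Q'\<close> that splits in \<open>K\<close>, the coefficient \<open>a p\<close> is the trace of \<open>\<rho> Q\<close>, so modulo one of the
two primes it is a product of a power of the trace \<open>T\<close> of \<open>\<psi> Q\<close> and two power residue symbols. Its quadratic character is
therefore a product of quadratic characters of \<open>T\<close>, \<open>eps d\<close> and \<open>\<alpha>\<close> at \<open>p\<close>. From \<open>4 p\<^sup>m = T\<^sup>2 + d Y\<^sup>2\<close>
and quadratic reciprocity, the symbol of \<open>T\<close> is explicit when \<open>p\<close> is 3 modulo 4, while for \<open>p\<close> congruent to 1 modulo 4 it is the
value at a Gaussian prime above \<open>p\<close> of a character of finite order of the Gaussian integers. All densities then follow from the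
nonvanishing at 1 of quadratic Dirichlet series and of one Hecke series over the Gaussian integers. The same method,
applied to \<open>4 p\<^sup>m = T\<^sup>2 + d Y\<^sup>2\<close> modulo the prime divisors of \<open>d\<close>, shows that only \<open>d = 1\<close>, \<open>d = 2\<close> and
primes \<open>d\<close> congruent to 3 modulo 4 occur.\<close>

text \<open>The obstacle is the sign of \<open>T\<close> when \<open>p\<close> is 1 modulo 4. It is
  read from a character \<theta> of order four on the Gaussian integers (the quartic symbol modulo
  \<open>d\<close> adjusted at 2, or a character modulo 8 if \<open>d = 2\<close>) whose square is a
  quadratic character of the norm; this makes 1 + 2 Re \<theta> + \<theta>^2 nonnegative at primes
  and so excludes a zero at 1. When \<open>p\<close> is 3 modulo 4, the factor \<open>eps d\<close>
  is exactly what cancels the symbol of \<open>T\<close>. All analysis takes place at real s > 1. No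
  L-series is continued: its terms are grouped into blocks of one period, whose coefficients sum to
  zero, and the grouped series is Lipschitz on [1, 2], so a nonzero value at 1 keeps the logarithm
  bounded. Prime sums are thus known up to O(1), against a full prime sum that tends to infinity.
  The indicator of the primes to be counted is a linear combination of quadratic characters and at
  most one Hecke coefficient. Only characters of squares have a nonzero mean, and D(\<alpha>)
  records which twists are squares.\<close>

hide_const (open) Divisibility.prime

section \<open>The Jacobi symbol\<close>

lemma Legendre_cases: "Legendre a p = 0 | Legendre a p = 1 | Legendre a p = -1"
 by (simp add: Legendre_def)

lemma Legendre_eq_0_iff: "Legendre a p = 0 \<longleftrightarrow> p dvd a"
 by (simp add: Legendre_def cong_0_iff)

lemma Legendre_cong: "[a = b] (mod p) ==> Legendre a p = Legendre b p"
 unfolding Legendre_def QuadRes_def by (simp add: cong_def)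

lemma Legendre_one_left [simp]: "prime p ==> Legendre 1 (int p) = 1"
 unfolding Legendre_def QuadRes_def
 by (metis cong_refl of_nat_1 one_power2 cong_0_iff zdvd1_eq abs_of_nat
   of_nat_eq_1_iff not_prime_1)

lemma small_cong_eq:
 fixes a b :: int
 assumes "[a = b] (mod p)" "\<bar>a\<bar> <= 1" "\<bar>b\<bar> <= 1" "p > 2"
 shows "a = b"
proof -
 have "p dvd a - b" using assms(1) by (simp add: cong_iff_dvd_diff)
 moreover have "\<bar>a - b\<bar> < p" using assms by linarith
 ultimately show ?thesis using zdvd_imp_le[of p "\<bar>a-b\<bar>"] by (cases "a = b") auto
qed

lemma Legendre_abs_le: "\<bar>Legendre a p\<bar> <= 1"
 using Legendre_cases[of a p] by auto

lemma Legendre_euler: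
 assumes "prime p" "p > 2" "[a^((p - 1) div 2) = c] (mod int p)" "\<bar>c\<bar> <= 1"
 shows "Legendre a (int p) = c"
 using small_cong_eq[OF cong_trans[OF euler_criterion[OF assms(1,2), of a] assms(3)] Legendre_abs_le assms(4)]
  assms(2) by simp

lemma Legendre_mult:
 assumes p: "prime p"
 shows "Legendre (a*b) (int p) = Legendre a (int p)*Legendre b (int p)"
proof (cases "p = 2")
 case False
 hence p2: "p > 2" using prime_ge_2_nat[OF p] by linarith
 have "[a^((p-1) div 2)*b^((p-1) div 2) = Legendre a p*Legendre b p] (mod int p)"
  by (intro cong_mult cong_sym[OF euler_criterion[OF p p2]])
 thus ?thesis using Legendre_cases[of a p] Legendre_cases[of b p]
  by (intro Legendre_euler[OF p p2]) (auto simp: power_mult_distrib)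
next
 \<comment> \<open>Modulo 2 every odd number is a residue, so the symbol is the indicator of odd
   numbers and multiplicativity holds there as well.\<close>
 case True
 have "Legendre x 2 = (if even x then 0 else 1)" for x
 proof -
  have "odd x ==> [1\<^sup>2 = x] (mod 2)" by (simp add: cong_def odd_iff_mod_2_eq_one)
  thus ?thesis unfolding Legendre_def QuadRes_def by (metis cong_0_iff)
 qed
 thus ?thesis using True by simp
qed

lemma Legendre_square:
 assumes "prime p" "~ int p dvd a"
 shows "Legendre (a\<^sup>2) (int p) = 1"
 using assms Legendre_cases[of a p] by (auto simp: power2_eq_square Legendre_mult Legendre_eq_0_iff)

lemma Legendre_power: "prime p ==> Legendre (a^n) (int p) = Legendre a (int p)^n"
 by (induction n) (auto simp: Legendre_mult)

lemma Legendre_minus_one: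
 assumes "prime p" "p > 2"
 shows "Legendre (-1) (int p) = (if p mod 4 = 1 then 1 else -1)"
proof (rule Legendre_euler[OF assms])
 have o: "odd p" using assms prime_odd_nat by simp
 have "even ((p - 1) div 2) \<longleftrightarrow> p mod 4 = 1" using o by presburger
 thus "[(- 1)^((p - 1) div 2) = (if p mod 4 = 1 then 1 else - 1)] (mod int p)" by simp
qed auto

lemma Legendre_reciprocity:
 assumes "prime p" "2 < p" "prime q" "2 < q" "p ~= q"
 shows "Legendre (int p) (int q) = Legendre (int q) (int p)*(if p mod 4 = 3 & q mod 4 = 3 then -1 else 1)"
proof -
 have o: "odd p" "odd q" using assms prime_odd_nat by simp_all
 have e: "even ((p - 1) div 2*((q - 1) div 2)) \<longleftrightarrow> ~ (p mod 4 = 3 & q mod 4 = 3)"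
  using o unfolding even_mult_iff by presburger
 have n: "~ int p dvd int q" "~ int q dvd int p"
  using assms primes_dvd_imp_eq by (auto simp: int_dvd_int_iff)
 have *: "Legendre p q*Legendre q p = (if p mod 4 = 3 & q mod 4 = 3 then -1 else 1)"
  using Quadratic_Reciprocity[OF assms] e by (simp add: minus_one_power_iff)
 have "Legendre q p*Legendre q p = 1" using Legendre_cases[of q p] n by (auto simp: Legendre_eq_0_iff)
 hence "Legendre p q = (Legendre p q*Legendre q p)*Legendre q p" by (simp only: mult.assoc mult_1_right)
 also note *
 finally show ?thesis by (subst mult.commute)
qed

text \<open>The Jacobi symbol, with primes counted with multiplicity. The factor at 2 is not that of
  the Kronecker symbol, so reciprocity and the rules for the upper argument are stated for odd
  \<open>n\<close>.\<close>

definition jac :: "int \<Rightarrow> nat \<Rightarrow> int" where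
 "jac a n = (\<Prod>p\<in>#prime_factorization n. Legendre a (int p))"

lemma jac_prime [simp]: "prime p ==> jac a p = Legendre a (int p)"
 by (simp add: jac_def prime_factorization_prime)

lemma jac_1_right [simp]: "jac a (Suc 0) = 1"
 by (simp add: jac_def)

lemma jac_mult_right: "m ~= 0 ==> n ~= 0 ==> jac a (m*n) = jac a m*jac a n"
 by (simp add: jac_def prime_factorization_mult)

lemma jac_power_right: "m ~= 0 ==> jac a (m^n) = jac a m^n"
 by (induction n) (auto simp: jac_mult_right)

lemma odd_prime_induct [consumes 1, case_names one mult]:
 fixes n :: nat
 assumes "odd n" "P 1" "\<And>p n. prime p ==> p > 2 ==> odd n ==> P n ==> P (p*n)"
 shows "P n"
 using assms(1)
proof (induction n rule: prime_divisors_induct)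
 case (factor p x)
 moreover have "p > 2" using factor prime_ge_2_nat[of p] by (cases "p = 2") auto
 ultimately show ?case using assms(3) by auto
qed (use assms in auto)

lemma jac_1_left [simp]: "odd n ==> jac 1 n = 1"
 by (induction n rule: odd_prime_induct) (auto simp: jac_mult_right odd_pos)

lemma odd_nat_neq_0: "odd (n::nat) ==> n ~= 0" by (rule ccontr) simp

lemma jac_mult_left: "odd n ==> jac (a*b) n = jac a n*jac b n"
 by (induction n rule: odd_prime_induct) (auto simp: jac_mult_right odd_nat_neq_0 Legendre_mult)

lemma jac_power_left: "odd n ==> jac (a^k) n = jac a n^k"
 by (induction k) (auto simp: jac_mult_left)

lemma jac_cong: "odd n ==> [a = b] (mod int n) ==> jac a n = jac b n"
proof (induction n rule: odd_prime_induct)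
 case (mult p n)
 hence "[a = b] (mod int p)" "[a = b] (mod int n)"
  using cong_modulus_mult[of a b "int p" "int n"] cong_modulus_mult[of a b "int n" "int p"]
  by (simp_all add: mult.commute)
 thus ?case using mult Legendre_cong by (simp add: jac_mult_right odd_nat_neq_0)
qed simp

lemma jac_coprime:
 "odd n ==> coprime a (int n) ==> jac a n = 1 | jac a n = -1"
proof (induction n rule: odd_prime_induct)
 case (mult p n)
 hence "coprime a (int p)" "coprime a (int n)" by auto
 moreover from this mult have "~ int p dvd a"
  by (metis coprime_common_divisor dvd_refl not_prime_unit prime_nat_int_transfer)
 ultimately show ?case using mult Legendre_cases[of a p]
  by (auto simp: jac_mult_right odd_nat_neq_0 Legendre_eq_0_iff)
qed simp

lemma jac_not_coprime:
 "odd n ==> ~ coprime a (int n) ==> jac a n = 0"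
proof (induction n rule: odd_prime_induct)
 case (mult p n)
 show ?case
 proof (cases "int p dvd a")
  case False
  hence "coprime a (int p)"
   using mult(1) by (metis coprime_commute prime_imp_coprime prime_nat_int_transfer)
  hence "~ coprime a (int n)" using mult by auto
  thus ?thesis using mult by (auto simp: jac_mult_right odd_nat_neq_0)
 qed (use mult in \<open>auto simp: jac_mult_right odd_nat_neq_0 Legendre_eq_0_iff\<close>)
qed simp

lemma jac_square_left: "odd n ==> coprime a (int n) ==> jac (a\<^sup>2) n = 1"
 using jac_coprime[of n a] by (auto simp: jac_power_left)

lemma jac_abs_le: "odd n ==> \<bar>jac a n\<bar> <= 1"
 using jac_coprime[of n a] jac_not_coprime[of n a] by (cases "coprime a (int n)") auto

lemma mod4_mult3: "odd (a::nat) ==> odd b ==> (a*b) mod 4 = 3 \<longleftrightarrow> (a mod 4 = 3) ~= (b mod 4 = 3)"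
proof -
 assume o: "odd a" "odd b"
 have "a mod 4 = 1 | a mod 4 = 3" "b mod 4 = 1 | b mod 4 = 3" using o by presburger+
 thus ?thesis by (auto simp: mod_mult_eq[of a 4 b, symmetric])
qed

lemma jac_minus_one: "odd n ==> jac (-1) n = (if n mod 4 = 3 then -1 else 1)"
proof (induction n rule: odd_prime_induct)
 case (mult p n)
 have o: "odd p" using mult prime_odd_nat by simp
 hence "p mod 4 = 1 \<longleftrightarrow> p mod 4 ~= 3" by presburger
 thus ?case using mult o by (auto simp: jac_mult_right odd_nat_neq_0 Legendre_minus_one mod4_mult3)
qed simp

text \<open>One argument stays prime while the other grows by one odd prime at a time;
  \<open>jac_reciprocity\<close> then runs the same induction in the other argument. When the new
  prime equals \<open>q\<close>, both sides vanish.\<close>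

lemma jac_reciprocity_aux:
 assumes q: "prime q" "q > 2"
 shows "odd m ==> jac (int m) q = jac (int q) m*(if m mod 4 = 3 & q mod 4 = 3 then -1 else 1)"
proof (induction m rule: odd_prime_induct)
 case (mult p n)
 have o: "odd p" using mult prime_odd_nat by simp
 show ?case
 proof (cases "p = q")
  case True
  thus ?thesis using mult q by (simp add: jac_mult_right odd_nat_neq_0 Legendre_eq_0_iff Legendre_mult)
 next
  case False
  thus ?thesis using mult q o Legendre_reciprocity[OF mult(1,2) q False]
   by (auto simp: jac_mult_right odd_nat_neq_0 Legendre_mult mod4_mult3)
 qed
qed (use q in auto)

lemma jac_reciprocity:
 "odd n ==> odd m ==> jac (int m) n = jac (int n) m*(if m mod 4 = 3 & n mod 4 = 3 then -1 else 1)"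
proof (induction n rule: odd_prime_induct)
 case (mult p n)
 have o: "odd p" using mult prime_odd_nat by simp
 show ?case using mult o jac_reciprocity_aux[OF mult(1,2) mult(5)]
  by (auto simp: jac_mult_right odd_nat_neq_0 jac_mult_left mod4_mult3)
qed auto

text \<open>Since \<open>2 \<equiv> -(n - 2)\<close> modulo \<open>n\<close>, reciprocity gives \<open>(2/n) = (-1/n) (2/(n-2))\<close>.\<close>

lemma jac_two: "odd n ==> jac 2 n = (if n mod 8 = 1 | n mod 8 = 7 then 1 else -1)"
proof (induction n rule: less_induct)
 case (less n)
 show ?case
 proof (cases "n = 1")
  case False
  hence "n \<ge> 3" using less.prems by presburger
  then obtain k where k: "n = k+2" by (metis add.commute le_add_diff_inverse less_imp_le_nat numeral_3_eq_3 numeral_2_eq_2 Suc_le_eq)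
  have "odd k" using k less.prems by simp
  note k = k this
  have "[2 = -1*int k] (mod int n)" unfolding k cong_iff_dvd_diff by simp
  hence "jac 2 n = jac (-1) n*jac (int k) n"
   using less.prems jac_cong jac_mult_left by metis
  also have "jac (int k) n = jac (int n) k"
  proof -
   have "~ (k mod 4 = 3 & n mod 4 = 3)" using k by presburger
   thus ?thesis using jac_reciprocity[of n k] less.prems k by auto
  qed
  also have "jac (int n) k = jac 2 k"
   by (rule jac_cong) (use k in \<open>auto simp: cong_def\<close>)
  also have "... = (if k mod 8 = 1 | k mod 8 = 7 then 1 else -1)"
   using less.IH k by auto
  finally have "jac 2 n = (if n mod 4 = 3 then -1 else 1)*(if k mod 8 = 1 | k mod 8 = 7 then 1 else -1)"
   using jac_minus_one less.prems by auto
  moreover have "k mod 8 = 1 | k mod 8 = 3 | k mod 8 = 5 | k mod 8 = 7" using k by presburger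
  moreover have "n mod 8 = (k mod 8+2) mod 8" "n mod 4 = n mod 8 mod 4"
   by (simp_all add: k mod_simps mod_mod_cancel)
  ultimately show ?thesis by auto
 qed simp
qed

text \<open>Squaring sends both 1 and \<open>r - 1\<close> to 1, so it is not injective on the
  nonzero residues, and on a finite set it cannot be surjective either.\<close>

lemma ex_nonresidue:
 assumes "prime r" "r > 2"
 shows "\<exists>c. Legendre (int c) (int r) = -1 & 0 < c & c < r"
proof (rule ccontr)
 assume neg: "~ ?thesis"
 have "{1..r-1} \<subseteq> (%x. x^2 mod r) ` {1..r-1}"
 proof
  fix c assume c: "c \<in> {1..r-1}"
  hence "~ r dvd c" using assms nat_dvd_not_less by auto
  hence "~ int r dvd int c" by (simp add: int_dvd_int_iff)
  hence "Legendre (int c) (int r) = 1"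
   using neg c assms Legendre_cases[of c r] by (auto simp: Legendre_eq_0_iff)
  hence "QuadRes (int r) (int c)" unfolding Legendre_def by (auto split: if_splits)
  then obtain y where y: "[y^2 = int c] (mod int r)" unfolding QuadRes_def by blast
  define x where "x = nat (y mod int r)"
  have x: "int x = y mod int r" using assms unfolding x_def by simp
  have "[int (x^2) = int c] (mod int r)"
   using y unfolding x of_nat_power by (simp add: cong_def power_mod)
  hence "[x^2 = c] (mod r)" by (simp only: cong_int_iff)
  hence e: "x^2 mod r = c" using c assms by (auto simp: cong_def)
  have "x < r" using x assms by (metis of_nat_less_iff pos_mod_bound of_nat_0_less_iff zero_less_numeral less_trans)
  moreover have "x ~= 0" using e c by (intro notI) auto
  ultimately show "c \<in> (%x. x^2 mod r) ` {1..r-1}" using e by force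
 qed
 hence "inj_on (%x. x^2 mod r) {1..r-1}"
  by (metis finite_atLeastAtMost finite_surj_inj card_image card_mono card_image_le eq_card_imp_inj_on finite_imageI order_antisym)
 moreover have "(r-1)^2 mod r = 1^2 mod r"
 proof -
  obtain t where t: "r = t+2" using assms by (metis add.commute le_add_diff_inverse less_imp_le_nat)
  have "(r-1)^2 = 1 + r*t" unfolding t by (simp add: power2_eq_square algebra_simps)
  hence "(r-1)^2 mod r = 1 mod r" by (simp only: mod_mult_self2)
  thus ?thesis by simp
 qed
 ultimately have "r - 1 = 1" by (rule inj_onD) (use assms in simp_all)
 thus False using assms by simp
qed

section \<open>Quadratic characters attached to an integer\<close>

definition qchar :: "int \<Rightarrow> nat \<Rightarrow> int" where
 "qchar \<beta> n = (if odd n then jac \<beta> n else 0)"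

lemma qchar_1 [simp]: "qchar \<beta> 1 = 1" "qchar \<beta> (Suc 0) = 1"
 by (simp_all add: qchar_def)

lemma qchar_0 [simp]: "qchar \<beta> 0 = 0"
 by (simp add: qchar_def)

lemma qchar_mult: "qchar \<beta> (m*n) = qchar \<beta> m*qchar \<beta> n"
 by (auto simp: qchar_def jac_mult_right odd_nat_neq_0)

lemma qchar_abs_le: "\<bar>qchar \<beta> n\<bar> <= 1"
 by (simp add: qchar_def jac_abs_le)

lemma qchar_prime: "prime p ==> p > 2 ==> qchar \<beta> p = Legendre \<beta> (int p)"
 using prime_odd_nat by (simp add: qchar_def)

lemma nat_odd_decomp:
 assumes "n > (0::nat)"
 obtains e b where "n = 2^e*b" "odd b"
proof -
 obtain b where "n = 2 ^ multiplicity 2 n*b" "~ 2 dvd b"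
  using multiplicity_decompose'[of n 2] assms by force
 thus ?thesis using that by blast
qed

text \<open>Write \<beta> as a sign times \<open>2^e\<close> times an odd \<open>b\<close>. The sign
  sees \<open>n\<close> modulo 4, the 2 sees \<open>n\<close> modulo 8, and reciprocity replaces
  (b/n) by (n/b) up to a sign that depends on \<open>n\<close> modulo 4.\<close>

lemma jac_periodic:
 assumes "\<beta> ~= 0" "odd n" "odd n'" "[n = n'] (mod (8*nat \<bar>\<beta>\<bar>))"
 shows "jac \<beta> n = jac \<beta> n'"
proof -
 obtain e b where b: "nat \<bar>\<beta>\<bar> = 2^e*b" "odd b"
  using nat_odd_decomp[of "nat \<bar>\<beta>\<bar>"] assms(1) by auto
 have \<beta>: "\<beta> = sgn \<beta>*(2^e*int b)"
 proof -
  have "\<bar>\<beta>\<bar> = int (2^e*b)" using b(1) by linarith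
  thus ?thesis by (simp add: sgn_if abs_if split: if_splits)
 qed
 have c8: "n mod 8 = n' mod 8" and cb: "[n = n'] (mod b)"
  using cong_dvd_modulus_nat[OF assms(4), of 8] cong_dvd_modulus_nat[OF assms(4), of b]
  unfolding b(1) by (simp_all add: cong_def)
 have c4: "n mod 4 = n' mod 4" using c8 mod_mod_cancel[of 4 8 n] mod_mod_cancel[of 4 8 n'] by simp
 have J: "jac \<beta> m = jac (sgn \<beta>) m*(jac 2 m^e*jac (int b) m)" if "odd m" for m
  by (subst \<beta>) (simp add: that jac_mult_left jac_power_left)
 have "jac (sgn \<beta>) n = jac (sgn \<beta>) n'"
  using assms c4 by (auto simp: sgn_if jac_minus_one)
 moreover have "jac 2 n = jac 2 n'" using assms c8 by (simp add: jac_two)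
 moreover have "jac (int b) n = jac (int b) n'"
  using jac_reciprocity[of n b] jac_reciprocity[of n' b] assms b(2) c4
   jac_cong[of b "int n" "int n'"] cb by (simp add: cong_int_iff)
 ultimately show ?thesis using J assms by simp
qed

lemma qchar_periodic:
 assumes "\<beta> ~= 0" "[n = n'] (mod (8*nat \<bar>\<beta>\<bar>))"
 shows "qchar \<beta> n = qchar \<beta> n'"
proof -
 have "[n = n'] (mod 2)" by (rule cong_dvd_modulus_nat[OF assms(2)]) simp
 hence "odd n = odd n'" unfolding cong_def by presburger
 thus ?thesis using jac_periodic[OF assms(1) _ _ assms(2)] by (cases "odd n") (auto simp: qchar_def)
qed

text \<open>If an odd prime \<open>r\<close> occurs in \<beta> to an odd power, \<open>n\<close> is
  taken to be a nonresidue modulo \<open>r\<close> and 1 modulo 8 times the cofactor, which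
  trivializes every other factor. Otherwise \<beta> is, up to sign, a square or twice a square, and
  a condition modulo 8 suffices.\<close>

lemma ex_jac_minus_one:
 assumes "\<beta> ~= 0" "~ (\<exists>c. \<beta> = c\<^sup>2)"
 shows "\<exists>n. odd n & jac \<beta> n = -1"
proof -
 define B where "B = nat \<bar>\<beta>\<bar>"
 have B0: "B > 0" using assms by (simp add: B_def)
 have \<beta>: "\<beta> = sgn \<beta>*int B" by (simp add: B_def sgn_mult_abs)
 define s where "s = squarefree_part B"
 define q where "q = square_part B"
 have Bsq: "B = s*q\<^sup>2" unfolding s_def q_def by (rule squarefree_decompose)
 have q0: "q > 0" using Bsq B0 by (cases "q = 0") auto
 show ?thesis
 proof (cases "\<exists>r. prime r & r > 2 & r dvd s")
  case True
  then obtain r where r: "prime r" "r > 2" "r dvd s" by blast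
  have or: "odd r" using r prime_odd_nat by simp
  define j where "j = multiplicity r B"
  have j: "odd j"
  proof -
   have "multiplicity r s ~= 0" using r by (simp add: prime_elem_multiplicity_eq_zero_iff s_def)
   thus ?thesis using prime_multiplicity_squarefree_part[OF r(1), of B] unfolding s_def j_def by presburger
  qed
  obtain b where b: "B = r^j*b" "~ r dvd b"
   using multiplicity_decompose'[of B r] B0 r unfolding j_def
   by (metis bot_nat_0.not_eq_extremum not_prime_unit)
  have b0: "b > 0" using b B0 by (cases "b = 0") auto
  obtain c where c: "Legendre (int c) (int r) = -1" using ex_nonresidue r by blast
  have "coprime r (8*b)"
  proof -
   have "coprime r 8" using or coprime_power_right_iff[of r 2 3] by simp
   moreover have "coprime r b" using r b prime_imp_coprime by blast
   ultimately show ?thesis by simp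
  qed
  then obtain n where n: "[n = c] (mod r)" "[n = 1] (mod (8*b))"
   using binary_chinese_remainder_nat[of r "8*b" c 1] by blast
  have n8: "[n = 1] (mod 8)" using n(2) cong_modulus_mult_nat by blast
  hence n4: "n mod 4 = 1" using mod_mod_cancel[of 4 8 n] by (simp add: cong_def)
  hence on: "odd n" by presburger
  have "\<beta> = (sgn \<beta>*int b)*int r^j" using \<beta> unfolding b(1) by (simp add: algebra_simps)
  hence "jac \<beta> n = jac ((sgn \<beta>*int b)*int r^j) n" by (rule arg_cong)
  hence "jac \<beta> n = jac (sgn \<beta>*int b) n*jac (int r) n^j"
   unfolding jac_mult_left[OF on] jac_power_left[OF on] .
  moreover have "jac (sgn \<beta>*int b) n = 1"
  proof -
   have a: "nat \<bar>sgn \<beta>*int b\<bar> = b" using assms by (simp add: abs_mult)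
   have "jac (sgn \<beta>*int b) n = jac (sgn \<beta>*int b) 1"
    by (rule jac_periodic) (use a b0 on n assms in \<open>auto simp: sgn_0_0\<close>)
   thus ?thesis by simp
  qed
  moreover have "jac (int r) n = -1"
  proof -
   have "jac (int r) n = jac (int n) r" using jac_reciprocity[of n r] on or n4 by simp
   also have "... = jac (int c) r" using n(1) or by (intro jac_cong) (auto simp: cong_int_iff)
   finally show ?thesis using c r by simp
  qed
  ultimately show ?thesis using on j by auto
 next
  case False
  have s12: "s = 1 | s = 2"
  proof (rule ccontr)
   assume ns: "~ ?thesis"
   hence "s ~= 1" by simp
   then obtain p where p: "prime p" "p dvd s" using prime_factor_nat[of s] by blast
   hence "p = 2" using False prime_ge_2_nat[of p] by (cases "p > 2") auto
   then obtain t where t: "s = 2*t" using p by blast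
   have "t ~= 1" using ns t by auto
   then obtain p' where p': "prime p'" "p' dvd t" using prime_factor_nat[of t] by blast
   have "p' = 2" using False prime_ge_2_nat[of p'] p' t by (cases "p' > 2") auto
   then obtain u where "t = 2*u" using p' by blast
   hence "2^2 dvd s" using t by simp
   moreover have "squarefree s" unfolding s_def by (rule squarefree_squarefree_part)
   ultimately have "is_unit (2::nat)" by (rule squarefreeD[rotated])
   thus False by simp
  qed
  obtain f q' where q': "q = 2 ^ f*q'" "odd q'" using nat_odd_decomp[OF q0] by blast
  \<comment> \<open>The residue 5 makes (2/n) = -1 while (-1/n) = 1, so the sign of \<beta> does not
    matter. The residue 3 makes (-1/n) = -1, as required when \<beta> is minus a square.\<close>
  define t where "t = (if s = 2 then 5 else 3::nat)"
  have "coprime q' 8" using q'(2) coprime_power_right_iff[of q' 2 3] by simp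
  then obtain n where n: "[n = 1] (mod q')" "[n = t] (mod 8)"
   using binary_chinese_remainder_nat[of q' 8 1 t] by blast
  have n8: "n mod 8 = t" using n(2) by (auto simp: cong_def t_def split: if_splits)
  hence on: "odd n" by (cases "s = 2") (simp_all add: t_def, presburger+)
  have cop: "coprime (int q) (int n)"
  proof -
   have "coprime q' n" using n(1) by (metis cong_imp_coprime cong_sym coprime_1_right coprime_commute)
   thus ?thesis using on q' by simp
  qed
  have "\<beta> = (sgn \<beta>*int s)*(int q)\<^sup>2" using \<beta> unfolding Bsq by (simp add: algebra_simps)
  hence "jac \<beta> n = jac ((sgn \<beta>*int s)*(int q)\<^sup>2) n" by (rule arg_cong)
  hence "jac \<beta> n = jac (sgn \<beta>) n*jac (int s) n"
   unfolding jac_mult_left[OF on] jac_square_left[OF on cop] by simp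
  moreover have "jac (sgn \<beta>) n*jac (int s) n = -1"
  proof (cases "s = 2")
   case True
   hence n5: "n mod 8 = 5" using n8 by (simp add: t_def)
   hence "n mod 4 = 1" by presburger
   thus ?thesis using True on n5 assms by (auto simp: sgn_if jac_minus_one jac_two)
  next
   case False
   hence s1: "s = 1" using s12 by simp
   have "\<beta> < 0"
   proof (rule ccontr)
    assume "~ \<beta> < 0"
    hence "\<beta> = (int q)\<^sup>2" using \<beta> Bsq s1 assms(1) by (simp add: sgn_if)
    thus False using assms by blast
   qed
   moreover have "n mod 4 = 3" using n8 False by (simp add: t_def, presburger)
   ultimately show ?thesis using s1 on by (auto simp: sgn_if jac_minus_one)
  qed
  ultimately show ?thesis using on by auto
 qed
qed

text \<open>Orthogonality: multiplication by an \<open>n\<close> with character value -1 permutes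
  the residues and negates the sum.\<close>

lemma qchar_sum_zero:
 assumes "\<beta> ~= 0" "~ (\<exists>c. \<beta> = c\<^sup>2)"
 shows "(\<Sum>r<8*nat \<bar>\<beta>\<bar>. qchar \<beta> r) = 0"
proof -
 define M where "M = 8*nat \<bar>\<beta>\<bar>"
 have M0: "M > 0" using assms by (simp add: M_def)
 obtain n where n: "odd n" "jac \<beta> n = -1" using ex_jac_minus_one assms by blast
 have "coprime \<beta> (int n)" using jac_not_coprime n by fastforce
 hence "coprime n (nat \<bar>\<beta>\<bar>)"
  by (metis coprime_commute coprime_abs_left_iff coprime_int_iff int_nat_eq abs_ge_zero)
 moreover have "coprime n 8" using n(1) coprime_power_right_iff[of n 2 3] by simp
 ultimately have cop: "coprime n M" unfolding M_def by simp
 have "(\<Sum>r<M. qchar \<beta> r) = (\<Sum>r<M. qchar \<beta> (n * r mod M))"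
 proof (rule sum.reindex_bij_betw[symmetric])
  have inj: "inj_on (%r. n * r mod M) {..<M}"
  proof (rule inj_onI)
   fix x y assume *: "x \<in> {..<M}" "y \<in> {..<M}" "n*x mod M = n*y mod M"
   hence "[x = y] (mod M)" using cong_mult_lcancel_nat[OF cop, of x y] by (simp add: cong_def)
   thus "x = y" using*by (simp add: cong_def)
  qed
  moreover have "(%r. n * r mod M) ` {..<M} = {..<M}"
   by (rule endo_inj_surj[OF _ _ inj]) (use M0 in auto)
  ultimately show "bij_betw (%r. n * r mod M) {..<M} {..<M}"
   by (simp add: bij_betw_def)
 qed
 also have "... = (\<Sum>r<M. qchar \<beta> n*qchar \<beta> r)"
 proof (rule sum.cong)
  fix r
  have "qchar \<beta> (n * r mod M) = qchar \<beta> (n * r)"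
   using qchar_periodic[OF assms(1), of "n * r mod M" "n * r"] by (simp add: M_def cong_def)
  thus "qchar \<beta> (n * r mod M) = qchar \<beta> n*qchar \<beta> r" by (simp add: qchar_mult)
 qed simp
 also have "... = - (\<Sum>r<M. qchar \<beta> r)" using n by (simp add: qchar_def sum_negf)
 finally show ?thesis unfolding M_def by linarith
qed

section \<open>Euler products\<close>

text \<open>One representative of each nonzero class of associates: the positive integers for
  \<open>nat\<close>, a quadrant for the Gaussian integers. A sum over this set is a sum over
  nonzero principal ideals.\<close>

definition normalized :: "'a::factorial_semiring set" where
 "normalized = {x. x ~= 0 & normalize x = x}"

definition smooth :: "'a::factorial_semiring set \<Rightarrow> 'a set" where
 "smooth S = {x \<in> normalized. prime_factors x \<subseteq> S}"

lemma primes_subset_normalized: "{p. prime p} \<subseteq> normalized"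
 by (auto simp: normalized_def normalize_prime)

lemma smooth_subset: "smooth S \<subseteq> normalized"
 by (auto simp: smooth_def)

lemma smooth_empty: "smooth {} = {1::'a::factorial_semiring}"
 by (auto simp: smooth_def normalized_def prime_factorization_empty_iff is_unit_normalize)

text \<open>The exponent is recovered as the multiplicity of \<open>p\<close>. The product is
  normalized again because \<open>normalized\<close> need not be closed under
  multiplication.\<close>

lemma bij_betw_smooth_insert:
 fixes p :: "'a::factorial_semiring"
 assumes p: "prime p" "p \<notin> S"
 shows "bij_betw (%(x, k). normalize (x*p^k)) (smooth S \<times> UNIV) (smooth (insert p S))"
proof -
 have p0: "p ~= 0" "prime_elem p" "~ is_unit p" using p by auto
 have ndvd: "~ p dvd x" if "x \<in> smooth S" for x
  using that p by (auto simp: smooth_def normalized_def in_prime_factors_iff)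
 have mult: "multiplicity p (normalize (x*p^k)) = k" if "x \<in> smooth S" for x k
  using multiplicity_prime_elem_times_other[OF p0(2) ndvd[OF that], of "p^k"] p0
  by (simp add: multiplicity_same_power')
 show ?thesis unfolding bij_betw_def
 proof
  show "inj_on (%(x, k). normalize (x*p^k)) (smooth S \<times> UNIV)"
  proof (rule inj_onI, clarify)
   fix x y k l assume *: "x \<in> smooth S" "y \<in> smooth S"
    "normalize (x*p^k) = normalize (y*p ^ l)"
   have kl: "k = l" using mult[OF *(1), of k] mult[OF *(2), of l] *(3) by simp
   have "normalize (p^k*x) = normalize (p^k*y)" using*kl by (simp add: mult.commute)
   hence "p^k*x dvd p^k*y" "p^k*y dvd p^k*x" by (simp_all add: associated_iff_dvd)
   hence "x dvd y" "y dvd x" using p0 by simp_all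
   hence "normalize x = normalize y" by (simp add: associated_iff_dvd)
   thus "x = y & k = l" using*kl by (simp add: smooth_def normalized_def)
  qed
  show "(%(x, k). normalize (x*p^k)) ` (smooth S \<times> UNIV) = smooth (insert p S)"
  proof (intro equalityI subsetI)
   fix y assume "y \<in> (%(x, k). normalize (x*p^k)) ` (smooth S \<times> UNIV)"
   then obtain x k where y: "y = normalize (x*p^k)" "x \<in> smooth S" by auto
   have "x ~= 0" using y by (auto simp: smooth_def normalized_def)
   moreover have "prime_factors (p^k) \<subseteq> {p}"
    using p by (auto simp: prime_factorization_prime_power)
   ultimately show "y \<in> smooth (insert p S)" using y p0
    by (auto simp: smooth_def normalized_def prime_factors_product)
  next
   fix y assume y: "y \<in> smooth (insert p S)"
   have y0: "y ~= 0" "normalize y = y" using y by (auto simp: smooth_def normalized_def)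
   obtain z where z: "y = p ^ multiplicity p y*z" "~ p dvd z"
    using multiplicity_decompose'[of y p] y0 p0 by blast
   have z0: "z ~= 0" using z(2) by auto
   have "prime_factors z \<subseteq> prime_factors y"
    using y0 z by (metis dvd_prime_factors dvd_triv_right)
   hence "prime_factors z \<subseteq> S" using y z by (auto simp: smooth_def in_prime_factors_iff)
   hence zs: "normalize z \<in> smooth S" using z0 by (simp add: smooth_def normalized_def)
   have "normalize (normalize z*p ^ multiplicity p y) = normalize (p ^ multiplicity p y*z)"
    by (simp add: mult.commute)
   also have "... = y" using z(1) y0 by simp
   finally show "y \<in> (%(x, k). normalize (x*p^k)) ` (smooth S \<times> UNIV)"
    using zs by (intro image_eqI[where x = "(normalize z, multiplicity p y)"]) auto
  qed
 qed
qed

lemma geometric_has_sum: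
 fixes c :: complex
 assumes "norm c < 1"
 shows "((%k. c^k) has_sum (1/(1 - c))) UNIV"
 by (rule norm_summable_imp_has_sum)
   (use assms in \<open>auto simp: norm_power intro: summable_geometric geometric_sums\<close>)

text \<open>Adjoining one prime multiplies the sum by a geometric series: by
  \<open>bij_betw_smooth_insert\<close> the new sum is a double sum, and the exponent is summed
  first.\<close>

lemma euler_finite:
 fixes f :: "'a::factorial_semiring \<Rightarrow> complex"
 assumes f1: "f 1 = 1" and fm: "\<And>x y. f (x*y) = f x * f y" and fn: "\<And>x. f (normalize x) = f x"
  and summ: "f summable_on normalized"
  and small: "\<And>p. prime p ==> norm (f p) <= 1/2"
 shows "finite S ==> S \<subseteq> {p. prime p} ==> (f has_sum (\<Prod>p\<in>S. 1/(1 - f p))) (smooth S)"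
proof (induction S rule: finite_induct)
 case empty
 show ?case by (simp add: smooth_empty f1 has_sum_finite_iff)
next
 case (insert p S)
 have p: "prime p" using insert by auto
 have fp: "f (p^k) = f p^k" for k by (induction k) (auto simp: f1 fm)
 let ?g = "%(x, k). normalize (x*p^k)"
 have "f summable_on smooth (insert p S)" using summable_on_subset_banach[OF summ smooth_subset] .
 then obtain T where T: "(f has_sum T) (smooth (insert p S))" by (auto simp: summable_on_def)
 hence "((%z. f (?g z)) has_sum T) (smooth S \<times> UNIV)"
  using has_sum_reindex_bij_betw[OF bij_betw_smooth_insert[OF p insert(2)], of f T] by simp
 moreover have "((%k. f (?g (x, k))) has_sum (f x*(1/(1 - f p)))) UNIV" for x
  using has_sum_cmult_right[OF geometric_has_sum[of "f p"], of "f x"] small[OF p]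
  by (simp add: fn fm fp)
 ultimately have "((%x. f x*(1/(1 - f p))) has_sum T) (smooth S)"
  by (rule has_sum_SigmaD)
 moreover have "((%x. f x*(1/(1 - f p))) has_sum ((\<Prod>p\<in>S. 1/(1 - f p))*(1/(1 - f p)))) (smooth S)"
  using insert by (intro has_sum_cmult_left) auto
 ultimately have "T = (\<Prod>p\<in>S. 1/(1 - f p))*(1/(1 - f p))" by (rule has_sum_unique)
 thus ?case using T insert(1,2) by (simp add: mult.commute)
qed

lemma euler_limit:
 fixes f :: "'a::factorial_semiring \<Rightarrow> complex"
 assumes f1: "f 1 = 1" and fm: "\<And>x y. f (x*y) = f x * f y" and fn: "\<And>x. f (normalize x) = f x"
  and summ: "(%x. norm (f x)) summable_on normalized"
  and small: "\<And>p. prime p ==> norm (f p) <= 1/2"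
 shows "((%S. \<Prod>p\<in>S. 1/(1 - f p)) \<longlongrightarrow> infsum f normalized) (finite_subsets_at_top {p. prime p})"
proof (rule tendstoI)
 fix e :: real assume e: "e > 0"
 have summ': "f summable_on normalized" using summ by (rule abs_summable_summable)
 have "((%x. norm (f x)) has_sum infsum (%x. norm (f x)) normalized) normalized"
  using summ by (rule has_sum_infsum)
 hence "eventually (%F. dist (\<Sum>x\<in>F. norm (f x)) (infsum (%x. norm (f x)) normalized) < e)
  (finite_subsets_at_top normalized)" unfolding has_sum_def using e tendstoD by blast
 then obtain F where F: "finite F" "F \<subseteq> normalized"
  "dist (\<Sum>x\<in>F. norm (f x)) (infsum (%x. norm (f x)) normalized) < e"
  unfolding eventually_finite_subsets_at_top by blast
 \<comment> \<open>The primes of a finite set \<open>F\<close> that carries the sum of norms up to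
   \<open>e\<close>. Once \<open>S\<close> contains them, the smooth numbers contain
   \<open>F\<close>, and what they miss of the series is below \<open>e\<close>.\<close>
 define S0 where "S0 = (\<Union>x\<in>F. prime_factors x)"
 have S0: "finite S0" "S0 \<subseteq> {p. prime p}" using F by (auto simp: S0_def)
 have "dist (\<Prod>p\<in>S. 1/(1 - f p)) (infsum f normalized) < e"
  if S: "finite S" "S0 \<subseteq> S" "S \<subseteq> {p. prime p}" for S
 proof -
  have FS: "F \<subseteq> smooth S" using F S by (auto simp: S0_def smooth_def)
  have "(\<Prod>p\<in>S. 1/(1 - f p)) = infsum f (smooth S)"
   using infsumI[OF euler_finite[OF f1 fm fn summ' small S(1,3)]] by simp
  moreover have "infsum f (normalized - smooth S) = infsum f normalized - infsum f (smooth S)"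
   by (rule infsum_Diff[OF summ' summable_on_subset_banach[OF summ' smooth_subset] smooth_subset])
  moreover have "norm (infsum f (normalized - smooth S)) <= infsum (%x. norm (f x)) (normalized - smooth S)"
   by (rule norm_infsum_bound) (use summ in \<open>auto intro: summable_on_subset_banach\<close>)
  moreover have "infsum (%x. norm (f x)) (normalized - smooth S) <= infsum (%x. norm (f x)) (normalized - F)"
   by (rule infsum_mono2) (use FS summ in \<open>auto intro: summable_on_subset_banach\<close>)
  moreover have "infsum (%x. norm (f x)) (normalized - F) = infsum (%x. norm (f x)) normalized - (\<Sum>x\<in>F. norm (f x))"
   using infsum_Diff[OF summ _ F(2)] F(1) by simp
  ultimately show ?thesis using F(3) by (simp add: dist_norm norm_minus_commute)
 qed
 thus "eventually (%S. dist (\<Prod>p\<in>S. 1/(1 - f p)) (infsum f normalized) < e)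
  (finite_subsets_at_top {p. prime p})"
  unfolding eventually_finite_subsets_at_top using S0 by blast
qed

lemma ln_norm_one_minus:
 fixes z :: complex
 assumes "norm z <= 1/2"
 shows "\<bar>ln (norm (1/(1 - z))) - Re z\<bar> <= 2*(norm z)\<^sup>2"
proof -
 have nz: "1 - z ~= 0" using assms by auto
 have "\<bar>Re (Ln (1+(-z)) - (-z))\<bar> <= norm (Ln (1+(-z)) - (-z))" by (rule abs_Re_le_cmod)
 also have "... <= norm (-z)^2/(1 - norm (-z))" using assms by (intro Ln_approx_linear) auto
 also have "... <= (norm z)\<^sup>2/(1/2)" using assms by (intro divide_left_mono_neg frac_le) auto
 finally have "\<bar>ln (norm (1 - z)) + Re z\<bar> <= 2*(norm z)\<^sup>2" using nz by (simp add: mult.commute)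
 moreover have "ln (norm (1/(1 - z))) = - ln (norm (1 - z))"
  using nz by (simp add: norm_divide ln_div)
 ultimately show ?thesis by linarith
qed

text \<open>Each factor satisfies log |1/(1 - z)| = Re z up to 2 |z|^2, so the logarithm of the
  product is the prime sum up to twice a bound for the sum of squares. The gain is uniformity: in
  the applications \<open>C\<close> does not depend on s.\<close>

lemma euler_ln:
 fixes f :: "'a::factorial_semiring \<Rightarrow> complex"
 assumes f1: "f 1 = 1" and fm: "\<And>x y. f (x*y) = f x * f y" and fn: "\<And>x. f (normalize x) = f x"
  and summ: "(%x. norm (f x)) summable_on normalized"
  and small: "\<And>p. prime p ==> norm (f p) <= 1/2"
  and bound: "\<And>S. finite S ==> S \<subseteq> {p. prime p} ==> (\<Sum>p\<in>S. (norm (f p))\<^sup>2) <= C"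
 shows "infsum f normalized ~= 0"
  and "\<bar>ln (norm (infsum f normalized)) - (\<Sum>\<^sub>\<infinity>p\<in>{p. prime p}. Re (f p))\<bar> <= 2*C"
proof -
 let ?P = "{p::'a. prime p}" and ?L = "infsum f normalized"
 let ?F = "finite_subsets_at_top ?P"
 define R where "R = (\<Sum>\<^sub>\<infinity>p\<in>?P. Re (f p))"
 have lim: "((%S. \<Prod>p\<in>S. 1/(1 - f p)) \<longlongrightarrow> ?L) ?F"
  by (rule euler_limit) (use assms in auto)
 have "f summable_on ?P"
  by (rule summable_on_subset_banach[OF abs_summable_summable[OF summ] primes_subset_normalized])
 hence "(%p. Re (f p)) summable_on ?P" by (rule summable_on_Re)
 hence limR: "((%S. \<Sum>p\<in>S. Re (f p)) \<longlongrightarrow> R) ?F"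
  using has_sum_infsum[of "%p. Re (f p)" ?P] unfolding has_sum_def R_def by simp
 have nz: "1 - f p ~= 0" if "prime p" for p using small[OF that] by auto
 have key: "\<bar>ln (norm (\<Prod>p\<in>S. 1/(1 - f p))) - (\<Sum>p\<in>S. Re (f p))\<bar> <= 2*C"
  if S: "finite S" "S \<subseteq> ?P" for S
 proof -
  have "ln (norm (\<Prod>p\<in>S. 1/(1 - f p))) = (\<Sum>p\<in>S. ln (norm (1/(1 - f p))))"
   unfolding prod_norm[symmetric] by (rule ln_prod) (use S nz in auto)
  hence "\<bar>ln (norm (\<Prod>p\<in>S. 1/(1 - f p))) - (\<Sum>p\<in>S. Re (f p))\<bar>
   = \<bar>\<Sum>p\<in>S. ln (norm (1/(1 - f p))) - Re (f p)\<bar>" by (simp only: sum_subtractf)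
  also have "... <= (\<Sum>p\<in>S. \<bar>ln (norm (1/(1 - f p))) - Re (f p)\<bar>)" by (rule sum_abs)
  also have "... <= (\<Sum>p\<in>S. 2*(norm (f p))\<^sup>2)"
   by (rule sum_mono) (use S small in \<open>intro ln_norm_one_minus, auto\<close>)
  also have "... <= 2*C" using bound[OF S] by (simp add: sum_distrib_left[symmetric])
  finally show ?thesis .
 qed
 have limn: "((%S. norm (\<Prod>p\<in>S. 1/(1 - f p))) \<longlongrightarrow> norm ?L) ?F" by (rule tendsto_norm[OF lim])
 have ev: "eventually (%S. finite S & S \<subseteq> ?P) ?F"
  unfolding eventually_finite_subsets_at_top by (rule exI[of _ "{}"]) auto
 \<comment> \<open>A lower bound for the finite products survives in the limit and shows that the
   limit is nonzero, before its logarithm is taken.\<close>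
 have "eventually (%S. exp ((\<Sum>p\<in>S. Re (f p)) - 2*C) <= norm (\<Prod>p\<in>S. 1/(1 - f p))) ?F"
  using ev
 proof eventually_elim
  case (elim S)
  have "norm (\<Prod>p\<in>S. 1/(1 - f p)) > 0" using elim nz by (subst zero_less_norm_iff) auto
  moreover have "(\<Sum>p\<in>S. Re (f p)) - 2*C <= ln (norm (\<Prod>p\<in>S. 1/(1 - f p)))"
   using key[of S] elim by linarith
  ultimately show ?case by (simp add: ln_ge_iff)
 qed
 moreover have "((%S. exp ((\<Sum>p\<in>S. Re (f p)) - 2*C)) \<longlongrightarrow> exp (R - 2*C)) ?F"
  by (intro tendsto_intros limR)
 ultimately have "exp (R - 2*C) <= norm ?L"
  by (intro tendsto_le[OF finite_subsets_at_top_neq_bot limn])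
 hence L0: "norm ?L > 0" by (smt (verit) exp_gt_zero)
 thus "?L ~= 0" by auto
 have "((%S. \<bar>ln (norm (\<Prod>p\<in>S. 1/(1 - f p))) - (\<Sum>p\<in>S. Re (f p))\<bar>) \<longlongrightarrow> \<bar>ln (norm ?L) - R\<bar>) ?F"
  using L0 by (intro tendsto_intros limR limn) auto
 moreover have "eventually (%S. \<bar>ln (norm (\<Prod>p\<in>S. 1/(1 - f p))) - (\<Sum>p\<in>S. Re (f p))\<bar> <= 2*C) ?F"
  using ev by eventually_elim (use key in auto)
 ultimately show "\<bar>ln (norm ?L) - (\<Sum>\<^sub>\<infinity>p\<in>?P. Re (f p))\<bar> <= 2*C"
  unfolding R_def by (intro tendsto_upperbound[OF _ _ finite_subsets_at_top_neq_bot])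
qed

section \<open>Dirichlet series with periodic coefficients of mean zero\<close>

text \<open>Mean value theorem twice, first in the base and then in the exponent. The logarithm that
  appears is absorbed by ln z <= 8 z^(1/8); with exponents at most 2 this gives the constant 1 + 2 *
  8 = 17 and weakens the decay z^(-2) to z^(-15/8).\<close>

lemma powr_diff_bound:
 fixes x y :: real
 assumes "1 <= y" "y <= x" and s: "s \<in> {1..2}" "t \<in> {1..2}"
 shows "\<bar>(x powr -s - y powr -s) - (x powr -t - y powr -t)\<bar> <= 17*\<bar>s - t\<bar>*(x - y)*y powr (-15/8)"
proof (cases "x = y")
 case False
 hence xy: "y < x" using assms by simp
 define g where "g = (%u. u powr -s - u powr -t)"
 have "\<exists>z>y. z < x & g x - g y = (x - y)*((-s)*z powr (-s - 1) - (-t)*z powr (-t - 1))"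
  unfolding g_def
  by (rule MVT2[OF xy]) (use assms in \<open>auto intro!: derivative_eq_intros\<close>)
 then obtain z where z: "y < z" "z < x"
  "g x - g y = (x - y)*((-s)*z powr (-s - 1) - (-t)*z powr (-t - 1))" by blast
 have z1: "z > 1" using z assms by linarith
 define k where "k = (%\<sigma>. \<sigma>*z powr (-\<sigma> - 1))"
 have kb: "\<bar>k a - k b\<bar> <= \<bar>a - b\<bar>*(17*z powr (-15/8))" if ab: "a \<in> {1..2}" "b \<in> {1..2}" "a < b" for a b
 proof -
  have "\<exists>\<sigma>>a. \<sigma> < b & k b - k a = (b - a)*(z powr (-\<sigma> - 1) - \<sigma> * ln z*z powr (-\<sigma> - 1))"
   unfolding k_def
   by (rule MVT2[OF ab(3)]) (use z1 in \<open>auto intro!: derivative_eq_intros simp: algebra_simps\<close>)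
  then obtain \<sigma> where \<sigma>: "a < \<sigma>" "\<sigma> < b"
   "k b - k a = (b - a)*(z powr (-\<sigma> - 1) - \<sigma> * ln z*z powr (-\<sigma> - 1))" by blast
  have \<sigma>12: "1 <= \<sigma>" "\<sigma> <= 2" using \<sigma> ab by auto
  have lnz: "0 <= ln z" "ln z <= 8*z powr (1/8)" using z1 ln_powr_bound[of z "1/8"] by auto
  have one: "1 <= z powr (1/8)" using z1 by (intro ge_one_powr_ge_zero) auto
  have "z powr (-\<sigma> - 1) - \<sigma> * ln z*z powr (-\<sigma> - 1) = (1 - \<sigma> * ln z)*z powr (-\<sigma> - 1)"
   by (simp add: algebra_simps)
  hence "\<bar>z powr (-\<sigma> - 1) - \<sigma> * ln z*z powr (-\<sigma> - 1)\<bar> = \<bar>1 - \<sigma> * ln z\<bar>*z powr (-\<sigma> - 1)"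
   by (simp add: abs_mult)
  also have "... <= (17*z powr (1/8))*z powr (-2)"
  proof (rule mult_mono)
   have "\<sigma> * ln z <= 2*(8*z powr (1/8))" using \<sigma>12 lnz by (intro mult_mono) auto
   moreover have "0 <= \<sigma> * ln z" using \<sigma>12 lnz by simp
   ultimately show "\<bar>1 - \<sigma> * ln z\<bar> <= 17*z powr (1/8)" using one by linarith
   show "z powr (-\<sigma> - 1) <= z powr (-2)" using z1 \<sigma>12 by (intro powr_mono) auto
  qed auto
  also have "... = 17*z powr (-15/8)" by (simp add: powr_add[symmetric])
  finally have "\<bar>z powr (-\<sigma> - 1) - \<sigma> * ln z*z powr (-\<sigma> - 1)\<bar> <= 17*z powr (-15/8)" .
  hence "\<bar>b - a\<bar>*\<bar>z powr (-\<sigma> - 1) - \<sigma> * ln z*z powr (-\<sigma> - 1)\<bar> <= \<bar>b - a\<bar>*(17*z powr (-15/8))"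
   by (intro mult_left_mono) auto
  hence "\<bar>k b - k a\<bar> <= \<bar>b - a\<bar>*(17*z powr (-15/8))" unfolding \<sigma>(3) abs_mult .
  thus ?thesis by (simp only: abs_minus_commute)
 qed
 have "\<bar>k t - k s\<bar> <= \<bar>s - t\<bar>*(17*z powr (-15/8))"
  using kb[OF s] kb[OF s(2,1)] by (cases s t rule: linorder_cases) (simp_all add: abs_minus_commute)
 also have "... <= \<bar>s - t\<bar>*(17*y powr (-15/8))"
  using z assms by (intro mult_left_mono powr_mono2') auto
 finally have *: "\<bar>k t - k s\<bar> <= \<bar>s - t\<bar>*(17*y powr (-15/8))" .
 have "g x - g y = (x - y)*(k t - k s)" unfolding z(3) k_def by simp
 hence "\<bar>g x - g y\<bar> = (x - y)*\<bar>k t - k s\<bar>" using xy by (simp add: abs_mult)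
 also have "... <= (x - y)*(\<bar>s - t\<bar>*(17*y powr (-15/8)))"
  using*xy by (intro mult_left_mono) auto
 finally have "\<bar>g x - g y\<bar> <= (x - y)*(\<bar>s - t\<bar>*(17*y powr (-15/8)))" .
 moreover have "g x - g y = (x powr -s - y powr -s) - (x powr -t - y powr -t)" by (simp add: g_def)
 ultimately show ?thesis by (simp add: mult_ac)
qed simp

text \<open>This takes the place of analytic continuation. In each block the coefficients sum to
  zero, so every \<open>u powr -s\<close> may be reduced by the value \<open>v powr -s\<close> at a
  base point. The blocks then form an absolutely convergent series for all s in [1, 2], s = 1
  included. It serves both for blocks of integers and for blocks of Gaussian integers.\<close>

lemma block_lipschitz:
 fixes u :: "'w \<Rightarrow> 'r \<Rightarrow> real" and c :: "'r \<Rightarrow> complex" and v \<delta> :: "'w \<Rightarrow> real"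
 assumes R: "finite R" "(\<Sum>r\<in>R. c r) = 0" "\<And>r. r \<in> R ==> norm (c r) <= 1"
  and v: "\<And>w. v w \<ge> 1" and u: "\<And>w r. r \<in> R ==> v w <= u w r" "\<And>w r. r \<in> R ==> u w r <= v w+\<delta> w"
  and summ: "(%w. \<delta> w * v w powr (-15/8)) summable_on UNIV"
 obtains C F where "C \<ge> 0"
  "\<And>s. s \<in> {1..2} ==> ((%w. \<Sum>r\<in>R. c r * of_real (u w r powr -s)) has_sum F s) UNIV"
  "\<And>s t. s \<in> {1..2} ==> t \<in> {1..2} ==> norm (F s - F t) <= C*\<bar>s - t\<bar>"
proof -
 define I where "I = (%s w. \<Sum>r\<in>R. c r * of_real (u w r powr -s))"
 define B where "B = (%w. real (card R)*(17*(\<delta> w * v w powr (-15/8))))"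
 have Bsum: "B summable_on UNIV" unfolding B_def by (intro summable_on_cmult_right summ)
 have I: "I s w = (\<Sum>r\<in>R. c r * of_real (u w r powr -s - v w powr -s))" for s w
 proof -
  have "(\<Sum>r\<in>R. c r * complex_of_real (v w powr -s)) = 0"
   using R(2) by (simp add: sum_distrib_right[symmetric])
  thus ?thesis unfolding I_def by (simp add: right_diff_distrib sum_subtractf)
 qed
 have dB: "norm (I s w - I t w) <= B w*\<bar>s - t\<bar>" if st: "s \<in> {1..2}" "t \<in> {1..2}" for s t w
 proof -
  have "norm (I s w - I t w) = norm (\<Sum>r\<in>R. c r * of_real ((u w r powr -s - v w powr -s) - (u w r powr -t - v w powr -t)))"
   unfolding I sum_subtractf[symmetric] right_diff_distrib[symmetric] of_real_diff ..
  also have "... <= (\<Sum>r\<in>R. 17*\<bar>s - t\<bar>*\<delta> w * v w powr (-15/8))"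
  proof (rule order_trans[OF norm_sum sum_mono])
   fix r assume r: "r \<in> R"
   have "norm (c r * of_real ((u w r powr -s - v w powr -s) - (u w r powr -t - v w powr -t)))
    <= 1*\<bar>(u w r powr -s - v w powr -s) - (u w r powr -t - v w powr -t)\<bar>"
    unfolding norm_mult norm_of_real by (intro mult_right_mono R r) auto
   also have "... <= 17*\<bar>s - t\<bar>*(u w r - v w) * v w powr (-15/8)"
    using powr_diff_bound[OF v u(1)[OF r] st] by simp
   also have "... <= 17*\<bar>s - t\<bar>*\<delta> w * v w powr (-15/8)"
    using u(2)[OF r, of w] by (intro mult_right_mono mult_left_mono) auto
   finally show "norm (c r * of_real ((u w r powr -s - v w powr -s) - (u w r powr -t - v w powr -t)))
    <= 17*\<bar>s - t\<bar>*\<delta> w * v w powr (-15/8)" .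
  qed
  also have "... = B w*\<bar>s - t\<bar>" by (simp add: B_def mult_ac)
  finally show ?thesis .
 qed
 have B1: "norm (I 1 w) <= B w" for w
 proof -
  have "norm (I 1 w) <= (\<Sum>r\<in>R. 17*(\<delta> w * v w powr (-15/8)))"
   unfolding I
  proof (rule order_trans[OF norm_sum sum_mono])
   fix r assume r: "r \<in> R"
   have vu: "1 <= v w" "v w <= u w r" "u w r <= v w+\<delta> w" using v u r by auto
   have "v w powr -1 - u w r powr -1 = (u w r - v w)/(u w r * v w)"
    using vu by (simp add: powr_minus field_simps)
   also have "... <= \<delta> w/(v w * v w)" using vu by (intro frac_le mult_mono) auto
   also have "... = \<delta> w * v w powr (-2)" using vu by (simp add: powr_minus field_simps power2_eq_square)
   also have "... <= \<delta> w * v w powr (-15/8)" using vu by (intro mult_left_mono powr_mono) auto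
   also have "... <= 17*(\<delta> w * v w powr (-15/8))" using vu by simp
   finally have *: "v w powr -1 - u w r powr -1 <= 17*(\<delta> w * v w powr (-15/8))" .
   have "u w r powr -1 <= v w powr -1" using vu by (intro powr_mono2') auto
   hence "norm (c r * of_real (u w r powr -1 - v w powr -1)) <= 1*(v w powr -1 - u w r powr -1)"
    unfolding norm_mult norm_of_real using R(3)[OF r] by (intro mult_mono) auto
   thus "norm (c r * of_real (u w r powr -1 - v w powr -1)) <= 17*(\<delta> w * v w powr (-15/8))"
    by (rule order_trans) (use*in simp)
  qed
  thus ?thesis by (simp add: B_def)
 qed
 have B0: "B w \<ge> 0" for w using B1[of w] norm_ge_zero order_trans by blast
 \<comment> \<open>Summability is known at s = 1 from \<open>B1\<close>; the bound \<open>dB\<close>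
   carries it to every other exponent.\<close>
 have sI: "(%w. I s w) summable_on UNIV" if s: "s \<in> {1..2}" for s
 proof -
  have "norm (I s w) <= 2*B w" for w
  proof -
   have "norm (I s w) <= norm (I 1 w)+norm (I s w - I 1 w)" by (metis norm_triangle_sub)
   also have "norm (I s w - I 1 w) <= B w*\<bar>s - 1\<bar>" using dB[of s 1 w] s by simp
   also have "... <= B w*1" using s B0 by (intro mult_left_mono) auto
   finally show ?thesis using B1[of w] by simp
  qed
  hence "(%w. norm (I s w)) summable_on UNIV"
   by (intro summable_on_comparison_test[OF summable_on_cmult_right[OF Bsum, of 2]]) auto
  thus ?thesis by (rule abs_summable_summable)
 qed
 show ?thesis
 proof (rule that[of "infsum B UNIV" "%s. infsum (I s) UNIV"])
  show "infsum B UNIV \<ge> 0" using B0 by (intro infsum_nonneg) auto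
  show "((%w. \<Sum>r\<in>R. c r * of_real (u w r powr -s)) has_sum infsum (I s) UNIV) UNIV"
   if "s \<in> {1..2}" for s
   using has_sum_infsum[OF sI[OF that]] unfolding I_def .
  fix s t :: real assume st: "s \<in> {1..2}" "t \<in> {1..2}"
  have "((%w. I s w + - I t w) has_sum (infsum (I s) UNIV + - infsum (I t) UNIV)) UNIV"
   by (intro has_sum_add has_sum_uminusI has_sum_infsum sI st)
  moreover have "((%w. B w*\<bar>s - t\<bar>) has_sum (infsum B UNIV*\<bar>s - t\<bar>)) UNIV"
   by (intro has_sum_cmult_left has_sum_infsum Bsum)
  ultimately have "norm (infsum (I s) UNIV + - infsum (I t) UNIV) <= infsum B UNIV*\<bar>s - t\<bar>"
   by (rule norm_infsum_le) (use dB[OF st] in simp)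
  thus "norm (infsum (I s) UNIV - infsum (I t) UNIV) <= infsum B UNIV*\<bar>s - t\<bar>" by simp
 qed
qed

section \<open>Quadratic Dirichlet series\<close>

lemma normalized_nat: "(normalized :: nat set) = {0<..}"
 by (auto simp: normalized_def)

lemma summable_on_nat_powr:
 assumes "s > 1"
 shows "(%n::nat. real n powr -s) summable_on A"
proof -
 have "summable (%n. real n powr -s)" using assms by (simp add: summable_real_powr_iff)
 hence "(%n::nat. real n powr -s) summable_on UNIV"
  by (intro norm_summable_imp_summable_on) simp
 thus ?thesis by (rule summable_on_subset_banach) auto
qed

text \<open>The value \<zeta>(2), which bounds the quadratic errors of all Euler products over the
  rational primes.\<close>

definition csq :: real where
 "csq = (\<Sum>\<^sub>\<infinity>n::nat. real n powr -2)"

lemma sum_powr_le_csq: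
 assumes "finite S" "s \<ge> 2"
 shows "(\<Sum>n\<in>S. real n powr -s) <= csq"
proof -
 have "(\<Sum>n\<in>S. real n powr -s) <= (\<Sum>n\<in>S. real n powr -2)"
 proof (rule sum_mono)
  fix n :: nat
  show "real n powr -s <= real n powr -2" using assms by (cases "n = 0") (auto intro!: powr_mono)
 qed
 also have "... <= csq" unfolding csq_def
  by (rule finite_sum_le_infsum) (use assms summable_on_nat_powr[of 2] in auto)
 finally show ?thesis .
qed

definition prime_sum :: "(nat \<Rightarrow> real) \<Rightarrow> real \<Rightarrow> real" where
 "prime_sum c s = (\<Sum>\<^sub>\<infinity>p\<in>{p. prime p}. c p * real p powr -s)"

definition Lser :: "(nat \<Rightarrow> real) \<Rightarrow> real \<Rightarrow> complex" where
 "Lser c s = (\<Sum>\<^sub>\<infinity>n\<in>{0<..}. of_real (c n * real n powr -s))"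

lemma abs_summable_bounded:
 assumes "\<And>n. \<bar>c n\<bar> <= B" "s > 1"
 shows "(%n::nat. norm (c n * real n powr -s)) summable_on A"
proof (rule summable_on_comparison_test[OF summable_on_cmult_right[OF summable_on_nat_powr[OF assms(2)], of B]])
 show "norm (c n * real n powr -s) <= B * real n powr -s" for n
  using assms(1) by (simp add: abs_mult mult_right_mono)
qed auto

lemma summable_bounded:
 assumes "\<And>n. \<bar>c n\<bar> <= B" "s > 1"
 shows "(%n::nat. c n * real n powr -s :: real) summable_on A"
 by (rule abs_summable_summable[OF abs_summable_bounded[OF assms]])

lemma Lser_ln:
 fixes c :: "nat \<Rightarrow> real"
 assumes "c 1 = 1" "\<And>m n. c (m*n) = c m * c n" "\<And>n. \<bar>c n\<bar> <= 1" "s > 1"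
 shows "Lser c s ~= 0" "\<bar>ln (norm (Lser c s)) - prime_sum c s\<bar> <= 2 * csq"
proof -
 define f where "f = (%n::nat. complex_of_real (c n * real n powr -s))"
 have nf: "norm (f n) <= real n powr -s" for n
  using mult_right_mono[OF assms(3)[of n], of "real n powr -s"] by (simp add: f_def norm_mult abs_mult del: of_real_mult)
 have half: "norm (f p) <= 1/2" if "prime p" for p
 proof -
  have p: "p \<ge> 2" using prime_ge_2_nat[OF that] .
  have "real p powr -s <= real p powr -1" using p assms(4) by (intro powr_mono) auto
  also have "... <= 1/2" using p by (simp add: powr_minus field_simps)
  finally show ?thesis using nf[of p] by linarith
 qed
 have bd: "(\<Sum>p\<in>S. (norm (f p))\<^sup>2) <= csq" if "finite S" for S
 proof -
  have "(\<Sum>p\<in>S. (norm (f p))\<^sup>2) <= (\<Sum>p\<in>S. real p powr -(2 * s))"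
  proof (rule sum_mono)
   fix p
   have "(norm (f p))\<^sup>2 <= (real p powr -s)\<^sup>2" using nf by (intro power_mono) auto
   also have "... = real p powr -(2 * s)"
    by (cases "p = 0") (auto simp: power2_eq_square powr_add[symmetric])
   finally show "(norm (f p))\<^sup>2 <= real p powr -(2 * s)" .
  qed
  also have "... <= csq" by (rule sum_powr_le_csq) (use that assms in auto)
  finally show ?thesis .
 qed
 have summ: "(%x. norm (f x)) summable_on normalized"
  using abs_summable_bounded[OF assms(3,4)] by (simp add: f_def norm_mult abs_mult)
 have f1: "f 1 = 1" using assms(1) by (simp add: f_def)
 have fm: "f (x*y) = f x * f y" for x y by (simp add: f_def assms(2) powr_mult)
 note E = euler_ln[of f csq, OF f1 fm _ summ half bd]
 have "infsum f normalized ~= 0"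
  "\<bar>ln (norm (infsum f normalized)) - (\<Sum>\<^sub>\<infinity>p\<in>{p. prime p}. Re (f p))\<bar> <= 2 * csq"
  by (rule E; simp)+
 thus "Lser c s ~= 0" "\<bar>ln (norm (Lser c s)) - prime_sum c s\<bar> <= 2 * csq"
  unfolding Lser_def prime_sum_def f_def normalized_nat by auto
qed

text \<open>Residues run from 1 to \<open>M\<close> rather than from 0 to \<open>M - 1\<close>, so
  that the blocks exhaust exactly the positive integers.\<close>

lemma bij_betw_blocks:
 assumes "M > (0::nat)"
 shows "bij_betw (%(w, r). M*w + r) (UNIV \<times> {1..M}) {0<..}"
proof (rule bij_betw_byWitness[where f' = "%n. ((n - 1) div M, (n - 1) mod M+1)"])
 show "\<forall>a\<in>UNIV \<times> {1..M}. (%n. ((n - 1) div M, (n - 1) mod M+1)) ((%(w, r). M*w + r) a) = a"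
 proof
  fix a :: "nat \<times> nat" assume "a \<in> UNIV \<times> {1..M}"
  then obtain w r where "a = (w, Suc r)" "r < M"
   by (cases a; cases "snd a") auto
  thus "(%n. ((n - 1) div M, (n - 1) mod M+1)) ((%(w, r). M*w + r) a) = a" by simp
 qed
 show "\<forall>a'\<in>{0<..}. (%(w, r). M*w + r) ((%n. ((n - 1) div M, (n - 1) mod M+1)) a') = a'"
  by (auto simp: mult_div_mod_eq)
 show "(%n. ((n - 1) div M, (n - 1) mod M+1)) ` {0<..} \<subseteq> UNIV \<times> {1..M}"
  using assms by (auto simp: Suc_le_eq)
qed (use assms in auto)

lemma sum_residues_shift:
 fixes c :: "nat \<Rightarrow> real"
 assumes "\<And>n. c (n+M) = c n"
 shows "(\<Sum>r\<in>{1..M}. c r) = (\<Sum>r<M. c r)"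
proof (cases M)
 case (Suc m)
 have "(\<Sum>r\<in>{1..M}. c r) = (\<Sum>r\<in>{1..m}. c r) + c (0+M)" unfolding Suc by simp
 also have "c (0+M) = c 0" by (rule assms)
 also have "(\<Sum>r\<in>{1..m}. c r) + c 0 = (\<Sum>r\<in>{0..m}. c r)" by (simp add: sum.atLeast_Suc_atMost)
 finally show ?thesis unfolding Suc by (simp add: lessThan_Suc_atMost atLeast0AtMost)
qed simp

lemma periodic_mult:
 assumes "\<And>n. c (n+M) = c n"
 shows "c (M*w + r) = c (r::nat)"
proof (induction w)
 case (Suc w)
 have "M*Suc w + r = (M*w + r)+M" by simp
 thus ?case using assms Suc by metis
qed simp

text \<open>The blocks are the periods, based at \<open>M*w + 1\<close>. Besides the extension to
  [1, 2], the value at 1 is identified with the grouped series of c(n)/n, the form in which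
  nonvanishing is proved.\<close>

lemma Lser_lipschitz:
 fixes c :: "nat \<Rightarrow> real"
 assumes c: "\<And>n. \<bar>c n\<bar> <= 1" and per: "\<And>n. c (n+M) = c n" and M: "M > 0" and zero: "(\<Sum>r<M. c r) = 0"
 obtains C F where "C \<ge> 0"
  "\<And>s. s \<in> {1<..2} ==> Lser c s = F s"
  "\<And>s t. s \<in> {1..2} ==> t \<in> {1..2} ==> norm (F s - F t) <= C*\<bar>s - t\<bar>"
  "((%w. \<Sum>r\<in>{1..M}. of_real (c r / real (M*w + r))) has_sum F 1) UNIV"
proof -
 note pm = periodic_mult[of c M, OF per]
 define u where "u = (%w r. real (M*w + r))"
 obtain C F where CF: "C \<ge> 0"
  "\<And>s. s \<in> {1..2} ==> ((%w::nat. \<Sum>r\<in>{1..M}. complex_of_real (c r) * of_real (u w r powr -s)) has_sum F s) UNIV"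
  "\<And>s t. s \<in> {1..2} ==> t \<in> {1..2} ==> norm (F s - F t) <= C*\<bar>s - t\<bar>"
 proof (rule block_lipschitz[where R = "{1..M}" and c = "%r. complex_of_real (c r)" and u = u
    and v = "%w. real (M*w)+1" and \<delta> = "%w. real M"])
  show "(\<Sum>r\<in>{1..M}. complex_of_real (c r)) = 0"
   using sum_residues_shift[of c M, OF per] zero unfolding of_real_sum[symmetric] by simp
  show "(%w. real M*(real (M*w)+1) powr (- 15/8)) summable_on UNIV"
  proof (rule summable_on_cmult_right)
   have "(%n. real (Suc n) powr (- (15/8))) summable_on UNIV"
    using summable_on_reindex[of Suc UNIV "%n. real n powr -(15/8)"] summable_on_nat_powr[of "15/8" "range Suc"]
    by (simp add: o_def)
   thus "(%w. (real (M*w)+1) powr (- 15/8)) summable_on UNIV"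
   proof (rule summable_on_comparison_test)
    fix w :: nat
    have "real (Suc w) <= real (M*w)+1" using M by (cases M) auto
    thus "(real (M*w)+1) powr (- 15/8) <= real (Suc w) powr (- (15/8))"
     by (simp only: minus_divide_left) (intro powr_mono2', auto)
   qed auto
  qed
 qed (use c in \<open>auto simp: u_def\<close>)
 show ?thesis
 proof (rule that[of C F])
  fix s :: real assume s: "s \<in> {1<..2}"
  let ?f = "%n::nat. complex_of_real (c n * real n powr -s)"
  have "?f summable_on {0<..}" using summable_bounded[OF c, where s = s and A = "{0<..}"] s
   by (intro summable_on_of_real) auto
  hence "(?f has_sum Lser c s) {0<..}" unfolding Lser_def by (rule has_sum_infsum)
  hence "((%z. ?f ((%(w, r). M*w + r) z)) has_sum Lser c s) (UNIV \<times> {1..M})"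
   using has_sum_reindex_bij_betw[OF bij_betw_blocks[OF M], of ?f "Lser c s"] by simp
  hence "((%w. \<Sum>r\<in>{1..M}. ?f (M*w + r)) has_sum Lser c s) UNIV"
   by (rule has_sum_SigmaD) (auto intro: has_sum_finiteI)
  moreover have "((%w. \<Sum>r\<in>{1..M}. ?f (M*w + r)) has_sum F s) UNIV"
   using CF(2)[of s] s by (simp add: pm u_def)
  ultimately show "Lser c s = F s" by (rule has_sum_unique)
 next
  have eq: "(%w. \<Sum>r\<in>{1..M}. complex_of_real (c r / real (M*w + r)))
   = (%w. \<Sum>r\<in>{1..M}. complex_of_real (c r) * of_real (u w r powr -1))"
   by (intro ext sum.cong) (simp_all add: u_def powr_minus field_simps)
  show "((%w. \<Sum>r\<in>{1..M}. of_real (c r / real (M*w + r))) has_sum F 1) UNIV"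
   unfolding eq by (rule CF(2)) simp
 qed (use CF in auto)
qed

subsection \<open>Nonvanishing at 1, after Monsky\<close>

text \<open>The difference of the \<open>n\<close>-th weights in L(1)/(1 - x) and in the Lambert
  series. If L(1) = 0, the Lambert series is minus the series with these weights, which decrease in
  \<open>n\<close>.\<close>

definition monsky_b :: "real \<Rightarrow> nat \<Rightarrow> real" where
 "monsky_b x n = 1/(real n*(1 - x)) - x^n/(1 - x^n)"

text \<open>Pair the exponents i and n - 1 - i and apply the arithmetic-geometric mean inequality to
  each pair.\<close>

lemma sum_powers_ge:
 fixes x :: real
 assumes "0 < x" "x < 1"
 shows "(\<Sum>i<n. x^i) \<ge> real n * sqrt (x^(n - 1))"
proof (cases n)
 case (Suc m)
 have am: "2 * sqrt (x ^ m) <= x^i+x^(m - i)" if "i <= m" for i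
 proof -
  have "x^i*x^(m - i) = x ^ m" using that by (simp add: power_add[symmetric])
  thus ?thesis using arith_geo_mean_sqrt[of "x^i" "x^(m - i)"] assms by simp
 qed
 have "2*(real n * sqrt (x ^ m)) = (\<Sum>i\<le>m. 2 * sqrt (x ^ m))" by (simp add: Suc)
 also have "... <= (\<Sum>i\<le>m. x^i+x^(m - i))" by (intro sum_mono am) auto
 also have "... = (\<Sum>i\<le>m. x^i)+(\<Sum>i\<le>m. x^(m - i))" by (rule sum.distrib)
 also have "(\<Sum>i\<le>m. x^(m - i)) = (\<Sum>i\<le>m. x^i)"
  by (rule sum.reindex_bij_witness[of _ "%i. m - i" "%i. m - i"]) auto
 finally have "real n * sqrt (x ^ m) <= (\<Sum>i\<le>m. x^i)" by simp
 thus ?thesis by (simp add: Suc lessThan_Suc_atMost)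
qed simp

lemma frac_le_one_over:
 fixes u y z :: real
 assumes "u*y <= z" "u > 0" "z > 0"
 shows "y/z <= 1/u"
 using assms by (simp add: field_simps)

text \<open>With A and B the sums of the first n and n + 1 powers of x, the relation B = 1 + x A
  reduces the claim to n (n + 1) x^n <= A B, which follows from
  \<open>sum_powers_ge\<close>.\<close>

lemma monsky_b_decreasing:
 assumes x: "0 < x" "x < 1" and n: "n \<ge> 1"
 shows "monsky_b x (Suc n) <= monsky_b x n"
proof -
 define A where "A = (\<Sum>i<n. x^i)"
 define B where "B = (\<Sum>i<Suc n. x^i)"
 have A: "1 - x^n = (1 - x)*A" "1 - x^Suc n = (1 - x)*B"
  unfolding A_def B_def by (rule one_diff_power_eq)+
 have "A > 0" unfolding A_def by (rule sum_pos) (use x n in \<open>auto simp: lessThan_empty_iff\<close>)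
 moreover have "B = A+x^n" unfolding A_def B_def by simp
 ultimately have A0: "A > 0" "B > 0" using x by (auto intro: add_pos_pos)
 have B1: "B = 1+x*A" unfolding A_def B_def by (subst sum.lessThan_Suc_shift) (simp add: sum_distrib_left)
 have "real n * real (Suc n)*x^n <= A*B"
 proof -
  have "A*B \<ge> (real n * sqrt (x^(n - 1)))*(real (Suc n) * sqrt (x^n))"
   using sum_powers_ge[OF x, of n] sum_powers_ge[OF x, of "Suc n"] x A0
   unfolding A_def[symmetric] B_def[symmetric] by (intro mult_mono) auto
  moreover have "sqrt (x^n) <= sqrt (x^(n - 1))" using x by (intro real_sqrt_le_mono power_decreasing) auto
  hence "sqrt (x^n) * sqrt (x^n) <= sqrt (x^(n - 1)) * sqrt (x^n)" using x by (intro mult_right_mono) auto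
  hence "x^n <= sqrt (x^(n - 1)) * sqrt (x^n)" using x by simp
  hence "(real n * real (Suc n))*x^n <= (real n * real (Suc n))*(sqrt (x^(n - 1)) * sqrt (x^n))"
   by (intro mult_left_mono) auto
  ultimately show ?thesis by (simp add: mult_ac)
 qed
 hence key: "x^n/(A*B) <= 1/(real n * real (Suc n))"
  using A0 n by (intro frac_le_one_over) auto
 have "x^n/A - x^Suc n/B = x^n*(B - x*A)/(A*B)" using A0 by (simp add: field_simps)
 also have "... = x^n/(A*B)" by (simp add: B1)
 also have "... <= 1/(real n * real (Suc n))" by (rule key)
 also have "... = 1 / real n - 1 / real (Suc n)" using n by (simp add: field_simps)
 finally have "1 / real (Suc n) - x^Suc n/B <= 1 / real n - x^n/A" by linarith
 hence "(1 / real (Suc n) - x^Suc n/B)/(1 - x) <= (1 / real n - x^n/A)/(1 - x)"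
  using x by (intro divide_right_mono) auto
 thus ?thesis unfolding monsky_b_def A using x A0 n
  by (simp add: diff_divide_distrib mult.commute)
qed

lemma monsky_b_mono:
 assumes x: "0 < x" "x < 1" and n: "1 <= m" "m <= n"
 shows "monsky_b x n <= monsky_b x m"
 using n(2)
proof (induction n rule: dec_induct)
 case (step k)
 thus ?case using monsky_b_decreasing[OF x, of k] n(1) by linarith
qed simp

lemma monsky_b_nonneg:
 assumes x: "0 < x" "x < 1" and n: "n \<ge> 1"
 shows "monsky_b x n \<ge> 0"
proof -
 define A where "A = (\<Sum>i<n. x^i)"
 have A: "1 - x^n = (1 - x)*A" unfolding A_def by (rule one_diff_power_eq)
 have A0: "A > 0" unfolding A_def by (rule sum_pos) (use x n in \<open>auto simp: lessThan_empty_iff\<close>)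
 have "real n*x^n = (\<Sum>i<n. x^n)" by simp
 also have "... <= A" unfolding A_def using x by (intro sum_mono power_decreasing) auto
 finally have "x^n/A <= 1 / real n" using A0 n by (simp add: field_simps)
 hence "x^n/A/(1 - x) <= 1 / real n/(1 - x)" using x by (intro divide_right_mono) auto
 thus ?thesis unfolding monsky_b_def A by (simp add: mult.commute)
qed

text \<open>The divisor sum is multiplicative, and at \<open>p^k\<close> it is 1 + c + ... + c^k
  with c in {-1, 0, 1}: never negative, and at least 1 if \<open>k\<close> is even.\<close>

lemma divisor_sum_nonneg:
 fixes c :: "nat \<Rightarrow> real"
 assumes c1: "c 1 = 1" and cm: "\<And>m n. c (m*n) = c m * c n" and cv: "\<And>n. c n \<in> {-1, 0, 1}"
 shows "m > 0 ==> 0 <= (\<Sum>n | n dvd m. c n) & ((\<exists>y. m = y\<^sup>2) \<longrightarrow> 1 <= (\<Sum>n | n dvd m. c n))"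
proof (induction m rule: less_induct)
 case (less m)
 show ?case
 proof (cases "m = 1")
  case True
  thus ?thesis using c1 by simp
 next
  case False
  then obtain p where p: "prime p" "p dvd m" using prime_factor_nat by blast
  define k where "k = multiplicity p m"
  obtain m' where m': "m = p^k * m'" "~ p dvd m'"
   using multiplicity_decompose'[of m p] less.prems p unfolding k_def
   by (metis bot_nat_0.not_eq_extremum not_prime_unit)
  have m'0: "m' > 0" using m'(2) by (cases m') auto
  have p1: "p > 1" using p prime_gt_1_nat by blast
  have k0: "k > 0" using p less.prems by (simp add: k_def prime_multiplicity_gt_zero_iff)
  have "m' < m" unfolding m'(1) using m'0 one_less_power[OF p1 k0] by simp
  note IH = less.IH[OF this m'0]
  have cop: "coprime (p^k) m'" using p m'(2) by (simp add: prime_imp_coprime)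
  have "(\<Sum>n | n dvd m. c n) = (\<Sum>(i, n)\<in>{..k} \<times> {n. n dvd m'}. c (p^i*n))"
  proof -
   have "bij_betw (%(i, n). p^i*n) ({..k} \<times> {n. n dvd m'}) {n. n dvd m}"
    unfolding bij_betw_def
   proof
    show "inj_on (%(i, n). p^i*n) ({..k} \<times> {n. n dvd m'})"
    proof (rule inj_onI, clarify)
     fix i n j l assume *: "n dvd m'" "l dvd m'" "p^i*n = p^j * l"
     have "~ p dvd n" "~ p dvd l" using * m' dvd_trans by blast+
     hence "multiplicity p (p^i*n) = i" "multiplicity p (p^j * l) = j"
      using p1 by (auto intro!: multiplicity_decomposeI[OF refl])
     hence "i = j" using*by simp
     thus "i = j & n = l" using*p1 by simp
    qed
    show "(%(i, n). p^i*n) ` ({..k} \<times> {n. n dvd m'}) = {n. n dvd m}"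
    proof (intro equalityI subsetI)
     fix y assume "y \<in> (%(i, n). p^i*n) ` ({..k} \<times> {n. n dvd m'})"
     thus "y \<in> {n. n dvd m}" unfolding m'(1) by (auto intro!: mult_dvd_mono le_imp_power_dvd)
    next
     fix y assume "y \<in> {n. n dvd m}"
     hence "y dvd p^k * m'" by (simp add: m'(1))
     then obtain a b where ab: "y = a*b" "a dvd p^k" "b dvd m'" by (rule dvd_productE)
     then obtain i where "i <= k" "a = p^i" using divides_primepow_nat[OF p(1)] by blast
     thus "y \<in> (%(i, n). p^i*n) ` ({..k} \<times> {n. n dvd m'})" using ab by force
    qed
   qed
   from sum.reindex_bij_betw[OF this, of c] show ?thesis by (simp add: split_def)
  qed
  also have "... = (\<Sum>i\<le>k. \<Sum>n | n dvd m'. c (p^i*n))"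
   by (rule sum.cartesian_product[symmetric])
  also have "... = (\<Sum>i\<le>k. c p^i)*(\<Sum>n | n dvd m'. c n)"
  proof -
   have "c (p^i) = c p^i" for i by (induction i) (auto simp: c1[unfolded One_nat_def] cm)
   thus ?thesis by (simp add: cm sum_product)
  qed
  finally have fact: "(\<Sum>n | n dvd m. c n) = (\<Sum>i\<le>k. c p^i)*(\<Sum>n | n dvd m'. c n)" .
  have geo: "(\<Sum>i\<le>k. (-1::real)^i) = (if even k then 1 else 0)" for k by (induction k) auto
  have geo0: "(\<Sum>i\<le>k. (0::real)^i) = 1" for k by (induction k) auto
  have pos: "(\<Sum>i\<le>k. c p^i) \<ge> 0" "even k ==> (\<Sum>i\<le>k. c p^i) \<ge> 1"
   using cv[of p] geo[of k] geo0[of k] by auto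
  show ?thesis
  proof (intro conjI impI)
   show "0 <= (\<Sum>n | n dvd m. c n)" unfolding fact using pos IH by simp
   assume "\<exists>y. m = y\<^sup>2"
   then obtain y where y: "m = y\<^sup>2" by blast
   have y0: "y ~= 0" using y less.prems by (intro notI) auto
   have ky: "k = 2 * multiplicity p y"
    unfolding k_def y using p y0 by (simp add: prime_elem_multiplicity_power_distrib)
   obtain y' where y': "y = p ^ multiplicity p y*y'" using multiplicity_dvd[of p y] by (auto simp: dvd_def)
   have "p^k * m' = p^k*y'\<^sup>2"
    using m'(1) y y' ky by (metis power_mult_distrib power_mult mult.commute)
   hence "m' = y'\<^sup>2" using p1 by simp
   hence "1 <= (\<Sum>n | n dvd m'. c n)" using IH by blast
   moreover have "1 <= (\<Sum>i\<le>k. c p^i)" using pos(2) ky by simp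
   ultimately show "1 <= (\<Sum>n | n dvd m. c n)" unfolding fact
    using mult_mono[of 1 "\<Sum>i\<le>k. c p^i" 1 "\<Sum>n | n dvd m'. c n"] by simp
  qed
 qed
qed

text \<open>Both series come from the double series of c(n) x^(n j), summed over j first or grouped
  by m = n j.\<close>

lemma lambert_has_sum:
 fixes c :: "nat \<Rightarrow> real"
 assumes x: "0 < x" "x < 1" and c: "\<And>n. \<bar>c n\<bar> <= 1"
 obtains f where "((%n. c n*(x^n/(1 - x^n))) has_sum f) {0<..}"
  "((%m. (\<Sum>n | n dvd m. c n)*x ^ m) has_sum f) {0<..}"
proof -
 have xn: "x^n < 1" "0 < x^n" if "n > 0" for n using x that by (auto simp: power_less_one_iff)
 have inner: "((%j. (x^n)^j) has_sum (x^n/(1 - x^n))) {0<..}" if n: "n > 0" for n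
 proof -
  have "((%j. (x^n)^j) has_sum (1/(1 - x^n))) UNIV"
   by (rule norm_summable_imp_has_sum)
     (use xn[OF n] in \<open>auto intro: summable_geometric geometric_sums\<close>)
  hence "((%j. (x^n)^j) has_sum (1/(1 - x^n) - 1)) (UNIV - {0})"
   by (intro has_sum_Diff) (auto simp: has_sum_finite_iff)
  moreover have "1/(1 - x^n) - 1 = x^n/(1 - x^n)" using xn[OF n] by (simp add: field_simps)
  moreover have "UNIV - {0::nat} = {0<..}" by auto
  ultimately show ?thesis by simp
 qed
 have outer: "(%n. x^n/(1 - x^n)) summable_on {0<..}"
 proof (rule summable_on_comparison_test)
  have "(%n. x^n) summable_on UNIV"
   by (rule norm_summable_imp_summable_on) (use x in \<open>auto intro: summable_geometric\<close>)
  thus "(%n. x^n*(1/(1 - x))) summable_on {0<..}"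
   by (intro summable_on_cmult_left) (auto intro: summable_on_subset_banach)
  fix n :: nat assume n: "n \<in> {0<..}"
  have "x^n <= x" using x n power_decreasing[of 1 n x] by auto
  hence "x^n/(1 - x^n) <= x^n/(1 - x)" using x by (intro divide_left_mono mult_pos_pos) auto
  thus "x^n/(1 - x^n) <= x^n*(1/(1 - x))" by simp
  show "0 <= x^n/(1 - x^n)" using xn[of n] n by auto
 qed
 have "(%(n, j). (x^n)^j) summable_on Sigma {0<..} (%_. {0<..})"
  by (rule summable_on_SigmaI[OF _ outer]) (use inner x in auto)
 hence "(%z. norm (case z of (n, j) \<Rightarrow> c n*(x^n)^j)) summable_on Sigma {0<..} (%_. {0<..})"
 proof (rule summable_on_comparison_test)
  fix z :: "nat \<times> nat"
  obtain n j where z: "z = (n, j)" by (cases z)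
  have "\<bar>c n\<bar>*(x^n)^j <= 1*(x^n)^j" using c x by (intro mult_right_mono) auto
  thus "norm (case z of (n, j) \<Rightarrow> c n*(x^n)^j) <= (case z of (n, j) \<Rightarrow> (x^n)^j)"
   using x by (simp add: z abs_mult)
 qed auto
 hence "(%(n, j). c n*(x^n)^j) summable_on Sigma {0<..} (%_. {0<..})"
  by (rule abs_summable_summable)
 then obtain f where f: "((%(n, j). c n*(x^n)^j) has_sum f) (Sigma {0<..} (%_. {0<..}))"
  by (auto simp: summable_on_def)
 show ?thesis
 proof (rule that[of f])
  show "((%n. c n*(x^n/(1 - x^n))) has_sum f) {0<..}"
  proof (rule has_sum_SigmaD[OF f])
   fix n :: nat assume "n \<in> {0<..}"
   thus "((%j. case (n, j) of (n, j) \<Rightarrow> c n*(x^n)^j) has_sum c n*(x^n/(1 - x^n))) {0<..}"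
    using has_sum_cmult_right[OF inner, of n "c n"] by simp
  qed
  let ?S = "Sigma {0<..} (%m::nat. {n. n dvd m})"
  have "bij_betw (%(m, n). (n, m div n)) ?S (Sigma {0<..} (%_. {0<..}))"
   by (rule bij_betw_byWitness[where f' = "%(n, j). (n*j, n)"])
     (auto simp: dvd_div_eq_0_iff dvd_pos_nat elim!: dvdE)
  hence "((%z. (%(n, j). c n*(x^n)^j) ((%(m, n). (n, m div n)) z)) has_sum f) ?S"
   using f has_sum_reindex_bij_betw by blast
  hence "((%m. \<Sum>n | n dvd m. c n*(x^n)^(m div n)) has_sum f) {0<..}"
   by (rule has_sum_SigmaD) (auto intro!: has_sum_finiteI)
  moreover have "(\<Sum>n | n dvd m. c n*(x^n)^(m div n)) = (\<Sum>n | n dvd m. c n)*x ^ m" for m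
   unfolding sum_distrib_right by (intro sum.cong) (auto simp: power_mult[symmetric])
  ultimately show "((%m. (\<Sum>n | n dvd m. c n)*x ^ m) has_sum f) {0<..}" by simp
 qed
qed

text \<open>If the value at 1 vanished, the Lambert series f(x) would be at most M for all x in (0,
  1). But its power series has nonnegative coefficients that are at least 1 at squares, so f(x) is
  at least a sum of M + 1 powers x^(k^2), which tends to M + 1.\<close>

lemma Lser_nonvanishing:
 fixes c :: "nat \<Rightarrow> real"
 assumes c1: "c 1 = 1" and cm: "\<And>m n. c (m*n) = c m * c n" and cv: "\<And>n. c n \<in> {-1, 0, 1}"
  and per: "\<And>n. c (n+M) = c n" and M: "M > 0" and zero: "(\<Sum>r<M. c r) = 0"
 shows "~ ((%w. \<Sum>r\<in>{1..M}. c r / real (M*w + r)) has_sum 0) UNIV"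
proof
 assume vanish: "((%w. \<Sum>r\<in>{1..M}. c r / real (M*w + r)) has_sum 0) UNIV"
 have c_le: "\<bar>c n\<bar> <= 1" for n using cv[of n] by auto
 note pm = periodic_mult[of c M, OF per]
 have main: "(\<Sum>k\<in>{1..M+1}. x^(k\<^sup>2)) <= real M" if x: "0 < x" "x < 1" for x :: real
 proof -
  obtain f where f: "((%n. c n*(x^n/(1 - x^n))) has_sum f) {0<..}"
   "((%m. (\<Sum>n | n dvd m. c n)*x ^ m) has_sum f) {0<..}"
   by (rule lambert_has_sum[of x c, OF x c_le])
  let ?g = "%n. c n*(x^n/(1 - x^n))"
  have "((%z. ?g ((%(w, r). M*w + r) z)) has_sum f) (UNIV \<times> {1..M})"
   using has_sum_reindex_bij_betw[OF bij_betw_blocks[OF M], of ?g f] f(1) by simp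
  hence "((%w. \<Sum>r\<in>{1..M}. ?g (M*w + r)) has_sum f) UNIV"
   by (rule has_sum_SigmaD) (auto intro: has_sum_finiteI)
  hence "((%w. (\<Sum>r\<in>{1..M}. c r / real (M*w + r))*(1/(1 - x)) + - (\<Sum>r\<in>{1..M}. ?g (M*w + r)))
   has_sum (0*(1/(1 - x)) + - f)) UNIV"
   by (intro has_sum_add has_sum_uminusI has_sum_cmult_left vanish)
  moreover have "(\<Sum>r\<in>{1..M}. c r / real (M*w + r))*(1/(1 - x)) + - (\<Sum>r\<in>{1..M}. ?g (M*w + r))
   = (\<Sum>r\<in>{1..M}. c r * monsky_b x (M*w + r))" for w
   unfolding sum_distrib_right sum_negf[symmetric] sum.distrib[symmetric]
   by (intro sum.cong refl) (simp add: pm monsky_b_def right_diff_distrib)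
  ultimately have "((%w. \<Sum>r\<in>{1..M}. c r * monsky_b x (M*w + r)) has_sum -f) UNIV" by simp
  hence sums: "(%w. \<Sum>r\<in>{1..M}. c r * monsky_b x (M*w + r)) sums -f" by (rule has_sum_imp_sums)
  \<comment> \<open>The zero coefficient sum allows the first weight of the block to be subtracted.
    By monotonicity each term is bounded by the drop over the block, and the drops telescope to at
    most \<open>monsky_b x 1\<close>, which is 1.\<close>
  have block: "\<bar>\<Sum>r\<in>{1..M}. c r * monsky_b x (M*w + r)\<bar>
   <= real M*(monsky_b x (M*w+1) - monsky_b x (M*Suc w+1))" for w
  proof -
   have "(\<Sum>r\<in>{1..M}. c r) * monsky_b x (M*w+1) = 0"
    using sum_residues_shift[of c M, OF per] zero by simp
   hence "(\<Sum>r\<in>{1..M}. c r * monsky_b x (M*w + r))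
    = (\<Sum>r\<in>{1..M}. c r*(monsky_b x (M*w + r) - monsky_b x (M*w+1)))"
    by (simp add: right_diff_distrib sum_subtractf sum_distrib_right)
   also have "\<bar>...\<bar> <= (\<Sum>r\<in>{1..M}. monsky_b x (M*w+1) - monsky_b x (M*Suc w+1))"
   proof (rule order_trans[OF sum_abs sum_mono])
    fix r assume r: "r \<in> {1..M}"
    have "monsky_b x (M*w + r) <= monsky_b x (M*w+1)"
     "monsky_b x (M*Suc w+1) <= monsky_b x (M*w + r)"
     using r by (auto intro!: monsky_b_mono[OF x])
    moreover have "\<bar>c r*(monsky_b x (M*w + r) - monsky_b x (M*w+1))\<bar>
     <= 1*\<bar>monsky_b x (M*w + r) - monsky_b x (M*w+1)\<bar>"
     unfolding abs_mult using c_le by (intro mult_right_mono) auto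
    ultimately show "\<bar>c r*(monsky_b x (M*w + r) - monsky_b x (M*w+1))\<bar>
     <= monsky_b x (M*w+1) - monsky_b x (M*Suc w+1)"
     by (elim order_trans) (simp only: mult_1 abs_le_iff, linarith)
   qed
   finally show ?thesis by simp
  qed
  have b1: "monsky_b x 1 = 1" using x by (simp add: monsky_b_def diff_divide_distrib[symmetric])
  have "(\<Sum>w<W. \<Sum>r\<in>{1..M}. c r * monsky_b x (M*w + r)) \<ge> - real M" for W
  proof -
   have "\<bar>\<Sum>w<W. \<Sum>r\<in>{1..M}. c r * monsky_b x (M*w + r)\<bar>
    <= (\<Sum>w<W. real M*(monsky_b x (M*w+1) - monsky_b x (M*Suc w+1)))"
    by (rule order_trans[OF sum_abs sum_mono]) (rule block)
   also have "... = real M*(monsky_b x (M*0+1) - monsky_b x (M*W+1))"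
    unfolding sum_distrib_left[symmetric] by (subst sum_lessThan_telescope') simp
   also have "... <= real M*1" using b1 monsky_b_nonneg[OF x, of "M*W+1"]
    by (intro mult_left_mono) auto
   finally show ?thesis by linarith
  qed
  hence "-f \<ge> - real M" using sums unfolding sums_def by (intro LIMSEQ_le_const) auto
  hence fM: "f <= real M" by simp
  have r: "0 <= (\<Sum>n | n dvd m. c n)" "(\<exists>y. m = y\<^sup>2) ==> 1 <= (\<Sum>n | n dvd m. c n)" if "m > 0" for m
   using divisor_sum_nonneg[of c m, OF c1 cm cv that] by auto
  have "(\<Sum>k\<in>{1..M+1}. x^(k\<^sup>2)) = (\<Sum>m\<in>(%k. k\<^sup>2) ` {1..M+1}. x ^ m)"
   by (subst sum.reindex) (auto simp: inj_on_def)
  also have "... <= (\<Sum>m\<in>(%k. k\<^sup>2) ` {1..M+1}. (\<Sum>n | n dvd m. c n)*x ^ m)"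
  proof (rule sum_mono)
   fix m assume "m \<in> (%k. k\<^sup>2) ` {1..M+1}"
   hence "1 <= (\<Sum>n | n dvd m. c n)" by (intro r) auto
   hence "1*x ^ m <= (\<Sum>n | n dvd m. c n)*x ^ m" using x by (intro mult_right_mono) auto
   thus "x ^ m <= (\<Sum>n | n dvd m. c n)*x ^ m" by simp
  qed
  also have "... <= f"
   by (rule finite_sum_le_has_sum[OF f(2)]) (use r x in auto)
  finally show ?thesis using fM by linarith
 qed
 have "((%x::real. \<Sum>k\<in>{1..M+1}. x^(k\<^sup>2)) \<longlongrightarrow> (\<Sum>k\<in>{1..M+1}. 1^(k\<^sup>2))) (at_left 1)"
  by (intro tendsto_intros)
 moreover have "eventually (%x. (\<Sum>k\<in>{1..M+1}. x^(k\<^sup>2)) <= real M) (at_left (1::real))"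
  using eventually_at_left_real[of 0 1] by (rule eventually_mono) (use main in auto)
 ultimately have "(\<Sum>k\<in>{1..M+1}. (1::real)^(k\<^sup>2)) <= real M"
  by (rule tendsto_upperbound) simp
 thus False by simp
qed

text \<open>Nonvanishing at 1 and continuity keep log |L(s)| bounded near 1, and
  \<open>Lser_ln\<close> passes this to the prime sum.\<close>

lemma prime_sum_bounded:
 fixes c :: "nat \<Rightarrow> real"
 assumes c1: "c 1 = 1" and cm: "\<And>m n. c (m*n) = c m * c n" and cv: "\<And>n. c n \<in> {-1, 0, 1}"
  and per: "\<And>n. c (n+M) = c n" and M: "M > 0" and zero: "(\<Sum>r<M. c r) = 0"
 shows "\<exists>B. eventually (%s. \<bar>prime_sum c s\<bar> <= B) (at_right 1)"
proof -
 have c_le: "\<bar>c n\<bar> <= 1" for n using cv[of n] by auto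
 obtain C F where CF: "C \<ge> 0"
  "\<And>s. s \<in> {1<..2} ==> Lser c s = F s"
  "\<And>s t. s \<in> {1..2} ==> t \<in> {1..2} ==> norm (F s - F t) <= C*\<bar>s - t\<bar>"
  "((%w. \<Sum>r\<in>{1..M}. complex_of_real (c r / real (M*w + r))) has_sum F 1) UNIV"
  using Lser_lipschitz[of c M, OF c_le per M zero] by blast
 have F1: "F 1 ~= 0"
 proof
  assume "F 1 = 0"
  hence "((%w. Re (\<Sum>r\<in>{1..M}. complex_of_real (c r / real (M*w + r)))) has_sum Re 0) UNIV"
   using CF(4) by (intro has_sum_Re) simp
  hence "((%w. \<Sum>r\<in>{1..M}. c r / real (M*w + r)) has_sum 0) UNIV"
   by (simp only: Re_sum Re_complex_of_real zero_complex.sel)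
  thus False using Lser_nonvanishing[of c M, OF c1 cm cv per M zero] by simp
 qed
 have ev: "eventually (%s. s \<in> {1<..2}) (at_right (1::real))"
  using eventually_at_right_real[of 1 2] by (rule eventually_mono) auto
 have "(F \<longlongrightarrow> F 1) (at_right 1)"
 proof (rule tendsto_norm_zero_cancel[THEN LIM_zero_cancel], rule tendsto_norm_zero_cancel)
  have "((%s. C*\<bar>s - 1\<bar>) \<longlongrightarrow> C*\<bar>1 - 1\<bar>) (at_right 1)" by (intro tendsto_intros)
  hence "((%s. C*\<bar>s - 1\<bar>) \<longlongrightarrow> 0) (at_right 1)" by simp
  thus "((%s. norm (norm (F s - F 1))) \<longlongrightarrow> 0) (at_right 1)"
  proof (rule Lim_null_comparison[rotated])
   have "norm (F s - F 1) <= C*\<bar>s - 1\<bar>" if "s \<in> {1<..2}" for s using CF(3)[of s 1] that by simp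
   thus "eventually (%s. norm (norm (norm (F s - F 1))) <= C*\<bar>s - 1\<bar>) (at_right 1)"
    by (intro eventually_mono[OF ev]) simp
  qed
 qed
 hence "((%s. ln (norm (F s))) \<longlongrightarrow> ln (norm (F 1))) (at_right 1)"
  using F1 by (intro tendsto_intros) auto
 hence "eventually (%s. dist (ln (norm (F s))) (ln (norm (F 1))) < 1) (at_right 1)"
  by (rule tendstoD) simp
 hence "eventually (%s. \<bar>prime_sum c s\<bar> <= 2 * csq+\<bar>ln (norm (F 1))\<bar>+1) (at_right 1)"
  using ev
 proof eventually_elim
  case (elim s)
  have "\<bar>ln (norm (Lser c s)) - prime_sum c s\<bar> <= 2 * csq"
   by (rule Lser_ln) (use c1 cm c_le elim in auto)
  thus ?case using elim CF(2)[of s] by (simp add: dist_real_def)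
 qed
 thus ?thesis by blast
qed

lemma prime_sum_qchar_bounded:
 assumes "\<beta> ~= 0" "~ (\<exists>c. \<beta> = c\<^sup>2)"
 shows "\<exists>B. eventually (%s. \<bar>prime_sum (%n. of_int (qchar \<beta> n)) s\<bar> <= B) (at_right 1)"
proof (rule prime_sum_bounded[where M = "8*nat \<bar>\<beta>\<bar>"])
 show "real_of_int (qchar \<beta> n) \<in> {-1, 0, 1}" for n using qchar_abs_le[of \<beta> n] by auto
 show "real_of_int (qchar \<beta> (n+8*nat \<bar>\<beta>\<bar>)) = real_of_int (qchar \<beta> n)" for n
  using qchar_periodic[OF assms(1), of "n+8*nat \<bar>\<beta>\<bar>" n] by (simp add: cong_def)
 show "(\<Sum>r<8*nat \<bar>\<beta>\<bar>. real_of_int (qchar \<beta> r)) = 0"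
  unfolding of_int_sum[symmetric] qchar_sum_zero[OF assms] by simp
qed (use assms in \<open>auto simp: qchar_mult\<close>)

subsection \<open>The pole of the zeta function\<close>

lemma powr_telescope:
 assumes "s > 1" "n \<ge> (1::nat)"
 shows "real (Suc n) powr -s <= (real n powr (1 - s) - real (Suc n) powr (1 - s))/(s - 1)"
proof -
 have "\<exists>z>real n. z < real (Suc n) \<and>
  real (Suc n) powr (1 - s) - real n powr (1 - s) = (real (Suc n) - real n)*((1 - s)*z powr (1 - s - 1))"
  by (rule MVT2) (use assms in \<open>auto intro!: derivative_eq_intros\<close>)
 then obtain z where z: "z > real n" "z < real (Suc n)"
  "real (Suc n) powr (1 - s) - real n powr (1 - s) = (1 - s)*z powr -s" by auto
 have "real (Suc n) powr -s <= z powr -s" using z assms by (intro powr_mono2') auto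
 also have "z powr -s = (real n powr (1 - s) - real (Suc n) powr (1 - s))/(s - 1)"
  using z(3) assms by (simp add: field_simps)
 finally show ?thesis .
qed

text \<open>Telescoping comparison with the integral. The exact order of the pole matters: the
  exclusion of a zero in \<open>gprime_sum_bounded\<close> compares multiples of log (1/(s -
  1)).\<close>

lemma zeta_upper:
 assumes s: "s \<in> {1<..2}"
 shows "norm (Lser (%_. 1) s) <= 2/(s - 1)"
proof -
 have part: "(\<Sum>n\<in>{1..Suc N}. real n powr -s) <= 1+(1 - real (Suc N) powr (1 - s))/(s - 1)" for N
 proof (induction N)
  case (Suc N)
  have "(\<Sum>n\<in>{1..Suc (Suc N)}. real n powr -s) = (\<Sum>n\<in>{1..Suc N}. real n powr -s) + real (Suc (Suc N)) powr -s" by simp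
  also have "... <= 1+(1 - real (Suc N) powr (1 - s))/(s - 1)
   + (real (Suc N) powr (1 - s) - real (Suc (Suc N)) powr (1 - s))/(s - 1)"
   using Suc powr_telescope[of s "Suc N"] s by auto
  also have "... = 1+(1 - real (Suc (Suc N)) powr (1 - s))/(s - 1)" by (simp add: add_divide_distrib[symmetric] diff_divide_distrib)
  finally show ?case .
 qed simp
 have fin: "(\<Sum>n\<in>F. real n powr -s) <= 2/(s - 1)" if F: "finite F" "F \<subseteq> {0<..}" for F :: "nat set"
 proof -
  have "F \<subseteq> {1..Suc (Max (insert 0 F))}"
   using F by (auto simp: Suc_le_eq intro!: le_SucI Max_ge)
  hence "(\<Sum>n\<in>F. real n powr -s) <= (\<Sum>n\<in>{1..Suc (Max (insert 0 F))}. real n powr -s)"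
   by (intro sum_mono2) auto
  also have "... <= 1+(1 - real (Suc (Max (insert 0 F))) powr (1 - s))/(s - 1)" by (rule part)
  also have "... <= 1+1/(s - 1)" using s by (intro add_left_mono divide_right_mono) auto
  finally have "(\<Sum>n\<in>F. real n powr -s) <= 1+1/(s - 1)" .
  moreover have "1 <= 1/(s - 1)" using s by simp
  moreover have "2/(s - 1) = 1/(s - 1)+1/(s - 1)" by simp
  ultimately show ?thesis by linarith
 qed
 have "norm (Lser (%_. 1) s) <= (\<Sum>\<^sub>\<infinity>n\<in>{0<..}. norm (complex_of_real (1 * real n powr -s)))"
  unfolding Lser_def by (rule norm_infsum_bound) (use summable_on_nat_powr[of s] s in auto)
 also have "... = (\<Sum>\<^sub>\<infinity>n\<in>{0<..}. real n powr -s)" by (intro infsum_cong) auto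
 also have "... <= 2/(s - 1)"
  by (rule infsum_le_finite_sums) (use summable_on_nat_powr[of s] s fin in auto)
 finally show ?thesis .
qed

lemma prime_sum_upper:
 assumes s: "s \<in> {1<..2}"
 shows "prime_sum (%_. 1) s <= ln 2 - ln (s - 1)+2 * csq"
proof -
 have L: "Lser (%_. 1) s ~= 0" "\<bar>ln (norm (Lser (%_. 1) s)) - prime_sum (%_. 1) s\<bar> <= 2 * csq"
  by (rule Lser_ln; use s in simp)+
 have "ln (norm (Lser (%_. 1) s)) <= ln (2/(s - 1))"
  using zeta_upper[OF s] L(1) s by (subst ln_le_cancel_iff) auto
 also have "... = ln 2 - ln (s - 1)" using s by (simp add: ln_div)
 finally show ?thesis using L(2) by linarith
qed

text \<open>A partial harmonic sum exceeds any bound and, being finite, is the limit of the same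
  partial sum at s; the logarithm of zeta then exceeds any bound near 1, and it differs from the
  prime sum by a bounded amount.\<close>

lemma prime_sum_at_top: "filterlim (prime_sum (%_. 1)) at_top (at_right 1)"
 unfolding filterlim_at_top
proof
 fix Z :: real
 obtain N where N: "harm N \<ge> exp (Z+2 * csq)+1"
  using harm_at_top[unfolded filterlim_at_top, rule_format, of "exp (Z+2 * csq)+1"]
  by (auto simp: eventually_at_top_linorder)
 have "((%s. \<Sum>n\<in>{1..N}. real n powr -s) \<longlongrightarrow> (\<Sum>n\<in>{1..N}. real n powr -1)) (at_right 1)"
  by (intro tendsto_intros) auto
 moreover have "(\<Sum>n\<in>{1..N}. real n powr -1) = harm N"
  unfolding harm_def by (intro sum.cong) (auto simp: powr_minus)
 ultimately have "((%s. \<Sum>n\<in>{1..N}. real n powr -s) \<longlongrightarrow> harm N) (at_right 1)" by simp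
 hence "eventually (%s. (\<Sum>n\<in>{1..N}. real n powr -s) > exp (Z+2 * csq)) (at_right 1)"
  using N by (intro order_tendstoD(1)) auto
 moreover have "eventually (%s::real. 1 < s) (at_right 1)" by (rule eventually_at_right_less)
 ultimately show "eventually (%s. Z <= prime_sum (%_. 1) s) (at_right 1)"
 proof eventually_elim
  case (elim s)
  have "Lser (%_. 1) s = of_real (\<Sum>\<^sub>\<infinity>n\<in>{0<..}. real n powr -s)"
   unfolding Lser_def mult_1
   by (intro infsumI has_sum_of_real has_sum_infsum summable_on_nat_powr elim(2))
  moreover have "(\<Sum>n\<in>{1..N}. real n powr -s) <= (\<Sum>\<^sub>\<infinity>n\<in>{0<..}. real n powr -s)"
   by (rule finite_sum_le_infsum) (use summable_on_nat_powr[OF elim(2)] in auto)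
  ultimately have "norm (Lser (%_. 1) s) > exp (Z+2 * csq)" using elim(1) by simp
  hence "ln (norm (Lser (%_. 1) s)) > Z+2 * csq"
   by (metis exp_gt_zero less_trans ln_exp ln_less_cancel_iff)
  moreover have "\<bar>ln (norm (Lser (%_. 1) s)) - prime_sum (%_. 1) s\<bar> <= 2 * csq"
   by (rule Lser_ln) (use elim in auto)
  ultimately show ?case by linarith
 qed
qed

section \<open>Gaussian integers\<close>

text \<open>The Gaussian integers are made a type so that they can become an instance of
  \<open>normalization_euclidean_semiring\<close> and have unique factorization;
  \<open>euler_ln\<close> then applies to them exactly as to \<open>nat\<close>.\<close>

datatype gint = Gint (gre: int) (gim: int)

instantiation gint :: comm_ring_1
begin

definition "0 = Gint 0 0"
definition "1 = Gint 1 0"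
definition "x+y = Gint (gre x+gre y) (gim x+gim y)"
definition "- x = Gint (- gre x) (- gim x)"
definition "x - y = Gint (gre x - gre y) (gim x - gim y)"
definition "x*y = Gint (gre x*gre y - gim x*gim y) (gre x*gim y+gim x*gre y)"

lemmas gint_defs = zero_gint_def one_gint_def plus_gint_def uminus_gint_def minus_gint_def times_gint_def

instance
 by standard (simp_all add: gint_defs gint.expand algebra_simps)

end

lemma gint_sel [simp]:
 "gre 0 = 0" "gim 0 = 0" "gre 1 = 1" "gim 1 = 0"
 "gre (x+y) = gre x+gre y" "gim (x+y) = gim x+gim y"
 "gre (x - y) = gre x - gre y" "gim (x - y) = gim x - gim y"
 "gre (- x) = - gre x" "gim (- x) = - gim x"
 "gre (x*y) = gre x*gre y - gim x*gim y" "gim (x*y) = gre x*gim y+gim x*gre y"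
 by (simp_all add: gint_defs)

lemma gint_eq_iff: "x = y \<longleftrightarrow> gre x = gre y & gim x = gim y"
 by (auto intro: gint.expand)

lemma gre_of_nat [simp]: "gre (of_nat n) = int n" and gim_of_nat [simp]: "gim (of_nat n) = 0"
 by (induction n) auto

lemma gre_of_int [simp]: "gre (of_int n) = n" and gim_of_int [simp]: "gim (of_int n) = 0"
 by (cases n; simp)+

lemma gre_numeral [simp]: "gre (numeral n) = numeral n" and gim_numeral [simp]: "gim (numeral n) = 0"
 using gre_of_nat[of "numeral n"] gim_of_nat[of "numeral n"] by simp_all

definition gnorm :: "gint \<Rightarrow> nat" where
 "gnorm z = nat ((gre z)\<^sup>2+(gim z)\<^sup>2)"

definition gcnj :: "gint \<Rightarrow> gint" where
 "gcnj z = Gint (gre z) (- gim z)"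

definition gI :: gint where
 "gI = Gint 0 1"

lemma gcnj_sel [simp]: "gre (gcnj z) = gre z" "gim (gcnj z) = - gim z"
 by (simp_all add: gcnj_def)

lemma gI_sel [simp]: "gre gI = 0" "gim gI = 1"
 by (simp_all add: gI_def)

lemma int_gnorm: "int (gnorm z) = (gre z)\<^sup>2+(gim z)\<^sup>2"
 by (simp add: gnorm_def)

lemma gcnj_mult: "gcnj (x*y) = gcnj x*gcnj y"
 by (simp add: gint_eq_iff)

lemma gcnj_power: "gcnj (x^n) = gcnj x^n"
 by (induction n) (auto simp: gcnj_mult, simp add: gint_eq_iff)

lemma gcnj_gcnj [simp]: "gcnj (gcnj z) = z"
 by (simp add: gint_eq_iff)

lemma mult_gcnj: "z*gcnj z = of_nat (gnorm z)"
 by (simp add: gint_eq_iff int_gnorm power2_eq_square)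

lemma gnorm_gcnj [simp]: "gnorm (gcnj z) = gnorm z"
 by (simp add: gnorm_def)

lemma gnorm_mult: "gnorm (x*y) = gnorm x*gnorm y"
proof -
 have "int (gnorm (x*y)) = int (gnorm x*gnorm y)"
  by (simp add: int_gnorm power2_eq_square algebra_simps)
 thus ?thesis by linarith
qed

lemma gnorm_0 [simp]: "gnorm 0 = 0" and gnorm_1 [simp]: "gnorm 1 = 1" and gnorm_gI [simp]: "gnorm gI = 1"
 by (simp_all add: gnorm_def)

lemma gnorm_eq_0_iff [simp]: "gnorm z = 0 \<longleftrightarrow> z = 0"
proof
 assume "gnorm z = 0"
 hence "(gre z)\<^sup>2+(gim z)\<^sup>2 = 0" using int_gnorm[of z] by simp
 thus "z = 0" by (simp add: sum_power2_eq_zero_iff gint_eq_iff)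
qed simp

lemma gnorm_pos: "z ~= 0 ==> gnorm z > 0"
 by (rule gr0I) simp

lemma gnorm_of_nat [simp]: "gnorm (of_nat n) = n\<^sup>2"
 by (simp add: gnorm_def nat_power_eq)

lemma gnorm_of_int: "gnorm (of_int n) = nat (n\<^sup>2)"
 by (simp add: gnorm_def)

lemma gnorm_power: "gnorm (z^n) = gnorm z^n"
 by (induction n) (auto simp: gnorm_mult)

instance gint :: idom
proof
 fix x y :: gint assume "x ~= 0" "y ~= 0"
 hence "gnorm (x*y) ~= 0" by (simp add: gnorm_mult)
 thus "x*y ~= 0" by auto
qed

text \<open>The floor of n/m + 1/2, that is, rounding to a nearest integer.\<close>

definition round_div :: "int \<Rightarrow> int \<Rightarrow> int" where
 "round_div n m = (2*n + m) div (2 * m)"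

lemma round_div_mult: "m > 0 ==> round_div (m*n) m = n"
proof -
 assume m: "m > 0"
 have "(2*(m*n) + m) div (2 * m) = (m+(2 * m)*n) div (2 * m)" by (simp add: algebra_simps)
 also have "... = n + m div (2 * m)" using m by simp
 also have "m div (2 * m) = 0" using m by simp
 finally show ?thesis by (simp add: round_div_def)
qed

lemma round_div_error: "m > 0 ==> 4*(n - m * round_div n m)\<^sup>2 <= m\<^sup>2"
proof -
 assume m: "m > 0"
 define r where "r = (2*n + m) mod (2 * m)"
 have "2*n + m = (2 * m) * round_div n m + r"
  unfolding round_div_def r_def by (simp add: mult_div_mod_eq)
 hence e: "2*(n - m * round_div n m) = r - m" by (simp add: algebra_simps)
 have "0 <= r" "r < 2 * m" using m by (auto simp: r_def)
 hence "\<bar>r - m\<bar> <= \<bar>m\<bar>" using m by linarith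
 hence h: "(r - m)\<^sup>2 <= m\<^sup>2" by (simp only: abs_le_square_iff)
 have sq: "4*x\<^sup>2 = (2*x)\<^sup>2" for x :: int by (simp add: power2_eq_square)
 show ?thesis unfolding sq e by (rule h)
qed

text \<open>The power of i by which z differs from an element of the half-open quadrant gre > 0, gim
  >= 0.\<close>

definition gunit :: "gint \<Rightarrow> gint" where
 "gunit z = (if gre z > 0 & gim z \<ge> 0 then 1 else if gre z <= 0 & gim z > 0 then gI
   else if gre z < 0 & gim z <= 0 then -1 else if gre z \<ge> 0 & gim z < 0 then - gI else 0)"

instantiation gint :: "{divide, modulo, unit_factor}"
begin

definition divide_gint :: "gint \<Rightarrow> gint \<Rightarrow> gint" where
 "divide_gint x y = Gint (round_div (gre (x*gcnj y)) (int (gnorm y))) (round_div (gim (x*gcnj y)) (int (gnorm y)))"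
definition modulo_gint :: "gint \<Rightarrow> gint \<Rightarrow> gint" where
 "modulo_gint x y = x - (x div y)*y"
definition unit_factor_gint :: "gint \<Rightarrow> gint" where
 "unit_factor_gint = gunit"

instance ..

end

instance gint :: semidom_divide
proof
 fix x y :: gint assume y: "y ~= 0"
 have n: "int (gnorm y) > 0" using gnorm_pos[OF y] by simp
 have e: "x*y*gcnj y = of_nat (gnorm y)*x" unfolding mult.assoc mult_gcnj by (rule mult.commute)
 have "gre (x*y*gcnj y) = int (gnorm y)*gre x" "gim (x*y*gcnj y) = int (gnorm y)*gim x"
  unfolding e by simp_all
 thus "x*y div y = x" unfolding divide_gint_def using round_div_mult[OF n] by (simp add: gint_eq_iff)
next
 fix x :: gint
 show "x div 0 = 0" by (simp add: divide_gint_def round_div_def gint_eq_iff)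
qed

instance gint :: semidom_modulo
 by standard (simp add: modulo_gint_def)

lemma gint_is_unit_iff: "z dvd 1 \<longleftrightarrow> gnorm z = 1"
proof
 assume "z dvd 1"
 then obtain w where "1 = z*w" by (elim dvdE)
 hence "gnorm z*gnorm w = 1" by (metis gnorm_mult gnorm_1)
 thus "gnorm z = 1" by simp
next
 assume "gnorm z = 1"
 hence "1 = z*gcnj z" by (simp add: mult_gcnj)
 thus "z dvd 1" by (rule dvdI)
qed

lemma gnorm_eq_1_cases: "gnorm z = 1 ==> z = 1 | z = -1 | z = gI | z = -gI"
proof -
 assume "gnorm z = 1"
 hence e: "(gre z)\<^sup>2+(gim z)\<^sup>2 = 1" using int_gnorm[of z] by simp
 have sq: "(gre z)\<^sup>2 \<ge> 0" "(gim z)\<^sup>2 \<ge> 0" by simp_all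
 hence "(gre z)\<^sup>2 <= 1" "(gim z)\<^sup>2 <= 1" using e by linarith+
 hence "\<bar>gre z\<bar> <= 1" "\<bar>gim z\<bar> <= 1" by (simp_all only: abs_square_le_1)
 hence "gre z \<in> {-1,0,1}" "gim z \<in> {-1,0,1}" by auto
 thus ?thesis using e by (auto simp: gint_eq_iff)
qed

lemma gunit_cases:
 obtains "z = 0" "gunit z = 0" | "gre z > 0" "gim z \<ge> 0" "gunit z = 1" | "gre z <= 0" "gim z > 0" "gunit z = gI"
 | "gre z < 0" "gim z <= 0" "gunit z = -1" | "gre z \<ge> 0" "gim z < 0" "gunit z = -gI"
proof -
 consider "gre z = 0 & gim z = 0" | "gre z > 0 & gim z \<ge> 0" | "gre z <= 0 & gim z > 0"
  | "gre z < 0 & gim z <= 0" | "gre z \<ge> 0 & gim z < 0" by linarith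
 thus ?thesis by cases (use that in \<open>simp_all add: gunit_def gint_eq_iff\<close>)
qed

lemma gnorm_gunit: "z ~= 0 ==> gnorm (gunit z) = 1"
 by (cases z rule: gunit_cases) (simp_all add: gnorm_def)

lemma gunit_gI_mult: "gunit (gI*z) = gI*gunit z"
 by (cases z rule: gunit_cases) (simp_all add: gunit_def gint_eq_iff)

lemma gunit_mult_unit:
 assumes "gnorm u = 1"
 shows "gunit (u*z) = u*gunit z"
proof -
 have I: "gI*(gI*w) = - w" "gI*(gI*(gI*w)) = - gI*w" for w by (simp_all add: gint_eq_iff)
 have "gunit (- w) = - gunit w" for w
  using gunit_gI_mult[of "gI*w"] gunit_gI_mult[of w] by (simp only: I)
 moreover from this have "gunit (- gI*w) = - gI*gunit w" for w
  by (simp add: gunit_gI_mult)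
 ultimately show ?thesis
  using gnorm_eq_1_cases[OF assms] gunit_gI_mult[of z] by (elim disjE) simp_all
qed

instantiation gint :: euclidean_semiring
begin

definition euclidean_size_gint :: "gint \<Rightarrow> nat" where
 "euclidean_size_gint = gnorm"

instance
proof
 fix a b :: gint assume b: "b ~= 0"
 have n: "int (gnorm b) > 0" using gnorm_pos[OF b] by simp
 define m where "m = int (gnorm b)"
 define x where "x = a*gcnj b"
 \<comment> \<open>Multiplication by the conjugate of \<open>b\<close> clears the denominator.
   Rounding leaves at most m/2 in each coordinate, so the norm of the remainder is at most
   m/2.\<close>
 have "(a mod b)*gcnj b = x - (a div b)*(b*gcnj b)"
  by (simp add: modulo_gint_def x_def algebra_simps)
 hence e: "(a mod b)*gcnj b = x - (a div b) * of_nat (gnorm b)" by (simp only: mult_gcnj)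
 have "gnorm (a mod b)*gnorm b = gnorm ((a mod b)*gcnj b)" by (simp add: gnorm_mult)
 also have "int ... = (gre x - m * round_div (gre x) m)\<^sup>2+(gim x - m * round_div (gim x) m)\<^sup>2"
  unfolding e int_gnorm by (simp add: divide_gint_def x_def m_def algebra_simps)
 finally have "4*(int (gnorm (a mod b)) * m) <= m\<^sup>2 + m\<^sup>2"
  using round_div_error[of m "gre x"] round_div_error[of m "gim x"] n unfolding m_def by simp
 hence "m*(4*int (gnorm (a mod b))) <= m*(2 * m)" by (simp add: power2_eq_square algebra_simps)
 hence "4*int (gnorm (a mod b)) <= 2 * m" using n unfolding m_def by (subst (asm) mult_le_cancel_left_pos)
 thus "euclidean_size (a mod b) < euclidean_size b"
  unfolding euclidean_size_gint_def using n unfolding m_def by linarith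
 show "euclidean_size a <= euclidean_size (a*b)"
  unfolding euclidean_size_gint_def gnorm_mult using gnorm_pos[OF b] by simp
qed (simp add: euclidean_size_gint_def)

end

instantiation gint :: normalization_euclidean_semiring
begin

definition normalize_gint :: "gint \<Rightarrow> gint" where
 "normalize_gint z = gcnj (gunit z)*z"

instance
proof
 show "unit_factor (0::gint) = 0" by (simp add: unit_factor_gint_def gunit_def)
 show "normalize (0::gint) = 0" by (simp add: normalize_gint_def)
 show "unit_factor a = a" if "a dvd 1" for a :: gint
  using gunit_mult_unit[of a 1] that unfolding gint_is_unit_iff
  by (simp add: unit_factor_gint_def) (simp add: gunit_def)
 show "unit_factor a dvd 1" if "a ~= 0" for a :: gint
  using gnorm_gunit[OF that] by (simp add: gint_is_unit_iff unit_factor_gint_def)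
 show "unit_factor (a*b) = a*unit_factor b" if "a dvd 1" for a b :: gint
  using gunit_mult_unit[of a b] that by (simp add: gint_is_unit_iff unit_factor_gint_def)
 show "unit_factor a*normalize a = a" for a :: gint
 proof (cases "a = 0")
  case False
  have "unit_factor a*normalize a = (gunit a*gcnj (gunit a))*a"
   by (simp add: unit_factor_gint_def normalize_gint_def mult.assoc)
  also have "... = a" using gnorm_gunit[OF False] by (simp add: mult_gcnj)
  finally show ?thesis .
 qed (simp add: normalize_gint_def)
qed

end

lemma normalized_gint: "(normalized :: gint set) = {z. gre z > 0 & gim z \<ge> 0}"
proof -
 have "z ~= 0 & normalize z = z \<longleftrightarrow> gre z > 0 & gim z \<ge> 0" for z :: gint
 proof
  assume z: "z ~= 0 & normalize z = z"
  hence "unit_factor z = 1" using unit_factor_mult_normalize[of z] by (metis mult_cancel_right2 mult.commute)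
  thus "gre z > 0 & gim z \<ge> 0" by (auto simp: unit_factor_gint_def gunit_def gint_eq_iff split: if_splits)
 next
  assume "gre z > 0 & gim z \<ge> 0"
  thus "z ~= 0 & normalize z = z" by (auto simp: normalize_gint_def gunit_def gint_eq_iff)
 qed
 thus ?thesis by (simp add: normalized_def)
qed

lemma gnorm_normalize [simp]: "gnorm (normalize z) = gnorm z"
 by (cases "z = 0") (simp_all add: normalize_gint_def gnorm_mult gnorm_gunit)

subsection \<open>Primes of the Gaussian integers\<close>

lemma gint_of_nat_dvd_iff: "of_nat n dvd z \<longleftrightarrow> int n dvd gre z & int n dvd gim z"
proof
 assume "of_nat n dvd z"
 then obtain w where "z = of_nat n*w" by (elim dvdE)
 thus "int n dvd gre z & int n dvd gim z" by simp
next
 assume "int n dvd gre z & int n dvd gim z"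
 then obtain a b where "gre z = int n*a" "gim z = int n*b" by (auto elim!: dvdE)
 hence "z = of_nat n*Gint a b" by (simp add: gint_eq_iff)
 thus "of_nat n dvd z" by simp
qed

lemma gnorm_dvd: "x dvd y ==> gnorm x dvd gnorm y"
 by (auto simp: gnorm_mult elim!: dvdE)

text \<open>A prime divides its norm and hence some rational prime p, so its norm divides p^2. If
  the norm is p^2, the cofactor is a unit, and normalization turns association with p into
  equality.\<close>

lemma gint_prime_over:
 fixes q :: gint
 assumes "prime q"
 obtains p where "prime p" "gnorm q = p | (gnorm q = p\<^sup>2 & q = of_nat p)"
proof -
 have q: "prime_elem q" "normalize q = q" "q ~= 0" "~ q dvd 1" using assms by (auto simp: normalize_prime)
 have "gnorm q ~= 1" using q(4) by (simp add: gint_is_unit_iff)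
 have "q dvd of_nat n ==> n > 0 ==> \<exists>p. prime p & q dvd of_nat p" for n :: nat
 proof (induction n rule: prime_divisors_induct)
  case (factor p x)
  thus ?case using prime_elem_dvd_multD[OF q(1), of "of_nat p" "of_nat x"] by auto
 qed (use q(4) in auto)
 moreover have "q dvd of_nat (gnorm q)" unfolding mult_gcnj[symmetric] by simp
 ultimately obtain p where p: "prime p" "q dvd of_nat p" using gnorm_pos[OF q(3)] by blast
 then obtain w where w: "of_nat p = q*w" by (elim dvdE)
 have "gnorm q dvd p^2" using gnorm_dvd[OF p(2)] by simp
 then obtain i where i: "i <= 2" "gnorm q = p^i" using divides_primepow_nat[OF p(1)] by blast
 have "i ~= 0" using i \<open>gnorm q ~= 1\<close> by (intro notI) simp
 hence "i = 1 | i = 2" using i by auto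
 moreover have "q = of_nat p" if "i = 2"
 proof -
  have "p\<^sup>2 = p\<^sup>2*gnorm w" using w i that by (metis gnorm_mult gnorm_of_nat)
  hence "gnorm w = 1" using p(1) by (simp add: prime_gt_0_nat)
  hence "w dvd 1" by (simp add: gint_is_unit_iff)
  hence "normalize (of_nat p) = normalize q" unfolding w by (simp add: normalize_mult_unit_right)
  moreover have "(of_nat p :: gint) \<in> normalized"
   using prime_gt_0_nat[OF p(1)] unfolding normalized_gint by simp
  ultimately show ?thesis using q(2) by (simp add: normalized_def)
 qed
 ultimately show ?thesis using that p i by auto
qed

lemma gint_prime_elem_of_norm:
 assumes "prime (gnorm q)"
 shows "prime_elem q"
proof (rule irreducible_imp_prime_elem)
 show "Factorial_Ring.irreducible q"
  unfolding Factorial_Ring.irreducible_def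
 proof (intro conjI allI impI)
  show "q ~= 0" using assms by auto
  show "~ q dvd 1" using assms by (auto simp: gint_is_unit_iff)
  fix a b assume "q = a*b"
  hence "gnorm q = gnorm a*gnorm b" by (simp add: gnorm_mult)
  hence "gnorm a = 1 | gnorm b = 1" using assms prime_product by metis
  thus "a dvd 1 | b dvd 1" by (simp add: gint_is_unit_iff)
 qed
qed

text \<open>With x^2 = -1 modulo p, the prime p divides (x + i)(x - i) but neither factor, so it is
  not prime in the Gaussian integers. A prime divisor of it therefore has norm neither 1 nor
  p^2.\<close>

lemma ex_gnorm_eq_prime:
 assumes p: "prime p" "p mod 4 = 1"
 obtains z where "gnorm z = p"
proof -
 have p2: "p > 2" using prime_ge_2_nat[OF p(1)] p(2) by (cases "p = 2") auto
 have "Legendre (-1) (int p) = 1" using Legendre_minus_one[OF p(1) p2] p by simp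
 then obtain x where x: "[x\<^sup>2 = -1] (mod int p)"
  unfolding Legendre_def QuadRes_def by (auto split: if_splits)
 have "~ prime_elem (of_nat p :: gint)"
 proof
  assume pe: "prime_elem (of_nat p :: gint)"
  have "int p dvd x\<^sup>2+1" using x by (simp add: cong_iff_dvd_diff)
  moreover have "Gint x 1*Gint x (-1) = Gint (x\<^sup>2+1) 0" by (simp add: gint_eq_iff power2_eq_square)
  ultimately have "of_nat p dvd Gint x 1*Gint x (-1)" by (simp add: gint_of_nat_dvd_iff)
  hence "of_nat p dvd Gint x 1 | of_nat p dvd Gint x (-1)" using pe by (simp add: prime_elem_dvd_mult_iff)
  thus False using p2 by (auto simp: gint_of_nat_dvd_iff)
 qed
 moreover have nu: "~ (of_nat p :: gint) dvd 1" "(of_nat p :: gint) ~= 0"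
  using p2 by (auto simp: gint_is_unit_iff gint_eq_iff)
 then obtain q :: gint where q: "prime q" "q dvd of_nat p" using prime_divisor_exists[of "of_nat p :: gint"] by blast
 obtain w where w: "of_nat p = q*w" using q by (elim dvdE)
 have n: "p\<^sup>2 = gnorm q*gnorm w" using w by (metis gnorm_mult gnorm_of_nat)
 hence "gnorm q dvd p^2" by simp
 then obtain i where i: "i <= 2" "gnorm q = p^i" using divides_primepow_nat[OF p(1)] by blast
 have "~ q dvd 1" using q(1) not_prime_unit by blast
 hence "gnorm q ~= 1" by (simp add: gint_is_unit_iff)
 hence "i ~= 0" using i by (intro notI) simp
 moreover have "i ~= 2"
 proof
  assume "i = 2"
  hence "gnorm w = 1" using n i p2 by simp
  hence "w dvd 1" by (simp add: gint_is_unit_iff)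
  hence "prime_elem (of_nat p :: gint)" unfolding w mult.commute[of q w]
   using q by (simp add: prime_elem_mult_unit_left prime_imp_prime_elem)
  thus False using \<open>~ prime_elem (of_nat p :: gint)\<close> by simp
 qed
 ultimately have "i = 1" using i by linarith
 thus ?thesis using that i by simp
qed

lemma gnorm_mod_4: "gnorm z mod 4 ~= 3"
proof -
 have sq: "(x\<^sup>2) mod 4 = 0 | (x\<^sup>2) mod 4 = 1" for x :: int
 proof (cases "even x")
  case True
  then obtain y where "x = 2*y" by blast
  thus ?thesis by (simp add: power_mult_distrib)
 next
  case False
  then obtain y where "x = 2*y+1" by (elim oddE)
  hence "x\<^sup>2 = 1+4*(y\<^sup>2+y)" by (simp add: power2_eq_square algebra_simps)
  hence "x\<^sup>2 mod 4 = 1 mod 4" by (simp only: mod_mult_self2)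
  thus ?thesis by simp
 qed
 have "int (gnorm z) mod 4 = ((gre z)\<^sup>2 mod 4+(gim z)\<^sup>2 mod 4) mod 4"
  by (simp add: int_gnorm mod_add_eq)
 hence "int (gnorm z) mod 4 ~= 3" using sq[of "gre z"] sq[of "gim z"] by auto
 thus ?thesis by (metis of_nat_mod of_nat_numeral)
qed

section \<open>Hecke series over the Gaussian integers\<close>

lemma summable_on_pairs:
 assumes "s > 1"
 shows "(%(a, b). ((1 + real a)*(1 + real b)) powr -s) summable_on (UNIV :: (nat \<times> nat) set)"
proof -
 have one: "(%n. (1 + real n) powr -s) summable_on (UNIV :: nat set)"
  using summable_on_reindex[of Suc UNIV "%n. real n powr -s"] summable_on_nat_powr[OF assms, of "range Suc"]
  by (simp add: o_def)
 define Z where "Z = (\<Sum>\<^sub>\<infinity>n::nat. (1 + real n) powr -s)"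
 have "(%(a, b). ((1 + real a)*(1 + real b)) powr -s) summable_on (Sigma (UNIV::nat set) (%_. UNIV :: nat set))"
 proof (rule summable_on_SigmaI)
  show "(%a. (1 + real a) powr -s*Z) summable_on (UNIV :: nat set)" by (rule summable_on_cmult_left[OF one])
  fix a :: nat
  show "((%b. case (a, b) of (a, b) \<Rightarrow> ((1 + real a)*(1 + real b)) powr -s) has_sum (1 + real a) powr -s*Z) UNIV"
   using has_sum_cmult_right[OF has_sum_infsum[OF one], of "(1 + real a) powr -s"]
   by (simp add: powr_mult Z_def)
 qed auto
 thus ?thesis by simp
qed

text \<open>The first bound lets a double sum over norms split into a product; the second says that
  1 + a + b is of the order of the square root of the norm at most.\<close>

lemma square_sum_lower:
 fixes a b :: real
 assumes "a \<ge> 0" "b \<ge> 0"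
 shows "(1+a)*(1+b) <= 2*((1+a)\<^sup>2+b\<^sup>2)" "(1+a+b)\<^sup>2 <= 2*((1+a)\<^sup>2+b\<^sup>2)"
proof -
 have "2*((1+a)*(1+b)) <= (1+a)\<^sup>2+(1+b)\<^sup>2" using sum_squares_bound[of "1+a" "1+b"] by (simp only: mult.assoc)
 moreover have "2*(1*b) <= 1\<^sup>2+b\<^sup>2" using sum_squares_bound[of 1 b] by simp
 hence "(1+b)\<^sup>2 <= 2+2*b\<^sup>2" by (simp add: power2_eq_square algebra_simps)
 moreover have "1 <= (1+a)\<^sup>2" using assms by simp
 moreover have "0 <= b\<^sup>2" by simp
 moreover have "u <= 2*(x+y)" if "2*u <= x+z" "z <= 2+2*y" "1 <= x" "0 <= y" for u x y z :: real
  using that by argo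
 ultimately show "(1+a)*(1+b) <= 2*((1+a)\<^sup>2+b\<^sup>2)" by blast
 have "2*(1+a)*b <= (1+a)\<^sup>2+b\<^sup>2" by (rule sum_squares_bound)
 thus "(1+a+b)\<^sup>2 <= 2*((1+a)\<^sup>2+b\<^sup>2)" by (simp add: power2_eq_square algebra_simps)
qed

text \<open>The quadrant gre > 0, gim >= 0 is tiled by squares of side \<open>M\<close>. Its
  asymmetry is why real residues run over 1..M and imaginary ones over 0..M-1.\<close>

lemma bij_betw_gint_blocks:
 assumes M: "M > (0::nat)"
 shows "bij_betw (%((a, b), (r, t)). Gint (int (M*a + r)) (int (M*b+t)))
  (UNIV \<times> ({1..M} \<times> {..<M})) normalized"
proof (rule bij_betw_byWitness[where f' = "%z. (((nat (gre z) - 1) div M, nat (gim z) div M),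
  ((nat (gre z) - 1) mod M+1, nat (gim z) mod M))"])
 show "\<forall>x\<in>UNIV \<times> ({1..M} \<times> {..<M}). (%z. (((nat (gre z) - 1) div M, nat (gim z) div M),
  ((nat (gre z) - 1) mod M+1, nat (gim z) mod M))) ((%((a, b), (r, t)). Gint (int (M*a + r)) (int (M*b+t))) x) = x"
 proof
  fix x :: "(nat \<times> nat) \<times> nat \<times> nat" assume "x \<in> UNIV \<times> ({1..M} \<times> {..<M})"
  moreover obtain w v where wv: "x = (w, v)" by (cases x)
  moreover obtain a b where ab: "w = (a, b)" by (cases w)
  moreover obtain r' t where rt: "v = (r', t)" by (cases v)
  ultimately have r': "1 <= r'" "r' <= M" "t < M" by simp_all
  then obtain r where "r' = Suc r" by (cases r') simp_all
  hence x: "x = ((a, b), (Suc r, t))" "r < M" "t < M" using r' wv ab rt by simp_all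
  have "nat (int M*int a+(1+int r)) = Suc (M*a + r)" "nat (int M*int b+int t) = M*b+t"
   by (simp_all add: nat_add_distrib nat_mult_distrib)
  thus "(%z. (((nat (gre z) - 1) div M, nat (gim z) div M),
   ((nat (gre z) - 1) mod M+1, nat (gim z) mod M))) ((%((a, b), (r, t)). Gint (int (M*a + r)) (int (M*b+t))) x) = x"
   using x by simp
 qed
 show "\<forall>z\<in>normalized. (%((a, b), (r, t)). Gint (int (M*a + r)) (int (M*b+t)))
  ((%z. (((nat (gre z) - 1) div M, nat (gim z) div M), ((nat (gre z) - 1) mod M+1, nat (gim z) mod M))) z) = z"
 proof
  fix z :: gint assume "z \<in> normalized"
  hence z: "gre z > 0" "gim z \<ge> 0" by (auto simp: normalized_gint)
  have "M*((nat (gre z) - 1) div M)+((nat (gre z) - 1) mod M+1) = nat (gre z)"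
   using z mult_div_mod_eq[of M "nat (gre z) - 1"] by linarith
  moreover have "M*(nat (gim z) div M)+nat (gim z) mod M = nat (gim z)" by simp
  ultimately show "(%((a, b), (r, t)). Gint (int (M*a + r)) (int (M*b+t)))
   ((%z. (((nat (gre z) - 1) div M, nat (gim z) div M), ((nat (gre z) - 1) mod M+1, nat (gim z) mod M))) z) = z"
   using z by (cases z) (simp only: split_conv gint.sel, simp)
 qed
 show "(%((a, b), (r, t)). Gint (int (M*a + r)) (int (M*b+t))) ` (UNIV \<times> ({1..M} \<times> {..<M})) \<subseteq> normalized"
 proof (intro image_subsetI)
  fix x assume x: "x \<in> (UNIV :: (nat \<times> nat) set) \<times> ({1..M} \<times> {..<M})"
  obtain w v where wv: "x = (w, v)" by (cases x)
  obtain a b where ab: "w = (a, b)" by (cases w)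
  obtain r t where rt: "v = (r, t)" by (cases v)
  have "0 < M*a + r" using x unfolding wv rt by simp
  thus "(%((a, b), (r, t)). Gint (int (M*a + r)) (int (M*b+t))) x \<in> normalized"
   unfolding wv ab rt normalized_gint split_conv mem_Collect_eq gint.sel of_nat_0_less_iff by simp
 qed
 show "(%z. (((nat (gre z) - 1) div M, nat (gim z) div M), ((nat (gre z) - 1) mod M+1, nat (gim z) mod M))) ` normalized
  \<subseteq> UNIV \<times> ({1..M} \<times> {..<M})"
 proof (intro image_subsetI)
  fix z :: gint
  have "x mod M < M" for x using M by (rule mod_less_divisor)
  thus "(((nat (gre z) - 1) div M, nat (gim z) div M), ((nat (gre z) - 1) mod M+1, nat (gim z) mod M))
   \<in> UNIV \<times> ({1..M} \<times> {..<M})"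
   by (simp only: mem_Times_iff fst_conv snd_conv UNIV_I atLeastAtMost_iff lessThan_iff) (simp add: Suc_le_eq)
 qed
qed

lemma summable_on_gnorm:
 assumes "s > 1"
 shows "(%z. real (gnorm z) powr -s) summable_on normalized"
proof -
 have "(%(a, b). 2 powr s*((1 + real a)*(1 + real b)) powr -s) summable_on (UNIV :: (nat \<times> nat) set)"
  using summable_on_cmult_right[OF summable_on_pairs[OF assms], of "2 powr s"] by (simp add: split_def)
 hence "(%(a, b). real (gnorm (Gint (1+int a) (int b))) powr -s) summable_on (UNIV :: (nat \<times> nat) set)"
 proof (rule summable_on_comparison_test)
  fix x :: "nat \<times> nat"
  obtain a b where x: "x = (a, b)" by (cases x)
  have g: "real (gnorm (Gint (1+int a) (int b))) = (1 + real a)\<^sup>2+(real b)\<^sup>2"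
  proof -
   have "real (gnorm z) = (real_of_int (gre z))\<^sup>2+(real_of_int (gim z))\<^sup>2" for z
    using arg_cong[OF int_gnorm[of z], of real_of_int] by simp
   thus ?thesis by simp
  qed
  have "((1 + real a)*(1 + real b))/2 <= (1 + real a)\<^sup>2+(real b)\<^sup>2"
   using square_sum_lower(1)[of "real a" "real b"] by simp
  hence "((1 + real a)\<^sup>2+(real b)\<^sup>2) powr -s <= (((1 + real a)*(1 + real b))/2) powr -s"
   using assms by (intro powr_mono2') auto
  also have "... = 2 powr s*((1 + real a)*(1 + real b)) powr -s"
   by (simp add: powr_divide powr_minus field_simps)
  finally show "(case x of (a, b) \<Rightarrow> real (gnorm (Gint (1+int a) (int b))) powr -s)
   <= (case x of (a, b) \<Rightarrow> 2 powr s*((1 + real a)*(1 + real b)) powr -s)"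
   by (simp add: x g)
 qed auto
 moreover have "bij_betw (%(a, b). Gint (1+int a) (int b)) UNIV normalized"
 proof (rule bij_betw_byWitness[where f' = "%z. (nat (gre z - 1), nat (gim z))"])
  show "\<forall>z\<in>normalized. (%(a, b). Gint (1+int a) (int b)) (nat (gre z - 1), nat (gim z)) = z"
   by (simp add: normalized_gint gint_eq_iff)
 qed (auto simp: normalized_gint)
 ultimately show ?thesis
  using summable_on_reindex_bij_betw[of "%(a, b). Gint (1+int a) (int b)" UNIV normalized "%z. real (gnorm z) powr -s"]
  by (simp add: split_def)
qed

text \<open>The \<open>p\<close>-th coefficient of the Hecke series. For \<theta> as in
  \<open>gauss_char\<close> it is 2 Re \<theta>(z) if the odd prime p is the norm of z, and 0 if p
  is 3 modulo 4.\<close>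

definition gprime_coeff :: "(gint \<Rightarrow> complex) \<Rightarrow> nat \<Rightarrow> real" where
 "gprime_coeff \<theta> p = (\<Sum>z | z \<in> normalized & gnorm z = p. Re (\<theta> z))"

lemma real_gnorm: "real (gnorm z) = (real_of_int (gre z))\<^sup>2+(real_of_int (gim z))\<^sup>2"
 using arg_cong[OF int_gnorm[of z], of real_of_int] by simp

lemma finite_gnorm: "finite {z. gnorm z = n}"
proof -
 have "{z. gnorm z = n} \<subseteq> (%(a, b). Gint a b) ` ({-int n..int n} \<times> {-int n..int n})"
 proof
  fix z assume "z \<in> {z. gnorm z = n}"
  hence e: "int n = (gre z)\<^sup>2+(gim z)\<^sup>2" using int_gnorm[of z] by simp
  have "\<bar>x\<bar> <= x\<^sup>2" for x :: int
  proof -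
   have "\<bar>x\<bar>*1 <= \<bar>x\<bar>*\<bar>x\<bar>" by (cases "x = 0") (simp, intro mult_left_mono, auto)
   thus ?thesis by (simp add: power2_eq_square)
  qed
  hence "\<bar>gre z\<bar> <= (gre z)\<^sup>2" "\<bar>gim z\<bar> <= (gim z)\<^sup>2" by blast+
  moreover have "0 <= (gre z)\<^sup>2" "0 <= (gim z)\<^sup>2" by simp_all
  ultimately have "\<bar>gre z\<bar> <= int n" "\<bar>gim z\<bar> <= int n" using e by linarith+
  thus "z \<in> (%(a, b). Gint a b) ` ({-int n..int n} \<times> {-int n..int n})"
   by (intro image_eqI[where x = "(gre z, gim z)"]) auto
 qed
 thus ?thesis by (rule finite_subset) auto
qed

text \<open>A character modulo \<open>M\<close> that is trivial on units and hence depends on ideals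
  only. The condition \<open>sum_zero\<close> is nontriviality, written for the residue system that
  tiles the quadrant; \<open>cnj\<close> relates the values at the two primes above a split
  p.\<close>

locale gauss_char =
 fixes \<theta> :: "gint \<Rightarrow> complex" and M :: nat
 assumes one: "\<theta> 1 = 1" and mult: "\<theta> (x*y) = \<theta> x*\<theta> y" and unit: "\<theta> gI = 1"
  and le_1: "norm (\<theta> z) <= 1" and cnj: "\<theta> (gcnj z) = cnj (\<theta> z)"
  and M_pos: "M > 0" and periodic: "\<theta> (z + of_nat M*w) = \<theta> z"
  and sum_zero: "(\<Sum>(r, t)\<in>{1..M} \<times> {..<M}. \<theta> (Gint (int r) (int t))) = 0"
begin

lemma chi_unit: "gnorm u = 1 ==> \<theta> u = 1"
proof -
 assume u: "gnorm u = 1"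
 have "gI*gI = -1" by (simp add: gint_eq_iff)
 hence m1: "\<theta> (-1) = 1" using mult[of gI gI] unit by simp
 have "\<theta> (- gI) = 1" using mult[of "-1" gI] m1 unit by simp
 thus ?thesis using gnorm_eq_1_cases[OF u] one unit m1 by auto
qed

lemma chi_normalize: "\<theta> (normalize z) = \<theta> z"
proof (cases "z = 0")
 case False
 thus ?thesis by (simp add: normalize_gint_def mult chi_unit gnorm_gunit)
qed simp

definition gterm :: "real \<Rightarrow> gint \<Rightarrow> complex" where
 "gterm s z = \<theta> z * of_real (real (gnorm z) powr -s)"

definition gL :: "real \<Rightarrow> complex" where
 "gL s = infsum (gterm s) normalized"

lemma norm_gterm: "norm (gterm s z) <= real (gnorm z) powr -s"
 unfolding gterm_def norm_mult using mult_right_mono[OF le_1[of z], of "real (gnorm z) powr -s"] by simp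

lemma gterm_abs_summable:
 assumes "s > 1" "A \<subseteq> normalized"
 shows "(%z. norm (gterm s z)) summable_on A"
 by (rule summable_on_comparison_test[OF summable_on_subset_banach[OF summable_on_gnorm[OF assms(1)] assms(2)]])
   (simp_all add: norm_gterm)

text \<open>The base value \<open>v\<close> of a square is the norm at its corner, and the norm
  grows within the square by at most \<delta>, of the order of the square root of \<open>v\<close>.
  So \<delta> v^(-15/8) is of order v^(-11/8), and 11/8 > 1 makes the double series
  converge.\<close>

lemma gL_lipschitz:
 obtains C F where "C \<ge> 0" "\<And>s. s \<in> {1<..2} ==> gL s = F s"
  "\<And>s t. s \<in> {1..2} ==> t \<in> {1..2} ==> norm (F s - F t) <= C*\<bar>s - t\<bar>"
proof -
 define R where "R = {1..M} \<times> {..<M}"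
 define c where "c = (%(r, t). \<theta> (Gint (int r) (int t)))"
 define u where "u = (%(a, b) (r, t). real (gnorm (Gint (int (M*a + r)) (int (M*b+t)))))"
 define v where "v = (%(a::nat, b::nat). (real (M*a)+1)\<^sup>2+(real (M*b))\<^sup>2)"
 define \<delta> where "\<delta> = (%(a::nat, b::nat). 4*(real M)\<^sup>2*(1 + real a + real b))"
 have u_eq: "u (a, b) (r, t) = (real (M*a) + real r)\<^sup>2+(real (M*b) + real t)\<^sup>2" for a b r t
  by (simp add: u_def real_gnorm)
 have h1: "finite R" by (simp add: R_def)
 have h2: "(\<Sum>r\<in>R. c r) = 0" using sum_zero by (simp add: R_def c_def)
 have h3: "norm (c r) <= 1" for r using le_1 by (cases r) (simp add: c_def)
 have h4: "v w \<ge> 1" for w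
 proof (cases w)
  case (Pair a b)
  have "(real (M*a)+1)\<^sup>2 \<ge> 1" by simp
  moreover have "(real (M*b))\<^sup>2 \<ge> 0" by simp
  ultimately show ?thesis unfolding v_def Pair by (simp only: split_conv)
 qed
 have h5: "v w <= u w r" if "r \<in> R" for w r
 proof -
  obtain a b x t where wr: "w = (a, b)" "r = (x, t)" by (cases w, cases r)
  have x: "1 <= x" using that by (simp add: R_def wr)
  have "(real (M*a)+1)\<^sup>2 <= (real (M*a) + real x)\<^sup>2" using x by (intro power_mono) auto
  moreover have "(real (M*b))\<^sup>2 <= (real (M*b) + real t)\<^sup>2" by (intro power_mono) auto
  ultimately show ?thesis unfolding wr u_eq v_def split_conv by (rule add_mono)
 qed
 have h6: "u w r <= v w+\<delta> w" if "r \<in> R" for w r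
 proof -
  obtain a b x t where wr: "w = (a, b)" "r = (x, t)" by (cases w, cases r)
  have x: "real x <= real M" "real t <= real M" using that by (auto simp: R_def wr)
  have "(real (M*a) + real x)\<^sup>2 <= (real (M*a) + real M)\<^sup>2"
   "(real (M*b) + real t)\<^sup>2 <= (real (M*b) + real M)\<^sup>2" using x by (auto intro!: power_mono)
  hence "u w r <= (real (M*a) + real M)\<^sup>2+(real (M*b) + real M)\<^sup>2" unfolding wr u_eq by linarith
  also have "... = (real (M*a))\<^sup>2+(real (M*b))\<^sup>2+(real M)\<^sup>2*(2 * real a+2 * real b+2)"
   by (simp add: power2_eq_square algebra_simps)
  also have "(real M)\<^sup>2*(2 * real a+2 * real b+2) <= (real M)\<^sup>2*(4*(1 + real a + real b))"
   by (intro mult_left_mono) auto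
  also have "(real (M*a))\<^sup>2 <= (real (M*a)+1)\<^sup>2" by (intro power_mono) auto
  finally have "u w r <= (real (M*a)+1)\<^sup>2+(real (M*b))\<^sup>2+(real M)\<^sup>2*(4*(1 + real a + real b))"
   by simp
  moreover have "(real M)\<^sup>2*(4*(1 + real a + real b)) = 4*(real M)\<^sup>2*(1 + real a + real b)" by (simp only: mult_ac)
  ultimately show ?thesis unfolding wr v_def \<delta>_def split_conv by (simp only:)
 qed
 \<comment> \<open>Obtained from 1 + a + b <= 2 v^(1/2) and v >= (1 + a)(1 + b)/2, the latter raised
   to the power -11/8.\<close>
 define K where "K = 4*(real M)\<^sup>2*2*2 powr (11/8)"
 have "(%(a, b). K*((1 + real a)*(1 + real b)) powr -(11/8)) summable_on (UNIV :: (nat \<times> nat) set)"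
  using summable_on_cmult_right[OF summable_on_pairs[of "11/8"], of K] by (simp add: split_def)
 hence h7: "(%w. \<delta> w * v w powr (- 15/8)) summable_on UNIV"
 proof (rule summable_on_comparison_test)
  fix w :: "nat \<times> nat"
  obtain a b where w: "w = (a, b)" by (cases w)
  have M1: "real M \<ge> 1" using M_pos by simp
  have "1 * real a <= real M * real a" "1 * real b <= real M * real b" using M1 by (intro mult_right_mono; simp)+
  hence "(1 + real a)\<^sup>2 <= (real (M*a)+1)\<^sup>2" "(real b)\<^sup>2 <= (real (M*b))\<^sup>2"
   by (auto intro!: power_mono)
  hence v: "(1 + real a)\<^sup>2+(real b)\<^sup>2 <= v w" unfolding w v_def split_conv by (rule add_mono)
  have "0 < (1 + real a)\<^sup>2+(real b)\<^sup>2" by (intro add_pos_nonneg) auto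
  hence v0: "v w > 0" using v by (rule less_le_trans)
  have "(1 + real a + real b)\<^sup>2 <= 2*((1 + real a)\<^sup>2+(real b)\<^sup>2)" by (rule square_sum_lower) auto
  also have "... <= 2 * v w" using v by (intro mult_left_mono) auto
  also have "2 * v w <= (2 * v w powr (1/2))\<^sup>2" using v0 by (simp add: power_mult_distrib powr_half_sqrt)
  finally have ab: "1 + real a + real b <= 2 * v w powr (1/2)" by (rule power2_le_imp_le) simp
  have "\<delta> w * v w powr (- 15/8) <= (4*(real M)\<^sup>2*(2 * v w powr (1/2))) * v w powr (- 15/8)"
   unfolding w \<delta>_def split_conv by (intro mult_right_mono mult_left_mono ab[unfolded w]) auto
  also have "... = 4*(real M)\<^sup>2*2*(v w powr (1/2) * v w powr (- 15/8))" by simp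
  also have "v w powr (1/2) * v w powr (- 15/8) = v w powr (-(11/8))" by (simp add: powr_add[symmetric])
  also have "4*(real M)\<^sup>2*2 * v w powr (-(11/8))
   <= 4*(real M)\<^sup>2*2*(2 powr (11/8)*((1 + real a)*(1 + real b)) powr -(11/8))"
  proof (rule mult_left_mono)
   have "v w powr (-(11/8)) <= (((1 + real a)*(1 + real b))/2) powr (-(11/8))"
   proof (rule powr_mono2')
    show "((1 + real a)*(1 + real b))/2 <= v w" using square_sum_lower(1)[of "real a" "real b"] v by simp
   qed auto
   also have "... = 2 powr (11/8)*((1 + real a)*(1 + real b)) powr -(11/8)"
    by (simp add: powr_divide powr_minus field_simps)
   finally show "v w powr (-(11/8)) <= 2 powr (11/8)*((1 + real a)*(1 + real b)) powr -(11/8)" .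
  qed auto
  finally show "\<delta> w * v w powr (- 15/8) <= (case w of (a, b) \<Rightarrow> K*((1 + real a)*(1 + real b)) powr -(11/8))"
   unfolding w K_def split_conv by (simp only: mult.assoc)
  show "0 <= \<delta> w * v w powr (- 15/8)" by (simp add: w \<delta>_def)
 qed
 obtain C F where CF: "C \<ge> 0"
  "\<And>s. s \<in> {1..2} ==> ((%w. \<Sum>r\<in>R. c r * of_real (u w r powr -s)) has_sum F s) UNIV"
  "\<And>s t. s \<in> {1..2} ==> t \<in> {1..2} ==> norm (F s - F t) <= C*\<bar>s - t\<bar>"
 proof (rule block_lipschitz[of R c v u \<delta>, OF h1 h2 h3 h4 h5 h6 h7])
  fix C F assume "0 <= C"
   "\<And>s. s \<in> {1..2} ==> ((%w. \<Sum>r\<in>R. c r * complex_of_real (u w r powr -s)) has_sum F s) UNIV"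
   "\<And>s t. s \<in> {1..2} ==> t \<in> {1..2} ==> norm (F s - F t) <= C*\<bar>s - t\<bar>"
  thus thesis by (rule that[of C F])
 qed
 show ?thesis
 proof (rule that[of C F])
  fix s :: real assume s: "s \<in> {1<..2}"
  have "1 < s" using s by simp
  hence "gterm s summable_on normalized"
   by (rule abs_summable_summable[OF gterm_abs_summable[OF _ order_refl]])
  hence "(gterm s has_sum gL s) normalized" unfolding gL_def by (rule has_sum_infsum)
  hence "((%z. gterm s ((%((a, b), (r, t)). Gint (int (M*a + r)) (int (M*b+t))) z)) has_sum gL s) (UNIV \<times> R)"
   using has_sum_reindex_bij_betw[OF bij_betw_gint_blocks[OF M_pos], of "gterm s" "gL s"] unfolding R_def by simp
  hence "((%w. \<Sum>r\<in>R. gterm s ((%((a, b), (r, t)). Gint (int (M*a + r)) (int (M*b+t))) (w, r))) has_sum gL s) UNIV"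
   by (rule has_sum_SigmaD) (auto intro: has_sum_finiteI simp: R_def)
  moreover have "gterm s ((%((a, b), (r, t)). Gint (int (M*a + r)) (int (M*b+t))) (w, r)) = c r * of_real (u w r powr -s)" for w r
  proof -
   obtain a b x t where wr: "w = (a, b)" "r = (x, t)" by (cases w, cases r)
   have "Gint (int (M*a+x)) (int (M*b+t)) = Gint (int x) (int t) + of_nat M*Gint (int a) (int b)"
    by (simp add: gint_eq_iff)
   hence "\<theta> (Gint (int (M*a+x)) (int (M*b+t))) = \<theta> (Gint (int x) (int t))" by (simp only: periodic)
   thus ?thesis unfolding wr by (simp add: gterm_def c_def u_def)
  qed
  ultimately have "((%w. \<Sum>r\<in>R. c r * of_real (u w r powr -s)) has_sum gL s) UNIV" by simp
  moreover have "((%w. \<Sum>r\<in>R. c r * of_real (u w r powr -s)) has_sum F s) UNIV" by (rule CF(2)) (use s in simp)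
  ultimately show "gL s = F s" by (rule has_sum_unique)
 qed (rule CF)+
qed

lemma gL_ln:
 obtains C where "\<And>s. s > 1 ==> gL s ~= 0 & \<bar>ln (norm (gL s)) - (\<Sum>\<^sub>\<infinity>q\<in>{q. prime q}. Re (gterm s q))\<bar> <= C"
proof -
 define C where "C = (\<Sum>\<^sub>\<infinity>z\<in>normalized. real (gnorm z) powr -2)"
 have "gL s ~= 0 & \<bar>ln (norm (gL s)) - (\<Sum>\<^sub>\<infinity>q\<in>{q. prime q}. Re (gterm s q))\<bar> <= 2*C" if s: "s > 1" for s
 proof -
  have g2: "gnorm q \<ge> 2" if "prime q" for q
  proof -
   have "q ~= 0" "~ q dvd 1" using that by auto
   hence "gnorm q ~= 0" "gnorm q ~= 1" by (simp, simp add: gint_is_unit_iff)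
   thus ?thesis by linarith
  qed
  have f1: "gterm s 1 = 1" by (simp add: gterm_def one)
  have fm: "gterm s (x*y) = gterm s x*gterm s y" for x y
   by (simp add: gterm_def mult gnorm_mult powr_mult)
  have fn: "gterm s (normalize x) = gterm s x" for x by (simp add: gterm_def chi_normalize)
  have half: "norm (gterm s q) <= 1/2" if "prime q" for q
  proof -
   have "real (gnorm q) powr -s <= real (gnorm q) powr -1" using g2[OF that] s by (intro powr_mono) auto
   also have "... <= 1/2" using g2[OF that] by (simp add: powr_minus field_simps)
   finally show ?thesis using norm_gterm[of s q] by linarith
  qed
  have bd: "(\<Sum>q\<in>S. (norm (gterm s q))\<^sup>2) <= C" if S: "finite S" "S \<subseteq> {q. prime q}" for S
  proof -
   have "(\<Sum>q\<in>S. (norm (gterm s q))\<^sup>2) <= (\<Sum>q\<in>S. real (gnorm q) powr -2)"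
   proof (rule sum_mono)
    fix q assume "q \<in> S"
    hence "gnorm q \<ge> 2" using S g2 by blast
    have "(norm (gterm s q))\<^sup>2 <= (real (gnorm q) powr -s)\<^sup>2" using norm_gterm by (intro power_mono) auto
    also have "... <= (real (gnorm q) powr -1)\<^sup>2"
     using \<open>gnorm q \<ge> 2\<close> s by (intro power_mono powr_mono) auto
    also have "... = real (gnorm q) powr -2"
     by (simp only: power2_eq_square powr_add[symmetric]) simp
    finally show "(norm (gterm s q))\<^sup>2 <= real (gnorm q) powr -2" .
   qed
   also have "... <= C" unfolding C_def
    by (rule finite_sum_le_infsum) (use S primes_subset_normalized summable_on_gnorm[of 2] in auto)
   finally show ?thesis .
  qed
  have "(%z. norm (gterm s z)) summable_on normalized" using gterm_abs_summable[OF s] by blast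
  note E = euler_ln[of "gterm s" C, OF f1 fm fn this half bd]
  show ?thesis unfolding gL_def by (intro conjI E)
 qed
 thus ?thesis using that by blast
qed

text \<open>Primes of prime norm are regrouped by that norm. The remaining ones are rational primes
  p, of norm p^2, and contribute at most \<zeta>(2) uniformly in s.\<close>

lemma gprime_coeff_has_sum:
 assumes s: "s > 1"
 shows "(%p. gprime_coeff \<theta> p * real p powr -s) summable_on {p. prime p}"
  "\<bar>(\<Sum>\<^sub>\<infinity>q\<in>{q. prime q}. Re (gterm s q)) - prime_sum (gprime_coeff \<theta>) s\<bar> <= csq"
proof -
 define A where "A = {q \<in> normalized. prime (gnorm q)}"
 define B where "B = {q. prime q & ~ prime (gnorm q)}"
 have "prime q" if "q \<in> A" for q
  using that gint_prime_elem_of_norm[of q] unfolding A_def normalized_def normalization_semidom_class.prime_def[of q] by simp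
 moreover have "q \<in> normalized" if "prime q" for q :: gint using that primes_subset_normalized by blast
 ultimately have AB: "{q. prime q} = A \<union> B" "A \<inter> B = {}" "A \<subseteq> normalized" "B \<subseteq> normalized"
  unfolding A_def B_def by blast+
 note AN = AB(3,4)
 have sA: "(%q. Re (gterm s q)) summable_on A" and sB: "(%q. Re (gterm s q)) summable_on B"
  by (rule summable_on_Re[OF abs_summable_summable[OF gterm_abs_summable[OF s AN(1)]]],
    rule summable_on_Re[OF abs_summable_summable[OF gterm_abs_summable[OF s AN(2)]]])
 have split: "(\<Sum>\<^sub>\<infinity>q\<in>{q. prime q}. Re (gterm s q)) = (\<Sum>\<^sub>\<infinity>q\<in>A. Re (gterm s q))+(\<Sum>\<^sub>\<infinity>q\<in>B. Re (gterm s q))"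
  unfolding AB(1) by (rule infsum_Un_disjoint[OF sA sB AB(2)])
 let ?S = "Sigma {p::nat. prime p} (%p. {z. z \<in> normalized & gnorm z = p})"
 have "bij_betw snd ?S A"
  by (rule bij_betw_byWitness[where f' = "%z. (gnorm z, z)"]) (auto simp: A_def)
 hence "((%x. Re (gterm s (snd x))) has_sum (\<Sum>\<^sub>\<infinity>q\<in>A. Re (gterm s q))) ?S"
  using has_sum_reindex_bij_betw[of snd ?S A "%q. Re (gterm s q)"] has_sum_infsum[OF sA] by simp
 hence hs: "((%p. gprime_coeff \<theta> p * real p powr -s) has_sum (\<Sum>\<^sub>\<infinity>q\<in>A. Re (gterm s q))) {p. prime p}"
 proof (rule has_sum_SigmaD)
  fix p :: nat
  have "(\<Sum>z | z \<in> normalized & gnorm z = p. Re (gterm s z)) = gprime_coeff \<theta> p * real p powr -s"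
   unfolding gprime_coeff_def sum_distrib_right by (intro sum.cong) (auto simp: gterm_def)
  thus "((%z. Re (gterm s (snd (p, z)))) has_sum gprime_coeff \<theta> p * real p powr -s) {z. z \<in> normalized & gnorm z = p}"
   by (intro has_sum_finiteI) (auto intro: finite_subset[OF _ finite_gnorm[of p]])
 qed
 thus "(%p. gprime_coeff \<theta> p * real p powr -s) summable_on {p. prime p}" by (rule has_sum_imp_summable)
 have B: "\<exists>p. prime p & q = of_nat p" if q: "q \<in> B" for q
 proof -
  have "prime q" using q by (simp add: B_def)
  then obtain p where "prime p" "gnorm q = p | (gnorm q = p\<^sup>2 & q = of_nat p)" by (rule gint_prime_over)
  thus ?thesis using q unfolding B_def by blast
 qed
 have "\<bar>\<Sum>\<^sub>\<infinity>q\<in>B. Re (gterm s q)\<bar> <= csq"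
 proof -
  have sBn: "(%q. real (gnorm q) powr -s) summable_on B"
   using summable_on_subset_banach[OF summable_on_gnorm[OF s] AN(2)] .
  have "norm (\<Sum>\<^sub>\<infinity>q\<in>B. Re (gterm s q)) <= (\<Sum>\<^sub>\<infinity>q\<in>B. real (gnorm q) powr -s)"
  proof (rule norm_infsum_le[OF has_sum_infsum[OF sB] has_sum_infsum[OF sBn]])
   show "norm (Re (gterm s q)) <= real (gnorm q) powr -s" for q
    using norm_gterm[of s q] abs_Re_le_cmod[of "gterm s q"] by simp
  qed
  also have "... <= csq"
  proof (rule infsum_le_finite_sums[OF sBn])
   fix F assume F: "finite F" "F \<subseteq> B"
   have inj: "inj_on (%q. nat (gre q)) F"
   proof (rule inj_onI)
    fix x y assume "x \<in> F" "y \<in> F" "nat (gre x) = nat (gre y)"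
    moreover obtain p p' where "x = of_nat p" "y = of_nat p'" using B F calculation by blast
    ultimately show "x = y" by simp
   qed
   have "(\<Sum>q\<in>F. real (gnorm q) powr -s) = (\<Sum>q\<in>F. real (nat (gre q)) powr -(2 * s))"
   proof (rule sum.cong)
    fix q assume "q \<in> F"
    then obtain p where p: "prime p" "q = of_nat p" using B F by blast
    have "real p > 0" using prime_gt_0_nat[OF p(1)] by simp
    hence "(real p)\<^sup>2 = real p powr 2" by simp
    hence "(real p)\<^sup>2 powr -s = real p powr -(2 * s)" by (simp only: powr_powr) simp
    thus "real (gnorm q) powr -s = real (nat (gre q)) powr -(2 * s)" by (simp add: p)
   qed simp
   also have "... = (\<Sum>p\<in>(%q. nat (gre q)) ` F. real p powr -(2 * s))" by (simp add: sum.reindex[OF inj])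
   also have "... <= csq" by (rule sum_powr_le_csq) (use F s in auto)
   finally show "(\<Sum>q\<in>F. real (gnorm q) powr -s) <= csq" .
  qed
  finally show ?thesis by simp
 qed
 thus "\<bar>(\<Sum>\<^sub>\<infinity>q\<in>{q. prime q}. Re (gterm s q)) - prime_sum (gprime_coeff \<theta>) s\<bar> <= csq"
  using split infsumI[OF hs] by (simp add: prime_sum_def)
qed

text \<open>The primes of norm p are z and its conjugate up to units. They are not associated, for
  otherwise p would be a square or twice a square.\<close>

lemma gprime_coeff_split:
 assumes p: "prime p" "p > 2" and z: "gnorm z = p"
 shows "gprime_coeff \<theta> p = 2 * Re (\<theta> z)"
proof -
 have z0: "z ~= 0" using z p by auto
 have assoc: "q = normalize x" if q: "q \<in> normalized" "gnorm q = p" "q dvd x" "gnorm x = p" for q x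
 proof -
  obtain w where w: "x = q*w" using q by (elim dvdE)
  have "p*gnorm w = p" using w q by (metis gnorm_mult)
  hence "w dvd 1" using p by (simp add: gint_is_unit_iff)
  thus ?thesis using w q by (simp add: normalize_mult_unit_right normalized_def)
 qed
 have "{q. q \<in> normalized & gnorm q = p} = {normalize z, normalize (gcnj z)}"
 proof (intro equalityI subsetI)
  fix q assume "q \<in> {q. q \<in> normalized & gnorm q = p}"
  hence q: "q \<in> normalized" "gnorm q = p" by auto
  have "q dvd of_nat (gnorm q)" unfolding mult_gcnj[symmetric] by simp
  hence "q dvd z*gcnj z" by (simp add: mult_gcnj z q)
  moreover have "prime_elem q" using gint_prime_elem_of_norm[of q] q p by simp
  ultimately have "q dvd z | q dvd gcnj z" by (simp add: prime_elem_dvd_mult_iff)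
  thus "q \<in> {normalize z, normalize (gcnj z)}" using assoc[OF q] z by auto
 next
  fix q assume "q \<in> {normalize z, normalize (gcnj z)}"
  moreover have "gcnj z ~= 0" using z0 by (simp add: gint_eq_iff)
  ultimately show "q \<in> {q. q \<in> normalized & gnorm q = p}"
   using z z0 by (auto simp: normalized_def)
 qed
 moreover have "normalize z ~= normalize (gcnj z)"
 proof
  assume "normalize z = normalize (gcnj z)"
  hence "z dvd gcnj z" by (simp add: associated_iff_dvd)
  then obtain w where w: "gcnj z = z*w" by (elim dvdE)
  have "p*gnorm w = p" using w z by (metis gnorm_mult gnorm_gcnj)
  hence "gnorm w = 1" using p by simp
  from gnorm_eq_1_cases[OF this] w
  have "gim z = 0 | gre z = 0 | gre z = gim z | gre z = - gim z" by (auto simp: gint_eq_iff)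
  hence "(\<exists>x::int. int p = x\<^sup>2) | (\<exists>x::int. int p = 2*x\<^sup>2)" using int_gnorm[of z] z by auto
  moreover have "~ (\<exists>x::int. int p = x\<^sup>2)"
  proof
   assume "\<exists>x::int. int p = x\<^sup>2"
   then obtain x :: int where "int p = x\<^sup>2" by blast
   hence "int p = int ((nat \<bar>x\<bar>)\<^sup>2)" by simp
   hence "p = nat \<bar>x\<bar>*nat \<bar>x\<bar>" by (simp only: of_nat_eq_iff power2_eq_square)
   moreover from this have "nat \<bar>x\<bar> = 1" using p(1) prime_product[of "nat \<bar>x\<bar>" "nat \<bar>x\<bar>"] by simp
   ultimately show False using p(2) by simp
  qed
  ultimately obtain x :: int where "int p = 2*x\<^sup>2" by blast
  hence "even (int p)" by simp
  thus False using prime_odd_nat[OF p] by simp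
 qed
 ultimately have "gprime_coeff \<theta> p = Re (\<theta> (normalize z)) + Re (\<theta> (normalize (gcnj z)))"
  unfolding gprime_coeff_def by simp
 thus ?thesis by (simp add: chi_normalize cnj)
qed

lemma gprime_coeff_inert:
 assumes "p mod 4 = 3"
 shows "gprime_coeff \<theta> p = 0"
proof -
 have "{z. z \<in> normalized & gnorm z = p} = {}" using assms gnorm_mod_4 by auto
 thus ?thesis by (simp only: gprime_coeff_def sum.empty)
qed

end

lemma lipschitz_ln_bounded:
 fixes F :: "real \<Rightarrow> complex"
 assumes lip: "\<And>s t. s \<in> {1..2} ==> t \<in> {1..2} ==> norm (F s - F t) <= C*\<bar>s - t\<bar>" and F1: "F 1 ~= 0"
 shows "\<exists>B. eventually (%s. \<bar>ln (norm (F s))\<bar> <= B) (at_right 1)"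
proof -
 have ev: "eventually (%s. s \<in> {1<..2}) (at_right (1::real))"
  using eventually_at_right_real[of 1 2] by (rule eventually_mono) auto
 have "((%s. norm (F s - F 1)) \<longlongrightarrow> 0) (at_right 1)"
 proof (rule Lim_null_comparison)
  have "norm (F s - F 1) <= C*\<bar>s - 1\<bar>" if "s \<in> {1<..2}" for s using lip[of s 1] that by simp
  thus "eventually (%s. norm (norm (F s - F 1)) <= C*\<bar>s - 1\<bar>) (at_right 1)"
   by (intro eventually_mono[OF ev]) simp
  have "((%s. C*\<bar>s - 1\<bar>) \<longlongrightarrow> C*\<bar>1 - 1\<bar>) (at_right 1)" by (intro tendsto_intros)
  thus "((%s. C*\<bar>s - 1\<bar>) \<longlongrightarrow> 0) (at_right 1)" by simp
 qed
 hence "((%s. F s - F 1) \<longlongrightarrow> 0) (at_right 1)" by (rule tendsto_norm_zero_cancel)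
 hence "(F \<longlongrightarrow> F 1) (at_right 1)" by (rule LIM_zero_cancel)
 hence "((%s. ln (norm (F s))) \<longlongrightarrow> ln (norm (F 1))) (at_right 1)"
  using F1 by (intro tendsto_intros) auto
 hence "eventually (%s. dist (ln (norm (F s))) (ln (norm (F 1))) < 1) (at_right 1)"
  by (rule tendstoD) simp
 hence "eventually (%s. \<bar>ln (norm (F s))\<bar> <= \<bar>ln (norm (F 1))\<bar>+1) (at_right 1)"
  by (rule eventually_mono) (simp add: dist_real_def)
 thus ?thesis by blast
qed

lemma prime_sum_has_sum:
 assumes "\<And>n. \<bar>c n\<bar> <= B" "s > 1"
 shows "((%p. c p * real p powr -s) has_sum prime_sum c s) {p. prime p}"
 unfolding prime_sum_def by (rule has_sum_infsum[OF summable_bounded[of c B, OF assms]])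

context gauss_char
begin

text \<open>If the series vanished at 1, then \<open>\<Sum> (1+2 Re \<theta>+\<theta>\<^sup>2) N\<^sup>-\<^sup>s\<close> over primes, which is
 bounded below, would be at most \<open>log (1/(s - 1)) - 2 log (1/(s - 1))+O(1)\<close>.\<close>

lemma gprime_sum_bounded:
 assumes \<beta>: "\<beta> ~= 0" "~ (\<exists>c. \<beta> = c\<^sup>2)" "~ (\<exists>c. -\<beta> = c\<^sup>2)"
  and even0: "\<And>z. even (gnorm z) ==> \<theta> z = 0"
  and pos: "\<And>p z. prime p ==> p mod 4 = 1 ==> gnorm z = p ==> 0 <= 1+2 * Re (\<theta> z) + of_int (Legendre \<beta> (int p))"
 shows "\<exists>B. eventually (%s. \<bar>prime_sum (gprime_coeff \<theta>) s\<bar> <= B) (at_right 1)"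
proof -
 define P where "P = prime_sum (%_. 1)"
 define S where "S = prime_sum (gprime_coeff \<theta>)"
 define Q where "Q = (%b. prime_sum (%n. real_of_int (qchar b n)))"
 have m1: "~ (\<exists>c::int. -1 = c\<^sup>2)"
 proof
  assume "\<exists>c::int. -1 = c\<^sup>2"
  then obtain c :: int where "-1 = c\<^sup>2" by blast
  thus False using zero_le_power2[of c] by simp
 qed
 obtain B1 where B1: "eventually (%s. \<bar>Q (-1) s\<bar> <= B1) (at_right 1)"
  using prime_sum_qchar_bounded[of "-1"] m1 unfolding Q_def by auto
 obtain B2 where B2: "eventually (%s. \<bar>Q \<beta> s\<bar> <= B2) (at_right 1)"
  using prime_sum_qchar_bounded[of \<beta>] \<beta> unfolding Q_def by auto
 obtain B3 where B3: "eventually (%s. \<bar>Q (-\<beta>) s\<bar> <= B3) (at_right 1)"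
  using prime_sum_qchar_bounded[of "-\<beta>"] \<beta> unfolding Q_def by auto
 \<comment> \<open>At p = 1 modulo 4 this is twice the quantity in \<open>pos\<close>; at p = 3
   modulo 4 it is 0, since (-1/p) = -1 makes the terms cancel. Adding the twists by -1 thus turns an
   inequality over Gaussian primes into one over all rational primes.\<close>
 have term_nonneg: "0 <= 1 + real_of_int (qchar (-1) p)+2*gprime_coeff \<theta> p + real_of_int (qchar \<beta> p) + real_of_int (qchar (-\<beta>) p)"
  if p: "prime p" for p
 proof (cases "p = 2")
  case True
  have "gprime_coeff \<theta> p = 0" unfolding gprime_coeff_def
   by (rule sum.neutral) (use True even0 in auto)
  thus ?thesis using True by (simp add: qchar_def)
 next
  case False
  hence p2: "p > 2" using prime_ge_2_nat[OF p] by simp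
  have q: "qchar b p = Legendre b (int p)" for b using qchar_prime[OF p p2] .
  have neg: "Legendre (-\<beta>) (int p) = Legendre (-1) (int p)*Legendre \<beta> (int p)"
   using Legendre_mult[OF p, of "-1" \<beta>] by simp
  have "odd p" using prime_odd_nat[OF p p2] by simp
  hence "p mod 4 = 1 | p mod 4 = 3" by presburger
  thus ?thesis
  proof
   assume p1: "p mod 4 = 1"
   obtain z where z: "gnorm z = p" using ex_gnorm_eq_prime[OF p p1] by blast
   have "0 <= 1+2 * Re (\<theta> z) + of_int (Legendre \<beta> (int p))" by (rule pos[OF p p1 z])
   thus ?thesis unfolding q neg gprime_coeff_split[OF p p2 z] Legendre_minus_one[OF p p2] using p1 by simp
  next
   assume p3: "p mod 4 = 3"
   show ?thesis unfolding q neg gprime_coeff_inert[OF p3] Legendre_minus_one[OF p p2] using p3 by simp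
  qed
 qed
 have nonneg: "0 <= P s+Q (-1) s+2*S s+Q \<beta> s+Q (-\<beta>) s" if s: "s > 1" for s
 proof -
  have qs: "((%p. real_of_int (qchar b p) * real p powr -s) has_sum Q b s) {p. prime p}" for b
   unfolding Q_def by (rule prime_sum_has_sum[where B = 1])
    (use s qchar_abs_le[of b] in \<open>simp_all add: of_int_abs[symmetric] del: of_int_abs\<close>)
  have ps: "((%p. 1 * real p powr -s) has_sum P s) {p. prime p}"
   unfolding P_def by (rule prime_sum_has_sum[where B = 1]) (use s in simp_all)
  have cs: "((%p. gprime_coeff \<theta> p * real p powr -s) has_sum S s) {p. prime p}"
   unfolding S_def prime_sum_def by (rule has_sum_infsum[OF gprime_coeff_has_sum(1)[OF s]])
  have "((%p. 1 * real p powr -s + real_of_int (qchar (-1) p) * real p powr -s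
    + 2*(gprime_coeff \<theta> p * real p powr -s) + real_of_int (qchar \<beta> p) * real p powr -s
    + real_of_int (qchar (-\<beta>) p) * real p powr -s)
   has_sum (P s+Q (-1) s+2*S s+Q \<beta> s+Q (-\<beta>) s)) {p. prime p}"
   by (intro has_sum_add ps qs has_sum_cmult_right cs)
  thus ?thesis
  proof (rule has_sum_nonneg)
   fix p :: nat assume "p \<in> {p. prime p}"
   hence "0 <= (1 + real_of_int (qchar (-1) p)+2*gprime_coeff \<theta> p + real_of_int (qchar \<beta> p) + real_of_int (qchar (-\<beta>) p)) * real p powr -s"
    using term_nonneg by simp
   thus "0 <= 1 * real p powr -s + real_of_int (qchar (-1) p) * real p powr -s
    + 2*(gprime_coeff \<theta> p * real p powr -s) + real_of_int (qchar \<beta> p) * real p powr -s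
    + real_of_int (qchar (-\<beta>) p) * real p powr -s"
    by (simp only: distrib_right mult.assoc)
  qed
 qed
 obtain C F where CF: "C \<ge> 0" "\<And>s. s \<in> {1<..2} ==> gL s = F s"
  "\<And>s t. s \<in> {1..2} ==> t \<in> {1..2} ==> norm (F s - F t) <= C*\<bar>s - t\<bar>"
  using gL_lipschitz by metis
 obtain D where D: "\<And>s. s > 1 ==> gL s ~= 0 & \<bar>ln (norm (gL s)) - (\<Sum>\<^sub>\<infinity>q\<in>{q. prime q}. Re (gterm s q))\<bar> <= D"
  using gL_ln by metis
 have lnS: "\<bar>ln (norm (F s)) - S s\<bar> <= D + csq" if s: "s \<in> {1<..2}" for s
 proof -
  have s1: "s > 1" using s by simp
  show ?thesis using D[OF s1] gprime_coeff_has_sum(2)[OF s1] CF(2)[OF s] unfolding S_def by auto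
 qed
 have ev: "eventually (%s. s \<in> {1<..2}) (at_right (1::real))"
  using eventually_at_right_real[of 1 2] by (rule eventually_mono) auto
 have F1: "F 1 ~= 0"
 proof
  assume F0: "F 1 = 0"
  \<comment> \<open>A zero gives S <= log (s - 1) + O(1) <= - P + O(1). Together with 0 <= P + 2 S +
    O(1) this bounds P by the constant \<open>K\<close>, although P tends to infinity.\<close>
  define K where "K = B1+B2+B3+2*(ln C + ln 2+2 * csq+D + csq)"
  have "eventually (%s. P s \<ge> K+1) (at_right 1)"
   using prime_sum_at_top unfolding P_def filterlim_at_top by blast
  hence "eventually (%s::real. False) (at_right 1)"
   using B1 B2 B3 ev
  proof eventually_elim
   case (elim s)
   have s: "1 < s" "s \<in> {1<..2}" using elim by auto
   have Fs: "norm (F s) > 0" using D[OF s(1)] CF(2)[OF s(2)] by simp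
   have "norm (F s) <= C*(s - 1)" using CF(3)[of s 1] s F0 by simp
   moreover from this Fs have C0: "C > 0" using CF(1) by (cases "C = 0") auto
   ultimately have "ln (norm (F s)) <= ln (C*(s - 1))" using Fs s by (subst ln_le_cancel_iff) auto
   also have "... = ln C + ln (s - 1)" using C0 s by (simp add: ln_mult)
   finally have a: "ln (norm (F s)) <= ln C + ln (s - 1)" .
   have b: "P s <= ln 2 - ln (s - 1)+2 * csq" unfolding P_def by (rule prime_sum_upper[OF s(2)])
   have c: "S s <= ln (norm (F s))+D + csq" using lnS[OF s(2)] by (simp add: abs_le_iff)
   have q: "Q (-1) s <= B1" "Q \<beta> s <= B2" "Q (-\<beta>) s <= B3" using elim by (simp_all add: abs_le_iff)
   show False using nonneg[OF s(1)] a b c q elim(1) unfolding K_def by argo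
  qed
  thus False by simp
 qed
 obtain B where B: "eventually (%s. \<bar>ln (norm (F s))\<bar> <= B) (at_right 1)"
  using lipschitz_ln_bounded[of F C, OF CF(3) F1] by auto
 have "eventually (%s. \<bar>S s\<bar> <= B+D + csq) (at_right 1)"
  using B ev
 proof eventually_elim
  case (elim s)
  thus ?case using lnS[of s] by auto
 qed
 thus ?thesis unfolding S_def by blast
qed

end

section \<open>Quartic characters of the Gaussian integers\<close>

text \<open>Reduction modulo \<open>M\<close> into {1..M} x {0..M-1}; the shift by one in the real
  coordinate matches \<open>bij_betw_gint_blocks\<close>.\<close>

definition gred :: "nat \<Rightarrow> gint \<Rightarrow> nat \<times> nat" where
 "gred M z = (nat ((gre z - 1) mod int M)+1, nat (gim z mod int M))"

lemma gint_sum_zero: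
 fixes \<theta> :: "gint \<Rightarrow> complex"
 assumes M: "M > 0" and per: "\<And>z w. \<theta> (z + of_nat M*w) = \<theta> z" and mult: "\<And>x y. \<theta> (x*y) = \<theta> x*\<theta> y"
  and c: "\<theta> c ~= 1" "coprime (gnorm c) M"
 shows "(\<Sum>(r, t)\<in>{1..M} \<times> {..<M}. \<theta> (Gint (int r) (int t))) = 0"
proof -
 define R where "R = {1..M} \<times> {..<M}"
 define g where "g = (%(r::nat, t::nat). Gint (int r) (int t))"
 define \<phi> where "\<phi> = (%x. gred M (c*g x))"
 have red: "\<exists>w. z = g (gred M z) + of_nat M*w" "gred M z \<in> R" for z
 proof -
  have "(gre z - 1) mod int M \<ge> 0" "gim z mod int M \<ge> 0" "(gre z - 1) mod int M < int M" "gim z mod int M < int M"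
   using M by simp_all
  note b = this
  have "z = g (gred M z) + of_nat M*Gint ((gre z - 1) div int M) (gim z div int M)"
   using b mult_div_mod_eq[of "int M" "gre z - 1"] mult_div_mod_eq[of "int M" "gim z"]
   by (simp add: gint_eq_iff g_def gred_def)
  thus "\<exists>w. z = g (gred M z) + of_nat M*w" by blast
  have "nat ((gre z - 1) mod int M) < M" "nat (gim z mod int M) < M" using b by (simp_all add: nat_less_iff)
  thus "gred M z \<in> R" by (simp add: gred_def R_def Suc_le_eq)
 qed
 have gdiff: "x = y" if "x \<in> R" "y \<in> R" "of_nat M dvd g x - g y" for x y
 proof -
  obtain r t r' t' where xy: "x = (r, t)" "y = (r', t')" by (cases x, cases y)
  have d: "int M dvd int r - int r'" "int M dvd int t - int t'"
   using that(3) unfolding gint_of_nat_dvd_iff xy g_def by simp_all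
  have lt: "\<bar>int r - int r'\<bar> < int M" "\<bar>int t - int t'\<bar> < int M" using that(1,2) unfolding xy R_def by auto
  have "int r - int r' = 0"
  proof (rule ccontr)
   assume "int r - int r' ~= 0"
   hence "\<bar>int M\<bar> <= \<bar>int r - int r'\<bar>" using d(1) by (rule dvd_imp_le_int)
   thus False using lt(1) by simp
  qed
  moreover have "int t - int t' = 0"
  proof (rule ccontr)
   assume "int t - int t' ~= 0"
   hence "\<bar>int M\<bar> <= \<bar>int t - int t'\<bar>" using d(2) by (rule dvd_imp_le_int)
   thus False using lt(2) by simp
  qed
  ultimately show ?thesis by (simp add: xy)
 qed
 obtain n' where n': "[gnorm c*n' = 1] (mod M)" using cong_solve_coprime_nat[OF c(2)] by auto
 have inj: "inj_on \<phi> R"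
 proof (rule inj_onI)
  fix x y assume xy: "x \<in> R" "y \<in> R" "\<phi> x = \<phi> y"
  obtain w where w: "c*g x = g (\<phi> x) + of_nat M*w" using red(1) unfolding \<phi>_def by blast
  obtain v where v: "c*g y = g (\<phi> y) + of_nat M * v" using red(1) unfolding \<phi>_def by blast
  have "c*(g x - g y) = of_nat M*(w - v)" using w v xy(3) by (simp add: algebra_simps)
  hence "of_nat M dvd c*(g x - g y)" by simp
  \<comment> \<open>\<open>of_nat n' * gcnj c\<close> inverts \<open>c\<close> modulo
    \<open>M\<close>, because \<open>c\<close> times its conjugate is its norm.\<close>
  hence "of_nat M dvd (of_nat n'*gcnj c)*(c*(g x - g y))" by (rule dvd_mult)
  moreover have "(of_nat n'*gcnj c)*(c*(g x - g y)) = of_nat (gnorm c*n')*(g x - g y)"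
  proof -
   have "(of_nat n'*gcnj c)*(c*(g x - g y)) = of_nat n'*((c*gcnj c)*(g x - g y))" by (simp only: mult_ac)
   thus ?thesis unfolding mult_gcnj by (simp add: mult_ac)
  qed
  ultimately have a: "of_nat M dvd of_nat (gnorm c*n')*(g x - g y)" by simp
  have "int M dvd int (gnorm c*n') - 1" using n' cong_int_iff[of "gnorm c*n'" 1 M] by (simp add: cong_iff_dvd_diff)
  hence "of_nat M dvd (of_nat (gnorm c*n') - 1 :: gint)" by (simp add: gint_of_nat_dvd_iff)
  hence "of_nat M dvd (of_nat (gnorm c*n') - 1)*(g x - g y)" by (rule dvd_mult2)
  hence "of_nat M dvd of_nat (gnorm c*n')*(g x - g y) - (of_nat (gnorm c*n') - 1)*(g x - g y)"
   using a by (rule dvd_diff[rotated])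
  moreover have "of_nat (gnorm c*n')*(g x - g y) - (of_nat (gnorm c*n') - 1)*(g x - g y) = g x - g y"
   by (simp add: algebra_simps)
  ultimately show "x = y" using gdiff xy(1,2) by simp
 qed
 have "\<phi> ` R = R"
  by (rule endo_inj_surj[OF _ _ inj]) (auto simp: R_def[symmetric] \<phi>_def red(2), simp add: R_def)
 hence bij: "bij_betw \<phi> R R" using inj by (simp add: bij_betw_def)
 have "(\<Sum>x\<in>R. \<theta> (g x)) = (\<Sum>x\<in>R. \<theta> (g (\<phi> x)))" using sum.reindex_bij_betw[OF bij, of "%x. \<theta> (g x)"] by simp
 also have "... = (\<Sum>x\<in>R. \<theta> c*\<theta> (g x))"
 proof (rule sum.cong)
  fix x
  obtain w where w: "c*g x = g (\<phi> x) + of_nat M*w" using red(1) unfolding \<phi>_def by blast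
  hence "\<theta> (g (\<phi> x)) = \<theta> (c*g x)" by (simp add: per)
  thus "\<theta> (g (\<phi> x)) = \<theta> c*\<theta> (g x)" by (simp add: mult)
 qed simp
 also have "... = \<theta> c*(\<Sum>x\<in>R. \<theta> (g x))" by (simp add: sum_distrib_left)
 finally have "(\<Sum>x\<in>R. \<theta> (g x)) = 0" using c(1) by simp
 thus ?thesis by (simp add: R_def g_def split_def)
qed

text \<open>The powers of \<open>gI\<close> and of the complex unit \<i> side by side: residues are
  computed in the first ring, character values in the second.\<close>

lemma gI_pow_cases:
 obtains "k mod 4 = 0" "gI^k = 1" "\<i>^k = 1" | "k mod 4 = 1" "gI^k = gI" "\<i>^k = \<i>"
 | "k mod 4 = 2" "gI^k = -1" "\<i>^k = -1" | "k mod 4 = 3" "gI^k = -gI" "\<i>^k = -\<i>"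
proof -
 have g2: "gI*gI = -1" by (simp add: gint_eq_iff)
 have g4: "gI^4 = 1" "\<i>^4 = 1" by (simp_all add: power4_eq_xxxx g2)
 have k: "k = 4*(k div 4)+k mod 4" by simp
 have e: "gI^k = gI^(k mod 4)" "\<i>^k = \<i>^(k mod 4)"
  by (subst k, simp only: power_add power_mult g4 power_one mult_1)+
 have "k mod 4 < 4" by simp
 then consider "k mod 4 = 0" | "k mod 4 = 1" | "k mod 4 = 2" | "k mod 4 = 3" by linarith
 thus ?thesis
  by cases (use that e g2 in \<open>simp_all add: power2_eq_square power3_eq_cube\<close>)
qed

text \<open>Such a \<open>d\<close> remains prime in the Gaussian integers, with a residue field of
  \<open>d^2\<close> elements. The number \<open>ee\<close> below is the exponent in the definition
  of the quartic residue symbol.\<close>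

locale inert_prime =
 fixes d :: nat
 assumes d: "prime d" "d mod 4 = 3"
begin

abbreviation gdvd :: "gint \<Rightarrow> bool" where "gdvd z \<equiv> of_nat d dvd z"

definition ee :: nat where "ee = (d\<^sup>2 - 1) div 4"

lemma d2: "d > 2"
 using prime_ge_2_nat[OF d(1)] d(2) by (cases "d = 2") auto

lemma odd_d: "odd d"
 using d(2) by presburger

lemma Leg_minus_one: "Legendre (-1) (int d) = -1"
 using Legendre_minus_one[OF d(1) d2] d(2) by simp

text \<open>Since -1 is a nonresidue modulo d, a sum of two squares is divisible by d only if both
  terms are. Divisibility by \<open>d\<close> is thus a question about the norm, whose
  multiplicativity makes \<open>d\<close> prime.\<close>

lemma gdvd_iff_norm: "gdvd z \<longleftrightarrow> d dvd gnorm z"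
proof
 assume "gdvd z"
 hence "gnorm (of_nat d) dvd gnorm z" by (rule gnorm_dvd)
 thus "d dvd gnorm z" by (simp add: power2_eq_square) (metis dvd_mult_left)
next
 assume "d dvd gnorm z"
 hence a: "int d dvd (gre z)\<^sup>2+(gim z)\<^sup>2" using int_gnorm[of z] by (metis int_dvd_int_iff)
 have im: "int d dvd gim z"
 proof (rule ccontr)
  assume n: "~ int d dvd gim z"
  have "[(gre z)\<^sup>2 = -1*(gim z)\<^sup>2] (mod int d)" using a by (simp add: cong_iff_dvd_diff)
  hence "Legendre ((gre z)\<^sup>2) (int d) = Legendre (-1*(gim z)\<^sup>2) (int d)" by (rule Legendre_cong)
  also have "... = -1" unfolding Legendre_mult[OF d(1)] Leg_minus_one Legendre_square[OF d(1) n] by simp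
  finally have "Legendre (gre z) (int d)^2 = -1" unfolding Legendre_power[OF d(1)] .
  thus False using zero_le_power2[of "Legendre (gre z) (int d)"] by simp
 qed
 hence "int d dvd (gim z)\<^sup>2" by (simp add: power2_eq_square)
 hence "int d dvd (gre z)\<^sup>2" using a dvd_add_left_iff by blast
 hence "int d dvd gre z" using d(1) prime_dvd_power by (metis prime_nat_int_transfer)
 thus "gdvd z" using im by (simp add: gint_of_nat_dvd_iff)
qed

lemma gdvd_mult_iff: "gdvd (z*w) \<longleftrightarrow> gdvd z | gdvd w"
 unfolding gdvd_iff_norm gnorm_mult using d(1) by (simp add: prime_dvd_mult_iff)

text \<open>Frobenius is conjugation: the d-th power is additive modulo d, fixes rational integers,
  and sends \<open>gI\<close> to \<open>- gI\<close> because d is 3 modulo 4.\<close>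

lemma gfrobenius: "gdvd (z^d - gcnj z)"
proof -
 have fresh: "of_nat d dvd (x+y)^d - (x^d+y^d)" for x y :: gint
 proof -
  have "(x+y)^d = (\<Sum>k\<le>d. of_nat (d choose k)*x^k*y^(d - k))" by (rule binomial_ring)
  also have "{..d} = insert 0 (insert d {1..d-1})" using d2 by auto
  also have "(\<Sum>k\<in>insert 0 (insert d {1..d-1}). of_nat (d choose k)*x^k*y^(d - k))
   = y^d+(x^d+(\<Sum>k\<in>{1..d-1}. of_nat (d choose k)*x^k*y^(d - k)))"
   using d2 by (subst sum.insert; simp)+
  finally have "(x+y)^d - (x^d+y^d) = (\<Sum>k\<in>{1..d-1}. of_nat (d choose k)*x^k*y^(d - k))"
   by (simp add: algebra_simps)
  also have "of_nat d dvd ..."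
  proof (rule dvd_sum)
   fix k assume "k \<in> {1..d-1}"
   hence "d dvd d choose k" using d2 using d(1) by (intro dvd_choose_prime) auto
   hence "(of_nat d :: gint) dvd of_nat (d choose k)" by (metis of_nat_mult dvd_def)
   thus "of_nat d dvd of_nat (d choose k)*x^k*y^(d - k)" by (simp add: mult.assoc)
  qed
  finally show ?thesis .
 qed
 have fermat: "gdvd (of_int a^d - of_int a)" for a :: int
 proof -
  have "int d dvd a^d - a"
  proof (cases "int d dvd a")
   case True
   have "a dvd a^d" using d2 by (intro dvd_power) auto
   thus ?thesis using True by (meson dvd_diff dvd_trans)
  next
   case False
   have "[a^(d - 1) = 1] (mod int d)"
   proof -
    have "[Legendre a (int d) = a^((d - 1) div 2)] (mod int d)" by (rule euler_criterion[OF d(1) d2])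
    hence "[(a^((d - 1) div 2))^2 = (Legendre a (int d))^2] (mod int d)" by (metis cong_pow cong_sym)
    moreover have "(Legendre a (int d))^2 = 1" using Legendre_cases[of a "int d"] False by (auto simp: Legendre_eq_0_iff)
    moreover have "(d - 1) div 2*2 = d - 1" using odd_d by simp
    ultimately show ?thesis by (simp add: power_mult[symmetric])
   qed
   hence "[a*a^(d - 1) = a*1] (mod int d)" by (rule cong_scalar_left)
   moreover have "a*a^(d - 1) = a^d" using d2 by (simp add: power_eq_if)
   ultimately show ?thesis by (simp add: cong_iff_dvd_diff)
  qed
  thus ?thesis by (metis of_int_diff of_int_power gint_of_nat_dvd_iff gre_of_int gim_of_int dvd_0_right)
 qed
 define a b where "a = gre z" and "b = gim z"
 have z: "z = of_int a + of_int b*gI" by (simp add: gint_eq_iff a_def b_def)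
 have gc: "gcnj z = of_int a + of_int b*(- gI)" by (simp add: gint_eq_iff a_def b_def)
 have gd: "gI^d = - gI" by (cases d rule: gI_pow_cases) (use d(2) in simp_all)
 have E: "z^d - gcnj z = (z^d - (of_int a^d+(of_int b*gI)^d))+(of_int a^d - of_int a)+(of_int b^d - of_int b)*(- gI)"
  unfolding gc power_mult_distrib gd by (simp add: algebra_simps)
 have A: "gdvd (z^d - (of_int a^d+(of_int b*gI)^d))" using fresh[of "of_int a" "of_int b*gI"] z by simp
 have B: "gdvd ((of_int b^d - of_int b)*(- gI))" using fermat by (rule dvd_mult2)
 show ?thesis unfolding E by (intro dvd_add A B fermat)
qed

lemma gcong_pow: "gdvd (x - y) ==> gdvd (x^n - y^n)"
proof (induction n)
 case (Suc n)
 have "x^Suc n - y^Suc n = (x - y)*x^n+y*(x^n - y^n)" by (simp add: algebra_simps)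
 thus ?case using Suc by (simp add: dvd_add dvd_mult dvd_mult2)
qed simp

lemma four_ee: "4*ee = d\<^sup>2 - 1" "d\<^sup>2 = 4*ee+1"
proof -
 obtain m where m: "d = 2 * m+1" using odd_d by (elim oddE)
 have "d\<^sup>2 - 1 = 4*(m * m + m)" unfolding m by (simp add: power2_eq_square algebra_simps)
 thus "4*ee = d\<^sup>2 - 1" by (simp add: ee_def)
 thus "d\<^sup>2 = 4*ee+1" using d2 by simp
qed

text \<open>Frobenius applied twice gives z^(d^2) = z, so y = z^ee has y^4 = 1 modulo d. As d is
  prime, it divides one of the four linear factors of y^4 - 1.\<close>

lemma ex_quartic: "~ gdvd z ==> \<exists>k. gdvd (z^ee - gI^k)"
proof -
 assume nz: "~ gdvd z"
 have "gdvd ((z^d)^d - gcnj z^d)" using gfrobenius gcong_pow by blast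
 moreover have "gdvd (gcnj z^d - z)" using gfrobenius[of "gcnj z"] by simp
 ultimately have "gdvd (((z^d)^d - gcnj z^d)+(gcnj z^d - z))" by (rule dvd_add)
 hence "gdvd (z^(d\<^sup>2) - z)" by (simp add: power_mult[symmetric] power2_eq_square)
 moreover have "z^(d\<^sup>2) - z = z*((z^ee)^4 - 1)"
 proof -
  have "z^(d\<^sup>2) = (z^ee)^4*z" unfolding four_ee(2) mult.commute[of 4 ee] power_add power_mult by simp
  thus ?thesis by (simp add: algebra_simps)
 qed
 ultimately have f: "gdvd ((z^ee)^4 - 1)" using nz gdvd_mult_iff by simp
 define y where "y = z^ee"
 have "y^4 - 1 = (y - 1)*((y - gI)*((y+1)*(y+gI)))"
 proof -
  have g2: "gI*gI = -1" by (simp add: gint_eq_iff)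
  have p1: "(y - gI)*(y+gI) = y*y+1" by (simp add: algebra_simps g2)
  have p2: "(y - 1)*(y+1) = y*y - 1" by (simp add: algebra_simps)
  have p3: "(y - 1)*((y - gI)*((y+1)*(y+gI))) = ((y - 1)*(y+1))*((y - gI)*(y+gI))" by (simp only: mult_ac)
  show ?thesis unfolding p3 p1 p2 by (simp add: power4_eq_xxxx algebra_simps)
 qed
 hence "gdvd (y - 1) | gdvd (y - gI) | gdvd (y+1) | gdvd (y+gI)" using f gdvd_mult_iff unfolding y_def by simp
 moreover have "gI^0 = 1" "gI^1 = gI" "gI^2 = -1" "gI^3 = -gI"
  by (simp_all add: gint_eq_iff power2_eq_square power3_eq_cube)
 ultimately show ?thesis unfolding y_def by (metis diff_minus_eq_add)
qed

lemma gI_pow_unique: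
 assumes "gdvd (gI^k - gI ^ l)"
 shows "\<i>^k = \<i> ^ l"
 by (cases k rule: gI_pow_cases; cases l rule: gI_pow_cases)
   (use assms d2 in \<open>auto simp: gint_of_nat_dvd_iff dest!: zdvd_imp_le\<close>)

text \<open>The quartic residue symbol modulo \<open>d\<close> with complex values. The exponent is
  chosen arbitrarily; \<open>gI_pow_unique\<close> makes the value independent of the
  choice.\<close>

definition quartic :: "gint \<Rightarrow> complex" where
 "quartic z = (if gdvd z then 0 else \<i>^(SOME k. gdvd (z^ee - gI^k)))"

lemma quartic_eqI:
 assumes "~ gdvd z" "gdvd (z^ee - gI^k)"
 shows "quartic z = \<i>^k"
proof -
 define l where "l = (SOME k. gdvd (z^ee - gI^k))"
 have "gdvd (z^ee - gI ^ l)" unfolding l_def using assms(2) by (rule someI)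
 hence "gdvd ((z^ee - gI^k) - (z^ee - gI ^ l))" using assms(2) by (rule dvd_diff[rotated])
 hence "gdvd (gI ^ l - gI^k)" by (simp add: algebra_simps)
 thus ?thesis using assms(1) gI_pow_unique unfolding quartic_def l_def by simp
qed

lemma quartic_0: "gdvd z ==> quartic z = 0"
 by (simp add: quartic_def)

lemma quartic_obtain:
 assumes "~ gdvd z"
 obtains k where "gdvd (z^ee - gI^k)" "quartic z = \<i>^k"
 using ex_quartic[OF assms] quartic_eqI[OF assms] by blast

lemma quartic_mult: "quartic (z*w) = quartic z*quartic w"
proof (cases "gdvd z | gdvd w")
 case True
 thus ?thesis by (auto simp: quartic_0 gdvd_mult_iff)
next
 case False
 hence nd: "~ gdvd z" "~ gdvd w" "~ gdvd (z*w)" by (simp_all add: gdvd_mult_iff)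
 obtain k where k: "gdvd (z^ee - gI^k)" "quartic z = \<i>^k" using quartic_obtain[OF nd(1)] .
 obtain l where l: "gdvd (w^ee - gI ^ l)" "quartic w = \<i> ^ l" using quartic_obtain[OF nd(2)] .
 have "(z*w)^ee - gI^(k + l) = (z^ee - gI^k)*w^ee+gI^k*(w^ee - gI ^ l)"
  by (simp add: power_mult_distrib power_add algebra_simps)
 hence "gdvd ((z*w)^ee - gI^(k + l))" using k l by (simp add: dvd_add dvd_mult dvd_mult2)
 from quartic_eqI[OF nd(3) this] show ?thesis using k l by (simp add: power_add)
qed

lemma quartic_cong: "gdvd (z - w) ==> quartic z = quartic w"
proof -
 assume zw: "gdvd (z - w)"
 have iff: "gdvd z \<longleftrightarrow> gdvd w" using zw dvd_diff_left_iff dvd_diff_right_iff by (metis dvd_diff_right_iff dvd_diff_left_iff)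
 show ?thesis
 proof (cases "gdvd z")
  case False
  obtain k where k: "gdvd (z^ee - gI^k)" "quartic z = \<i>^k" using quartic_obtain[OF False] .
  have "w^ee - gI^k = (z^ee - gI^k) - (z^ee - w^ee)" by simp
  hence "gdvd (w^ee - gI^k)" using k(1) gcong_pow[OF zw, of ee] by (simp only: dvd_diff)
  thus ?thesis using quartic_eqI[of w k] k False iff by simp
 qed (use iff in \<open>simp add: quartic_0\<close>)
qed

lemma quartic_gcnj: "quartic (gcnj z) = cnj (quartic z)"
proof (cases "gdvd z")
 case True
 thus ?thesis by (simp add: quartic_0 gdvd_iff_norm)
next
 case False
 obtain k where k: "gdvd (z^ee - gI^k)" "quartic z = \<i>^k" using quartic_obtain[OF False] .
 have "gcnj (z^ee - gI^k) = gcnj z^ee - gcnj gI^k" by (simp add: gint_eq_iff flip: gcnj_power)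
 moreover have "gcnj gI = gI^3" by (simp add: gint_eq_iff power3_eq_cube)
 ultimately have e: "gcnj (z^ee - gI^k) = gcnj z^ee - gI^(3*k)" by (simp add: power_mult)
 have "gdvd (gcnj z^ee - gI^(3*k))" using k(1) unfolding e[symmetric] by (simp add: gdvd_iff_norm)
 moreover have "~ gdvd (gcnj z)" using False by (simp add: gdvd_iff_norm)
 ultimately have "quartic (gcnj z) = \<i>^(3*k)" by (intro quartic_eqI)
 moreover have "\<i>^3 = cnj \<i>" by (simp add: power3_eq_cube)
 ultimately show ?thesis using k(2) by (simp add: power_mult)
qed

text \<open>z^(2 ee) is the power (d - 1)/2 of z^(d + 1), and by Frobenius z^(d + 1) is the norm;
  Euler's criterion recognizes its quadratic symbol.\<close>

lemma quartic_square: "quartic z^2 = of_int (Legendre (int (gnorm z)) (int d))"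
proof (cases "gdvd z")
 case True
 thus ?thesis by (simp add: quartic_0 gdvd_iff_norm Legendre_eq_0_iff)
next
 case False
 obtain k where k: "gdvd (z^ee - gI^k)" "quartic z = \<i>^k" using quartic_obtain[OF False] .
 define f where "f = (d - 1) div 2"
 have ef: "2*ee = (d+1) * f"
 proof -
  obtain m where m: "d = 2 * m+1" using odd_d by (elim oddE)
  have "f = m" unfolding f_def m by simp
  moreover have "d\<^sup>2 - 1 = 4*(m * m + m)" unfolding m by (simp add: power2_eq_square algebra_simps)
  hence "ee = m * m + m" using four_ee(1) by simp
  ultimately show ?thesis using m by (simp add: algebra_simps)
 qed
 have "gdvd (z*(z^d - gcnj z))" using gfrobenius by (rule dvd_mult)
 hence "gdvd (z^(d+1) - of_nat (gnorm z))" by (simp add: algebra_simps mult_gcnj)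
 hence a: "gdvd (z^(2*ee) - of_nat (gnorm z) ^ f)" using gcong_pow[of "z^(d+1)" "of_nat (gnorm z)" f] by (simp only: ef power_mult)
 have b: "gdvd (z^(2*ee) - (-1)^k)"
 proof -
  have "gdvd ((z^ee)^2 - (gI^k)^2)" using gcong_pow[OF k(1)] .
  moreover have g2: "gI^2 = -1" by (simp add: gint_eq_iff power2_eq_square)
  have "(gI^k)^2 = (gI^2)^k" by (simp only: power_mult[symmetric] mult.commute)
  hence "(gI^k)^2 = (-1)^k" by (simp only: g2)
  moreover have "(z^ee)^2 = z^(2*ee)" by (simp only: power_mult[symmetric] mult.commute)
  ultimately show ?thesis by (simp only:)
 qed
 have "gdvd ((z^(2*ee) - (-1)^k) - (z^(2*ee) - of_nat (gnorm z) ^ f))" using b a by (rule dvd_diff)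
 hence "gdvd (of_int (int (gnorm z) ^ f - (-1)^k))" by simp
 hence "int d dvd int (gnorm z) ^ f - (-1)^k" by (simp only: gint_of_nat_dvd_iff gre_of_int)
 hence "[int (gnorm z) ^ f = (-1)^k] (mod int d)" by (simp add: cong_iff_dvd_diff)
 hence "Legendre (int (gnorm z)) (int d) = (-1)^k"
  unfolding f_def by (rule Legendre_euler[OF d(1) d2]) (simp add: power_abs)
 moreover have "(\<i>^k)^2 = (-1)^k" by (simp add: power_mult[symmetric] mult.commute)
 ultimately show ?thesis using k(2) by simp
qed

text \<open>The value is \<i> to the power \<open>ee\<close>, and \<open>ee\<close> is 0 or 2 modulo
  4 according to d modulo 8, just as (2/d) is 1 or -1.\<close>

lemma quartic_gI: "quartic gI = of_int (Legendre 2 (int d))"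
proof -
 have "~ gdvd gI" using d2 by (simp add: gint_of_nat_dvd_iff)
 hence "quartic gI = \<i>^ee" by (rule quartic_eqI) simp
 moreover have "Legendre 2 (int d) = (if d mod 8 = 7 then 1 else -1)"
 proof -
  have "Legendre 2 (int d) = jac 2 d" using d(1) by simp
  moreover have "d mod 8 ~= 1" using d(2) by presburger
  ultimately show ?thesis using jac_two[OF odd_d] by simp
 qed
 moreover have "\<i>^ee = (if d mod 8 = 7 then 1 else -1)"
 proof (cases "d mod 8 = 7")
  case True
  then obtain m where m: "d = 8 * m+7" by (metis mult_div_mod_eq)
  have "d\<^sup>2 - 1 = 4*(4*(4 * m * m+7 * m+3))" unfolding m by (simp add: power2_eq_square algebra_simps)
  hence "ee = 4*(4 * m * m+7 * m+3)" using four_ee(1) by simp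
  hence "ee mod 4 = 0" by (simp only: mod_mult_self1_is_0)
  thus ?thesis using True by (cases ee rule: gI_pow_cases) simp_all
 next
  case False
  hence "d mod 8 = 3" using d(2) by presburger
  then obtain m where m: "d = 8 * m+3" by (metis mult_div_mod_eq)
  have "d\<^sup>2 - 1 = 4*(2+4*(4 * m * m+3 * m))" unfolding m by (simp add: power2_eq_square algebra_simps)
  hence "ee = 2+4*(4 * m * m+3 * m)" using four_ee(1) by simp
  hence "ee mod 4 = 2 mod 4" by (simp only: mod_mult_self2)
  thus ?thesis using False by (cases ee rule: gI_pow_cases) simp_all
 qed
 ultimately show ?thesis by simp
qed

text \<open>d - 1 divides \<open>ee\<close>, with quotient (d + 1)/4, so the power is trivial by
  Fermat.\<close>

lemma quartic_of_int:
 assumes "~ int d dvd n"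
 shows "quartic (of_int n) = 1"
proof -
 have nd: "~ gdvd (of_int n)" using assms by (simp add: gint_of_nat_dvd_iff)
 obtain m where m: "d = 4 * m+3" using d(2) by (metis mult_div_mod_eq)
 have "d\<^sup>2 - 1 = 4*(((d - 1) div 2*2)*(m+1))"
  unfolding m by (simp add: power2_eq_square algebra_simps)
 hence e: "ee = ((d - 1) div 2*2)*(m+1)" using four_ee(1) by simp
 have "[Legendre n (int d) = n^((d - 1) div 2)] (mod int d)" by (rule euler_criterion[OF d(1) d2])
 hence "[(n^((d - 1) div 2))^2 = (Legendre n (int d))^2] (mod int d)" by (metis cong_pow cong_sym)
 moreover have "(Legendre n (int d))^2 = 1" using Legendre_cases[of n "int d"] assms by (auto simp: Legendre_eq_0_iff)
 ultimately have "[((n^((d - 1) div 2))^2)^(m+1) = 1^(m+1)] (mod int d)" by (metis cong_pow)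
 hence "[n^ee = 1] (mod int d)" unfolding e by (simp only: power_mult power_one)
 hence "int d dvd n^ee - 1" by (simp add: cong_iff_dvd_diff)
 hence "gdvd (of_int (n^ee - 1))" unfolding gint_of_nat_dvd_iff gre_of_int gim_of_int by simp
 hence "gdvd (of_int n^ee - gI^0)" by simp
 from quartic_eqI[OF nd this] show ?thesis by simp
qed

end

section \<open>Reciprocity for binary forms\<close>

text \<open>On odd integers of either sign this is the nontrivial character modulo 4. It is the
  correction between (u/d) and (d/|u|) for a prime d that is 3 modulo 4.\<close>

definition sgn4 :: "int \<Rightarrow> int" where
 "sgn4 u = (if u mod 4 = 3 then -1 else 1)"

lemma sgn4_square [simp]: "sgn4 u * sgn4 u = 1" "sgn4 u*(sgn4 u*x) = x"
 by (simp_all add: sgn4_def)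

text \<open>A prime r that divides u but not both a and b makes D a square modulo r. If r divides u,
  a and b, then it does not divide u', so r^2 divides u; removing r^2 leaves the symbol unchanged
  and the induction on |u| continues.\<close>

lemma jac_form_one:
 fixes u u' a b D :: int
 assumes "odd u" "coprime u D" "u*u' = a\<^sup>2 - D*b\<^sup>2"
  "\<And>r. prime r ==> int r dvd u ==> int r dvd a ==> int r dvd b ==> ~ int r dvd u'"
 shows "jac D (nat \<bar>u\<bar>) = 1"
 using assms
proof (induction "nat \<bar>u\<bar>" arbitrary: u a b rule: less_induct)
 case less
 have u0: "u ~= 0" using less.prems(1) by auto
 show ?case
 proof (cases "\<exists>r. prime r & int r dvd u & int r dvd a & int r dvd b")
  case True
  then obtain r where r: "prime r" "int r dvd u" "int r dvd a" "int r dvd b" by blast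
  obtain a' where a': "a = int r*a'" using r by blast
  obtain b' where b': "b = int r*b'" using r by blast
  have r0: "int r ~= 0" using r(1) by auto
  have ru': "~ int r dvd u'" using less.prems(4)[OF r] .
  have "coprime (int r) u'" using r(1) ru' by (simp add: prime_imp_coprime prime_nat_int_transfer)
  hence cop: "coprime ((int r)\<^sup>2) u'" by simp
  have e: "u*u' = (int r)\<^sup>2*(a'\<^sup>2 - D*b'\<^sup>2)" using less.prems(3) unfolding a' b' by (simp add: power_mult_distrib algebra_simps)
  hence "(int r)\<^sup>2 dvd u*u'" by simp
  hence "(int r)\<^sup>2 dvd u" using cop by (simp add: coprime_dvd_mult_left_iff)
  then obtain v where v: "u = (int r)\<^sup>2 * v" by blast
  have ev: "v * u' = a'\<^sup>2 - D*b'\<^sup>2" using e r0 unfolding v by (simp add: mult.assoc)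
  have ov: "odd v" using less.prems(1) unfolding v by simp
  have cv: "coprime v D" using less.prems(2) unfolding v by simp
  have rD: "~ int r dvd D"
  proof
   assume "int r dvd D"
   hence "is_unit (int r)" using less.prems(2) r(2) by (meson coprime_common_divisor)
   thus False using r(1) by simp
  qed
  have nv: "nat \<bar>u\<bar> = r * r*nat \<bar>v\<bar>"
   unfolding v by (simp add: abs_mult nat_mult_distrib power2_eq_square)
  have v0: "nat \<bar>v\<bar> > 0" using u0 v by auto
  have "r * r > 1" by (rule less_1_mult[OF prime_gt_1_nat[OF r(1)] prime_gt_1_nat[OF r(1)]])
  hence lt: "nat \<bar>v\<bar> < nat \<bar>u\<bar>" unfolding nv using v0 by simp
  have "jac D (nat \<bar>v\<bar>) = 1"
  proof (rule less.hyps[OF lt ov cv ev])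
   fix s assume s: "prime s" "int s dvd v" "int s dvd a'" "int s dvd b'"
   show "~ int s dvd u'" by (rule less.prems(4)[OF s(1)]) (use s in \<open>simp_all add: v a' b'\<close>)
  qed
  moreover have "jac D (r * r*nat \<bar>v\<bar>) = Legendre D (int r)*Legendre D (int r)*jac D (nat \<bar>v\<bar>)"
   using v0 r(1) r0 by (simp add: jac_mult_right)
  moreover have "Legendre D (int r)*Legendre D (int r) = 1"
   using Legendre_cases[of D "int r"] rD by (auto simp: Legendre_eq_0_iff)
  ultimately show ?thesis unfolding nv by simp
 next
  case False
  have one: "Legendre D (int r) = 1" if r: "prime r" "int r dvd u" for r
  proof -
   have rp: "prime (int r)" using r(1) by (simp add: prime_nat_int_transfer)
   have rD: "~ int r dvd D"
   proof
    assume "int r dvd D"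
    hence "is_unit (int r)" using less.prems(2) r(2) by (meson coprime_common_divisor)
    thus False using r(1) by simp
   qed
   have dv: "int r dvd a\<^sup>2 - D*b\<^sup>2" using r(2) less.prems(3) by (metis dvd_mult2)
   have rb: "~ int r dvd b"
   proof
    assume b: "int r dvd b"
    hence "int r dvd D*b\<^sup>2" by (simp add: power2_eq_square)
    hence "int r dvd (a\<^sup>2 - D*b\<^sup>2)+D*b\<^sup>2" using dv by (rule dvd_add[rotated])
    hence "int r dvd a\<^sup>2" by simp
    hence "int r dvd a" using rp prime_dvd_power by blast
    thus False using False r b by blast
   qed
   have "[a\<^sup>2 = D*b\<^sup>2] (mod int r)" using dv by (simp add: cong_iff_dvd_diff)
   hence L: "Legendre a (int r)^2 = Legendre D (int r)"
    using Legendre_cong[of "a\<^sup>2" "D*b\<^sup>2" "int r"] Legendre_square[OF r(1) rb]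
    by (simp add: Legendre_mult[OF r(1)] Legendre_power[OF r(1)])
   have "Legendre D (int r) ~= 0" using rD by (simp add: Legendre_eq_0_iff)
   thus ?thesis using L Legendre_cases[of a "int r"] by auto
  qed
  have "\<forall>x\<in>#image_mset (%p. Legendre D (int p)) (prime_factorization (nat \<bar>u\<bar>)). x = 1"
  proof
   fix x assume "x \<in># image_mset (%p. Legendre D (int p)) (prime_factorization (nat \<bar>u\<bar>))"
   then obtain p where p: "p \<in> prime_factors (nat \<bar>u\<bar>)" "x = Legendre D (int p)" by auto
   hence "prime p" "p dvd nat \<bar>u\<bar>" by (auto simp: in_prime_factors_iff)
   hence "int p dvd u" by (simp add: int_dvd_int_iff[symmetric])
   thus "x = 1" using one[OF \<open>prime p\<close>] p(2) by simp
  qed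
  thus ?thesis unfolding jac_def by (rule prod_mset.neutral)
 qed
qed

text \<open>A common prime factor of x and y divides \<open>k^2 * p^m\<close> and is odd, so it
  could only be p, which does not divide x.\<close>

lemma form_coprime:
 fixes x y D k c :: int
 assumes p: "prime p" and e: "k\<^sup>2*int p ^ m = c*x\<^sup>2+D*y\<^sup>2" and x: "odd x" and k: "k = 1 | k = 2"
  and px: "~ int p dvd x"
 shows "coprime x y"
proof (rule ccontr)
 assume "~ coprime x y"
 hence "\<bar>gcd x y\<bar> ~= 1" by (simp add: coprime_iff_gcd_eq_1)
 then obtain r :: int where r: "prime r" "r dvd gcd x y" using prime_factor_int by blast
 hence rxy: "r dvd x" "r dvd y" by simp_all
 have "r dvd c*x\<^sup>2+D*y\<^sup>2" using rxy by (simp add: power2_eq_square)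
 hence "r dvd k\<^sup>2*int p ^ m" by (simp only: e)
 moreover have "~ r dvd k"
 proof
  assume "r dvd k"
  hence "r dvd 2" using k by auto
  hence "r = 2" using r(1) two_is_prime_nat primes_dvd_imp_eq[of r 2] by simp
  thus False using rxy(1) x by simp
 qed
 ultimately have "r dvd int p ^ m" using r(1) by (metis prime_dvd_mult_iff prime_dvd_power)
 hence "r dvd int p" using r(1) prime_dvd_power by blast
 hence "r = int p" using r(1) p by (metis primes_dvd_imp_eq prime_nat_int_transfer)
 thus False using rxy(1) px by simp
qed

text \<open>Both sides of the form are compared modulo \<open>x\<close>; oddness of \<open>m\<close> removes the exponent.\<close>

lemma jac_form_swap:
 fixes x y D k c :: int
 assumes p: "prime p" and e: "k\<^sup>2*int p ^ m = c*x\<^sup>2+D*y\<^sup>2" and x: "odd x" and k: "k = 1 | k = 2"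
  and px: "~ int p dvd x" and m: "odd m"
 shows "jac (int p) (nat \<bar>x\<bar>) = jac D (nat \<bar>x\<bar>)"
proof -
 define n where "n = nat \<bar>x\<bar>"
 have n: "odd n" using x by (simp add: n_def even_nat_iff)
 have nx: "int n = \<bar>x\<bar>" by (simp add: n_def)
 have cy: "coprime y (int n)" using form_coprime[OF p e x k px] by (simp add: nx coprime_commute)
 have ck: "coprime k (int n)" using k x by (auto simp: nx)
 have cp: "coprime (int p) (int n)" using p px by (simp add: nx prime_imp_coprime prime_nat_int_transfer)
 have "[k\<^sup>2*int p ^ m = D*y\<^sup>2] (mod int n)" unfolding e by (simp add: cong_iff_dvd_diff nx power2_eq_square)
 hence "jac (k\<^sup>2*int p ^ m) n = jac (D*y\<^sup>2) n" by (rule jac_cong[OF n])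
 hence "jac (int p) n ^ m = jac D n"
  unfolding jac_mult_left[OF n] jac_square_left[OF n cy] jac_square_left[OF n ck] by (simp add: jac_power_left[OF n])
 moreover have "jac (int p) n ^ m = jac (int p) n" using jac_coprime[OF n cp] m by auto
 ultimately show ?thesis unfolding n_def by simp
qed

lemma Legendre_jac_1mod4:
 assumes p: "prime p" "p mod 4 = 1" and x: "odd x"
 shows "Legendre x (int p) = jac (int p) (nat \<bar>x\<bar>)"
proof -
 have p2: "p > 2" using prime_ge_2_nat[OF p(1)] p(2) by (cases "p = 2") auto
 have op: "odd p" using prime_odd_nat[OF p(1) p2] by simp
 have n: "odd (nat \<bar>x\<bar>)" using x by (simp add: even_nat_iff)
 have "Legendre x (int p) = Legendre (int (nat \<bar>x\<bar>)) (int p)"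
 proof (cases "x \<ge> 0")
  case False
  hence "int (nat \<bar>x\<bar>) = -1*x" by simp
  moreover have "Legendre (-1*x) (int p) = Legendre x (int p)"
   unfolding Legendre_mult[OF p(1)] Legendre_minus_one[OF p(1) p2] using p(2) by simp
  ultimately show ?thesis by (simp only:)
 qed simp
 also have "... = jac (int (nat \<bar>x\<bar>)) p" using p by simp
 also have "... = jac (int p) (nat \<bar>x\<bar>)" using jac_reciprocity[OF op n] p(2) by simp
 finally show ?thesis .
qed

lemma (in inert_prime) Legendre_jac_3mod4:
 assumes x: "odd x"
 shows "Legendre x (int d) = jac (int d) (nat \<bar>x\<bar>) * sgn4 x"
proof -
 define n where "n = nat \<bar>x\<bar>"
 have n: "odd n" using x by (simp add: n_def even_nat_iff)
 have r: "Legendre (int n) (int d) = jac (int d) n*(if n mod 4 = 3 then -1 else 1)"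
  using jac_reciprocity[OF odd_d n] d by simp
 show ?thesis
 proof (cases "x \<ge> 0")
  case True
  hence xn: "x = int n" by (simp add: n_def)
  have "x mod 4 = 3 \<longleftrightarrow> n mod 4 = 3" unfolding xn by presburger
  moreover have "Legendre x (int d) = Legendre (int n) (int d)" using xn by (rule arg_cong)
  ultimately show ?thesis using r unfolding sgn4_def n_def[symmetric] by simp
 next
  case False
  hence xn: "x = - 1*int n" by (simp add: n_def)
  have "n mod 4 = 1 | n mod 4 = 3" using n by presburger
  moreover have "n mod 4 = 1 ==> x mod 4 = 3" "n mod 4 = 3 ==> x mod 4 = 1" unfolding xn by presburger+
  moreover have "Legendre x (int d) = - Legendre (int n) (int d)"
   unfolding xn Legendre_mult[OF d(1)] Leg_minus_one by simp
  ultimately show ?thesis using r unfolding sgn4_def n_def[symmetric] by auto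
 qed
qed

context inert_prime
begin

lemma Legendre_two: "Legendre 2 (int d) = (if d mod 8 = 3 then -1 else 1)"
proof -
 have "Legendre 2 (int d) = jac 2 d" using d(1) by simp
 moreover have "d mod 8 = 3 | d mod 8 = 7" using d(2) by presburger
 ultimately show ?thesis using jac_two[OF odd_d] by auto
qed

text \<open>Put w = t + 2 z. Modulo d, 4 N(z) = t^2 implies t w^2 = 2 n z and N(w) = n. Rational
  integers have quartic symbol 1, so the symbol of z is the square of that of w, which is the
  quadratic symbol of N(w).\<close>

lemma quartic_norm_square:
 assumes t: "~ int d dvd t" and e: "[4*int (gnorm z) = t\<^sup>2] (mod int d)"
  and n: "n = 2*t*(t+2*gre z)" "~ int d dvd n"
 shows "quartic z = of_int (Legendre n (int d))"
proof -
 define w where "w = of_int t+2*z"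
 have nw: "int (gnorm w) - n = 4*int (gnorm z) - t\<^sup>2"
  unfolding int_gnorm n w_def by (simp add: power2_eq_square algebra_simps)
 have dv: "int d dvd 4*int (gnorm z) - t\<^sup>2" using e by (simp add: cong_iff_dvd_diff)
 have "of_int t*(w*w) - of_int (2*n)*z = of_int (t*(t\<^sup>2 - 4*int (gnorm z)))"
  unfolding n w_def int_gnorm by (simp add: gint_eq_iff power2_eq_square algebra_simps)
 moreover have "int d dvd t\<^sup>2 - 4*int (gnorm z)" using dv by (simp add: dvd_diff_commute)
 hence "gdvd (of_int (t*(t\<^sup>2 - 4*int (gnorm z))))"
  unfolding gint_of_nat_dvd_iff gre_of_int gim_of_int by simp
 ultimately have "gdvd (of_int t*(w*w) - of_int (2*n)*z)" by (simp only:)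
 hence q: "quartic (of_int t)*(quartic w*quartic w) = quartic (of_int (2*n))*quartic z"
  unfolding quartic_mult[symmetric] by (rule quartic_cong)
 have "~ int d dvd 2*n"
 proof
  assume "int d dvd 2*n"
  hence "int d dvd 2" using n(2) d(1) by (metis prime_dvd_mult_iff prime_nat_int_transfer)
  hence "int d <= 2" by (rule zdvd_imp_le) simp
  thus False using d2 by simp
 qed
 hence "quartic z = quartic w^2"
  using q unfolding quartic_of_int[OF t] quartic_of_int[OF \<open>~ int d dvd 2*n\<close>] power2_eq_square by simp
 also have "... = of_int (Legendre (int (gnorm w)) (int d))" by (rule quartic_square)
 also have "Legendre (int (gnorm w)) (int d) = Legendre n (int d)"
  by (rule Legendre_cong) (use nw dv in \<open>simp add: cong_iff_dvd_diff\<close>)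
 finally show ?thesis .
qed

text \<open>The quartic symbol is -1 at \<open>gI\<close> when d is 3 modulo 8. The parity sign is
  multiplicative on elements of odd norm and also -1 at \<open>gI\<close>, so the product is trivial
  on units.\<close>

definition dtheta :: "gint \<Rightarrow> complex" where
 "dtheta z = (if even (gnorm z) then 0 else quartic z*(if d mod 8 = 3 & even (gre z) then -1 else 1))"

lemma even_gnorm_iff: "even (gnorm z) \<longleftrightarrow> (even (gre z) \<longleftrightarrow> even (gim z))"
proof -
 have "even (gnorm z) \<longleftrightarrow> even ((gre z)\<^sup>2+(gim z)\<^sup>2)" unfolding int_gnorm[symmetric] by simp
 thus ?thesis by simp
qed

lemma dtheta_square: "odd (gnorm z) ==> dtheta z^2 = of_int (Legendre (int (gnorm z)) (int d))"
 using quartic_square[of z] by (simp add: dtheta_def power_mult_distrib)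

text \<open>The least nonresidue n exceeds a residue by one, so modulo d it is x^2 + 1, a norm, and
  there the square of \<open>dtheta\<close> is -1. An even representative x keeps the norm
  odd.\<close>

lemma ex_dtheta_neq_1: "\<exists>c. dtheta c ~= 1 & coprime (gnorm c) (2*d)"
proof -
 define n where "n = (LEAST n. n > 0 & Legendre (int n) (int d) = -1)"
 obtain c0 where c0: "Legendre (int c0) (int d) = -1" "0 < c0" "c0 < d" using ex_nonresidue[OF d(1) d2] by blast
 have n: "n > 0" "Legendre (int n) (int d) = -1" "n <= c0"
  unfolding n_def using LeastI[of "%n. n > 0 & Legendre (int n) (int d) = -1" c0]
   Least_le[of "%n. n > 0 & Legendre (int n) (int d) = -1" c0] c0 by auto
 have "n ~= 1" using n(2) Legendre_one_left[OF d(1)] by auto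
 hence n1: "0 < n - 1" "n - 1 < n" "n - 1 < d" using n c0 by auto
 have "Legendre (int (n - 1)) (int d) ~= -1"
  using not_less_Least[of "n - 1" "%n. n > 0 & Legendre (int n) (int d) = -1"] n1 unfolding n_def by auto
 moreover have "~ int d dvd int (n - 1)" using nat_dvd_not_less[OF n1(1,3)] by (simp only: int_dvd_int_iff not_False_eq_True)
 hence "Legendre (int (n - 1)) (int d) ~= 0" by (simp add: Legendre_eq_0_iff)
 ultimately have "Legendre (int (n - 1)) (int d) = 1" using Legendre_cases by blast
 then obtain y where y: "[y\<^sup>2 = int (n - 1)] (mod int d)"
  unfolding Legendre_def QuadRes_def by (auto split: if_splits)
 define x where "x = (if even y then y else y+int d)"
 have ex: "even x" using odd_d by (simp add: x_def)
 have "[x\<^sup>2 = y\<^sup>2] (mod int d)" by (rule cong_pow) (simp add: x_def cong_def)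
 hence "[x\<^sup>2 = int (n - 1)] (mod int d)" using y by (rule cong_trans)
 hence "[x\<^sup>2+1 = int (n - 1)+1] (mod int d)" by (rule cong_add) simp
 moreover have "int (n - 1)+1 = int n" using n by simp
 ultimately have "[x\<^sup>2+1 = int n] (mod int d)" by simp
 hence "Legendre (x\<^sup>2+1) (int d) = -1" using n(2) Legendre_cong by metis
 moreover have "int (gnorm (Gint x 1)) = x\<^sup>2+1" by (simp add: int_gnorm)
 ultimately have L: "Legendre (int (gnorm (Gint x 1))) (int d) = -1" by simp
 have o: "odd (gnorm (Gint x 1))" using ex by (simp add: even_gnorm_iff)
 have "~ int d dvd int (gnorm (Gint x 1))" using L Legendre_eq_0_iff[of "int (gnorm (Gint x 1))" "int d"] by auto
 hence "coprime d (gnorm (Gint x 1))" using d(1) by (simp add: prime_imp_coprime int_dvd_int_iff)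
 hence "coprime (gnorm (Gint x 1)) (2*d)" using o by (simp add: coprime_commute)
 moreover have "dtheta (Gint x 1) ~= 1" using dtheta_square[OF o] unfolding L by auto
 ultimately show ?thesis by blast
qed

lemma gauss_char_dtheta: "gauss_char dtheta (2*d)"
proof
 have nq: "~ gdvd 1" using d2 by (simp add: gint_of_nat_dvd_iff)
 have q1: "quartic 1 = 1" using quartic_of_int[of 1] d2 by simp
 show "dtheta 1 = 1" by (simp add: dtheta_def q1)
 show m: "dtheta (x*y) = dtheta x*dtheta y" for x y
 proof (cases "even (gnorm x) | even (gnorm y)")
  case True
  thus ?thesis by (auto simp: dtheta_def gnorm_mult)
 next
  case False
  hence "(even (gre x) \<longleftrightarrow> odd (gim x)) & (even (gre y) \<longleftrightarrow> odd (gim y))" by (simp add: even_gnorm_iff)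
  hence "even (gre (x*y)) \<longleftrightarrow> (even (gre x) ~= even (gre y))" by auto
  thus ?thesis using False by (simp add: dtheta_def gnorm_mult quartic_mult del: gint_sel)
 qed
 show "dtheta gI = 1" using quartic_gI Legendre_two by (simp add: dtheta_def)
 show "norm (dtheta z) <= 1" for z
 proof -
  have "norm (quartic z) <= 1"
  proof (cases "gdvd z")
   case False
   obtain k where "quartic z = \<i>^k" using quartic_obtain[OF False] by blast
   thus ?thesis by (simp add: norm_power)
  qed (simp add: quartic_0)
  thus ?thesis by (simp add: dtheta_def norm_mult)
 qed
 show "dtheta (gcnj z) = cnj (dtheta z)" for z by (simp add: dtheta_def quartic_gcnj)
 show "2*d > 0" using d2 by simp
 show per: "dtheta (z + of_nat (2*d)*w) = dtheta z" for z w
 proof -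
  have "gdvd ((z + of_nat (2*d)*w) - z)" by simp
  hence "quartic (z + of_nat (2*d)*w) = quartic z" by (rule quartic_cong)
  moreover have "even (gre (z + of_nat (2*d)*w)) \<longleftrightarrow> even (gre z)" "even (gim (z + of_nat (2*d)*w)) \<longleftrightarrow> even (gim z)" by simp_all
  ultimately show ?thesis unfolding dtheta_def even_gnorm_iff by simp
 qed
 obtain c where "dtheta c ~= 1" "coprime (gnorm c) (2*d)" using ex_dtheta_neq_1 by blast
 thus "(\<Sum>(r, t)\<in>{1..2*d} \<times> {..<2*d}. dtheta (Gint (int r) (int t))) = 0"
  using d2 by (intro gint_sum_zero[OF _ per m]) auto
qed

sublocale dth: gauss_char dtheta "2*d"
 by (rule gauss_char_dtheta)

lemma Legendre_recip_1mod4: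
 assumes p: "prime p" "p mod 4 = 1"
 shows "Legendre (int d) (int p) = Legendre (int p) (int d)"
proof -
 have "p > 2" using prime_ge_2_nat[OF p(1)] p(2) by (cases "p = 2") auto
 moreover have "d ~= p" using p(2) d(2) by auto
 ultimately show ?thesis using Legendre_reciprocity[OF d(1) d2 p(1)] p(2) by simp
qed

text \<open>The square of \<open>dtheta\<close> at z is (p/d) = (d/p). If this is -1 the value is
  purely imaginary and 1 + 2 Re \<open>dtheta z\<close> + (d/p) is 0; if it is 1 the sum is at least
  0. This supplies the positivity for \<open>gprime_sum_bounded\<close>.\<close>

lemma dtheta_prime:
 assumes p: "prime p" "p mod 4 = 1" and z: "gnorm z = p"
 shows "Legendre (int d) (int p) = -1 ==> Re (dtheta z) = 0"
  "Legendre (int d) (int p) ~= 0"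
proof -
 have o: "odd (gnorm z)" using p(2) z by presburger
 have sq: "dtheta z^2 = of_int (Legendre (int d) (int p))"
  using dtheta_square[OF o] z Legendre_recip_1mod4[OF p] by simp
 show "Re (dtheta z) = 0" if "Legendre (int d) (int p) = -1"
 proof -
  have "dtheta z^2 = \<i>^2" using sq that by simp
  hence "dtheta z = \<i> | dtheta z = - \<i>" by (simp only: power2_eq_iff)
  thus ?thesis by auto
 qed
 have "d ~= p" using p(2) d(2) by auto
 hence "~ int p dvd int d" using primes_dvd_imp_eq[OF p(1) d(1)] by (auto simp: int_dvd_int_iff)
 thus "Legendre (int d) (int p) ~= 0" by (simp add: Legendre_eq_0_iff)
qed

lemma dtheta_sum_bounded:
 "\<exists>B. eventually (%s. \<bar>prime_sum (gprime_coeff dtheta) s\<bar> <= B) (at_right 1)"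
proof (rule dth.gprime_sum_bounded[of "int d"])
 show "int d ~= 0" using d2 by simp
 show "~ (\<exists>c. int d = c\<^sup>2)"
 proof
  assume "\<exists>c. int d = c\<^sup>2"
  then obtain c where c: "int d = c\<^sup>2" by blast
  hence "int d = int ((nat \<bar>c\<bar>)\<^sup>2)" by simp
  hence "d = nat \<bar>c\<bar>*nat \<bar>c\<bar>" by (simp only: of_nat_eq_iff power2_eq_square)
  hence "nat \<bar>c\<bar> = 1" using d(1) prime_product[of "nat \<bar>c\<bar>" "nat \<bar>c\<bar>"] by simp
  moreover have "c\<^sup>2 = (int (nat \<bar>c\<bar>))\<^sup>2" by simp
  ultimately have "int d = 1" using c by simp
  thus False using d2 by simp
 qed
 show "~ (\<exists>c. - int d = c\<^sup>2)"
 proof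
  assume "\<exists>c. - int d = c\<^sup>2"
  then obtain c :: int where "- int d = c\<^sup>2" by blast
  thus False using zero_le_power2[of c] d2 by simp
 qed
 show "dtheta z = 0" if "even (gnorm z)" for z using that by (simp add: dtheta_def)
 fix p z assume pz: "prime p" "p mod 4 = 1" "gnorm z = p"
 have "\<bar>Re (dtheta z)\<bar> <= 1" using dth.le_1[of z] abs_Re_le_cmod[of "dtheta z"] by simp
 thus "0 <= 1+2 * Re (dtheta z) + real_of_int (Legendre (int d) (int p))"
  using dtheta_prime[OF pz] Legendre_cases[of "int d" "int p"] by auto
qed

lemma gint_power_parity: "odd (gre z) & even (gim z) ==> odd (gre (z^n)) & even (gim (z^n))"
 by (induction n) auto

text \<open>With \<open>z ^ m = A+B i\<close> one compares \<open>4 p ^ m = T\<^sup>2+d Y\<^sup>2\<close> with \<open>p ^ m = A\<^sup>2+B\<^sup>2\<close>: the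
 quartic symbol is the quadratic symbol of \<open>T+2 A\<close> (or \<open>X - B\<close> if \<open>T = 2 X\<close>), whose reciprocal is trivial
 because \<open>T\<^sup>2 - 4 A\<^sup>2 = 4 B\<^sup>2 - d Y\<^sup>2\<close>.\<close>

lemma dtheta_eq_Legendre:
 assumes p: "prime p" "p mod 4 = 1" and m: "odd m" and e: "4*int p ^ m = T\<^sup>2+int d*Y\<^sup>2"
  and pT: "~ int p dvd T" and T: "Legendre (2*T) (int d) = 1"
 shows "gprime_coeff dtheta p = 2 * of_int (Legendre T (int p))"
proof -
 have p2: "p > 2" using prime_ge_2_nat[OF p(1)] p(2) by (cases "p = 2") auto
 have op: "odd p" using prime_odd_nat[OF p(1) p2] by simp
 obtain z0 where z0: "gnorm z0 = p" using ex_gnorm_eq_prime[OF p] by blast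
 \<comment> \<open>An odd real part makes the sign in \<open>dtheta\<close> trivial, and this parity
   survives in the power z^m.\<close>
 define z where "z = (if odd (gre z0) then z0 else gI*z0)"
 have z: "gnorm z = p" using z0 by (simp add: z_def gnorm_mult)
 have "even (gre z0) \<longleftrightarrow> odd (gim z0)" using even_gnorm_iff[of z0] z0 op by auto
 hence zpar: "odd (gre z) & even (gim z)" by (simp add: z_def)
 define Z where "Z = z ^ m"
 define A B where "A = gre Z" and "B = gim Z"
 have par: "odd A" "even B" using gint_power_parity[OF zpar, of m] by (simp_all add: Z_def A_def B_def)
 have NZ: "gnorm Z = p ^ m" by (simp add: Z_def gnorm_power z)
 have AB: "int p ^ m = A\<^sup>2+B\<^sup>2" using int_gnorm[of Z] by (simp add: NZ A_def B_def)
 have dT: "~ int d dvd T"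
 proof
  assume "int d dvd T"
  hence "Legendre (2*T) (int d) = 0" by (simp add: Legendre_eq_0_iff)
  thus False using T by simp
 qed
 have "[4*int p ^ m = T\<^sup>2] (mod int d)" unfolding e by (simp add: cong_iff_dvd_diff)
 note cT = this
 have dprime: "prime (int d)" using d(1) by simp
 have L2: "Legendre (2\<^sup>2) (int d) = 1"
  using d2 by (intro Legendre_square[OF d(1)]) (auto dest: zdvd_imp_le)
 have "Legendre (2\<^sup>2*int p ^ m) (int d) = Legendre (T\<^sup>2) (int d)" using cT by (intro Legendre_cong) simp
 hence "Legendre (int p) (int d) ^ m = 1"
  unfolding Legendre_mult[OF d(1)] L2 Legendre_square[OF d(1) dT] by (simp add: Legendre_power[OF d(1)])
 hence Lp: "Legendre (int p) (int d) = 1" using Legendre_cases[of "int p" "int d"] m by (cases m) auto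
 have dz: "dtheta z = quartic z" using zpar z op by (simp add: dtheta_def)
 have "quartic z^2 = 1" using quartic_square[of z] z Lp by simp
 hence "quartic z = 1 | quartic z = -1" by (simp add: power2_eq_1_iff)
 moreover have qZ: "quartic Z = quartic z ^ m" unfolding Z_def
  using quartic_of_int[of 1] d2 by (induction m) (auto simp: quartic_mult)
 ultimately have qz: "quartic Z = quartic z" and qreal: "cnj (quartic Z) = quartic Z" using m by auto
 have eZ: "[4*int (gnorm x) = T\<^sup>2] (mod int d)" if "gnorm x = p ^ m" for x using cT that by simp
 have key: "quartic Z = of_int (Legendre T (int p))"
 proof (cases "odd T")
  case oT: True
  have oY: "odd Y"
  proof
   assume "even Y"
   then obtain y where "Y = 2*y" by blast
   hence "4*int p ^ m - int d*(2*y)\<^sup>2 = T\<^sup>2" using e by simp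
   hence "even (T\<^sup>2)" by (metis even_mult_iff even_numeral dvd_diff power2_eq_square dvd_mult2 dvd_mult dvd_triv_left)
   thus False using oT by simp
  qed
  \<comment> \<open>For odd T and Y the equation reads 4 = 1 + d modulo 8.\<close>
  have d8: "d mod 8 = 3"
  proof -
   have sq: "x\<^sup>2 mod 8 = 1" if "odd x" for x :: int
   proof -
    obtain k where k: "x = 2*k+1" using \<open>odd x\<close> by (elim oddE)
    have "even (k*(k+1))" by simp
    then obtain j where j: "k*(k+1) = 2*j" by blast
    have "x\<^sup>2 = 1+4*(k*(k+1))" unfolding k by (simp add: power2_eq_square algebra_simps)
    hence "x\<^sup>2 = 1+8*j" unfolding j by simp
    thus ?thesis by (simp only: mod_mult_self2) simp
   qed
   obtain y where y: "Y\<^sup>2 = 1+8*y" using sq[OF oY] by (metis mult_div_mod_eq add.commute)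
   obtain t where t: "T\<^sup>2 = 1+8*t" using sq[OF oT] by (metis mult_div_mod_eq add.commute)
   obtain h where h: "int p ^ m = 2*h+1" using op by (metis even_of_nat_iff even_power oddE)
   have "4+8*h = 1+8*t+int d+8*(int d*y)" using e unfolding h t y by (simp add: algebra_simps)
   hence "int d mod 8 = 3" by presburger
   thus ?thesis by presburger
  qed
  \<comment> \<open>\<open>d\<close> cannot divide both T + 2 A and T - 2 A, since it does not
    divide 2 T. Passing to -Z, which has the same quartic symbol, reaches the good sign.\<close>
  obtain A' Z' where A': "A' = A | A' = -A" "gre Z' = A'" "(gim Z')\<^sup>2 = B\<^sup>2" "quartic Z' = quartic Z" "~ int d dvd T+2*A'"
  proof (cases "int d dvd T+2*A")
   case False
   moreover have "gre Z = A" "(gim Z)\<^sup>2 = B\<^sup>2" by (simp_all only: A_def B_def)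
   ultimately show ?thesis using that[of A Z] by metis
  next
   case True
   have "~ int d dvd T - 2*A"
   proof
    assume "int d dvd T - 2*A"
    hence "int d dvd (T+2*A)+(T - 2*A)" using True by (rule dvd_add[rotated])
    hence "int d dvd 2*T" by simp
    thus False using T Legendre_eq_0_iff[of "2*T" "int d"] by simp
   qed
   moreover have "quartic (- Z) = quartic Z"
    using quartic_mult[of "of_int (-1)" Z] quartic_of_int[of "-1"] d2 by simp
   moreover have "gre (- Z) = - A" "(gim (- Z))\<^sup>2 = B\<^sup>2" by (simp_all add: A_def B_def)
   moreover have "T+2*(- A) = T - 2*A" by simp
   ultimately show ?thesis using that[of "-A" "-Z"] by metis
  qed
  define u where "u = T+2*A'"
  have ou: "odd u" using oT by (simp add: u_def)
  have A'2: "A'\<^sup>2 = A\<^sup>2" using A'(1) by auto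
  have NZ': "gnorm Z' = p ^ m"
  proof -
   have "int (gnorm Z') = int (p ^ m)" unfolding int_gnorm A'(2,3) A'2 using AB by simp
   thus ?thesis by (simp only: of_nat_eq_iff)
  qed
  have dn: "~ int d dvd 2*T*u"
  proof
   assume "int d dvd 2*T*u"
   moreover have "~ int d dvd 2*T" using T Legendre_eq_0_iff[of "2*T" "int d"] by auto
   ultimately show False using A'(5) unfolding u_def prime_dvd_mult_iff[OF dprime, of "2*T"] by simp
  qed
  have "quartic Z' = of_int (Legendre (2*T*u) (int d))"
   by (rule quartic_norm_square[OF dT eZ[OF NZ'] _ dn]) (simp add: u_def A'(2))
  also have "Legendre (2*T*u) (int d) = Legendre u (int d)" using T by (simp add: Legendre_mult[OF d(1)])
  also have "... = jac (int d) (nat \<bar>u\<bar>) * sgn4 u" by (rule Legendre_jac_3mod4[OF ou])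
  also have "jac (int d) (nat \<bar>u\<bar>) = 1"
  proof (rule jac_form_one[OF ou])
   show "coprime u (int d)" using prime_imp_coprime[OF dprime A'(5)] unfolding u_def by (simp add: coprime_commute)
   show "u*(T - 2*A') = (2*B)\<^sup>2 - int d*Y\<^sup>2"
   proof -
    have "u*(T - 2*A') = T\<^sup>2 - 4*A'\<^sup>2" unfolding u_def by (simp add: power2_eq_square algebra_simps)
    thus ?thesis using e AB unfolding A'2 by (simp add: power_mult_distrib)
   qed
   fix r assume r: "prime r" "int r dvd u" "int r dvd 2*B" "int r dvd Y"
   show "~ int r dvd T - 2*A'"
   proof
    assume "int r dvd T - 2*A'"
    hence "int r dvd u+(T - 2*A')" using r(2) by (rule dvd_add[rotated])
    hence "int r dvd 2*T" by (simp add: u_def)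
    moreover have "odd (int r)" using r(2) ou dvd_trans by blast
    hence "coprime (int r) 2" by simp
    ultimately have "int r dvd T" by (simp add: coprime_dvd_mult_right_iff)
    moreover have "coprime T Y" by (rule form_coprime[OF p(1), of 2 m 1 T "int d" Y]) (use e oT pT in auto)
    ultimately have "is_unit (int r)" using r(4) by (meson coprime_common_divisor)
    thus False using r(1) by simp
   qed
  qed
  \<comment> \<open>As A' is odd, u is T + 2 modulo 4. The resulting sign is matched below by (T/d)
    = (2/d) = -1.\<close>
  also have "1 * sgn4 u = - sgn4 T"
  proof -
   have "odd A'" using A'(1) par by auto
   then obtain k where "A' = 2*k+1" by (elim oddE)
   hence u: "u = T+2+4*k" by (simp add: u_def)
   have "T mod 4 = 1 | T mod 4 = 3" using oT by presburger
   thus ?thesis unfolding u sgn4_def by presburger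
  qed
  finally have q: "quartic Z = of_int (- sgn4 T)" using A'(4) by simp
  have "Legendre T (int p) = jac (int p) (nat \<bar>T\<bar>)" by (rule Legendre_jac_1mod4[OF p oT])
  also have "... = jac (int d) (nat \<bar>T\<bar>)"
   by (rule jac_form_swap[OF p(1), of 2 m 1 T "int d" Y]) (use e oT pT m in auto)
  also have "... = Legendre T (int d) * sgn4 T" using Legendre_jac_3mod4[OF oT] by (simp add: mult.assoc)
  also have "Legendre T (int d) = -1" using T Legendre_two d8 by (simp add: Legendre_mult[OF d(1)])
  finally show ?thesis using q by simp
 next
  case False
  then obtain xh where xh: "T = 2*xh" by blast
  have "int d*Y\<^sup>2 = 2*(2*int p ^ m - 2*xh\<^sup>2)" using e unfolding xh by (simp add: power2_eq_square)
  hence "even (int d*Y\<^sup>2)" by simp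
  hence "even Y" using odd_d by simp
  then obtain y where y: "Y = 2*y" by blast
  have e': "int p ^ m = xh\<^sup>2+int d*y\<^sup>2" using e unfolding xh y by (simp add: power_mult_distrib)
  have pX: "~ int p dvd xh" using pT unfolding xh by auto
  have Lx: "Legendre xh (int d) = 1" using T L2 unfolding xh by (simp add: Legendre_mult[OF d(1)] power2_eq_square)
  have dX: "~ int d dvd xh" using Lx Legendre_eq_0_iff[of xh "int d"] by auto
  have p4: "int p mod 4 = 1" using p(2) by presburger
  have "int p ^ m mod 4 = (int p mod 4) ^ m mod 4" by (simp add: power_mod)
  hence pm4: "int p ^ m mod 4 = 1" using p4 by simp
  \<comment> \<open>Otherwise y is odd and p^m is d modulo 4, that is 3, against p = 1 modulo
    4.\<close>
  have oX: "odd xh"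
  proof
   assume "even xh"
   then obtain k where k: "xh = 2*k" by blast
   have "odd (int p ^ m)" using op by simp
   hence "odd y" using e' k odd_d by auto
   then obtain j where j: "y = 2*j+1" by (elim oddE)
   define c where "c = int d div 4"
   have c: "int d = 4 * c+3" unfolding c_def using d(2) by presburger
   have "int p ^ m = 3+4*(k\<^sup>2 + c*(2*j+1)\<^sup>2+3*(j\<^sup>2+j))"
    unfolding e' k j c by (simp add: power2_eq_square algebra_simps)
   hence "int p ^ m mod 4 = 3" by (simp only: mod_mult_self2) simp
   thus False using pm4 by simp
  qed
  \<comment> \<open>Here conjugation plays the part of the sign change: it negates B and conjugates
    the quartic symbol, which is real.\<close>
  obtain B' Z' where B': "B' = B | B' = -B" "gim Z' = B'" "gre Z' = A" "quartic Z' = quartic Z" "~ int d dvd xh - B'"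
  proof (cases "int d dvd xh - B")
   case False
   moreover have "gre Z = A" "gim Z = B" by (simp_all only: A_def B_def)
   ultimately show ?thesis using that[of B Z] by metis
  next
   case True
   have "~ int d dvd xh+B"
   proof
    assume "int d dvd xh+B"
    hence "int d dvd (xh - B)+(xh+B)" using True by (rule dvd_add[rotated])
    hence "int d dvd T" by (simp add: xh)
    thus False using dT by simp
   qed
   moreover have "gim (gcnj Z) = - B" "gre (gcnj Z) = A" "quartic (gcnj Z) = quartic Z" "xh - (- B) = xh+B"
    using qreal by (simp_all add: A_def B_def quartic_gcnj)
   ultimately show ?thesis using that[of "-B" "gcnj Z"] by metis
  qed
  define u where "u = xh - B'"
  have ou: "odd u" using oX par B'(1) by (auto simp: u_def)
  have B'2: "B'\<^sup>2 = B\<^sup>2" using B'(1) by auto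
  have NZ': "gnorm (gI*Z') = p ^ m"
  proof -
   have "int (gnorm (gI*Z')) = int (p ^ m)" unfolding gnorm_mult gnorm_gI mult_1 int_gnorm B'(2,3) B'2 using AB by simp
   thus ?thesis by (simp only: of_nat_eq_iff)
  qed
  \<comment> \<open>The real part of gI Z' is - B', so \<open>quartic_norm_square\<close> applied to
    gI Z' speaks about xh - B'. The extra symbol of \<open>gI\<close> is (2/d), which also occurs on
    the other side and cancels.\<close>
  have n: "2*T*(T+2*gre (gI*Z')) = (2\<^sup>2*xh)*(2*u)" by (simp add: xh u_def B'(2) algebra_simps)
  have du: "~ int d dvd 2\<^sup>2*xh*(2*u)"
  proof
   assume "int d dvd 2\<^sup>2*xh*(2*u)"
   hence "int d dvd 2 | int d dvd xh | int d dvd u" unfolding prime_dvd_mult_iff[OF dprime] power2_eq_square by blast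
   moreover have "~ int d dvd 2" using d2 by (auto dest: zdvd_imp_le)
   ultimately show False using dX B'(5) by (simp add: u_def)
  qed
  have "quartic (gI*Z') = of_int (Legendre (2\<^sup>2*xh*(2*u)) (int d))"
   by (rule quartic_norm_square[OF dT eZ[OF NZ'] n[symmetric] du])
  also have "Legendre (2\<^sup>2*xh*(2*u)) (int d) = Legendre 2 (int d)*Legendre u (int d)"
   unfolding Legendre_mult[OF d(1)] L2 Lx by simp
  also have "Legendre u (int d) = jac (int d) (nat \<bar>u\<bar>) * sgn4 u" by (rule Legendre_jac_3mod4[OF ou])
  also have "jac (int d) (nat \<bar>u\<bar>) = 1"
  proof (rule jac_form_one[OF ou])
   show "coprime u (int d)" using prime_imp_coprime[OF dprime B'(5)] unfolding u_def by (simp add: coprime_commute)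
   have "u*(xh+B') = xh\<^sup>2 - B'\<^sup>2" unfolding u_def by (simp add: power2_eq_square algebra_simps)
   thus "u*(xh+B') = A\<^sup>2 - int d*y\<^sup>2" using e' AB unfolding B'2 by simp
   fix r assume r: "prime r" "int r dvd u" "int r dvd A" "int r dvd y"
   show "~ int r dvd xh+B'"
   proof
    assume "int r dvd xh+B'"
    hence "int r dvd u+(xh+B')" using r(2) by (rule dvd_add[rotated])
    hence "int r dvd 2*xh" by (simp add: u_def)
    moreover have "odd (int r)" using r(2) ou dvd_trans by blast
    hence "coprime (int r) 2" by simp
    ultimately have "int r dvd xh" by (simp add: coprime_dvd_mult_right_iff)
    moreover have "coprime xh y" by (rule form_coprime[OF p(1), of 1 m 1 xh "int d" y]) (use e' oX pX in auto)
    ultimately have "is_unit (int r)" using r(4) by (meson coprime_common_divisor)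
    thus False using r(1) by simp
   qed
  qed
  finally have q1: "quartic gI*quartic Z = of_int (Legendre 2 (int d) * sgn4 u)"
   unfolding quartic_mult B'(4) by simp
  have "Legendre 2 (int d) = 1 | Legendre 2 (int d) = -1" by (simp add: Legendre_two)
  hence q: "quartic Z = of_int (sgn4 u)" using q1 unfolding quartic_gI by auto
  have "Legendre xh (int p) = jac (int p) (nat \<bar>xh\<bar>)" by (rule Legendre_jac_1mod4[OF p oX])
  also have "... = jac (int d) (nat \<bar>xh\<bar>)"
   by (rule jac_form_swap[OF p(1), of 1 m 1 xh "int d" y]) (use e' oX pX m in auto)
  also have "... = sgn4 xh" using Legendre_jac_3mod4[OF oX] Lx by (auto simp: sgn4_def split: if_splits)
  finally have "Legendre T (int p) = Legendre 2 (int p) * sgn4 xh" unfolding xh by (simp add: Legendre_mult[OF p(1)])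
  \<comment> \<open>Modulo 8, p^m is p and also 1 + B^2. So B/2 is even exactly when (2/p) = 1, and
    u differs from xh by 2 modulo 4 exactly when B/2 is odd.\<close>
  moreover have "sgn4 u = Legendre 2 (int p) * sgn4 xh"
  proof -
   obtain b where b: "B = 2*b" using par(2) by blast
   obtain a where a: "A = 2*a+1" using par(1) by (elim oddE)
   have "even (a*(a+1))" by simp
   then obtain j where j: "a*(a+1) = 2*j" by blast
   have "A\<^sup>2 = 1+4*(a*(a+1))" unfolding a by (simp add: power2_eq_square algebra_simps)
   hence pm: "int p ^ m = 1+8*j+4*b\<^sup>2" unfolding AB j by (simp add: b power_mult_distrib)
   have L2p: "Legendre 2 (int p) = (if p mod 8 = 1 then 1 else -1)"
   proof -
    have "p mod 8 = 1 | p mod 8 = 5" using p(2) by presburger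
    thus ?thesis using jac_two[OF op] p(1) by auto
   qed
   have pm8: "int p ^ m mod 8 = int p mod 8"
   proof -
    obtain h where h: "m = 2*h+1" using m by (elim oddE)
    have "int p mod 8 = 1 | int p mod 8 = 5" using p(2) by presburger
    moreover have "int p^2 mod 8 = (int p mod 8)^2 mod 8" by (simp add: power_mod)
    ultimately have "int p^2 mod 8 = 1" by auto
    moreover have "(int p^2)^h mod 8 = (int p^2 mod 8)^h mod 8" by (simp only: power_mod)
    ultimately have "(int p^2)^h mod 8 = 1" by simp
    hence "((int p^2)^h*int p) mod 8 = int p mod 8" by (metis mod_mult_left_eq mult_1)
    thus ?thesis unfolding h by (simp only: power_add power_mult power_one_right)
   qed
   have "p mod 8 = 1 \<longleftrightarrow> even b"
   proof -
    have "p mod 8 = 1 | p mod 8 = 5" using p(2) by presburger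
    moreover have "even b ==> int p ^ m mod 8 = 1"
    proof -
     assume "even b"
     then obtain k where "b = 2*k" by blast
     hence "int p ^ m = 1+8*(j+2*k\<^sup>2)" unfolding pm by (simp add: power_mult_distrib)
     thus ?thesis by (simp only: mod_mult_self2) simp
    qed
    moreover have "odd b ==> int p ^ m mod 8 = 5"
    proof -
     assume "odd b"
     then obtain k where "b = 2*k+1" by (elim oddE)
     hence "int p ^ m = 5+8*(j+2*(k\<^sup>2+k))" unfolding pm by (simp add: power2_eq_square algebra_simps)
     thus ?thesis by (simp only: mod_mult_self2) simp
    qed
    moreover have "int p mod 8 = int (p mod 8)" by (simp add: of_nat_mod)
    ultimately show ?thesis unfolding pm8 by (cases "even b") auto
   qed
   moreover have "u mod 4 = (if even b then xh mod 4 else (xh+2) mod 4)"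
   proof -
    define b' where "b' = (if B' = B then b else - b)"
    have b': "B' = 2*b'" "even b' \<longleftrightarrow> even b" using B'(1) b by (auto simp: b'_def)
    show ?thesis
    proof (cases "even b")
     case True
     then obtain k where "b' = 2*k" using b'(2) by blast
     thus ?thesis using True unfolding u_def b'(1) by presburger
    next
     case False
     then obtain k where "b' = 2*k+1" using b'(2) by (metis oddE)
     thus ?thesis using False unfolding u_def b'(1) by presburger
    qed
   qed
   moreover have "xh mod 4 = 1 & (xh+2) mod 4 = 3 | xh mod 4 = 3 & (xh+2) mod 4 = 1" using oX by presburger
   ultimately show ?thesis unfolding L2p sgn4_def by auto
  qed
  ultimately show ?thesis using q by simp
 qed
 have "gprime_coeff dtheta p = 2 * Re (dtheta z)" by (rule dth.gprime_coeff_split[OF p(1) p2 z])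
 thus ?thesis unfolding dz qz[symmetric] key by simp
qed

lemma dtheta_nonsplit:
 assumes p: "prime p" "p mod 4 = 1" and L: "Legendre (- int d) (int p) = -1"
 shows "gprime_coeff dtheta p = 0"
proof -
 have p2: "p > 2" using prime_ge_2_nat[OF p(1)] p(2) by (cases "p = 2") auto
 obtain z where z: "gnorm z = p" using ex_gnorm_eq_prime[OF p] by blast
 have "Legendre (int d) (int p) = -1"
  using L Legendre_mult[OF p(1), of "-1" "int d"] Legendre_minus_one[OF p(1) p2] p(2) by simp
 thus ?thesis using dtheta_prime(1)[OF p z] dth.gprime_coeff_split[OF p(1) p2 z] by simp
qed

end

lemma square_mod_8: "odd (x::int) ==> x\<^sup>2 mod 8 = 1"
proof -
 assume "odd x"
 then obtain k where k: "x = 2*k+1" by (elim oddE)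
 have "even (k*(k+1))" by simp
 then obtain j where j: "k*(k+1) = 2*j" by blast
 have "x\<^sup>2 = 1+4*(k*(k+1))" unfolding k by (simp add: power2_eq_square algebra_simps)
 hence "x\<^sup>2 = 1+8*j" unfolding j by simp
 thus ?thesis by (simp only: mod_mult_self2) simp
qed

lemma odd_power_mod_8:
 assumes "odd (x::int)" "odd m"
 shows "x ^ m mod 8 = x mod 8"
proof -
 obtain h where h: "m = 2*h+1" using assms(2) by (elim oddE)
 have "(x\<^sup>2)^h mod 8 = (x\<^sup>2 mod 8)^h mod 8" by (simp only: power_mod)
 hence "(x\<^sup>2)^h mod 8 = 1" using square_mod_8[OF assms(1)] by simp
 hence "((x\<^sup>2)^h*x) mod 8 = x mod 8" using mod_mult_left_eq[of "(x\<^sup>2)^h" 8 x] by simp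
 thus ?thesis unfolding h by (simp only: power_add power_mult power_one_right)
qed

text \<open>Both primes are 3 modulo 4, so the corrections \<open>sgn4\<close> cancel, and T, or its
  odd part if T is even, has the same symbol modulo p and modulo d. If T is even, then so is T/2,
  and either 4 divides T exactly or p = d modulo 8, so that 2 has the same symbol for both
  primes.\<close>

lemma (in inert_prime) Legendre_trace_3mod4:
 assumes p: "prime p" "p mod 4 = 3" and m: "odd m" and e: "4*int p ^ m = T\<^sup>2+int d*Y\<^sup>2"
  and pT: "~ int p dvd T" and T: "Legendre (2*T) (int d) = 1"
 shows "Legendre T (int p) = Legendre 2 (int d)"
proof -
 interpret P: inert_prime p by standard (use p in auto)
 have l2: "Legendre 2 (int d) = 1 | Legendre 2 (int d) = -1" "Legendre 2 (int p) = 1 | Legendre 2 (int p) = -1"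
  by (simp_all add: Legendre_two P.Legendre_two)
 show ?thesis
 proof (cases "odd T")
  case oT: True
  have "Legendre T (int p) = jac (int p) (nat \<bar>T\<bar>) * sgn4 T" by (rule P.Legendre_jac_3mod4[OF oT])
  also have "jac (int p) (nat \<bar>T\<bar>) = jac (int d) (nat \<bar>T\<bar>)"
   by (rule jac_form_swap[OF p(1), of 2 m 1 T "int d" Y]) (use e oT pT m in auto)
  also have "jac (int d) (nat \<bar>T\<bar>) * sgn4 T = Legendre T (int d)" using Legendre_jac_3mod4[OF oT] by simp
  finally show ?thesis using T l2(1) unfolding Legendre_mult[OF d(1)] by auto
 next
  case False
  then obtain x where x: "T = 2*x" by blast
  have "int d*Y\<^sup>2 = 2*(2*int p ^ m - 2*x\<^sup>2)" using e unfolding x by (simp add: power2_eq_square)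
  hence "even (int d*Y\<^sup>2)" by simp
  hence "even Y" using odd_d by simp
  then obtain y where y: "Y = 2*y" by blast
  have e': "int p ^ m = x\<^sup>2+int d*y\<^sup>2" using e unfolding x y by (simp add: power_mult_distrib)
  have px: "~ int p dvd x" using pT unfolding x by auto
  have x0: "x ~= 0" using px by auto
  obtain x' where x': "x = 2 ^ multiplicity 2 x*x'" "~ 2 dvd x'"
   using multiplicity_decompose'[of x "2::int"] x0 by auto
  define j where "j = multiplicity 2 x"
  have xj: "x = 2^j*x'" using x'(1) by (simp add: j_def)
  have px': "~ int p dvd x'" using px unfolding xj by auto
  have op: "odd (int p)" using P.odd_d by simp
  have pm: "odd (int p ^ m)" using op by simp
  have pm8: "int p ^ m mod 8 = int p mod 8" by (rule odd_power_mod_8[OF op m])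
  have oy: "odd y"
  proof
   assume ey: "even y"
   then obtain k where k: "y = 2*k" by blast
   have "odd (x\<^sup>2+int d*y\<^sup>2)" using pm unfolding e' .
   hence "odd x" using ey by simp
   hence "x\<^sup>2 mod 8 = 1" by (rule square_mod_8)
   then obtain q where q: "x\<^sup>2 = 1+8*q" by (metis mult_div_mod_eq add.commute)
   have "int p ^ m = 1+4*(2*q+int d*k\<^sup>2)" unfolding e' k q by (simp add: power_mult_distrib)
   hence "int p ^ m mod 4 = 1" by (simp only: mod_mult_self2) simp
   moreover have "int p mod 4 = 3" using p(2) by presburger
   ultimately show False using pm8 by presburger
  qed
  have ex: "even x" using pm oy odd_d unfolding e' by simp
  have j0: "j ~= 0" using ex x'(2) xj by (intro notI) simp
  have Lx': "Legendre x' (int p) = Legendre x' (int d)"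
  proof -
   have ox: "odd x'" using x'(2) .
   have "jac (int p) (nat \<bar>x'\<bar>) = jac (int d) (nat \<bar>x'\<bar>)"
    by (rule jac_form_swap[OF p(1), of 1 m "(2^j)\<^sup>2" x' "int d" y])
      (use e' ox px' m in \<open>auto simp: xj power_mult_distrib\<close>)
   thus ?thesis using P.Legendre_jac_3mod4[OF ox] Legendre_jac_3mod4[OF ox] by simp
  qed
  have nz: "~ int d dvd x'"
  proof
   assume "int d dvd x'"
   hence "int d dvd 2*T" unfolding x xj by simp
   thus False using T Legendre_eq_0_iff[of "2*T" "int d"] by simp
  qed
  have TL: "Legendre T (int p) = Legendre 2 (int p)*(Legendre 2 (int p)^j*Legendre x' (int d))"
   unfolding x xj Legendre_mult[OF p(1)] Legendre_power[OF p(1)] Lx' by simp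
  have "2*T = 2*(2*(2^j*x'))" unfolding x xj by simp
  hence T1: "Legendre 2 (int d)*(Legendre 2 (int d)*(Legendre 2 (int d)^j*Legendre x' (int d))) = 1"
   using T by (simp only: Legendre_mult[OF d(1)] Legendre_power[OF d(1)])
  have x'1: "Legendre x' (int d) = 1 | Legendre x' (int d) = -1"
   using Legendre_cases[of x' "int d"] nz by (auto simp: Legendre_eq_0_iff)
  show ?thesis
  proof (cases "j = 1")
   case True
   show ?thesis using TL T1 l2 x'1 unfolding True by auto
  next
   case False
   hence "j \<ge> 2" using j0 by simp
   then obtain i where i: "j = i+2" using le_Suc_ex[of 2 j] by (auto simp: add.commute)
   have x2: "x\<^sup>2 = 8*(2*(2^i*x')\<^sup>2)" unfolding xj i by (simp add: power_mult_distrib power_add)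
   obtain k where k: "y\<^sup>2 = 1+8*k" using square_mod_8[OF oy] by (metis mult_div_mod_eq add.commute)
   have "int p ^ m = int d+8*(2*(2^i*x')\<^sup>2+int d*k)" unfolding e' x2 k by (simp add: algebra_simps)
   hence "int p ^ m mod 8 = int d mod 8" by (simp only: mod_mult_self2)
   hence "int (p mod 8) = int (d mod 8)" using pm8 by (simp only: of_nat_mod of_nat_numeral)
   hence "p mod 8 = d mod 8" by (simp only: of_nat_eq_iff)
   hence "Legendre 2 (int p) = Legendre 2 (int d)" by (simp add: Legendre_two P.Legendre_two)
   thus ?thesis using TL T1 l2 x'1 by auto
  qed
 qed
qed

text \<open>Modulo a, p is the square of b, so (a/p) = 1. The trace 2 a therefore has the symbol of
  2, which is \<open>eps 1\<close>.\<close>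

lemma Legendre_trace_gauss:
 assumes p: "prime p" "p mod 4 = 1" and e: "int p = a\<^sup>2+b\<^sup>2" and a: "odd a" and pa: "~ int p dvd a"
 shows "Legendre (2*a) (int p) = Legendre 2 (int p)"
proof -
 have "jac (int p) (nat \<bar>a\<bar>) = jac 1 (nat \<bar>a\<bar>)"
  by (rule jac_form_swap[OF p(1), of 1 1 1 a 1 b]) (use e a pa in auto)
 also have "... = 1" using a by (simp add: even_nat_iff)
 finally show ?thesis using Legendre_jac_1mod4[OF p a] by (simp add: Legendre_mult[OF p(1)])
qed

lemma jac_two_int:
 assumes "odd x"
 shows "jac 2 (nat \<bar>x\<bar>) = (if x mod 8 = 1 | x mod 8 = 7 then 1 else -1)"
proof -
 have o: "odd (nat \<bar>x\<bar>)" using assms by (simp add: even_nat_iff)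
 have "(nat \<bar>x\<bar> mod 8 = 1 | nat \<bar>x\<bar> mod 8 = 7) \<longleftrightarrow> (x mod 8 = 1 | x mod 8 = 7)"
 proof (cases "x \<ge> 0")
  case True
  define n where "n = nat \<bar>x\<bar>"
  have "x = int n" using True by (simp add: n_def)
  hence "x mod 8 = int (n mod 8)" by (simp add: of_nat_mod)
  thus ?thesis unfolding n_def[symmetric] by simp
 next
  case False
  define n where "n = nat \<bar>x\<bar>"
  have "x = - int n" using False by (simp add: n_def)
  hence "x mod 8 = (if int (n mod 8) = 0 then 0 else 8 - int (n mod 8))" by (simp only: zmod_zminus1_eq_if of_nat_mod of_nat_numeral)
  thus ?thesis unfolding n_def[symmetric] by auto
 qed
 thus ?thesis using jac_two[OF o] by simp
qed

text \<open>The residues prescribed for \<open>d = 2\<close> enter here: those with odd coefficient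
  of the square root have rational part 5 or 7 modulo 8, and for both (x/p) = -1 = (2/p).\<close>

lemma Legendre_trace_two_3mod8:
 assumes p: "prime p" "p mod 8 = 3" and e: "int p = x\<^sup>2+2*y\<^sup>2" and px: "~ int p dvd x"
  and x: "x mod 8 = 5 | x mod 8 = 7"
 shows "Legendre (2*x) (int p) = 1"
proof -
 interpret P: inert_prime p by standard (use p in \<open>auto, presburger\<close>)
 have ox: "odd x" using x by presburger
 have "jac (int p) (nat \<bar>x\<bar>) = jac 2 (nat \<bar>x\<bar>)"
  by (rule jac_form_swap[OF p(1), of 1 1 1 x 2 y]) (use e ox px in auto)
 hence L: "Legendre x (int p) = jac 2 (nat \<bar>x\<bar>) * sgn4 x" using P.Legendre_jac_3mod4[OF ox] by simp
 have "x mod 8 = 5 ==> x mod 4 = 1" "x mod 8 = 7 ==> x mod 4 = 3" by presburger+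
 hence "Legendre x (int p) = -1" unfolding L jac_two_int[OF ox] sgn4_def using x by auto
 thus ?thesis using P.Legendre_two p(2) by (simp add: Legendre_mult[OF p(1)])
qed

section \<open>The quartic character for d = 2\<close>

definition ipow :: "int \<Rightarrow> complex" where
 "ipow n = \<i>^nat (n mod 4)"

lemma i4: "\<i>^4 = 1"
 by (simp add: power4_eq_xxxx)

lemma ipow_add: "ipow (a+b) = ipow a*ipow b"
proof -
 define m where "m = a mod 4+b mod 4"
 have m: "0 <= m" by (simp add: m_def)
 have "\<i>^nat m = \<i>^(4*(nat m div 4)+nat m mod 4)" by simp
 also have "... = \<i>^(nat m mod 4)" by (simp only: power_add power_mult i4 power_one mult_1)
 also have "nat m mod 4 = nat ((a+b) mod 4)" using m by (simp add: m_def nat_mod_distrib[symmetric] mod_add_eq nat_mod_as_int)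
 finally show ?thesis unfolding ipow_def m_def by (simp add: nat_add_distrib power_add)
qed

lemma ipow_0 [simp]: "ipow 0 = 1"
 by (simp add: ipow_def)

lemma ipow_cong: "a mod 4 = b mod 4 ==> ipow a = ipow b"
 by (simp add: ipow_def)

lemma norm_ipow [simp]: "norm (ipow a) = 1"
 by (simp add: ipow_def norm_power)

lemma ipow_minus: "ipow (- a) = cnj (ipow a)"
proof -
 have "ipow a*ipow (- a) = 1" using ipow_add[of a "-a"] by simp
 moreover have "ipow a * cnj (ipow a) = 1" using complex_norm_square[of "ipow a"] by simp
 moreover have "ipow a ~= 0" using norm_ipow[of a] by (metis norm_zero zero_neq_one)
 ultimately show ?thesis by (metis mult_left_cancel)
qed

text \<open>For d = 2 this takes the place of \<open>dtheta\<close>; it is a character modulo 8.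
  Multiplication by \<open>gI\<close> maps (x, y) to (-y, x), and the sign of the exponent at even x
  makes the value invariant under it.\<close>

definition theta2 :: "gint \<Rightarrow> complex" where
 "theta2 z = (if even (gnorm z) then 0 else if odd (gre z) then ipow (gre z*gim z div 2) else ipow (- (gre z*gim z div 2)))"

lemma even_gnorm_iff: "even (gnorm z) \<longleftrightarrow> (even (gre z) \<longleftrightarrow> even (gim z))"
proof -
 have "even (gnorm z) \<longleftrightarrow> even ((gre z)\<^sup>2+(gim z)\<^sup>2)" unfolding int_gnorm[symmetric] by simp
 thus ?thesis by simp
qed

lemma theta2_gI: "theta2 (gI*z) = theta2 z"
proof (cases "even (gnorm z)")
 case True
 thus ?thesis by (simp add: theta2_def gnorm_mult)
next
 case False
 hence par: "even (gre z) \<longleftrightarrow> odd (gim z)" by (simp add: even_gnorm_iff)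
 have "even (gre z*gim z)" using par by auto
 then obtain k where k: "gre z*gim z = 2*k" by blast
 have "gre (gI*z)*gim (gI*z) = 2*(- k)" using k by (simp add: mult.commute)
 hence "gre (gI*z)*gim (gI*z) div 2 = - k" "gre z*gim z div 2 = k" using k by simp_all
 moreover have "odd (gre (gI*z)) \<longleftrightarrow> even (gre z)" using par by simp
 moreover have "even (gnorm (gI*z)) \<longleftrightarrow> False" using False by (simp add: gnorm_mult)
 ultimately show ?thesis using False unfolding theta2_def by simp
qed

text \<open>After multiplication by \<open>gI\<close> both factors have odd real parts, A + 2 b i
  and C + 2 c i. Since A^2 and C^2 are 1 modulo 8, the exponent of the product is A b + C c modulo
  4.\<close>

lemma theta2_mult: "theta2 (z*w) = theta2 z*theta2 w"
proof -
 have oo: "theta2 (z*w) = theta2 z*theta2 w"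
  if zw: "odd (gnorm z)" "odd (gnorm w)" "odd (gre z)" "odd (gre w)" for z w
 proof -
  obtain b where b: "gim z = 2*b" using zw even_gnorm_iff[of z] by blast
  obtain c where c: "gim w = 2 * c" using zw even_gnorm_iff[of w] by blast
  define A C where "A = gre z" and "C = gre w"
  have oA: "odd A" "odd C" using zw by (simp_all add: A_def C_def)
  obtain a where a: "A\<^sup>2 = 1+8*a" using square_mod_8[OF oA(1)] by (metis mult_div_mod_eq add.commute)
  obtain e where e: "C\<^sup>2 = 1+8*e" using square_mod_8[OF oA(2)] by (metis mult_div_mod_eq add.commute)
  have "gre (z*w)*gim (z*w) = 2*((A\<^sup>2 - 4*b\<^sup>2)*(C * c)+(C\<^sup>2 - 4 * c\<^sup>2)*(A*b))"
   by (simp add: b c A_def C_def power2_eq_square algebra_simps)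
  hence h: "gre (z*w)*gim (z*w) div 2 = (A*b+C * c)+4*(2*a*(C * c) - b\<^sup>2*(C * c)+2*e*(A*b) - c\<^sup>2*(A*b))"
   unfolding a e by (simp add: algebra_simps)
  have "gre (z*w)*gim (z*w) div 2 mod 4 = (A*b+C * c) mod 4" unfolding h by (rule mod_mult_self2)
  hence "ipow (gre (z*w)*gim (z*w) div 2) = ipow (A*b)*ipow (C * c)"
   using ipow_cong ipow_add by metis
  moreover have "odd (gre (z*w))" using oA by (simp add: b c A_def C_def)
  moreover have "odd (gnorm (z*w))" using zw by (simp add: gnorm_mult)
  moreover have "gre z*gim z div 2 = A*b" "gre w*gim w div 2 = C * c" by (simp_all add: b c A_def C_def)
  ultimately show ?thesis using zw unfolding theta2_def by simp
 qed
 show ?thesis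
 proof (cases "even (gnorm z) | even (gnorm w)")
  case True
  thus ?thesis by (auto simp: theta2_def gnorm_mult)
 next
  case False
  define z' where "z' = (if odd (gre z) then z else gI*z)"
  define w' where "w' = (if odd (gre w) then w else gI*w)"
  have z': "odd (gnorm z')" "odd (gre z')" "theta2 z' = theta2 z"
   using False even_gnorm_iff[of z] by (auto simp: z'_def gnorm_mult theta2_gI)
  have w': "odd (gnorm w')" "odd (gre w')" "theta2 w' = theta2 w"
   using False even_gnorm_iff[of w] by (auto simp: w'_def gnorm_mult theta2_gI)
  have "theta2 (z'*w) = theta2 (z*w)" by (simp add: z'_def theta2_gI mult.assoc)
  moreover have "theta2 (z'*w') = theta2 (z'*w)"
   using theta2_gI[of "z'*w"] by (simp add: w'_def mult.left_commute)
  ultimately show ?thesis using oo[OF z'(1) w'(1) z'(2) w'(2)] z'(3) w'(3) by simp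
 qed
qed

lemma gauss_char_theta2: "gauss_char theta2 8"
proof
 show "theta2 1 = 1" by (simp add: theta2_def)
 thus "theta2 gI = 1" using theta2_gI[of 1] by simp
 show m: "theta2 (x*y) = theta2 x*theta2 y" for x y by (rule theta2_mult)
 show "norm (theta2 z) <= 1" for z by (simp add: theta2_def)
 show "theta2 (gcnj z) = cnj (theta2 z)" for z
 proof (cases "even (gnorm z)")
  case False
  hence "even (gre z*gim z)" by (auto simp: even_gnorm_iff)
  then obtain k where k: "gre z*gim z = 2*k" by blast
  have "gre (gcnj z)*gim (gcnj z) = 2*(- k)" using k by simp
  hence "gre (gcnj z)*gim (gcnj z) div 2 = - k" "gre z*gim z div 2 = k" using k by simp_all
  thus ?thesis using False unfolding theta2_def by (simp add: ipow_minus)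
 qed (simp add: theta2_def)
 show per: "theta2 (z + of_nat 8*w) = theta2 z" for z w
 proof -
  have e: "even (gnorm (z + of_nat 8*w)) \<longleftrightarrow> even (gnorm z)" "odd (gre (z + of_nat 8*w)) \<longleftrightarrow> odd (gre z)"
   by (simp_all add: even_gnorm_iff)
  show ?thesis
  proof (cases "even (gnorm z)")
   case False
   hence "even (gre z*gim z)" by (auto simp: even_gnorm_iff)
   then obtain k where k: "gre z*gim z = 2*k" by blast
   define n where "n = gre z*gim w+gre w*gim z+8*(gre w*gim w)"
   have "gre (z + of_nat 8*w)*gim (z + of_nat 8*w) = gre z*gim z+8*n"
    by (simp add: n_def algebra_simps)
   hence "gre (z + of_nat 8*w)*gim (z + of_nat 8*w) = 2*(k+4*n)" unfolding k by simp
   hence "gre (z + of_nat 8*w)*gim (z + of_nat 8*w) div 2 = k+4*n" "gre z*gim z div 2 = k" using k by simp_all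
   moreover have "ipow (k+4*n) = ipow k" by (rule ipow_cong) simp
   moreover have "ipow (- (k+4*n)) = ipow (- k)" using calculation(3) by (simp only: ipow_minus)
   ultimately show ?thesis unfolding theta2_def e by simp
  qed (use e in \<open>simp add: theta2_def\<close>)
 qed
 have "theta2 (Gint 1 2) = \<i>" by (simp add: theta2_def even_gnorm_iff ipow_def)
 moreover have "gnorm (Gint 1 2) = 5" by (simp add: gnorm_def)
 moreover have "coprime (5::nat) (2^3)" unfolding coprime_power_right_iff by simp
 ultimately have c: "theta2 (Gint 1 2) ~= 1" "coprime (gnorm (Gint 1 2)) 8" by simp_all
 show "(\<Sum>(r, t)\<in>{1..8} \<times> {..<8}. theta2 (Gint (int r) (int t))) = 0"
  by (rule gint_sum_zero[OF _ per m c]) simp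
qed simp

interpretation th2: gauss_char theta2 8
 by (rule gauss_char_theta2)

lemma theta2_prime:
 assumes p: "prime p" "p mod 4 = 1"
 obtains z where "gnorm z = p" "odd (gre z)" "even (gim z)" "theta2 z = ipow (gre z*gim z div 2)"
  "4 dvd gim z \<longleftrightarrow> p mod 8 = 1"
proof -
 have op: "odd p" using p(2) by presburger
 obtain z0 where z0: "gnorm z0 = p" using ex_gnorm_eq_prime[OF p] by blast
 define z where "z = (if odd (gre z0) then z0 else gI*z0)"
 have z: "gnorm z = p" using z0 by (simp add: z_def gnorm_mult)
 have "even (gre z0) \<longleftrightarrow> odd (gim z0)" using even_gnorm_iff[of z0] z0 op by auto
 hence zpar: "odd (gre z)" "even (gim z)" by (simp_all add: z_def)
 obtain b where b: "gim z = 2*b" using zpar by blast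
 obtain a where a: "(gre z)\<^sup>2 = 1+8*a" using square_mod_8[OF zpar(1)] by (metis mult_div_mod_eq add.commute)
 have ip: "int p = 1+8*a+4*b\<^sup>2" using int_gnorm[of z] z a b by (simp add: power_mult_distrib)
 have "4 dvd gim z \<longleftrightarrow> even b" unfolding b by presburger
 also have "... \<longleftrightarrow> p mod 8 = 1"
 proof (cases "even b")
  case True
  then obtain k where "b = 2*k" by blast
  hence "int p = 1+8*(a+2*k\<^sup>2)" unfolding ip by (simp add: power_mult_distrib)
  hence "int p mod 8 = 1" by (simp only: mod_mult_self2) simp
  thus ?thesis using True by presburger
 next
  case False
  then obtain k where "b = 2*k+1" by (elim oddE)
  hence "int p = 5+8*(a+2*(k\<^sup>2+k))" unfolding ip by (simp add: power2_eq_square algebra_simps)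
  hence "int p mod 8 = 5" by (simp only: mod_mult_self2) simp
  thus ?thesis using False by presburger
 qed
 finally show ?thesis using that[of z] z zpar op by (simp add: theta2_def)
qed

lemma ipow_values: "n mod 4 = 0 ==> ipow n = 1" "n mod 4 = 2 ==> ipow n = -1" "odd n ==> Re (ipow n) = 0"
proof -
 show "n mod 4 = 0 ==> ipow n = 1" "n mod 4 = 2 ==> ipow n = -1" by (simp_all add: ipow_def)
 assume "odd n"
 hence "n mod 4 = 1 | n mod 4 = 3" by presburger
 thus "Re (ipow n) = 0" by (auto simp: ipow_def power3_eq_cube)
qed

lemma theta2_nonsplit:
 assumes p: "prime p" "p mod 8 = 5"
 shows "gprime_coeff theta2 p = 0"
proof -
 have p4: "p mod 4 = 1" using p(2) by presburger
 have p2: "p > 2" using prime_ge_2_nat[OF p(1)] p4 by (cases "p = 2") auto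
 obtain z where z: "gnorm z = p" "odd (gre z)" "even (gim z)" "theta2 z = ipow (gre z*gim z div 2)"
  "4 dvd gim z \<longleftrightarrow> p mod 8 = 1" using theta2_prime[OF p(1) p4] .
 obtain b where b: "gim z = 2*b" using z(3) by blast
 have "~ 4 dvd gim z" using z(5) p(2) by simp
 hence "odd b" unfolding b by presburger
 hence "odd (gre z*b)" using z(2) by simp
 hence "Re (theta2 z) = 0" unfolding z(4) b using ipow_values(3)[of "gre z*b"] by simp
 thus ?thesis using th2.gprime_coeff_split[OF p(1) p2 z(1)] by simp
qed

text \<open>Two representations of p are compared: (x - Im z)(x + Im z) = (Re z)^2 - 2 y^2. Hence
  (2/|u|) = 1 for u = x - Im z, so u is 1 or 7 modulo 8. Since Im z = 4 b, going from u to x changes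
  the class modulo 8 exactly when b is odd, and so does the value of \<open>theta2\<close>.\<close>

lemma theta2_eq_Legendre:
 assumes p: "prime p" "p mod 8 = 1" and e: "int p = x\<^sup>2+2*y\<^sup>2" and ox: "odd x" and px: "~ int p dvd x"
 shows "gprime_coeff theta2 p = 2 * of_int (Legendre (2*x) (int p))"
proof -
 have p4: "p mod 4 = 1" using p(2) by presburger
 have p2: "p > 2" using prime_ge_2_nat[OF p(1)] p4 by (cases "p = 2") auto
 obtain z where z: "gnorm z = p" "odd (gre z)" "even (gim z)" "theta2 z = ipow (gre z*gim z div 2)"
  "4 dvd gim z \<longleftrightarrow> p mod 8 = 1" using theta2_prime[OF p(1) p4] .
 obtain b where b: "gim z = 4*b" using z(5) p(2) by auto
 have ip: "int p = (gre z)\<^sup>2+(gim z)\<^sup>2" using int_gnorm[of z] z(1) by simp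
 define u where "u = x - gim z"
 have ou: "odd u" using ox z(3) by (simp add: u_def)
 have "jac 2 (nat \<bar>u\<bar>) = 1"
 proof (rule jac_form_one[OF ou])
  show "coprime u 2" using ou by simp
  have "u*(x+gim z) = x\<^sup>2 - (gim z)\<^sup>2" unfolding u_def by (simp add: power2_eq_square algebra_simps)
  thus "u*(x+gim z) = (gre z)\<^sup>2 - 2*y\<^sup>2" using e ip by simp
  fix r assume r: "prime r" "int r dvd u" "int r dvd gre z" "int r dvd y"
  show "~ int r dvd x+gim z"
  proof
   assume "int r dvd x+gim z"
   hence "int r dvd u+(x+gim z)" using r(2) by (rule dvd_add[rotated])
   hence "int r dvd 2*x" by (simp add: u_def)
   moreover have "odd (int r)" using r(2) ou dvd_trans by blast
   hence "coprime (int r) 2" by simp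
   ultimately have "int r dvd x" by (simp add: coprime_dvd_mult_right_iff)
   moreover have "coprime x y" by (rule form_coprime[OF p(1), of 1 1 1 x 2 y]) (use e ox px in auto)
   ultimately have "is_unit (int r)" using r(4) by (meson coprime_common_divisor)
   thus False using r(1) by simp
  qed
 qed
 hence u8: "u mod 8 = 1 | u mod 8 = 7" unfolding jac_two_int[OF ou] by presburger
 have op: "odd p" using p(2) by presburger
 have "Legendre 2 (int p) = 1" using jac_two[OF op] p by simp
 hence "Legendre (2*x) (int p) = Legendre x (int p)" by (simp add: Legendre_mult[OF p(1)])
 also have "... = jac (int p) (nat \<bar>x\<bar>)" by (rule Legendre_jac_1mod4[OF p(1) p4 ox])
 also have "... = jac 2 (nat \<bar>x\<bar>)"
  by (rule jac_form_swap[OF p(1), of 1 1 1 x 2 y]) (use e ox px in auto)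
 also have "... = (if even b then 1 else -1)"
 proof -
  have xu: "x = u+4*b" by (simp add: u_def b)
  show ?thesis
  proof (cases "even b")
   case True
   then obtain k where "b = 2*k" by blast
   hence "x = u+8*k" using xu by simp
   hence "x mod 8 = u mod 8" by (simp only: mod_mult_self2)
   thus ?thesis using u8 True jac_two_int[OF ox] by simp
  next
   case False
   then obtain k where "b = 2*k+1" by (elim oddE)
   hence "x = (u+4)+8*k" using xu by simp
   hence "x mod 8 = (u+4) mod 8" by (simp only: mod_mult_self2)
   hence "x mod 8 = 5 | x mod 8 = 3" using u8 by presburger
   thus ?thesis using False jac_two_int[OF ox] by auto
  qed
 qed
 finally have L: "Legendre (2*x) (int p) = (if even b then 1 else -1)" .
 have "theta2 z = (if even b then 1 else -1)"
 proof -
  obtain a where a: "gre z = 2*a+1" using z(2) by (elim oddE)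
  have h: "gre z*gim z div 2 = 4*(a*b)+2*b" unfolding a b by (simp add: algebra_simps)
  show ?thesis
  proof (cases "even b")
   case True
   then obtain k where "b = 2*k" by blast
   hence "(4*(a*b)+2*b) mod 4 = 0" by simp
   thus ?thesis unfolding z(4) h using True ipow_values(1) by simp
  next
   case False
   then obtain k where "b = 2*k+1" by (elim oddE)
   hence "4*(a*b)+2*b = 2+4*(a*b+k)" by simp
   hence "(4*(a*b)+2*b) mod 4 = 2 mod 4" by (simp only: mod_mult_self2)
   thus ?thesis unfolding z(4) h using False ipow_values(2) by simp
  qed
 qed
 thus ?thesis using th2.gprime_coeff_split[OF p(1) p2 z(1)] L by simp
qed

lemma theta2_sum_bounded:
 "\<exists>B. eventually (%s. \<bar>prime_sum (gprime_coeff theta2) s\<bar> <= B) (at_right 1)"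
proof (rule th2.gprime_sum_bounded[of 2])
 show "~ (\<exists>c::int. 2 = c\<^sup>2)"
 proof
  assume "\<exists>c::int. 2 = c\<^sup>2"
  then obtain c :: int where c: "2 = c\<^sup>2" by blast
  have "even (c\<^sup>2)" unfolding c[symmetric] by simp
  hence "even c" by simp
  then obtain k where "c = 2*k" by blast
  hence "2 = 4*k\<^sup>2" using c by (simp add: power_mult_distrib)
  thus False by presburger
 qed
 show "~ (\<exists>c::int. - 2 = c\<^sup>2)"
 proof
  assume "\<exists>c::int. - 2 = c\<^sup>2"
  then obtain c :: int where "- 2 = c\<^sup>2" by blast
  thus False using zero_le_power2[of c] by simp
 qed
 show "theta2 z = 0" if "even (gnorm z)" for z using that by (simp add: theta2_def)
 fix p z assume p: "prime p" "p mod 4 = 1" and zp: "gnorm z = p"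
 have p2: "p > 2" using prime_ge_2_nat[OF p(1)] p(2) by (cases "p = 2") auto
 have op: "odd p" using p(2) by presburger
 have "\<bar>Re (theta2 z)\<bar> <= 1" using th2.le_1[of z] abs_Re_le_cmod[of "theta2 z"] by simp
 moreover have "Re (theta2 z) = 0" if "p mod 8 = 5"
  using theta2_nonsplit[OF p(1) that] th2.gprime_coeff_split[OF p(1) p2 zp] by simp
 moreover have "p mod 8 = 1 | p mod 8 = 5" using p(2) by presburger
 moreover have "Legendre 2 (int p) = jac 2 p" using p(1) by simp
 ultimately show "0 <= 1+2 * Re (theta2 z) + real_of_int (Legendre 2 (int p))"
  using jac_two[OF op] by auto
qed simp

section \<open>Integers and discriminants of quadratic fields\<close>

text \<open>For t = u/v in lowest terms, every power of v divides \<open>C\<close>, so v =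
  1.\<close>

lemma rat_int_of_bounded_denominators:
 fixes t :: rat and C :: int
 assumes C: "C > 0" and int: "\<And>k. of_int C*t^k \<in> \<int>"
 shows "t \<in> \<int>"
proof -
 obtain u v where q: "quotient_of t = (u, v)" by (cases "quotient_of t")
 have v: "v > 0" "coprime u v" "t = of_int u / of_int v"
  using q quotient_of_denom_pos quotient_of_coprime quotient_of_div by blast+
 have "v ^ k dvd C" for k
 proof -
  obtain n where n: "of_int C*t^k = of_int n" using int[of k] by (elim Ints_cases)
  have "of_int (C*u^k) = (of_int (n * v ^ k) :: rat)"
   using n v(1) unfolding v(3) by (simp add: power_divide field_simps)
  hence "C*u^k = n * v ^ k" by (simp only: of_int_eq_iff)
  hence "v ^ k dvd C*u^k" by simp
  moreover have "coprime (v ^ k) (u^k)" using v(2) by (simp add: coprime_commute)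
  ultimately show ?thesis by (simp add: coprime_dvd_mult_left_iff)
 qed
 hence le: "v ^ k <= C" for k using C by (intro zdvd_imp_le) auto
 have "v = 1"
 proof (rule ccontr)
  assume "v ~= 1"
  hence "v \<ge> 2" using v(1) by simp
  hence "2^nat C <= v ^ nat C" by (intro power_mono) auto
  hence "2^nat C <= C" using le[of "nat C"] by simp
  moreover have "int (nat C) < int (2^nat C)" using less_exp[of "nat C"] by (simp only: of_nat_less_iff)
  ultimately show False using C by simp
 qed
 thus ?thesis using v(3) by simp
qed

locale quad =
 fixes \<beta> :: int
 assumes sqf: "squarefree \<beta>" "\<beta> ~= 1"
begin

definition s :: complex where "s = csqrt (of_int \<beta>)"

lemma \<beta>0: "\<beta> ~= 0"
 using sqf by auto

lemma ss: "s * s = of_int \<beta>"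
 unfolding s_def by (metis power2_csqrt power2_eq_square)

text \<open>In lowest terms the square of the denominator would divide the squarefree
  \<beta>.\<close>

lemma square_rat:
 fixes r :: rat
 assumes "of_int \<beta> * r\<^sup>2 \<in> \<int>"
 shows "r \<in> \<int>"
proof -
 obtain u v where q: "quotient_of r = (u, v)" by (cases "quotient_of r")
 have v: "v > 0" "coprime u v" "r = of_int u / of_int v"
  using q quotient_of_denom_pos quotient_of_coprime quotient_of_div by blast+
 obtain n where n: "of_int \<beta> * r\<^sup>2 = of_int n" using assms by (elim Ints_cases)
 have "of_int (\<beta>*u\<^sup>2) = (of_int (n * v\<^sup>2) :: rat)"
  using n v(1) unfolding v(3) by (simp add: power_divide field_simps)
 hence "\<beta>*u\<^sup>2 = n * v\<^sup>2" by (simp only: of_int_eq_iff)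
 hence "v\<^sup>2 dvd \<beta>*u\<^sup>2" by simp
 moreover have "coprime (v\<^sup>2) (u\<^sup>2)" using v(2) by (simp add: coprime_commute)
 ultimately have "v\<^sup>2 dvd \<beta>" by (simp add: coprime_dvd_mult_left_iff)
 hence "is_unit v" using sqf(1) by (simp add: squarefree_def)
 hence "v = 1" using v(1) by simp
 thus ?thesis using v(3) by simp
qed

lemma nonsquare: "~ (\<exists>r::rat. of_int \<beta> = r\<^sup>2)"
proof
 assume "\<exists>r::rat. of_int \<beta> = r\<^sup>2"
 then obtain r :: rat where r: "of_int \<beta> = r\<^sup>2" by blast
 have r0: "r ~= 0"
 proof
  assume "r = 0"
  hence "(of_int \<beta> :: rat) = 0" using r by simp
  thus False using \<beta>0 by simp
 qed
 have "of_int \<beta>*(1 / r)\<^sup>2 = 1" unfolding r using r0 by (simp add: power_divide)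
 hence "of_int \<beta>*(1 / r)\<^sup>2 \<in> \<int>" by (simp only: Ints_1)
 hence "1 / r \<in> \<int>" by (rule square_rat)
 then obtain n where n: "1 / r = of_int n" by (elim Ints_cases)
 have "of_int (\<beta>*n\<^sup>2) = (1 :: rat)" using \<open>of_int \<beta>*(1 / r)\<^sup>2 = 1\<close> unfolding n by simp
 hence "\<beta>*n\<^sup>2 = 1" by (simp only: of_int_eq_1_iff)
 hence "\<beta> dvd 1" by (rule dvdI[OF sym])
 hence "\<bar>\<beta>\<bar> = 1" by (simp only: zdvd1_eq)
 hence "\<beta> = 1 | \<beta> = -1" by linarith
 moreover have "(of_int \<beta> :: rat) \<ge> 0" using r by simp
 ultimately show False using sqf(2) by auto
qed

lemma uniq:
 assumes "of_rat x + of_rat y * s = of_rat x' + of_rat y' * s"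
 shows "x = x' & y = y'"
proof -
 have e: "of_rat (x - x') = (of_rat (y' - y) * s :: complex)" using assms by (simp add: of_rat_diff algebra_simps)
 have y: "y' - y = 0"
 proof (rule ccontr)
  assume n: "y' - y ~= 0"
  define r where "r = (x - x')/(y' - y)"
  have "s = of_rat (x - x') / of_rat (y' - y)" using e n by (simp add: field_simps)
  hence "s = of_rat r" by (simp add: r_def of_rat_divide)
  hence "of_int \<beta> = (of_rat (r * r) :: complex)" using ss by (simp add: of_rat_mult)
  hence "of_rat (of_int \<beta>) = (of_rat (r * r) :: complex)" by simp
  hence "of_int \<beta> = r * r" by (simp only: of_rat_eq_iff)
  thus False using nonsquare by (auto simp: power2_eq_square)
 qed
 moreover have "x - x' = 0"
 proof -
  have "of_rat (x - x') = (0 :: complex)" using e unfolding y by simp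
  thus ?thesis by (simp only: of_rat_eq_0_iff)
 qed
 ultimately show ?thesis by simp
qed

lemma uniq_int:
 assumes "of_int a + of_int b * s = of_int a' + of_int b' * s"
 shows "a = a' & b = b'"
 using uniq[of "of_int a" "of_int b" "of_int a'" "of_int b'"] assms by simp

lemma quad_elem_s: "quad_elem (of_int \<beta>) x y = of_rat x + of_rat y * s"
 by (simp add: quad_elem_def s_def)

text \<open>The order spanned by 1 and \<open>s\<close>, not always the maximal one. It serves to
  express bounded denominators.\<close>

definition Zs :: "complex set" where "Zs = {of_int a + of_int b * s | a b. True}"

lemma Zs_add: "w \<in> Zs ==> w' \<in> Zs ==> w+w' \<in> Zs"
proof -
 assume "w \<in> Zs" "w' \<in> Zs"
 then obtain a b a' b' where "w = of_int a + of_int b * s" "w' = of_int a' + of_int b' * s" by (auto simp: Zs_def)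
 hence "w+w' = of_int (a+a') + of_int (b+b') * s" by (simp add: algebra_simps)
 thus ?thesis unfolding Zs_def by blast
qed

lemma Zs_mult: "w \<in> Zs ==> w' \<in> Zs ==> w*w' \<in> Zs"
proof -
 assume "w \<in> Zs" "w' \<in> Zs"
 then obtain a b a' b' where w: "w = of_int a + of_int b * s" "w' = of_int a' + of_int b' * s" by (auto simp: Zs_def)
 have "w*w' = of_int a * of_int a' + of_int b * of_int b'*(s * s)+(of_int a * of_int b' + of_int b * of_int a') * s"
  unfolding w by (simp add: algebra_simps)
 also have "... = of_int (a*a'+b*b'*\<beta>) + of_int (a*b'+b*a') * s" unfolding ss by simp
 finally show ?thesis unfolding Zs_def by blast
qed

lemma Zs_int: "of_int a \<in> Zs"
 unfolding Zs_def by (rule CollectI, rule exI[of _ a], rule exI[of _ 0]) simp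

lemma Zs_sum: "finite I ==> (\<And>i. i \<in> I ==> f i \<in> Zs) ==> sum f I \<in> Zs"
 by (induction I rule: finite_induct) (use Zs_int[of 0] in \<open>auto intro: Zs_add\<close>)

lemma Zs_power: "w \<in> Zs ==> w^k \<in> Zs"
 by (induction k) (use Zs_int[of 1] in \<open>auto intro: Zs_mult\<close>)

lemma power_coords:
 "\<exists>A B. (of_rat x + of_rat y * s)^k = of_rat A + of_rat B * s & A\<^sup>2 - of_int \<beta>*B\<^sup>2 = (x\<^sup>2 - of_int \<beta>*y\<^sup>2)^k"
proof (induction k)
 case 0
 show ?case by (rule exI[of _ 1], rule exI[of _ 0]) simp
next
 case (Suc k)
 then obtain A B where AB: "(of_rat x + of_rat y * s)^k = of_rat A + of_rat B * s"
  "A\<^sup>2 - of_int \<beta>*B\<^sup>2 = (x\<^sup>2 - of_int \<beta>*y\<^sup>2)^k" by blast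
 have "(of_rat x + of_rat y * s)^Suc k = (of_rat x + of_rat y * s)*(of_rat A + of_rat B * s)" using AB(1) by simp
 also have "... = of_rat x * of_rat A + of_rat y * of_rat B*(s * s)+(of_rat x * of_rat B + of_rat y * of_rat A) * s"
  by (simp add: algebra_simps)
 also have "... = of_rat (x*A+y*B * of_int \<beta>) + of_rat (x*B+y*A) * s"
  unfolding ss by (simp add: of_rat_add of_rat_mult)
 finally have "(of_rat x + of_rat y * s)^Suc k = of_rat (x*A+y*B * of_int \<beta>) + of_rat (x*B+y*A) * s" .
 moreover have "(x*A+y*B * of_int \<beta>)\<^sup>2 - of_int \<beta>*(x*B+y*A)\<^sup>2 = (x\<^sup>2 - of_int \<beta>*y\<^sup>2)*(A\<^sup>2 - of_int \<beta>*B\<^sup>2)"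
  by (simp add: power2_eq_square algebra_simps)
 ultimately show ?case using AB(2) by auto
qed

text \<open>Bounded denominators of the powers of an element pass to the powers of its norm, and
  \<open>rat_int_of_bounded_denominators\<close> applies to the norm.\<close>

lemma norm_int:
 assumes E: "E > 0" and int: "\<And>k. of_int E*(of_rat x + of_rat y * s)^k \<in> Zs"
 shows "x\<^sup>2 - of_int \<beta>*y\<^sup>2 \<in> \<int>"
proof (rule rat_int_of_bounded_denominators)
 show "E*E > 0" using E by simp
 fix k
 obtain A B where AB: "(of_rat x + of_rat y * s)^k = of_rat A + of_rat B * s"
  "A\<^sup>2 - of_int \<beta>*B\<^sup>2 = (x\<^sup>2 - of_int \<beta>*y\<^sup>2)^k" using power_coords by blast
 obtain a b where ab: "of_int E*(of_rat A + of_rat B * s) = of_int a + of_int b * s"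
  using int[of k] unfolding AB(1) Zs_def by blast
 have "of_rat (of_int E*A) + of_rat (of_int E*B) * s = of_rat (of_int a) + of_rat (of_int b) * s"
  using ab by (simp add: of_rat_mult algebra_simps)
 hence "of_int E*A = of_int a & of_int E*B = of_int b" by (rule uniq)
 hence EA: "of_int E*A = of_int a" "of_int E*B = of_int b" by simp_all
 have "of_int (E*E)*(x\<^sup>2 - of_int \<beta>*y\<^sup>2)^k = (of_int E*A)\<^sup>2 - of_int \<beta>*(of_int E*B)\<^sup>2"
  unfolding AB(2)[symmetric] by (simp add: power2_eq_square algebra_simps)
 also have "... = of_int (a\<^sup>2 - \<beta>*b\<^sup>2)" unfolding EA by simp
 finally show "of_int (E*E)*(x\<^sup>2 - of_int \<beta>*y\<^sup>2)^k \<in> \<int>" by simp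
qed

lemma rat_denom: "\<exists>D::int. D > 0 & of_int D*(x::rat) \<in> \<int>"
proof -
 obtain u v where q: "quotient_of x = (u, v)" by (cases "quotient_of x")
 have v: "v > 0" "x = of_int u / of_int v" using q quotient_of_denom_pos quotient_of_div by blast+
 have "of_int v * x = of_int u" using v by simp
 thus ?thesis using v(1) by (intro exI[of _ v]) simp
qed

text \<open>If D z lies in \<open>Zs\<close>, then D^n clears the denominators of all powers below
  the degree n, and the monic equation reduces higher powers to these without new
  denominators.\<close>

lemma algebraic_int_powers:
 assumes z: "algebraic_int (of_rat x + of_rat y * s)"
 obtains E where "E > 0" "\<And>k. of_int E*(of_rat x + of_rat y * s)^k \<in> Zs"
proof -
 define z where "z = of_rat x + of_rat y * s"
 obtain p where p: "Polynomial.lead_coeff p = 1" "\<forall>i. Polynomial.coeff p i \<in> \<int>" "poly p z = 0"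
  using assms unfolding z_def[symmetric] by (auto elim: algebraic_int.cases)
 define n where "n = Polynomial.degree p"
 obtain D1 D2 where D12: "D1 > 0" "of_int D1*x \<in> \<int>" "D2 > 0" "of_int D2*y \<in> \<int>" using rat_denom by metis
 define D where "D = D1*D2"
 obtain a b where ab: "of_int D1*x = of_int a" "of_int D2*y = of_int b" using D12 by (auto elim!: Ints_cases)
 have Dx: "of_int D*x = of_int (D2*a)" "of_int D*y = of_int (D1*b)"
  using ab unfolding D_def by (simp_all add: mult_ac)
 have "of_int D*z = of_rat (of_int D*x) + of_rat (of_int D*y) * s"
  unfolding z_def by (simp add: of_rat_mult algebra_simps)
 also have "... = of_int (D2*a) + of_int (D1*b) * s" unfolding Dx by (simp only: of_rat_of_int_eq)
 finally have Dz: "of_int D*z \<in> Zs" unfolding Zs_def by blast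
 define E where "E = D^n"
 have E0: "E > 0" using D12 by (simp add: E_def D_def)
 have zn: "z^n = - (\<Sum>i<n. Polynomial.coeff p i*z^i)"
 proof -
  have "0 = (\<Sum>i\<le>n. Polynomial.coeff p i*z^i)" using p(3) unfolding poly_altdef n_def by simp
  also have "... = (\<Sum>i<n. Polynomial.coeff p i*z^i)+z^n" using p(1) by (simp add: n_def lessThan_Suc_atMost[symmetric])
  finally show ?thesis by (simp add: eq_neg_iff_add_eq_0 add.commute)
 qed
 have "of_int E*z^k \<in> Zs" for k
 proof (induction k rule: less_induct)
  case (less k)
  show ?case
  proof (cases "k < n")
   case True
   hence "D^n = D^(n - k)*D^k" by (simp add: power_add[symmetric])
   hence "of_int E*z^k = of_int (D^(n - k))*(of_int D*z)^k"
    unfolding E_def by (simp add: power_mult_distrib)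
   thus ?thesis using Zs_mult[OF Zs_int[of "D^(n - k)"] Zs_power[OF Dz, of k]] by (simp only:)
  next
   case False
   hence "z^k = z^(k - n)*z^n" by (simp add: power_add[symmetric])
   also have "... = - (\<Sum>i<n. Polynomial.coeff p i*z^(k - n+i))"
    unfolding zn by (simp add: sum_distrib_left power_add mult_ac)
   finally have "of_int E*z^k = of_int (-1)*(\<Sum>i<n. Polynomial.coeff p i*(of_int E*z^(k - n+i)))"
    by (simp add: sum_distrib_left sum_negf mult_ac)
   moreover have "(\<Sum>i<n. Polynomial.coeff p i*(of_int E*z^(k - n+i))) \<in> Zs"
   proof (rule Zs_sum)
    fix i assume "i \<in> {..<n}"
    hence "k - n+i < k" using False by simp
    hence "of_int E*z^(k - n+i) \<in> Zs" by (rule less.IH)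
    moreover obtain c where "Polynomial.coeff p i = of_int c" using p(2) by (meson Ints_cases)
    ultimately show "Polynomial.coeff p i*(of_int E*z^(k - n+i)) \<in> Zs" using Zs_mult[OF Zs_int] by simp
   qed simp
   ultimately show ?thesis using Zs_mult[OF Zs_int[of "-1"]] by simp
  qed
 qed
 thus ?thesis using that E0 unfolding z_def by blast
qed

text \<open>z and z + 1 both have integral norm, and the two norms differ by 2 x + 1; this yields
  the trace. Conversely z is a root of the polynomial with its trace and norm as
  coefficients.\<close>

lemma algebraic_int_iff:
 "algebraic_int (of_rat x + of_rat y * s) \<longleftrightarrow> 2*x \<in> \<int> & x\<^sup>2 - of_int \<beta>*y\<^sup>2 \<in> \<int>"
proof
 assume "algebraic_int (of_rat x + of_rat y * s)"
 then obtain E where E: "E > 0" "\<And>k. of_int E*(of_rat x + of_rat y * s)^k \<in> Zs" using algebraic_int_powers by blast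
 have N: "x\<^sup>2 - of_int \<beta>*y\<^sup>2 \<in> \<int>" by (rule norm_int[OF E])
 have "(x+1)\<^sup>2 - of_int \<beta>*y\<^sup>2 \<in> \<int>"
 proof (rule norm_int[OF E(1)])
  fix k
  define z where "z = of_rat x + of_rat y * s"
  have "of_rat (x+1) + of_rat y * s = z+1" by (simp add: z_def of_rat_add)
  hence "of_int E*(of_rat (x+1) + of_rat y * s)^k = of_int E*(\<Sum>i\<le>k. of_nat (k choose i)*z^i*1^(k - i))"
   by (simp only: binomial_ring)
  also have "... = (\<Sum>i\<le>k. of_int (int (k choose i))*(of_int E*z^i))" by (simp add: sum_distrib_left mult_ac)
  also have "... \<in> Zs" by (rule Zs_sum) (auto intro!: Zs_mult Zs_int E(2) simp del: of_int_of_nat_eq simp: z_def)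
  finally show "of_int E*(of_rat (x+1) + of_rat y * s)^k \<in> Zs" .
 qed
 hence "((x+1)\<^sup>2 - of_int \<beta>*y\<^sup>2) - (x\<^sup>2 - of_int \<beta>*y\<^sup>2) - 1 \<in> \<int>" by (rule Ints_diff[OF Ints_diff[OF _ N] Ints_1])
 moreover have "((x+1)\<^sup>2 - of_int \<beta>*y\<^sup>2) - (x\<^sup>2 - of_int \<beta>*y\<^sup>2) - 1 = 2*x" by (simp add: power2_eq_square algebra_simps)
 ultimately have "2*x \<in> \<int>" by (simp only:)
 thus "2*x \<in> \<int> & x\<^sup>2 - of_int \<beta>*y\<^sup>2 \<in> \<int>" using N by (rule conjI)
next
 assume "2*x \<in> \<int> & x\<^sup>2 - of_int \<beta>*y\<^sup>2 \<in> \<int>"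
 then obtain t n where tn: "2*x = of_int t" "x\<^sup>2 - of_int \<beta>*y\<^sup>2 = of_int n" by (auto elim!: Ints_cases)
 define z where "z = of_rat x + of_rat y * s"
 have "z*z - of_rat (2*x)*z + of_rat (x\<^sup>2 - of_int \<beta>*y\<^sup>2) = of_rat y * of_rat y*(s * s - of_int \<beta>)"
  unfolding z_def by (simp add: of_rat_mult of_rat_diff power2_eq_square algebra_simps)
 hence zero: "z*z - of_int t*z + of_int n = 0" unfolding tn ss by simp
 define p where "p = [:of_int n, - of_int t, 1 :: complex:]"
 have "Polynomial.lead_coeff p = 1" by (simp add: p_def)
 moreover have "\<forall>i. Polynomial.coeff p i \<in> \<int>"
 proof
  fix i :: nat
  consider "i = 0" | "i = 1" | "i = 2" | "i > 2" by linarith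
  thus "Polynomial.coeff p i \<in> \<int>" by cases (auto simp: p_def numeral_2_eq_2 Polynomial.coeff_eq_0)
 qed
 moreover have "poly p z = 0" using zero by (simp add: p_def algebra_simps)
 ultimately show "algebraic_int (of_rat x + of_rat y * s)" unfolding z_def by (rule algebraic_int.intros)
qed

text \<open>Doubling clears all denominators: 2 x is the trace, and 2 y is integral by
  \<open>square_rat\<close>.\<close>

lemma mem_quad_integers_iff:
 "z \<in> quad_integers (of_int \<beta>) \<longleftrightarrow> (\<exists>a b::int. 2*z = of_int a + of_int b * s & 4 dvd a\<^sup>2 - \<beta>*b\<^sup>2)"
proof
 assume "z \<in> quad_integers (of_int \<beta>)"
 then obtain x y where z: "z = of_rat x + of_rat y * s" "algebraic_int z"
  unfolding quad_integers_def quad_field_def quad_elem_s by blast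
 have "2*x \<in> \<int> & x\<^sup>2 - of_int \<beta>*y\<^sup>2 \<in> \<int>" using z algebraic_int_iff by simp
 then obtain a n where an: "2*x = of_int a" "x\<^sup>2 - of_int \<beta>*y\<^sup>2 = of_int n" by (auto elim!: Ints_cases)
 have e: "of_int \<beta>*(2*y)\<^sup>2 = (2*x)\<^sup>2 - 4*(x\<^sup>2 - of_int \<beta>*y\<^sup>2)" by (simp add: power2_eq_square algebra_simps)
 have "of_int \<beta>*(2*y)\<^sup>2 = (of_int a)\<^sup>2 - 4 * of_int n" using e unfolding an(1) an(2) .
 hence e': "of_int \<beta>*(2*y)\<^sup>2 = of_int (a\<^sup>2 - 4*n)" by (simp only: of_int_diff of_int_mult of_int_power of_int_numeral)
 have "2*y \<in> \<int>" by (rule square_rat) (simp only: e' Ints_of_int)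
 then obtain b where b: "2*y = of_int b" by (elim Ints_cases)
 have "of_int (\<beta>*b\<^sup>2) = (of_int (a\<^sup>2 - 4*n) :: rat)" using e' unfolding b by simp
 hence "\<beta>*b\<^sup>2 = a\<^sup>2 - 4*n" by (simp only: of_int_eq_iff)
 hence "4 dvd a\<^sup>2 - \<beta>*b\<^sup>2" by simp
 moreover have "2*z = of_rat (2*x) + of_rat (2*y) * s" unfolding z(1) by (simp add: of_rat_mult algebra_simps)
 hence "2*z = of_int a + of_int b * s" unfolding an b by simp
 ultimately show "\<exists>a b::int. 2*z = of_int a + of_int b * s & 4 dvd a\<^sup>2 - \<beta>*b\<^sup>2" by blast
next
 assume "\<exists>a b::int. 2*z = of_int a + of_int b * s & 4 dvd a\<^sup>2 - \<beta>*b\<^sup>2"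
 then obtain a b :: int where ab: "2*z = of_int a + of_int b * s" "4 dvd a\<^sup>2 - \<beta>*b\<^sup>2" by blast
 obtain n where n: "a\<^sup>2 - \<beta>*b\<^sup>2 = 4*n" using ab(2) by blast
 define x y where "x = (of_int a/2 :: rat)" and "y = (of_int b/2 :: rat)"
 have z: "z = of_rat x + of_rat y * s" using ab(1) by (simp add: x_def y_def of_rat_divide field_simps)
 have "x\<^sup>2 - of_int \<beta>*y\<^sup>2 = of_int (a\<^sup>2 - \<beta>*b\<^sup>2)/4" by (simp add: x_def y_def power_divide diff_divide_distrib)
 also have "... = of_int n" unfolding n by simp
 finally have "x\<^sup>2 - of_int \<beta>*y\<^sup>2 \<in> \<int>" by simp
 moreover have "2*x \<in> \<int>" by (simp add: x_def)
 ultimately show "z \<in> quad_integers (of_int \<beta>)"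
  unfolding quad_integers_def quad_field_def quad_elem_s using z algebraic_int_iff by blast
qed

text \<open>Coordinates of the second element of the standard integral basis, (1 + s)/2 or
  s.\<close>

definition \<omega>x :: rat where "\<omega>x = (if \<beta> mod 4 = 1 then 1/2 else 0)"
definition \<omega>y :: rat where "\<omega>y = (if \<beta> mod 4 = 1 then 1/2 else 1)"

lemma std_basis: "quad_integral_basis (of_int \<beta>) (quad_elem (of_int \<beta>) 1 0) (quad_elem (of_int \<beta>) \<omega>x \<omega>y)"
proof -
 define w where "w = of_rat \<omega>x + of_rat \<omega>y * s"
 have w2: "2*w = (if \<beta> mod 4 = 1 then 1 + s else 2 * s)"
  by (simp add: w_def \<omega>x_def \<omega>y_def of_rat_divide)
 have one: "1 \<in> quad_integers (of_int \<beta>)" unfolding mem_quad_integers_iff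
  by (rule exI[of _ 2], rule exI[of _ 0]) simp
 have wi: "w \<in> quad_integers (of_int \<beta>)"
 proof (cases "\<beta> mod 4 = 1")
  case True
  have "4 dvd 1 - \<beta>" using True by presburger
  hence "4 dvd 1\<^sup>2 - \<beta>*1\<^sup>2" by simp
  thus ?thesis unfolding mem_quad_integers_iff w2 using True by (intro exI[of _ 1]) simp
 next
  case False
  thus ?thesis unfolding mem_quad_integers_iff w2 by (intro exI[of _ 0] exI[of _ 2]) simp
 qed
 have "\<exists>!c :: int \<times> int. z = of_int (fst c)*1 + of_int (snd c)*w" if "z \<in> quad_integers (of_int \<beta>)" for z
 proof -
  obtain a b :: int where ab: "2*z = of_int a + of_int b * s" "4 dvd a\<^sup>2 - \<beta>*b\<^sup>2"
   using \<open>z \<in> _\<close> mem_quad_integers_iff by blast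
  have ex: "\<exists>e f :: int. z = of_int e + of_int f*w"
  proof (cases "\<beta> mod 4 = 1")
   case True
   then obtain q where q: "\<beta> = 4*q+1" by (metis mult_div_mod_eq)
   have "even (a - b)"
   proof -
    have "4 dvd (a\<^sup>2 - \<beta>*b\<^sup>2)+4*(q*b\<^sup>2)" using ab(2) by simp
    hence "4 dvd a\<^sup>2 - b\<^sup>2" unfolding q by (simp add: algebra_simps)
    hence "even (a\<^sup>2 - b\<^sup>2)" by (meson dvd_trans even_numeral)
    thus ?thesis by simp
   qed
   then obtain e where e: "a = b+2*e" by (metis add.commute dvdE diff_add_cancel)
   have "2*z = 2*(of_int e + of_int b*w)" unfolding ab(1) e distrib_left mult.left_commute[of 2 "of_int b" w] w2
    using True by (simp add: algebra_simps)
   hence "z = of_int e + of_int b*w" by (simp only: mult_cancel_left) simp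
   thus ?thesis by blast
  next
   case False
   have "even a & even b"
   proof (rule ccontr)
    assume n: "~ (even a & even b)"
    have sq: "odd x ==> \<exists>k. x\<^sup>2 = 1+4*k" for x :: int
     using square_mod_8[of x] by (metis mult_div_mod_eq add.commute mult.assoc numeral_Bit0 mult_2 distrib_right)
    have sqe: "even x ==> \<exists>k. x\<^sup>2 = 4*k" for x :: int by (auto simp: power_mult_distrib elim!: evenE)
    have ev: "even (a\<^sup>2 - \<beta>*b\<^sup>2)" using ab(2) by (meson dvd_trans even_numeral)
    consider "odd b" "odd a" | "odd b" "even a" | "even b" "odd a" using n by blast
    thus False
    proof cases
     case 1
     obtain k l where kl: "a\<^sup>2 = 1+4*k" "b\<^sup>2 = 1+4 * l" using sq 1 by blast
     have "4 dvd (a\<^sup>2 - \<beta>*b\<^sup>2) - 4*(k - \<beta> * l)" using ab(2) by simp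
     hence "4 dvd 1 - \<beta>" unfolding kl by (simp add: algebra_simps)
     thus False using False by presburger
    next
     case 2
     obtain k l where kl: "a\<^sup>2 = 4*k" "b\<^sup>2 = 1+4 * l" using sq sqe 2 by blast
     have "4 dvd 4*(k - \<beta> * l) - (a\<^sup>2 - \<beta>*b\<^sup>2)" using ab(2) by simp
     hence "4 dvd \<beta>" unfolding kl by (simp add: algebra_simps)
     hence "2\<^sup>2 dvd \<beta>" by simp
     hence "is_unit (2::int)" using sqf(1) unfolding squarefree_def by blast
     thus False by simp
    next
     case 3
     thus False using ev by simp
    qed
   qed
   then obtain e f where "a = 2*e" "b = 2 * f" by blast
   hence "2*z = 2*(of_int e + of_int f * s)" using ab(1) by (simp add: algebra_simps)
   hence "z = of_int e + of_int f * s" by (simp only: mult_cancel_left) simp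
   moreover have "w = s" using w2 False by simp
   ultimately show ?thesis by blast
  qed
  then obtain e f :: int where ef: "z = of_int e + of_int f*w" by blast
  show ?thesis
  proof (rule ex1I[of _ "(e, f)"])
   show "z = of_int (fst (e, f))*1 + of_int (snd (e, f))*w" using ef by simp
   fix c :: "int \<times> int" assume c: "z = of_int (fst c)*1 + of_int (snd c)*w"
   have "of_rat (of_int e + of_int f*\<omega>x) + of_rat (of_int f*\<omega>y) * s
    = of_rat (of_int (fst c) + of_int (snd c)*\<omega>x) + of_rat (of_int (snd c)*\<omega>y) * s"
    using c unfolding ef w_def by (simp add: of_rat_add of_rat_mult algebra_simps)
   hence "of_int e + of_int f*\<omega>x = of_int (fst c) + of_int (snd c)*\<omega>x & of_int f*\<omega>y = of_int (snd c)*\<omega>y" by (rule uniq)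
   moreover have "\<omega>y ~= 0" by (simp add: \<omega>y_def)
   ultimately show "c = (e, f)" by (cases c) auto
  qed
 qed
 thus ?thesis using one wi unfolding quad_integral_basis_def quad_elem_s w_def by simp
qed

text \<open>Coordinates in an integral basis form an integer matrix, whose determinant is
  \<open>k\<close>. Applied in both directions, this shows that the determinants of two integral
  bases agree up to sign.\<close>

lemma basis_det:
 assumes "quad_integral_basis (of_int \<beta>) (quad_elem (of_int \<beta>) x1 y1) (quad_elem (of_int \<beta>) x2 y2)"
  "quad_elem (of_int \<beta>) x3 y3 \<in> quad_integers (of_int \<beta>)" "quad_elem (of_int \<beta>) x4 y4 \<in> quad_integers (of_int \<beta>)"
 shows "\<exists>k::int. x3*y4 - x4*y3 = of_int k*(x1*y2 - x2*y1)"
proof -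
 have ex: "\<exists>e f :: int. x = of_int e*x1 + of_int f*x2 & y = of_int e*y1 + of_int f*y2"
  if "quad_elem (of_int \<beta>) x y \<in> quad_integers (of_int \<beta>)" for x y
 proof -
  have "\<forall>z\<in>quad_integers (of_int \<beta>). \<exists>!c :: int \<times> int. z = of_int (fst c)*quad_elem (of_int \<beta>) x1 y1 + of_int (snd c)*quad_elem (of_int \<beta>) x2 y2"
   using assms(1) unfolding quad_integral_basis_def by (elim conjE)
  from ex1_implies_ex[OF bspec[OF this that]]
  obtain c :: "int \<times> int" where c: "quad_elem (of_int \<beta>) x y = of_int (fst c)*quad_elem (of_int \<beta>) x1 y1 + of_int (snd c)*quad_elem (of_int \<beta>) x2 y2"
   by (elim exE)
  have "of_rat x + of_rat y * s = of_rat (of_int (fst c)*x1 + of_int (snd c)*x2) + of_rat (of_int (fst c)*y1 + of_int (snd c)*y2) * s"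
   using c unfolding quad_elem_s by (simp add: of_rat_add of_rat_mult algebra_simps)
  hence "x = of_int (fst c)*x1 + of_int (snd c)*x2 & y = of_int (fst c)*y1 + of_int (snd c)*y2" by (rule uniq)
  thus ?thesis by blast
 qed
 obtain e f where ef: "x3 = of_int e*x1 + of_int f*x2" "y3 = of_int e*y1 + of_int f*y2" using ex[OF assms(2)] by blast
 obtain g h where gh: "x4 = of_int g*x1 + of_int h*x2" "y4 = of_int g*y1 + of_int h*y2" using ex[OF assms(3)] by blast
 have "x3*y4 - x4*y3 = of_int (e*h - f*g)*(x1*y2 - x2*y1)"
  unfolding ef gh by (simp add: algebra_simps)
 thus ?thesis by blast
qed

lemma disc_expr:
 "(quad_elem (of_int \<beta>) x1 y1*quad_elem (of_int \<beta>) x2 (- y2) - quad_elem (of_int \<beta>) x2 y2*quad_elem (of_int \<beta>) x1 (- y1))\<^sup>2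
  = of_rat (4 * of_int \<beta>*(x1*y2 - x2*y1)\<^sup>2)"
proof -
 have "quad_elem (of_int \<beta>) x1 y1*quad_elem (of_int \<beta>) x2 (- y2) - quad_elem (of_int \<beta>) x2 y2*quad_elem (of_int \<beta>) x1 (- y1)
  = of_rat (- 2*(x1*y2 - x2*y1)) * s"
  unfolding quad_elem_s by (simp add: of_rat_mult of_rat_diff of_rat_minus algebra_simps)
 also have "...\<^sup>2 = of_rat ((- 2*(x1*y2 - x2*y1))\<^sup>2)*(s * s)" by (simp add: power2_eq_square of_rat_mult)
 also have "... = of_rat ((- 2*(x1*y2 - x2*y1))\<^sup>2 * of_int \<beta>)" unfolding ss by (simp add: of_rat_mult)
 also have "(- 2*t)\<^sup>2*b = 4*b*t\<^sup>2" for t b :: rat by (simp add: power2_eq_square)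
 finally show ?thesis .
qed

definition disc :: int where "disc = (if \<beta> mod 4 = 1 then \<beta> else 4*\<beta>)"

lemma disc_unique:
 "(\<exists>x1 y1 x2 y2. quad_integral_basis (of_int \<beta>) (quad_elem (of_int \<beta>) x1 y1) (quad_elem (of_int \<beta>) x2 y2) \<and>
   of_int D = (quad_elem (of_int \<beta>) x1 y1*quad_elem (of_int \<beta>) x2 (- y2)
    - quad_elem (of_int \<beta>) x2 y2*quad_elem (of_int \<beta>) x1 (- y1))\<^sup>2) \<longleftrightarrow> D = disc"
proof -
 have d0: "4 * of_int \<beta>*(1*\<omega>y - \<omega>x*0)\<^sup>2 = (of_int disc :: rat)"
  by (simp add: \<omega>y_def disc_def power_divide)
 show ?thesis
 proof
  assume "\<exists>x1 y1 x2 y2. quad_integral_basis (of_int \<beta>) (quad_elem (of_int \<beta>) x1 y1) (quad_elem (of_int \<beta>) x2 y2) \<and>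
   of_int D = (quad_elem (of_int \<beta>) x1 y1*quad_elem (of_int \<beta>) x2 (- y2)
    - quad_elem (of_int \<beta>) x2 y2*quad_elem (of_int \<beta>) x1 (- y1))\<^sup>2"
  then obtain x1 y1 x2 y2 where b: "quad_integral_basis (of_int \<beta>) (quad_elem (of_int \<beta>) x1 y1) (quad_elem (of_int \<beta>) x2 y2)"
   and D: "of_int D = (of_rat (4 * of_int \<beta>*(x1*y2 - x2*y1)\<^sup>2) :: complex)"
   unfolding disc_expr by blast
  have "of_rat (of_int D) = (of_rat (4 * of_int \<beta>*(x1*y2 - x2*y1)\<^sup>2) :: complex)" using D by simp
  hence D': "of_int D = 4 * of_int \<beta>*(x1*y2 - x2*y1)\<^sup>2" by (simp only: of_rat_eq_iff)
  obtain k where k: "1*\<omega>y - \<omega>x*0 = of_int k*(x1*y2 - x2*y1)"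
   using basis_det[OF b, of 1 0 \<omega>x \<omega>y] std_basis unfolding quad_integral_basis_def by blast
  obtain l where l: "x1*y2 - x2*y1 = of_int l*(1*\<omega>y - \<omega>x*0)"
   using basis_det[OF std_basis, of x1 y1 x2 y2] b unfolding quad_integral_basis_def by blast
  have w0: "1*\<omega>y - \<omega>x*0 ~= 0" by (simp add: \<omega>y_def)
  have "1*\<omega>y - \<omega>x*0 = of_int (k * l)*(1*\<omega>y - \<omega>x*0)" using k l by (simp add: mult.assoc)
  hence "of_int (k * l) = (1::rat)" using w0 by simp
  hence "k * l = 1" by (simp only: of_int_eq_1_iff)
  hence "l\<^sup>2 = 1" by (auto simp: zmult_eq_1_iff)
  hence "(of_int l)\<^sup>2 = (1 :: rat)" by (metis of_int_1 of_int_power)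
  hence "(x1*y2 - x2*y1)\<^sup>2 = (1*\<omega>y - \<omega>x*0)\<^sup>2" unfolding l by (simp add: power_mult_distrib)
  hence "(of_int D :: rat) = of_int disc" using D' d0 by simp
  thus "D = disc" by simp
 next
  assume "D = disc"
  hence "of_int D = (of_rat (4 * of_int \<beta>*(1*\<omega>y - \<omega>x*0)\<^sup>2) :: complex)" unfolding d0 by simp
  thus "\<exists>x1 y1 x2 y2. quad_integral_basis (of_int \<beta>) (quad_elem (of_int \<beta>) x1 y1) (quad_elem (of_int \<beta>) x2 y2) \<and>
   of_int D = (quad_elem (of_int \<beta>) x1 y1*quad_elem (of_int \<beta>) x2 (- y2)
    - quad_elem (of_int \<beta>) x2 y2*quad_elem (of_int \<beta>) x1 (- y1))\<^sup>2"
   using std_basis disc_expr by metis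
 qed
qed

text \<open>The principal root of \<alpha> is m s up to sign. The sign is absorbed in \<mu>, and
  rescaling the second coordinate by \<mu> translates all data from \<alpha> to \<beta>.\<close>

lemma quad_disc_eq:
 assumes m: "m ~= 0" and \<alpha>: "\<alpha> = of_int \<beta> * m\<^sup>2"
 shows "quad_disc \<alpha> = disc"
proof -
 have nsq: "~ (\<exists>r. \<alpha> = r\<^sup>2)"
 proof
  assume "\<exists>r. \<alpha> = r\<^sup>2"
  then obtain r where "\<alpha> = r\<^sup>2" by blast
  hence "of_int \<beta> = (r / m)\<^sup>2" using \<alpha> m by (simp add: power_divide field_simps)
  thus False using nonsquare by blast
 qed
 have "(of_rat m * s)\<^sup>2 = of_rat (m\<^sup>2)*(s * s)" by (simp add: power2_eq_square of_rat_mult)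
 also have "... = of_rat \<alpha>" unfolding ss \<alpha> by (simp add: of_rat_mult mult.commute)
 finally have "(csqrt (of_rat \<alpha>))\<^sup>2 = (of_rat m * s)\<^sup>2" by (simp only: power2_csqrt)
 hence "csqrt (of_rat \<alpha>) = of_rat m * s | csqrt (of_rat \<alpha>) = - (of_rat m * s)" by (simp only: power2_eq_iff)
 then obtain \<mu> where \<mu>: "csqrt (of_rat \<alpha>) = of_rat \<mu> * s" "\<mu> ~= 0" using m by (metis mult_minus_left neg_equal_0_iff_equal of_rat_minus)
 have qe: "quad_elem \<alpha> x y = quad_elem (of_int \<beta>) x (\<mu>*y)" for x y
  unfolding quad_elem_s unfolding quad_elem_def \<mu>(1) by (simp add: of_rat_mult mult_ac)
 have qe': "quad_elem (of_int \<beta>) x y = quad_elem \<alpha> x (y/\<mu>)" for x y unfolding qe using \<mu>(2) by simp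
 have "quad_field \<alpha> = quad_field (of_int \<beta>)"
  unfolding quad_field_def using qe qe' by (auto, metis+)
 hence "quad_integers \<alpha> = quad_integers (of_int \<beta>)" by (simp add: quad_integers_def)
 hence basis: "quad_integral_basis \<alpha> u v \<longleftrightarrow> quad_integral_basis (of_int \<beta>) u v" for u v
  by (simp add: quad_integral_basis_def)
 have "(\<exists>x1 y1 x2 y2. quad_integral_basis \<alpha> (quad_elem \<alpha> x1 y1) (quad_elem \<alpha> x2 y2) \<and>
   of_int D = (quad_elem \<alpha> x1 y1*quad_elem \<alpha> x2 (- y2) - quad_elem \<alpha> x2 y2*quad_elem \<alpha> x1 (- y1))\<^sup>2) \<longleftrightarrow>
  (\<exists>x1 y1 x2 y2. quad_integral_basis (of_int \<beta>) (quad_elem (of_int \<beta>) x1 y1) (quad_elem (of_int \<beta>) x2 y2) \<and>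
   of_int D = (quad_elem (of_int \<beta>) x1 y1*quad_elem (of_int \<beta>) x2 (- y2)
    - quad_elem (of_int \<beta>) x2 y2*quad_elem (of_int \<beta>) x1 (- y1))\<^sup>2)" (is "?A \<longleftrightarrow> ?B") for D
 proof
  assume ?A
  then obtain x1 y1 x2 y2 where "quad_integral_basis \<alpha> (quad_elem \<alpha> x1 y1) (quad_elem \<alpha> x2 y2)"
   "of_int D = (quad_elem \<alpha> x1 y1*quad_elem \<alpha> x2 (- y2) - quad_elem \<alpha> x2 y2*quad_elem \<alpha> x1 (- y1))\<^sup>2" by blast
  thus ?B unfolding basis unfolding qe mult_minus_right by blast
 next
  assume ?B
  then obtain x1 y1 x2 y2 where "quad_integral_basis (of_int \<beta>) (quad_elem (of_int \<beta>) x1 y1) (quad_elem (of_int \<beta>) x2 y2)"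
   "of_int D = (quad_elem (of_int \<beta>) x1 y1*quad_elem (of_int \<beta>) x2 (- y2)
    - quad_elem (of_int \<beta>) x2 y2*quad_elem (of_int \<beta>) x1 (- y1))\<^sup>2" by blast
  thus ?A unfolding basis unfolding qe' minus_divide_left[symmetric] by blast
 qed
 hence "quad_disc \<alpha> = (THE D. D = disc)" using nsq unfolding quad_disc_def disc_unique by simp
 thus ?thesis by simp
qed

end

section \<open>Ideals of imaginary quadratic orders\<close>

lemma squarefree_int_of_nat:
 assumes "squarefree d"
 shows "squarefree (int d)"
proof (rule squarefreeI)
 fix x :: int assume "x\<^sup>2 dvd int d"
 hence "int ((nat \<bar>x\<bar>)\<^sup>2) dvd int d" by simp
 hence "(nat \<bar>x\<bar>)\<^sup>2 dvd d" by (simp only: of_nat_dvd_iff)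
 hence "nat \<bar>x\<bar> dvd 1" using squarefreeD[OF assms] by blast
 thus "x dvd 1" by simp
qed

locale Kd =
 fixes d :: nat
 assumes d_pos: "d > 0" and sqfree_d: "squarefree d"
begin

sublocale quad "- int d"
proof
 show "squarefree (- int d)" using squarefree_int_of_nat[OF sqfree_d] by simp
 show "- int d ~= 1" by simp
qed

abbreviation Od :: "complex set" where "Od \<equiv> carrier (OK d)"

lemma OK_simps [simp]:
 "monoid.mult (OK d) = (*)" "one (OK d) = 1" "ring.zero (OK d) = 0" "ring.add (OK d) = (+)"
 by (simp_all add: OK_def)

lemma s_eq: "s = sqrt_neg d"
proof -
 have "s = csqrt (of_real (- real d))" by (simp add: s_def)
 also have "... = \<i> * of_real (sqrt (real d))" by (subst csqrt_of_real_nonpos) simp_all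
 finally show ?thesis by (simp add: sqrt_neg_def)
qed

lemma Re_s [simp]: "Re s = 0" and Im_s: "Im s = sqrt (real d)" and cnj_s [simp]: "cnj s = - s"
 by (simp_all add: s_eq sqrt_neg_def)

lemma ssd: "s * s = - of_nat d" using ss by simp

text \<open>The coordinates of 2 z with respect to 1 and \<open>s\<close>. On ring elements the real
  quotients are integers, so the floor is exact, and \<open>ca\<close> is the trace.\<close>

definition ca :: "complex \<Rightarrow> int" where "ca z = \<lfloor>2 * Re z\<rfloor>"
definition cb :: "complex \<Rightarrow> int" where "cb z = \<lfloor>2*Im z / sqrt (real d)\<rfloor>"

lemma coordsI:
 assumes "2*z = of_int a + of_int b * s"
 shows "ca z = a" "cb z = b"
proof -
 have "2 * Re z = of_int a" using arg_cong[OF assms, of Re] by simp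
 thus "ca z = a" by (simp add: ca_def)
 have "2*Im z = of_int b * sqrt (real d)" using arg_cong[OF assms, of Im] by (simp add: Im_s)
 hence "2*Im z / sqrt (real d) = of_int b" using d_pos by simp
 thus "cb z = b" by (simp add: cb_def)
qed

lemma OO_iff: "z \<in> Od \<longleftrightarrow> 2*z = of_int (ca z) + of_int (cb z) * s & 4 dvd (ca z)\<^sup>2+int d*(cb z)\<^sup>2"
proof -
 have "z \<in> Od \<longleftrightarrow> z \<in> quad_integers (of_int (- int d))" by (simp add: OK_def)
 also have "... \<longleftrightarrow> (\<exists>a b::int. 2*z = of_int a + of_int b * s & 4 dvd a\<^sup>2+int d*b\<^sup>2)"
  unfolding mem_quad_integers_iff by simp
 also have "... \<longleftrightarrow> 2*z = of_int (ca z) + of_int (cb z) * s & 4 dvd (ca z)\<^sup>2+int d*(cb z)\<^sup>2"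
  using coordsI by blast
 finally show ?thesis .
qed

lemma OO_I:
 assumes "2*z = of_int a + of_int b * s" "4 dvd a\<^sup>2+int d*b\<^sup>2"
 shows "z \<in> Od"
 using coordsI[OF assms(1)] assms unfolding OO_iff by simp

lemma OO_coords: "z \<in> Od ==> 2*z = of_int (ca z) + of_int (cb z) * s"
 unfolding OO_iff by blast

definition \<omega> :: complex where "\<omega> = of_rat \<omega>x + of_rat \<omega>y * s"

lemma \<omega>2: "2*\<omega> = (if (- int d) mod 4 = 1 then 1 + s else 2 * s)"
 by (simp add: \<omega>_def \<omega>x_def \<omega>y_def of_rat_divide)

lemma OO_basis: "z \<in> Od \<longleftrightarrow> (\<exists>e f::int. z = of_int e + of_int f*\<omega>)"
proof
 assume "z \<in> Od"
 hence "z \<in> quad_integers (of_int (- int d))" by (simp add: OK_def)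
 hence "\<exists>c :: int \<times> int. z = of_int (fst c)*quad_elem (of_int (- int d)) 1 0 + of_int (snd c)*quad_elem (of_int (- int d)) \<omega>x \<omega>y"
  using std_basis unfolding quad_integral_basis_def by blast
 thus "\<exists>e f::int. z = of_int e + of_int f*\<omega>" unfolding quad_elem_s \<omega>_def by auto
next
 assume "\<exists>e f::int. z = of_int e + of_int f*\<omega>"
 then obtain e f :: int where z: "z = of_int e + of_int f*\<omega>" by blast
 have z2: "2*z = 2 * of_int e + of_int f*(2*\<omega>)" unfolding z by (simp add: algebra_simps)
 show "z \<in> Od"
 proof (cases "(- int d) mod 4 = 1")
  case True
  hence "4 dvd 1+int d" by presburger
  then obtain q where q: "1+int d = 4*q" by blast
  have "(2*e + f)\<^sup>2+int d * f\<^sup>2 = 4*(e\<^sup>2+e * f)+(1+int d) * f\<^sup>2" by (simp add: power2_eq_square algebra_simps)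
  hence "(2*e + f)\<^sup>2+int d * f\<^sup>2 = 4*(e\<^sup>2+e * f+q * f\<^sup>2)" unfolding q by simp
  hence "4 dvd (2*e + f)\<^sup>2+int d * f\<^sup>2" by simp
  moreover have "2*z = of_int (2*e + f) + of_int f * s" unfolding z2 \<omega>2 using True by (simp add: algebra_simps)
  ultimately show ?thesis by (rule OO_I[rotated])
 next
  case False
  have "2*z = of_int (2*e) + of_int (2 * f) * s" unfolding z2 \<omega>2 using False by (simp add: algebra_simps)
  moreover have "4 dvd (2*e)\<^sup>2+int d*(2 * f)\<^sup>2" by (simp add: power_mult_distrib)
  ultimately show ?thesis by (rule OO_I)
 qed
qed

lemma OO_int [simp]: "of_int n \<in> Od"
 unfolding OO_basis by (rule exI[of _ n], rule exI[of _ 0]) simp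

lemma OO_nat [simp]: "of_nat n \<in> Od" using OO_int[of "int n"] by simp
lemma OO_0 [simp]: "0 \<in> Od" using OO_int[of 0] by simp
lemma OO_1 [simp]: "1 \<in> Od" using OO_int[of 1] by simp

lemma OO_s [simp]: "s \<in> Od"
 by (rule OO_I[of _ 0 2]) simp_all

lemma OO_add [simp]: "z \<in> Od ==> w \<in> Od ==> z+w \<in> Od"
proof -
 assume "z \<in> Od" "w \<in> Od"
 then obtain e f e' f' where "z = of_int e + of_int f*\<omega>" "w = of_int e' + of_int f'*\<omega>" unfolding OO_basis by blast
 hence "z+w = of_int (e+e') + of_int (f + f')*\<omega>" by (simp add: algebra_simps)
 thus ?thesis unfolding OO_basis by blast
qed

lemma \<omega>_square: "\<omega>*\<omega> \<in> Od"
proof (cases "(- int d) mod 4 = 1")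
 case True
 hence "4 dvd 1+int d" by presburger
 then obtain q where q: "1+int d = 4*q" by blast
 have "4*(\<omega>*\<omega>) = (2*\<omega>)*(2*\<omega>)" by simp
 also have "... = 1+2 * s + s * s" unfolding \<omega>2 using True by (simp add: algebra_simps)
 also have "... = 2*(1 + s) - of_int (1+int d)" unfolding ssd by simp
 also have "... = 2*(2*\<omega>) - of_int (4*q)" unfolding q \<omega>2 using True by simp
 also have "... = 4*(of_int (- q) + of_int 1*\<omega>)" by (simp add: algebra_simps)
 finally have "\<omega>*\<omega> = of_int (- q) + of_int 1*\<omega>" by (simp only: mult_cancel_left) simp
 thus ?thesis unfolding OO_basis by blast
next
 case False
 hence "\<omega> = s" using \<omega>2 by simp
 hence "\<omega>*\<omega> = of_int (- int d)" using ss by simp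
 thus ?thesis by (simp only: OO_int)
qed

lemma OO_int_mult: "z \<in> Od ==> of_int n*z \<in> Od"
proof -
 assume "z \<in> Od"
 then obtain e f where "z = of_int e + of_int f*\<omega>" unfolding OO_basis by blast
 hence "of_int n*z = of_int (n*e) + of_int (n * f)*\<omega>" by (simp add: algebra_simps)
 thus ?thesis unfolding OO_basis by blast
qed

lemma OO_\<omega>: "\<omega> \<in> Od"
 unfolding OO_basis by (rule exI[of _ 0], rule exI[of _ 1]) simp

lemma OO_mult [simp]: "z \<in> Od ==> w \<in> Od ==> z*w \<in> Od"
proof -
 assume "z \<in> Od" "w \<in> Od"
 then obtain e f e' f' where "z = of_int e + of_int f*\<omega>" "w = of_int e' + of_int f'*\<omega>" unfolding OO_basis by blast
 hence "z*w = of_int (e*e') + of_int (e * f' + f*e')*\<omega> + of_int (f * f')*(\<omega>*\<omega>)" by (simp add: algebra_simps)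
 thus ?thesis by (simp only:) (intro OO_add OO_int OO_int_mult OO_\<omega> \<omega>_square)
qed

lemma OO_uminus [simp]: "z \<in> Od ==> - z \<in> Od" using OO_int_mult[of z "-1"] by simp
lemma OO_diff [simp]: "z \<in> Od ==> w \<in> Od ==> z - w \<in> Od" using OO_add[of z "- w"] by simp
lemma OO_power [simp]: "z \<in> Od ==> z^n \<in> Od" by (induction n) simp_all
lemma OO_sum: "(\<And>i. i \<in> A ==> f i \<in> Od) ==> sum f A \<in> Od"
 by (induction A rule: infinite_finite_induct) simp_all

lemma OO_cnj [simp]: "z \<in> Od ==> cnj z \<in> Od"
proof (rule OO_I[of _ "ca z" "- cb z"])
 assume z: "z \<in> Od"
 show "2 * cnj z = of_int (ca z) + of_int (- cb z) * s" using arg_cong[OF OO_coords[OF z], of cnj] by simp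
 show "4 dvd (ca z)\<^sup>2+int d*(- cb z)\<^sup>2" using z OO_iff by simp
qed

lemma coords_cnj: "z \<in> Od ==> ca (cnj z) = ca z & cb (cnj z) = - cb z"
 using coordsI[of "cnj z" "ca z" "- cb z"] arg_cong[OF OO_coords, of z cnj] by simp

lemma coords_add: "z \<in> Od ==> w \<in> Od ==> ca (z+w) = ca z + ca w & cb (z+w) = cb z + cb w"
 using coordsI[of "z+w" "ca z + ca w" "cb z + cb w"] OO_coords[of z] OO_coords[of w] by (simp add: algebra_simps)

lemma coords_int: "ca (of_int n) = 2*n" "cb (of_int n) = 0"
 using coordsI[of "of_int n" "2*n" 0] by simp_all

lemma coords_mult:
 assumes "z \<in> Od" "w \<in> Od"
 shows "2 * ca (z*w) = ca z * ca w - int d*(cb z * cb w)" "2 * cb (z*w) = ca z * cb w + cb z * ca w"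
proof -
 have "of_int (2 * ca (z*w)) + of_int (2 * cb (z*w)) * s = 2*(2*(z*w))"
  unfolding OO_coords[OF OO_mult[OF assms]] by (simp add: algebra_simps)
 also have "... = (2*z)*(2*w)" by simp
 also have "... = of_int (ca z) * of_int (ca w) + of_int (cb z) * of_int (cb w)*(s * s)
   + (of_int (ca z) * of_int (cb w) + of_int (cb z) * of_int (ca w)) * s"
  unfolding OO_coords[OF assms(1)] OO_coords[OF assms(2)] by (simp add: algebra_simps)
 also have "... = of_int (ca z * ca w - int d*(cb z * cb w)) + of_int (ca z * cb w + cb z * ca w) * s"
  unfolding ssd by (simp add: algebra_simps)
 finally have "2 * ca (z*w) = ca z * ca w - int d*(cb z * cb w) & 2 * cb (z*w) = ca z * cb w + cb z * ca w"
  by (rule uniq_int)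
 thus "2 * ca (z*w) = ca z * ca w - int d*(cb z * cb w)" "2 * cb (z*w) = ca z * cb w + cb z * ca w" by simp_all
qed

lemma trace: "z \<in> Od ==> z + cnj z = of_int (ca z)"
proof -
 assume z: "z \<in> Od"
 have "2*(z + cnj z) = (of_int (ca z) + of_int (cb z) * s) + cnj (of_int (ca z) + of_int (cb z) * s)"
  unfolding OO_coords[OF z, symmetric] by simp
 also have "... = 2 * of_int (ca z)" by simp
 finally show ?thesis by (simp only: mult_cancel_left) simp
qed

definition nm :: "complex \<Rightarrow> int" where "nm z = ((ca z)\<^sup>2+int d*(cb z)\<^sup>2) div 4"

lemma nm4: "z \<in> Od ==> 4*nm z = (ca z)\<^sup>2+int d*(cb z)\<^sup>2"
 unfolding nm_def OO_iff by simp

lemma nm_eq: "z \<in> Od ==> z * cnj z = of_int (nm z)"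
proof -
 assume z: "z \<in> Od"
 have "4*(z * cnj z) = (2*z) * cnj (2*z)" by simp
 also have "... = of_int (ca z) * of_int (ca z) - of_int (cb z) * of_int (cb z)*(s * s)"
  unfolding OO_coords[OF z] by (simp add: algebra_simps)
 also have "... = of_int ((ca z)\<^sup>2+int d*(cb z)\<^sup>2)" unfolding ssd by (simp add: power2_eq_square algebra_simps)
 also have "... = 4 * of_int (nm z)" unfolding nm4[OF z, symmetric] by simp
 finally show ?thesis by simp
qed

lemma nm_mult: "z \<in> Od ==> w \<in> Od ==> nm (z*w) = nm z*nm w"
proof -
 assume zw: "z \<in> Od" "w \<in> Od"
 have "(of_int (nm (z*w)) :: complex) = (z * cnj z)*(w * cnj w)" unfolding nm_eq[OF OO_mult[OF zw], symmetric] by simp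
 also have "... = of_int (nm z*nm w)" by (simp add: nm_eq zw)
 finally show ?thesis by (simp only: of_int_eq_iff)
qed

lemma nm_power: "z \<in> Od ==> nm (z^n) = nm z^n"
 by (induction n) (simp_all add: nm_mult, simp add: nm_def coords_int[of 1, simplified])

lemma nm_int: "nm (of_int n) = n\<^sup>2"
 by (simp add: nm_def coords_int power_mult_distrib)

lemma nm_nonneg: "nm z \<ge> 0"
proof -
 have "0 <= (ca z)\<^sup>2+int d*(cb z)\<^sup>2" by simp
 thus ?thesis unfolding nm_def by (metis pos_imp_zdiv_nonneg_iff zero_less_numeral)
qed

lemma cring_OK: "cring (OK d)"
proof (rule cringI)
 show "abelian_group (OK d)"
 proof (rule abelian_groupI)
  fix x assume "x \<in> Od"
  thus "\<exists>y\<in>Od. y \<oplus>\<^bsub>OK d\<^esub> x = \<zero>\<^bsub>OK d\<^esub>" by (intro bexI[of _ "- x"]) simp_all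
 qed simp_all
 show "comm_monoid (OK d)" by (rule comm_monoidI) simp_all
qed (simp add: algebra_simps)

sublocale R: cring "OK d" by (rule cring_OK)

lemma a_inv_OK: "x \<in> Od ==> a_inv (OK d) x = - x"
 by (rule R.minus_equality) simp_all

lemma ideal_plain:
 assumes I: "ideal I (OK d)"
 shows "I \<subseteq> Od" "0 \<in> I" "x \<in> I ==> y \<in> I ==> x+y \<in> I" "x \<in> I ==> - x \<in> I"
  "x \<in> I ==> y \<in> I ==> x - y \<in> I" "x \<in> I ==> r \<in> Od ==> r*x \<in> I"
proof -
 interpret ideal I "OK d" by fact
 show sub: "I \<subseteq> Od" by (rule a_subset)
 show "0 \<in> I" using zero_closed by simp
 show add: "x+y \<in> I" if "x \<in> I" "y \<in> I" for x y using a_closed[OF that] by simp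
 show um: "- x \<in> I" if "x \<in> I" for x using a_inv_closed[OF that] a_inv_OK sub that by auto
 show "x - y \<in> I" if "x \<in> I" "y \<in> I" using add[OF that(1) um[OF that(2)]] by simp
 show "r*x \<in> I" if "x \<in> I" "r \<in> Od" using I_l_closed[OF that] by simp
qed

lemma OK_idealI:
 assumes "I \<subseteq> Od" "0 \<in> I" "\<And>x y. x \<in> I ==> y \<in> I ==> x+y \<in> I" "\<And>r x. x \<in> I ==> r \<in> Od ==> r*x \<in> I"
 shows "ideal I (OK d)"
proof (rule idealI)
 show "ring (OK d)" by (rule R.ring_axioms)
 show "subgroup I (add_monoid (OK d))"
 proof (rule subgroup.intro)
  fix x assume x: "x \<in> I"
  have "inv\<^bsub>add_monoid (OK d)\<^esub> x = a_inv (OK d) x" by (simp add: a_inv_def)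
  also have "... = - x" using x assms(1) by (intro a_inv_OK) auto
  also have "... \<in> I" using assms(4)[OF x, of "-1"] by simp
  finally show "inv\<^bsub>add_monoid (OK d)\<^esub> x \<in> I" .
 qed (use assms in auto)
qed (use assms in \<open>auto simp: mult.commute\<close>)

lemma cgen_eq: "cgenideal (OK d) a = {x*a | x. x \<in> Od}"
 by (simp add: cgenideal_def)

definition coset :: "complex set \<Rightarrow> complex \<Rightarrow> complex set" where "coset I x = (%h. h+x) ` I"

lemma a_r_coset_OK: "I +>\<^bsub>OK d\<^esub> x = coset I x"
 unfolding a_r_coset_def' coset_def by auto

lemma ideal_norm_coset: "ideal_norm d I = card (coset I ` Od)"
proof -
 have "carrier (OK d Quot I) = a_rcosets\<^bsub>OK d\<^esub> I" by (simp add: FactRing_def)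
 also have "... = coset I ` Od" unfolding A_RCOSETS_def' a_r_coset_OK by auto
 finally show ?thesis by (simp add: ideal_norm_def)
qed

lemma coset_eq_iff:
 assumes "ideal I (OK d)"
 shows "coset I x = coset I y \<longleftrightarrow> x - y \<in> I"
proof
 assume "coset I x = coset I y"
 moreover have "x \<in> coset I x" using ideal_plain(2)[OF assms] unfolding coset_def by force
 ultimately have "x \<in> coset I y" by simp
 thus "x - y \<in> I" unfolding coset_def by auto
next
 assume xy: "x - y \<in> I"
 have "coset I u \<subseteq> coset I v" if "u - v \<in> I" for u v
 proof
  fix z assume "z \<in> coset I u"
  then obtain h where "h \<in> I" "z = h+u" by (auto simp: coset_def)
  hence "z = (h+(u - v)) + v" "h+(u - v) \<in> I" using ideal_plain(3)[OF assms] that by auto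
  thus "z \<in> coset I v" unfolding coset_def by blast
 qed
 moreover have "y - x \<in> I" using ideal_plain(4)[OF assms xy] by simp
 ultimately show "coset I x = coset I y" using xy by blast
qed

lemma int_rep_mod:
 assumes I: "ideal I (OK d)" and p: "p > 0" "of_nat p \<in> I" and rep: "z - of_int n \<in> I"
 shows "z - of_int (n mod int p) \<in> I"
proof -
 have "z - of_int (n mod int p) = (z - of_int n) + of_int (n div int p) * of_nat p"
 proof -
  have "of_int n = (of_int (int p*(n div int p)+n mod int p) :: complex)" by (simp only: mult_div_mod_eq)
  thus ?thesis unfolding of_int_add of_int_mult of_int_of_nat_eq by (simp add: algebra_simps)
 qed
 thus ?thesis using ideal_plain(3)[OF I rep ideal_plain(6)[OF I p(2) OO_int]] by (simp only:)
qed

text \<open>The integers induce a bijection from Z/p to the quotient: \<open>int\<close> gives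
  injectivity and \<open>rep\<close> surjectivity.\<close>

lemma ideal_norm_eqI:
 assumes I: "ideal I (OK d)" and p: "p > 0" and int: "\<And>n::int. of_int n \<in> I \<longleftrightarrow> int p dvd n"
  and rep: "\<And>z. z \<in> Od ==> \<exists>n::int. z - of_int n \<in> I"
 shows "ideal_norm d I = p"
proof -
 have pI: "of_nat p \<in> I" using int[of "int p"] by simp
 have "coset I ` Od = (%n. coset I (of_int n)) ` {0..<int p}"
 proof (intro equalityI subsetI)
  fix C assume "C \<in> coset I ` Od"
  then obtain z where z: "z \<in> Od" "C = coset I z" by blast
  obtain n where "z - of_int n \<in> I" using rep z by blast
  hence "z - of_int (n mod int p) \<in> I" using int_rep_mod[OF I p pI] by blast
  hence "C = coset I (of_int (n mod int p))" using z coset_eq_iff[OF I] by simp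
  moreover have m: "n mod int p \<in> {0..<int p}" unfolding atLeastLessThan_iff
   by (intro conjI pos_mod_sign pos_mod_bound) (use p in simp_all)
  ultimately show "C \<in> (%n. coset I (of_int n)) ` {0..<int p}" by (rule image_eqI)
 qed auto
 moreover have "inj_on (%n. coset I (of_int n)) {0..<int p}"
 proof (rule inj_onI)
  fix m n assume mn: "m \<in> {0..<int p}" "n \<in> {0..<int p}" "coset I (of_int m) = coset I (of_int n)"
  hence "of_int (m - n) \<in> I" using coset_eq_iff[OF I] by simp
  hence "m mod int p = n mod int p" using int mod_eq_dvd_iff by blast
  thus "m = n" using mn by simp
 qed
 ultimately show ?thesis unfolding ideal_norm_coset by (simp add: card_image)
qed

text \<open>Lagrange's theorem: the order of the additive quotient group annihilates the class of
  1.\<close>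

lemma norm_in_ideal:
 assumes I: "ideal I (OK d)" and n: "ideal_norm d I = n"
 shows "of_nat n \<in> I"
proof -
 interpret I: ideal I "OK d" by fact
 interpret Q: ring "OK d Quot I" by (rule I.quotient_is_ring)
 define G where "G = add_monoid (OK d Quot I)"
 have grp: "group G" unfolding G_def by (rule Q.a_group)
 interpret G: group G by (rule grp)
 have one: "coset I 1 \<in> carrier G" unfolding G_def by (auto simp: FactRing_def A_RCOSETS_def' a_r_coset_OK)
 have zero: "\<one>\<^bsub>G\<^esub> = coset I 0" unfolding G_def by (simp add: FactRing_def coset_def)
 have pw: "coset I 1 [^]\<^bsub>G\<^esub> k = coset I (of_nat k)" for k :: nat
 proof (induction k)
  case (Suc k)
  have "coset I 1 [^]\<^bsub>G\<^esub> Suc k = coset I (of_nat k) <+>\<^bsub>OK d\<^esub> coset I 1"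
   by (simp add: Suc) (simp add: G_def FactRing_def)
  also have "... = coset I (of_nat k+1)"
   using I.a_rcos_sum[of "of_nat k" 1] unfolding a_r_coset_OK by simp
  finally show ?case by (simp add: add.commute)
 qed (simp add: zero)
 have "coset I 1 [^]\<^bsub>G\<^esub> order G = \<one>\<^bsub>G\<^esub>" by (rule G.pow_order_eq_1[OF one])
 moreover have "order G = n" using n unfolding order_def G_def ideal_norm_def by simp
 ultimately have "coset I (of_nat n) = coset I 0" unfolding pw zero by simp
 thus ?thesis using coset_eq_iff[OF I] by simp
qed

text \<open>The integers in the ideal are the multiples of p, so the classes of 0, ..., p - 1 are
  distinct and by counting exhaust the quotient.\<close>

lemma prime_norm_ideal:
 assumes I: "ideal I (OK d)" and p: "prime p" and n: "ideal_norm d I = p"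
 shows "of_int n \<in> I \<longleftrightarrow> int p dvd n" "z \<in> Od ==> \<exists>n::int. z - of_int n \<in> I"
proof -
 have p0: "p > 1" using p by (rule prime_gt_1_nat)
 have pI: "of_nat p \<in> I" by (rule norm_in_ideal[OF I n])
 have one: "1 \<notin> I"
 proof
  assume "1 \<in> I"
  hence "z \<in> I" if "z \<in> Od" for z using ideal_plain(6)[OF I _ that, of 1] by simp
  hence "coset I z = coset I 0" if "z \<in> Od" for z using coset_eq_iff[OF I] that by simp
  hence "coset I ` Od = {coset I 0}" using OO_0 by blast
  thus False using n p0 unfolding ideal_norm_coset by simp
 qed
 have iff: "of_int n \<in> I \<longleftrightarrow> int p dvd n" for n
 proof
  assume "int p dvd n"
  then obtain k where "n = k*int p" by (metis dvdE mult.commute)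
  thus "of_int n \<in> I" using ideal_plain(6)[OF I pI OO_int[of k]] by simp
 next
  assume nI: "of_int n \<in> I"
  show "int p dvd n"
  proof (rule ccontr)
   assume "~ int p dvd n"
   hence "coprime (int p) n" using p by (intro prime_imp_coprime) auto
   then obtain u v where "u*int p + v * n = 1" using bezout_int[of "int p" n] by auto
   hence "of_int (u*int p + v * n) = (1 :: complex)" by (simp only: of_int_1)
   hence "1 = of_int u * of_nat p + of_int v * (of_int n :: complex)" by simp
   moreover have "of_int u * of_nat p + of_int v * (of_int n :: complex) \<in> I"
    using ideal_plain(3,6)[OF I] pI nI OO_int by blast
   ultimately show False using one by simp
  qed
 qed
 show "of_int n \<in> I \<longleftrightarrow> int p dvd n" by (rule iff)
 have inj: "inj_on (%n. coset I (of_int n)) {0..<int p}"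
 proof (rule inj_onI)
  fix m n assume mn: "m \<in> {0..<int p}" "n \<in> {0..<int p}" "coset I (of_int m) = coset I (of_int n)"
  hence "of_int (m - n) \<in> I" using coset_eq_iff[OF I] by simp
  hence "m mod int p = n mod int p" using iff mod_eq_dvd_iff by blast
  thus "m = n" using mn by simp
 qed
 have c: "card (coset I ` Od) = p" using n unfolding ideal_norm_coset .
 hence fin: "finite (coset I ` Od)" using p0 card_ge_0_finite[of "coset I ` Od"] by simp
 have "(%n. coset I (of_int n)) ` {0..<int p} = coset I ` Od"
 proof (rule card_subset_eq[OF fin])
  show "(%n. coset I (of_int n)) ` {0..<int p} \<subseteq> coset I ` Od" by auto
  show "card ((%n. coset I (of_int n)) ` {0..<int p}) = card (coset I ` Od)" unfolding c card_image[OF inj] by simp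
 qed
 hence "coset I z \<in> (%n. coset I (of_int n)) ` {0..<int p}" if "z \<in> Od" using that by simp
 thus "z \<in> Od ==> \<exists>n::int. z - of_int n \<in> I" using coset_eq_iff[OF I] by blast
qed

lemma ideal_prime_to_int:
 assumes I: "ideal I (OK d)" and p: "of_nat p \<in> I" and cop: "coprime (int p) n"
 shows "ideal_prime_to d I n"
proof -
 obtain u v where "u*int p + v * n = 1" using bezout_int[of "int p" n] cop by auto
 hence "of_int (u*int p + v * n) = (1 :: complex)" by (simp only: of_int_1)
 hence uv: "of_int u * of_nat p + of_int v * (of_int n :: complex) = 1" by simp
 have "I <+>\<^bsub>OK d\<^esub> cgenideal (OK d) (of_int n) = Od"
 proof (intro equalityI subsetI)
  fix z assume "z \<in> I <+>\<^bsub>OK d\<^esub> cgenideal (OK d) (of_int n)"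
  thus "z \<in> Od" using ideal_plain(1)[OF I] unfolding set_add_def' cgen_eq by auto
 next
  fix z assume z: "z \<in> Od"
  have "z = (z * of_int u) * of_nat p+(z * of_int v) * of_int n"
   using arg_cong[OF uv, of "%t. z*t"] by (simp add: algebra_simps)
  moreover have "(z * of_int u) * of_nat p \<in> I" using ideal_plain(6)[OF I p, of "z * of_int u"] z by simp
  moreover have "(z * of_int v) * of_int n \<in> cgenideal (OK d) (of_int n)" using z unfolding cgen_eq by (intro CollectI exI[of _ "z * of_int v"]) simp
  ultimately show "z \<in> I <+>\<^bsub>OK d\<^esub> cgenideal (OK d) (of_int n)" unfolding set_add_def' by auto
 qed
 thus ?thesis by (simp add: ideal_prime_to_def ideals_coprime_def)
qed

end

section \<open>Primes of K above a split rational prime\<close>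

locale split_prime = Kd +
 fixes p :: nat and c :: int
 assumes p: "prime p" "p > 2" "~ p dvd d" and c: "int p dvd c\<^sup>2+int d"
begin

text \<open>An inverse of 2 modulo p, needed because \<open>ca\<close> and \<open>cb\<close> are the
  coordinates of 2 z.\<close>

definition hh :: int where "hh = (int p+1) div 2"

lemma hh: "2*hh = int p+1"
proof -
 have "odd (int p)" using prime_odd_nat[OF p(1)] p(2) by simp
 thus ?thesis unfolding hh_def by presburger
qed

lemma pint: "prime (int p)" using p by simp

text \<open>Reduction modulo a prime above p, sending \<open>s\<close> to the chosen square root
  \<open>c\<close> of -d. It respects products only modulo p; \<open>Q\<close> is the kernel, and
  the root -c gives the conjugate prime.\<close>

definition H :: "complex \<Rightarrow> int" where "H z = hh*(ca z + cb z * c)"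

definition Q :: "complex set" where "Q = {z \<in> Od. int p dvd H z}"

lemma two_dvd: "int p dvd 2*n \<longleftrightarrow> int p dvd n"
 using p by (auto simp: prime_dvd_mult_iff[OF pint] dest!: zdvd_imp_le)

lemma hh_dvd: "int p dvd hh*n \<longleftrightarrow> int p dvd n"
proof -
 have "int p dvd hh*n \<longleftrightarrow> int p dvd 2*(hh*n)" by (simp add: two_dvd)
 also have "2*(hh*n) = int p*n+n" unfolding mult.assoc[symmetric] hh by (simp add: algebra_simps)
 also have "int p dvd int p*n+n \<longleftrightarrow> int p dvd n" by (rule dvd_add_right_iff) simp
 finally show ?thesis .
qed

lemma Q_iff: "z \<in> Q \<longleftrightarrow> z \<in> Od & int p dvd ca z + cb z * c"
 by (simp add: Q_def H_def hh_dvd)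

lemma c_nz: "~ int p dvd c"
proof
 assume "int p dvd c"
 hence "int p dvd c\<^sup>2" by (simp add: power2_eq_square)
 hence "int p dvd int d" using c dvd_add_right_iff by blast
 thus False using p(3) by simp
qed

lemma split_neg: "split_prime d p (- c)"
 using p c by unfold_locales simp_all

lemma H_add: "z \<in> Od ==> w \<in> Od ==> H (z+w) = H z+H w"
 by (simp add: H_def coords_add algebra_simps)

lemma H_int: "[H (of_int n) = n] (mod int p)"
proof -
 have "H (of_int n) = (2*hh)*n" by (simp add: H_def coords_int)
 hence "H (of_int n) - n = int p*n" unfolding hh by (simp add: algebra_simps)
 thus ?thesis by (simp add: cong_iff_dvd_diff)
qed

lemma H_mult:
 assumes "z \<in> Od" "w \<in> Od"
 shows "[H (z*w) = H z*H w] (mod int p)"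
proof -
 have "2*(ca (z*w) + cb (z*w) * c) = 2 * ca (z*w)+(2 * cb (z*w)) * c" by (simp add: algebra_simps)
 also have "... = (ca z + cb z * c)*(ca w + cb w * c) - (c\<^sup>2+int d)*(cb z * cb w)"
  unfolding coords_mult[OF assms] by (simp add: power2_eq_square algebra_simps)
 finally have e: "2*(ca (z*w) + cb (z*w) * c) = (ca z + cb z * c)*(ca w + cb w * c) - (c\<^sup>2+int d)*(cb z * cb w)" .
 have "2*(H z*H w - H (z*w)) = hh*((2*hh)*((ca z + cb z * c)*(ca w + cb w * c)) - 2*(ca (z*w) + cb (z*w) * c))"
  unfolding H_def by (simp add: algebra_simps)
 also have "... = hh*(int p*((ca z + cb z * c)*(ca w + cb w * c))+(c\<^sup>2+int d)*(cb z * cb w))"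
  unfolding e hh by (simp add: algebra_simps)
 finally have "int p dvd 2*(H z*H w - H (z*w))" using c by (simp add: dvd_add dvd_mult)
 hence "int p dvd H z*H w - H (z*w)" by (simp only: two_dvd)
 thus ?thesis by (simp only: cong_iff_dvd_diff dvd_diff_commute[of _ "H (z*w)"])
qed

lemma H_power: "z \<in> Od ==> [H (z^n) = H z^n] (mod int p)"
proof (induction n)
 case 0
 show ?case using H_int[of 1] by simp
next
 case (Suc n)
 have "[H (z*z^n) = H z*H (z^n)] (mod int p)" using Suc.prems by (intro H_mult) simp_all
 also have "[H z*H (z^n) = H z*H z^n] (mod int p)" by (rule cong_mult[OF cong_refl Suc.IH[OF Suc.prems]])
 finally show ?case by simp
qed

lemma H_0: "H 0 = 0" using coords_int[of 0] by (simp add: H_def)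

lemma H_uminus: "z \<in> Od ==> H (- z) = - H z"
 using H_add[of z "- z"] H_0 by simp

lemma H_diff: "z \<in> Od ==> w \<in> Od ==> H (z - w) = H z - H w"
 using H_add[of z "- w"] H_uminus[of w] by simp

lemma H_cnj: "z \<in> Od ==> H (cnj z) = split_prime.H d p (- c) z"
proof -
 interpret cj: split_prime d p "- c" by (rule split_neg)
 show "z \<in> Od ==> H (cnj z) = cj.H z" using coords_cnj[of z] by (simp add: H_def cj.H_def)
qed

lemma Q_ideal: "ideal Q (OK d)"
proof (rule OK_idealI)
 show "r*x \<in> Q" if "x \<in> Q" "r \<in> Od" for r x
 proof -
  have "[H (r*x) = H r*H x] (mod int p)" using that by (intro H_mult) (auto simp: Q_def)
  moreover have "int p dvd H r*H x" using that by (simp add: Q_def)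
  ultimately show ?thesis using that by (simp add: Q_def cong_dvd_iff)
 qed
qed (auto simp: Q_def H_add H_0)

lemma Q_prime:
 assumes "x \<in> Od" "y \<in> Od" "x*y \<in> Q"
 shows "x \<in> Q | y \<in> Q"
proof -
 have "int p dvd H x*H y" using H_mult[OF assms(1,2)] assms(3) cong_dvd_iff by (auto simp: Q_def)
 thus ?thesis using assms prime_dvd_mult_iff[OF pint] by (auto simp: Q_def)
qed

lemma Q_int: "of_int n \<in> Q \<longleftrightarrow> int p dvd n"
 using cong_dvd_iff[OF H_int[of n]] by (simp add: Q_def)

lemma Q_p: "of_nat p \<in> Q" using Q_int[of "int p"] by simp

lemma Q_nz: "Q \<in> nz_ideals d" "Q \<in> nz_primes d"
proof -
 have "Q ~= {0}" using Q_p p(2) by (metis not_less0 of_nat_eq_0_iff singletonD)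
 moreover have "primeideal Q (OK d)"
 proof (rule primeidealI[OF Q_ideal cring_OK])
  have "of_int 1 \<notin> Q" using p(2) by (simp only: Q_int) (simp add: zdvd1_eq)
  thus "Od ~= Q" using OO_int[of 1] by blast
  show "\<And>a b. a \<in> Od ==> b \<in> Od ==> a \<otimes>\<^bsub>OK d\<^esub> b \<in> Q ==> a \<in> Q | b \<in> Q" using Q_prime by simp
 qed
 ultimately show "Q \<in> nz_ideals d" "Q \<in> nz_primes d" using Q_ideal by (simp_all add: nz_ideals_def nz_primes_def)
qed

lemma Q_rep: "z \<in> Od ==> z - of_int (H z) \<in> Q"
 using H_int[of "H z"] by (simp add: Q_def H_diff cong_iff_dvd_diff dvd_diff_commute)

lemma Q_norm: "ideal_norm d Q = p"
 using p by (intro ideal_norm_eqI Q_ideal Q_int) (auto intro: Q_rep)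

lemma Q_cong_c:
 assumes "[c = c'] (mod int p)"
 shows "split_prime.Q d p c' = Q"
proof -
 have "int p dvd c'\<^sup>2+int d \<longleftrightarrow> int p dvd c\<^sup>2+int d"
  by (rule cong_dvd_iff) (intro cong_add cong_pow cong_refl cong_sym[OF assms])
 hence "split_prime d p c'" using p c by unfold_locales simp_all
 then interpret c': split_prime d p c' .
 have "int p dvd a+b * c \<longleftrightarrow> int p dvd a+b * c'" for a b
  by (rule cong_dvd_iff) (intro cong_add cong_mult cong_refl assms)
 thus ?thesis unfolding set_eq_iff c'.Q_iff Q_iff by blast
qed

lemma Q_neg_neq: "split_prime.Q d p (- c) ~= Q"
proof -
 interpret cj: split_prime d p "- c" by (rule split_neg)
 have cs: "ca (s - of_int c) = - 2 * c" "cb (s - of_int c) = 2" using coordsI[of "s - of_int c" "- 2 * c" 2] by (simp_all add: algebra_simps)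
 have "s - of_int c \<in> Q" unfolding Q_iff cs by simp
 moreover have "s - of_int c \<notin> cj.Q"
 proof
  assume "s - of_int c \<in> cj.Q"
  hence "int p dvd 2*(2*(- c))" unfolding cj.Q_iff cs by simp
  hence "int p dvd - c" by (simp only: two_dvd)
  thus False using c_nz by simp
 qed
 ultimately show ?thesis by blast
qed

lemma cnj_Q: "z \<in> Od ==> cnj z \<in> Q \<longleftrightarrow> z \<in> split_prime.Q d p (- c)"
proof -
 interpret cj: split_prime d p "- c" by (rule split_neg)
 show "z \<in> Od ==> cnj z \<in> Q \<longleftrightarrow> z \<in> cj.Q" by (simp add: Q_def cj.Q_def H_cnj)
qed

end

context Kd
begin

text \<open>In an ideal of norm p the root \<open>s\<close> is congruent to an integer c. Then c^2 +
  d lies in the ideal, so p divides it, and membership is tested after replacing \<open>s\<close> by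
  c.\<close>

lemma ideal_of_prime_norm:
 assumes I: "ideal I (OK d)" and p: "prime p" "p > 2" "~ p dvd d" and n: "ideal_norm d I = p"
 shows "\<exists>c. split_prime d p c & I = split_prime.Q d p c"
proof -
 note int = prime_norm_ideal(1)[OF I p(1) n] and rep = prime_norm_ideal(2)[OF I p(1) n]
 obtain c where c: "s - of_int c \<in> I" using rep[OF OO_s] by blast
 have "(s + of_int c)*(s - of_int c) \<in> I" by (rule ideal_plain(6)[OF I c]) simp
 moreover have "(s + of_int c)*(s - of_int c) = s * s - of_int c * of_int c" by (simp add: algebra_simps)
 hence "(s + of_int c)*(s - of_int c) = of_int (- (c\<^sup>2+int d))" unfolding ssd by (simp add: power2_eq_square)
 ultimately have "of_int (- (c\<^sup>2+int d)) \<in> I" by (simp only:)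
 hence "int p dvd - (c\<^sup>2+int d)" by (simp only: int)
 hence "int p dvd c\<^sup>2+int d" by (simp only: dvd_minus_iff)
 then interpret S: split_prime d p c using p by unfold_locales
 have "z \<in> I \<longleftrightarrow> z \<in> S.Q" for z
 proof (cases "z \<in> Od")
  case True
  have "2*z - of_int (ca z + cb z * c) = of_int (cb z)*(s - of_int c)" unfolding OO_coords[OF True] by (simp add: algebra_simps)
  hence d1: "2*z - of_int (ca z + cb z * c) \<in> I" using ideal_plain(6)[OF I c OO_int[of "cb z"]] by simp
  have pI: "of_nat p \<in> I" by (rule norm_in_ideal[OF I n])
  have half: "z \<in> I \<longleftrightarrow> 2*z \<in> I"
  proof
   assume "z \<in> I" thus "2*z \<in> I" using ideal_plain(6)[OF I _ OO_int[of 2], of z] by simp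
  next
   assume a: "2*z \<in> I"
   have "of_int S.hh*(2*z) = of_int (2*S.hh)*z" by simp
   also have "... = z * of_nat p+z" unfolding S.hh by (simp add: algebra_simps)
   finally have "z = of_int S.hh*(2*z) - z * of_nat p" by simp
   moreover have "of_int S.hh*(2*z) - z * of_nat p \<in> I" by (intro ideal_plain(5)[OF I] ideal_plain(6)[OF I] a OO_int pI True)
   ultimately show "z \<in> I" by simp
  qed
  have "2*z \<in> I \<longleftrightarrow> of_int (ca z + cb z * c) \<in> I"
   using ideal_plain(5)[OF I _ d1, of "2*z"] ideal_plain(3)[OF I d1, of "of_int (ca z + cb z * c)"] by auto
  thus ?thesis unfolding half S.Q_iff int using True by simp
 next
  case False
  thus ?thesis using ideal_plain(1)[OF I] by (auto simp: S.Q_def)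
 qed
 hence "I = S.Q" by blast
 thus ?thesis using S.split_prime_axioms by blast
qed

lemma no_ideal_inert:
 assumes "prime p" "p > 2" "~ p dvd d" "Legendre (- int d) (int p) = -1" "ideal I (OK d)"
 shows "ideal_norm d I ~= p"
proof
 assume "ideal_norm d I = p"
 then obtain c where "split_prime d p c" using ideal_of_prime_norm[OF assms(5,1,2,3)] by blast
 then interpret S: split_prime d p c .
 have "[c\<^sup>2 = - int d] (mod int p)" using S.c by (simp add: cong_iff_dvd_diff)
 hence "QuadRes (int p) (- int d)" unfolding QuadRes_def by blast
 thus False using assms(4) unfolding Legendre_def by (auto split: if_splits)
qed

end

context split_prime
begin

lemma prime_norm_ideals:
 assumes "ideal I (OK d)" "ideal_norm d I = p"
 shows "I = Q | I = split_prime.Q d p (- c)"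
proof -
 obtain c' where c': "split_prime d p c'" "I = split_prime.Q d p c'" using ideal_of_prime_norm[OF assms(1) p assms(2)] by blast
 interpret c': split_prime d p c' by fact
 interpret cj: split_prime d p "- c" by (rule split_neg)
 have "int p dvd (c\<^sup>2+int d) - (c'\<^sup>2+int d)" using c c'.c by (rule dvd_diff)
 hence "int p dvd (c - c')*(- c - c')" by (simp add: power2_eq_square algebra_simps dvd_diff_commute)
 hence "int p dvd c - c' | int p dvd - c - c'" using prime_dvd_mult_iff[OF pint] by blast
 thus ?thesis using Q_cong_c[of c'] cj.Q_cong_c[of c'] c'(2) by (auto simp: cong_iff_dvd_diff)
qed

end

context Kd
begin

lemma cgen_self: "x \<in> Od ==> x \<in> cgenideal (OK d) x"
 unfolding cgen_eq by (rule CollectI, rule exI[of _ 1]) simp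

sublocale IS: comm_monoid "ideals_set (OK d)" by (rule R.ideals_set_is_comm_monoid)

abbreviation ipow :: "complex set \<Rightarrow> nat \<Rightarrow> complex set" where "ipow I m \<equiv> I [^]\<^bsub>ideals_set (OK d)\<^esub> m"

lemma ipow_0: "ipow I 0 = Od" and ipow_Suc: "ipow I (Suc m) = ideal_prod (OK d) (ipow I m) I"
 by (simp_all add: nat_pow_def) (simp_all add: ideals_set_def)

lemma ideal_prod_induct_OK:
 assumes "z \<in> ideal_prod (OK d) I J" "\<And>i j. i \<in> I ==> j \<in> J ==> K (i*j)" "\<And>x y. K x ==> K y ==> K (x+y)"
 shows "K z"
 using assms(1)
proof (induct z rule: ideal_prod.induct)
 case (prod i j) thus ?case using assms(2) by simp
next
 case (sum a b) thus ?case using assms(3) by simp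
qed

lemma power_in_ipow: "x \<in> I ==> x ^ m \<in> ipow I m"
proof (induction m)
 case (Suc m)
 have "x ^ m \<otimes>\<^bsub>OK d\<^esub> x \<in> ideal_prod (OK d) (ipow I m) I" using Suc by (intro ideal_prod.prod) auto
 thus ?case unfolding ipow_Suc by (simp add: mult.commute)
next
 case 0
 show ?case unfolding ipow_0 by simp
qed

lemma int_dvd_of_OO:
 assumes "y \<in> Od" "of_int n = of_int q*y" "q ~= 0"
 shows "q dvd n"
proof -
 have "of_int (2*n) + of_int 0 * s = of_int q*(2*y)" using assms(2) by simp
 also have "... = of_int (q * ca y) + of_int (q * cb y) * s" unfolding OO_coords[OF assms(1)] by (simp add: algebra_simps)
 finally have "2*n = q * ca y & 0 = q * cb y" by (rule uniq_int)
 hence e: "2*n = q * ca y" "cb y = 0" using assms(3) by simp_all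
 have "4 dvd (ca y)\<^sup>2" using assms(1) e(2) OO_iff by simp
 hence "even ((ca y)\<^sup>2)" by (meson dvd_trans even_numeral)
 then obtain t where "ca y = 2*t" by (auto elim: evenE)
 hence "n = q*t" using e(1) by simp
 thus ?thesis by simp
qed

section \<open>Units\<close>

definition U :: "complex set" where "U = {u \<in> Od. nm u = 1}"

lemma Units_eq: "Units (OK d) = U"
proof (intro equalityI subsetI)
 fix u assume "u \<in> Units (OK d)"
 then obtain y where y: "u \<in> Od" "y \<in> Od" "y*u = 1" unfolding Units_def by auto
 have "nm y*nm u = nm (of_int 1)" using nm_mult[OF y(2,1)] y(3) by simp
 hence "nm y*nm u = 1" by (simp only: nm_int) simp
 hence "nm u = 1" using nm_nonneg[of u] by (auto simp: zmult_eq_1_iff)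
 thus "u \<in> U" using y by (simp add: U_def)
next
 fix u assume "u \<in> U"
 hence u: "u \<in> Od" "u * cnj u = 1" using nm_eq by (simp_all add: U_def)
 thus "u \<in> Units (OK d)" unfolding Units_def by (auto intro!: bexI[of _ "cnj u"] simp: mult.commute)
qed

text \<open>Counting units becomes solving a^2 + d b^2 = 4, the norm equation in doubled
  coordinates.\<close>

lemma U_coords: "bij_betw (%u. (ca u, cb u)) U {(a, b). a\<^sup>2+int d*b\<^sup>2 = 4}"
proof (rule bij_betwI')
 fix x y assume "x \<in> U" "y \<in> U"
 hence "2*x = of_int (ca x) + of_int (cb x) * s" "2*y = of_int (ca y) + of_int (cb y) * s"
  by (simp_all add: U_def OO_coords)
 hence "ca x = ca y & cb x = cb y ==> 2*x = 2*y" by simp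
 thus "((ca x, cb x) = (ca y, cb y)) = (x = y)" by auto
next
 fix x assume "x \<in> U" thus "(ca x, cb x) \<in> {(a, b). a\<^sup>2+int d*b\<^sup>2 = 4}" using nm4[of x] by (simp add: U_def)
next
 fix t assume "t \<in> {(a, b). a\<^sup>2+int d*b\<^sup>2 = 4}"
 then obtain a b where t: "t = (a, b)" "a\<^sup>2+int d*b\<^sup>2 = 4" by blast
 define u where "u = (of_int a + of_int b * s)/2"
 have u2: "2*u = of_int a + of_int b * s" by (simp add: u_def)
 have uO: "u \<in> Od" by (rule OO_I[OF u2]) (simp add: t)
 have "nm u = 1" using nm4[OF uO] coordsI[OF u2] t(2) by simp
 thus "\<exists>u\<in>U. t = (ca u, cb u)" using uO coordsI[OF u2] t(1) by (intro bexI[of _ u]) (simp_all add: U_def)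
qed

lemma num_units_eq: "num_units d = (if d = 1 then 4 else if d = 3 then 6 else 2)"
proof -
 have "num_units d = card {(a, b). a\<^sup>2+int d*b\<^sup>2 = 4}"
  unfolding num_units_def Units_eq using bij_betw_same_card[OF U_coords] .
 moreover have "{(a, b). a\<^sup>2+int d*b\<^sup>2 = 4} = (if d = 1 then {(2, 0), (-2, 0), (0, 2), (0, -2)}
   else if d = 3 then {(2, 0), (-2, 0), (1, 1), (1, -1), (-1, 1), (-1, -1)} else {(2, 0), (-2, 0)})" (is "?A = ?B")
 proof (intro equalityI subsetI)
  fix t assume "t \<in> ?A"
  then obtain a b where t: "t = (a, b)" "a\<^sup>2+int d*b\<^sup>2 = 4" by blast
  have d4: "d ~= 4"
  proof
   assume "d = 4"
   hence "(2::nat)\<^sup>2 dvd d" by simp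
   hence "(2::nat) dvd 1" using squarefreeD[OF sqfree_d] by blast
   thus False by simp
  qed
  have le4: "0 <= Y ==> x+Y = 4 ==> x <= 2\<^sup>2" for x Y :: int by simp
  have "a\<^sup>2 <= 2\<^sup>2" by (rule le4[OF _ t(2)]) simp
  hence "\<bar>a\<bar> <= 2" using abs_le_square_iff[of a 2] by simp
  have "1*b\<^sup>2 <= int d*b\<^sup>2" using d_pos by (intro mult_right_mono) simp_all
  also have "int d*b\<^sup>2 <= 2\<^sup>2" by (rule le4[of "a\<^sup>2"]) (use t(2) in \<open>simp_all add: add.commute\<close>)
  finally have "b\<^sup>2 <= 2\<^sup>2" by simp
  hence "\<bar>b\<bar> <= 2" using abs_le_square_iff[of b 2] by simp
  hence "b \<in> {-2, -1, 0, 1, 2}" by auto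
  moreover have "a \<in> {-2, -1, 0, 1, 2}" using \<open>\<bar>a\<bar> <= 2\<close> by auto
  ultimately consider "b = 0" "a = 2 | a = -2" | "b = 1 | b = -1" "a = 1 | a = -1" "d = 3" | "b = 2 | b = -2" "a = 0" "d = 1"
  proof -
   assume b: "b \<in> {-2, -1, 0, 1, 2}" and a: "a \<in> {-2, -1, 0, 1, 2}"
   assume h: "b = 0 ==> a = 2 | a = -2 ==> thesis" "b = 1 | b = -1 ==> a = 1 | a = -1 ==> d = 3 ==> thesis"
    "b = 2 | b = -2 ==> a = 0 ==> d = 1 ==> thesis"
   have b2: "b = 0 | b = 1 | b = -1 | b = 2 | b = -2" using b by blast
   have a2: "a = 0 | a = 1 | a = -1 | a = 2 | a = -2" using a by blast
   have e0: "a = 2 | a = -2" if "b = 0" using t(2) a2 unfolding that by auto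
   have e1: "(a = 1 | a = -1) & d = 3" if "b = 1 | b = -1"
   proof -
    have "b\<^sup>2 = 1" using that by auto
    hence "a\<^sup>2+int d = 4" using t(2) by simp
    thus ?thesis using a2 d4 d_pos by auto
   qed
   have e2: "a = 0 & d = 1" if "b = 2 | b = -2"
   proof -
    have "b\<^sup>2 = 4" using that by auto
    hence "a\<^sup>2+int d*4 = 4" using t(2) by simp
    thus ?thesis using a2 d_pos by auto
   qed
   show thesis using b2 e0 e1 e2 h by blast
  qed
  thus "t \<in> ?B" unfolding t(1) by cases auto
 qed (auto split: if_splits)
 ultimately show ?thesis by simp
qed

lemma finite_U: "finite U"
proof -
 have "card U > 0" using num_units_eq unfolding num_units_def Units_eq by simp
 thus ?thesis by (rule card_ge_0_finite)
qed

lemma U_pow: "u \<in> U ==> u^num_units d = 1"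
proof -
 assume u: "u \<in> U"
 have nz: "v ~= 0" if "v \<in> U" for v using that nm_eq[of v] by (auto simp: U_def)
 have inj: "inj_on ((*) u) U" using nz[OF u] by (simp add: inj_on_def)
 have "(*) u ` U \<subseteq> U" using u by (auto simp: U_def nm_mult)
 hence "(*) u ` U = U" using endo_inj_surj[OF finite_U _ inj] by blast
 hence "\<Prod>U = (\<Prod>v\<in>U. u * v)" using prod.reindex[OF inj, of "%v. v"] by simp
 also have "... = u ^ card U*\<Prod>U" by (simp add: prod.distrib)
 finally show ?thesis using nz finite_U unfolding num_units_def Units_eq by simp
qed

lemma U_iff: "\<zeta> \<in> U \<longleftrightarrow> \<zeta> \<in> Od & \<zeta>^num_units d = 1"
proof
 assume a: "\<zeta> \<in> Od & \<zeta>^num_units d = 1"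
 have "nm \<zeta>^num_units d = nm (of_int 1)" using a nm_power[of \<zeta> "num_units d"] by simp
 hence "nm \<zeta>^num_units d = 1" by (simp only: nm_int) simp
 moreover have "num_units d > 0" using num_units_eq by simp
 ultimately have "nm \<zeta> dvd 1" by (metis dvd_power)
 hence "nm \<zeta> = 1" using nm_nonneg[of \<zeta>] by simp
 thus "\<zeta> \<in> U" using a by (simp add: U_def)
qed (auto simp: U_pow, simp add: U_def)

text \<open>The norm of u - 1 is 2 minus the trace of u, hence at most 4. As a multiple of a norm
  exceeding 4 it is 0: a modulus of such norm separates the units from 1.\<close>

lemma unit_eq_1:
 assumes u: "u \<in> U" and g: "g \<in> Od" "v \<in> Od" "u - 1 = v * g" "nm g > 4"
 shows "u = 1"
proof -
 have uO: "u \<in> Od" "nm u = 1" using u by (simp_all add: U_def)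
 have "of_int (nm (u - 1)) = (u - 1) * cnj (u - 1)" using uO nm_eq[of "u - 1"] by simp
 also have "... = u * cnj u - (u + cnj u)+1" by (simp add: algebra_simps)
 also have "... = of_int (2 - ca u)" unfolding nm_eq[OF uO(1)] trace[OF uO(1)] uO(2) by simp
 finally have n: "nm v * nm g = 2 - ca u" using nm_mult[OF g(2,1)] g(3) by (simp only: of_int_eq_iff)
 have e4: "(ca u)\<^sup>2+int d*(cb u)\<^sup>2 = 4" using nm4[OF uO(1)] uO(2) by simp
 have "0 <= int d*(cb u)\<^sup>2" by simp
 moreover have "0 <= Y ==> x+Y = 4 ==> x <= 2\<^sup>2" for x Y :: int by simp
 ultimately have "(ca u)\<^sup>2 <= 2\<^sup>2" using e4 by blast
 hence a2: "\<bar>ca u\<bar> <= 2" using abs_le_square_iff[of "ca u" 2] by simp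
 have "nm v = 0"
 proof (rule ccontr)
  assume "nm v ~= 0"
  hence "1 <= nm v" using nm_nonneg[of v] by simp
  hence "1*nm g <= nm v * nm g" using g(4) by (intro mult_right_mono) simp_all
  thus False using n a2 g(4) by linarith
 qed
 hence a: "ca u = 2" using n by simp
 hence "cb u = 0" using e4 d_pos by simp
 thus ?thesis using OO_coords[OF uO(1)] a by simp
qed

lemma U_small: "d ~= 1 ==> d ~= 3 ==> u \<in> U ==> u = 1 | u = -1"
proof -
 assume a: "d ~= 1" "d ~= 3" "u \<in> U"
 have "u^2 = 1" using U_pow[OF a(3)] num_units_eq a by simp
 thus ?thesis by (simp add: power2_eq_1_iff)
qed

end

section \<open>Generators of powers of a split prime\<close>

context split_prime
begin

text \<open>Combining the two congruences shows that p divides both coordinates; since p is odd, the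
  quotient still satisfies the integrality condition modulo 4.\<close>

lemma QQbar:
 assumes "z \<in> Q" "z \<in> split_prime.Q d p (- c)"
 shows "\<exists>y\<in>Od. z = of_nat p*y"
proof -
 interpret cj: split_prime d p "- c" by (rule split_neg)
 have z: "z \<in> Od" "int p dvd ca z + cb z * c" "int p dvd ca z + cb z*(- c)" using assms by (simp_all only: Q_iff cj.Q_iff)
 have "int p dvd 2 * ca z" using dvd_add[OF z(2,3)] by simp
 hence pa: "int p dvd ca z" by (simp only: two_dvd)
 hence "int p dvd cb z * c" using z(2) dvd_add_right_iff by blast
 hence "int p dvd cb z" using c_nz prime_dvd_mult_iff[OF pint] by blast
 then obtain a b where ab: "ca z = int p*a" "cb z = int p*b" using pa by blast
 define y where "y = z / of_nat p"
 have zy: "z = of_nat p*y" using p(2) by (simp add: y_def)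
 have "of_nat p*(2*y) = of_nat p*(of_int a + of_int b * s)"
 proof -
  have "of_nat p*(2*y) = 2*z" using zy by simp
  also have "... = of_nat p*(of_int a + of_int b * s)" unfolding OO_coords[OF z(1)] ab by (simp add: algebra_simps)
  finally show ?thesis .
 qed
 hence y2: "2*y = of_int a + of_int b * s" using p(2) by (simp only: mult_cancel_left) simp
 have "4 dvd (int p)\<^sup>2*(a\<^sup>2+int d*b\<^sup>2)" using z(1) OO_iff[of z] unfolding ab by (simp add: power_mult_distrib algebra_simps)
 moreover have "coprime 4 ((int p)\<^sup>2)"
 proof -
  have "odd (int p)" using prime_odd_nat[OF p(1)] p(2) by simp
  hence "coprime (2^2) ((int p)\<^sup>2)" by (simp only: coprime_power_left_iff coprime_power_right_iff) simp
  thus ?thesis by simp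
 qed
 ultimately have "4 dvd a\<^sup>2+int d*b\<^sup>2" by (simp only: coprime_dvd_mult_right_iff)
 hence "y \<in> Od" by (rule OO_I[OF y2])
 thus ?thesis using zy by blast
qed

lemma ipow_mult:
 assumes "z \<in> ipow Q m" "w \<in> ipow (split_prime.Q d p (- c)) m"
 shows "\<exists>y\<in>Od. z*w = of_nat p ^ m*y"
 using assms
proof (induction m arbitrary: z w)
 case 0
 thus ?case unfolding ipow_0 by (intro bexI[of _ "z*w"]) simp_all
next
 case (Suc m)
 interpret cj: split_prime d p "- c" by (rule split_neg)
 show ?case
 proof (rule ideal_prod_induct_OK[OF Suc.prems(1)[unfolded ipow_Suc]])
  fix i j assume ij: "i \<in> ipow Q m" "j \<in> Q"
  show "\<exists>y\<in>Od. i*j*w = of_nat p^Suc m*y"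
  proof (rule ideal_prod_induct_OK[OF Suc.prems(2)[unfolded ipow_Suc]])
   fix i' j' assume ij': "i' \<in> ipow cj.Q m" "j' \<in> cj.Q"
   have jO: "j \<in> Od" "j' \<in> Od" using ij(2) ij'(2) by (simp_all add: Q_def cj.Q_def)
   obtain y where y: "y \<in> Od" "i*i' = of_nat p ^ m*y" using Suc.IH[OF ij(1) ij'(1)] by blast
   have "j*j' \<in> cj.Q" using ideal_plain(6)[OF cj.Q_ideal ij'(2) jO(1)] .
   moreover have "j*j' \<in> Q" using ideal_plain(6)[OF Q_ideal ij(2) jO(2)] by (simp only: mult.commute)
   ultimately obtain y' where y': "y' \<in> Od" "j*j' = of_nat p*y'" using QQbar by blast
   have "i*j*(i'*j') = (i*i')*(j*j')" by simp
   also have "... = of_nat p^Suc m*(y*y')" unfolding y y' by simp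
   finally show "\<exists>y\<in>Od. i*j*(i'*j') = of_nat p^Suc m*y" using y(1) y'(1) by (intro bexI[of _ "y*y'"]) simp_all
  next
   fix x x' assume "\<exists>y\<in>Od. i*j*x = of_nat p^Suc m*y" "\<exists>y\<in>Od. i*j*x' = of_nat p^Suc m*y"
   then obtain y y' where "y \<in> Od" "i*j*x = of_nat p^Suc m*y" "y' \<in> Od" "i*j*x' = of_nat p^Suc m*y'" by blast
   thus "\<exists>y\<in>Od. i*j*(x+x') = of_nat p^Suc m*y" by (intro bexI[of _ "y+y'"]) (simp_all add: distrib_left)
  qed
 next
  fix x x' assume "\<exists>y\<in>Od. x*w = of_nat p^Suc m*y" "\<exists>y\<in>Od. x'*w = of_nat p^Suc m*y"
  then obtain y y' where "y \<in> Od" "x*w = of_nat p^Suc m*y" "y' \<in> Od" "x'*w = of_nat p^Suc m*y'" by blast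
  thus "\<exists>y\<in>Od. (x+x')*w = of_nat p^Suc m*y" by (intro bexI[of _ "y+y'"]) (simp_all add: distrib_left distrib_right)
 qed
qed

lemma Q_subset: "Q \<subseteq> Od" by (auto simp: Q_def)

lemma cnj_ipow: "z \<in> ipow Q m ==> cnj z \<in> ipow (split_prime.Q d p (- c)) m"
proof (induction m arbitrary: z)
 case 0
 thus ?case unfolding ipow_0 by simp
next
 case (Suc m)
 interpret cj: split_prime d p "- c" by (rule split_neg)
 show ?case
 proof (rule ideal_prod_induct_OK[OF Suc.prems[unfolded ipow_Suc]])
  fix i j assume ij: "i \<in> ipow Q m" "j \<in> Q"
  have "cnj j \<in> cj.Q" using cj.cnj_Q[of j] ij(2) by (simp add: Q_def)
  hence "cnj i \<otimes>\<^bsub>OK d\<^esub> cnj j \<in> ideal_prod (OK d) (ipow cj.Q m) cj.Q" using Suc.IH[OF ij(1)] by (intro ideal_prod.prod)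
  thus "cnj (i*j) \<in> ipow cj.Q (Suc m)" unfolding ipow_Suc by simp
 next
  fix x y assume "cnj x \<in> ipow cj.Q (Suc m)" "cnj y \<in> ipow cj.Q (Suc m)"
  hence "cnj x \<oplus>\<^bsub>OK d\<^esub> cnj y \<in> ideal_prod (OK d) (ipow cj.Q m) cj.Q" unfolding ipow_Suc by (intro ideal_prod.sum)
  thus "cnj (x+y) \<in> ipow cj.Q (Suc m)" unfolding ipow_Suc by simp
 qed
qed

lemma s_c_mem:
 assumes "[c' = c] (mod int p)"
 shows "s - of_int c' \<in> Q" "s - of_int c' \<notin> split_prime.Q d p (- c)"
proof -
 interpret cj: split_prime d p "- c" by (rule split_neg)
 have cs: "ca (s - of_int c') = - 2 * c'" "cb (s - of_int c') = 2" using coordsI[of "s - of_int c'" "- 2 * c'" 2] by (simp_all add: algebra_simps)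
 have d1: "int p dvd c - c'" using assms by (simp add: cong_iff_dvd_diff dvd_diff_commute)
 have "int p dvd 2*(c - c')" using d1 by (simp only: two_dvd)
 thus "s - of_int c' \<in> Q" unfolding Q_iff cs by (simp add: algebra_simps)
 show "s - of_int c' \<notin> cj.Q"
 proof
  assume "s - of_int c' \<in> cj.Q"
  hence "int p dvd - 2 * c'+2*(- c)" unfolding cj.Q_iff cs by blast
  moreover have "- 2 * c'+2*(- c) = 2*(- c' - c)" by simp
  ultimately have "int p dvd 2*(- c' - c)" by (simp only:)
  hence "int p dvd - c' - c" by (simp only: two_dvd)
  hence "int p dvd (c - c') - (- c' - c)" using d1 by (rule dvd_diff[rotated])
  hence "int p dvd 2 * c" by simp
  thus False using c_nz by (simp only: two_dvd)
 qed
qed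

lemma Q_power_mem: "x \<in> Od ==> x ^ m \<in> Q ==> x \<in> Q"
proof (induction m)
 case 0
 thus ?case using Q_int[of 1] p(2) by simp
next
 case (Suc m)
 thus ?case using Q_prime[of x "x ^ m"] by auto
qed

text \<open>The norm of x is pinned down by elements of known norm. It is divisible by p^m, divides
  p^(2 m), and divides (p u)^m with u prime to p, the norm of the m-th power of an element s - c' of
  \<open>Q\<close>; so it is p^m.\<close>

lemma generator_power:
 assumes x: "x \<in> Od" "cgenideal (OK d) x = ipow Q m" and m: "m > 0"
 shows "nm x = int p ^ m" "x \<in> Q" "~ int p dvd ca x"
proof -
 interpret cj: split_prime d p "- c" by (rule split_neg)
 have xm: "x \<in> ipow Q m" using cgen_self[OF x(1)] x(2) by simp
 have gen: "\<exists>y\<in>Od. q ^ m = y*x" if "q \<in> Q" for q using power_in_ipow[OF that, of m] unfolding x(2)[symmetric] cgen_eq by blast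
 \<comment> \<open>If p^2 divides c^2 + d, it does not divide (c + p)^2 + d, because p does not
   divide 2 c.\<close>
 have "\<exists>c'. [c' = c] (mod int p) & ~ (int p)\<^sup>2 dvd c'\<^sup>2+int d"
 proof (cases "(int p)\<^sup>2 dvd c\<^sup>2+int d")
  case True
  have "~ (int p)\<^sup>2 dvd (c+int p)\<^sup>2+int d"
  proof
   assume "(int p)\<^sup>2 dvd (c+int p)\<^sup>2+int d"
   hence "(int p)\<^sup>2 dvd ((c+int p)\<^sup>2+int d) - (c\<^sup>2+int d) - (int p)\<^sup>2" using True by (intro dvd_diff) simp_all
   also have "((c+int p)\<^sup>2+int d) - (c\<^sup>2+int d) - (int p)\<^sup>2 = int p*(2 * c)" by (simp add: power2_eq_square algebra_simps)
   finally have "int p dvd 2 * c" using p(2) by (simp add: power2_eq_square)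
   thus False using c_nz by (simp only: two_dvd)
  qed
  thus ?thesis by (intro exI[of _ "c+int p"]) (simp add: cong_iff_dvd_diff)
 qed (intro exI[of _ c], simp)
 then obtain c' where c': "[c' = c] (mod int p)" "~ (int p)\<^sup>2 dvd c'\<^sup>2+int d" by blast
 have "int p dvd c'\<^sup>2+int d \<longleftrightarrow> int p dvd c\<^sup>2+int d"
  by (rule cong_dvd_iff) (intro cong_add cong_pow cong_refl c'(1))
 then obtain u where u: "c'\<^sup>2+int d = int p*u" using c by blast
 have pu: "~ int p dvd u"
 proof
  assume "int p dvd u" hence "(int p)\<^sup>2 dvd c'\<^sup>2+int d" unfolding u by (simp add: power2_eq_square)
  thus False using c'(2) by simp
 qed
 have cs: "ca (s - of_int c') = - 2 * c'" "cb (s - of_int c') = 2" using coordsI[of "s - of_int c'" "- 2 * c'" 2] by (simp_all add: algebra_simps)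
 have sO: "s - of_int c' \<in> Od" by simp
 have "4*nm (s - of_int c') = 4*(c'\<^sup>2+int d)" unfolding nm4[OF sO] cs by (simp add: power_mult_distrib)
 hence ns: "nm (s - of_int c') = int p*u" using u by simp
 obtain y where y: "y \<in> Od" "(s - of_int c') ^ m = y*x" using gen s_c_mem(1)[OF c'(1)] by blast
 have y1: "nm y*nm x = (int p*u) ^ m" using nm_power[OF sO, of m] unfolding y(2) ns nm_mult[OF y(1) x(1)] .
 obtain y2 where y2: "y2 \<in> Od" "of_nat p ^ m = y2*x" using gen Q_p by blast
 have "of_nat p ^ m = (of_int (int p ^ m) :: complex)" by simp
 hence "nm (y2*x) = (int p ^ m)\<^sup>2" unfolding y2(2)[symmetric] by (simp only: nm_int)
 hence y3: "nm y2*nm x = (int p ^ m)\<^sup>2" unfolding nm_mult[OF y2(1) x(1)] .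
 obtain y4 where y4: "y4 \<in> Od" "x * cnj x = of_nat p ^ m*y4" using ipow_mult[OF xm cnj_ipow[OF xm]] by blast
 have "of_int (nm x) = of_int (int p ^ m)*y4" using y4(2) unfolding nm_eq[OF x(1)] by simp
 hence "int p ^ m dvd nm x" using p(2) by (intro int_dvd_of_OO[OF y4(1)]) simp_all
 then obtain t where t: "nm x = int p ^ m*t" by blast
 have pm0: "int p ^ m ~= 0" using p(2) by simp
 have "int p ^ m*(nm y*t) = int p ^ m*u ^ m" using y1 unfolding t by (simp add: power_mult_distrib mult_ac)
 hence "nm y*t = u ^ m" using pm0 by (simp only: mult_cancel_left) simp
 hence t1: "t dvd u ^ m" by (metis dvd_triv_right)
 have "int p ^ m*(nm y2*t) = int p ^ m*int p ^ m" using y3 unfolding t by (simp add: power2_eq_square mult_ac)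
 hence "nm y2*t = int p ^ m" using pm0 by (simp only: mult_cancel_left) simp
 hence t2: "t dvd int p ^ m" by (metis dvd_triv_right)
 have "coprime (int p) u" using pu prime_imp_coprime[OF pint] by blast
 hence "coprime (u ^ m) (int p ^ m)" by (simp add: coprime_commute)
 hence "is_unit t" using t1 t2 by (rule coprime_common_divisor)
 moreover have "int p ^ m > 0" using p(2) by simp
 hence "t \<ge> 0" using nm_nonneg[of x] unfolding t by (simp only: zero_le_mult_iff) linarith
 ultimately have "t = 1" by simp
 thus nx: "nm x = int p ^ m" using t by simp
 \<comment> \<open>Otherwise a power of s - c', a multiple of x, would lie in the conjugate prime,
   and so would s - c'.\<close>
 have nQ: "x \<notin> cj.Q"
 proof
  assume "x \<in> cj.Q"
  hence "(s - of_int c') ^ m \<in> cj.Q" unfolding y(2) using ideal_plain(6)[OF cj.Q_ideal _ y(1)] by blast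
  hence "s - of_int c' \<in> cj.Q" by (rule cj.Q_power_mem[OF sO])
  thus False using s_c_mem(2)[OF c'(1)] by blast
 qed
 have "int p dvd int p ^ m" using m by simp
 hence "x * cnj x \<in> Q" unfolding nm_eq[OF x(1)] nx by (simp only: Q_int)
 hence "x \<in> Q | cnj x \<in> Q" using Q_prime x(1) by simp
 thus xQ: "x \<in> Q" using nQ cnj_Q[OF x(1)] by blast
 show "~ int p dvd ca x"
 proof
  assume a: "int p dvd ca x"
  have "int p dvd ca x + cb x * c" using xQ by (simp only: Q_iff)
  hence "int p dvd cb x * c" using a dvd_add_right_iff by blast
  hence "int p dvd ca x + cb x*(- c)" using a by simp
  thus False using nQ x(1) unfolding cj.Q_iff by blast
 qed
qed

text \<open>By \<open>ipow_mult\<close> the product x x' is p^m y; comparing norms makes y a unit,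
  and x times its conjugate is p^m.\<close>

lemma generator_conj:
 assumes x: "x \<in> Od" "cgenideal (OK d) x = ipow Q m" and m: "m > 0"
  and x': "x' \<in> Od" "cgenideal (OK d) x' = ipow (split_prime.Q d p (- c)) m"
 shows "\<exists>u\<in>U. x' = u * cnj x"
proof -
 interpret cj: split_prime d p "- c" by (rule split_neg)
 have "x \<in> ipow Q m" "x' \<in> ipow cj.Q m" using cgen_self x x' by auto
 then obtain y where y: "y \<in> Od" "x*x' = of_nat p ^ m*y" using ipow_mult by blast
 have n: "nm x = int p ^ m" "nm x' = int p ^ m" using generator_power(1)[OF x m] cj.generator_power(1)[OF x' m] by simp_all
 have pm0: "int p ^ m ~= 0" using p(2) by simp
 have yy: "x*x' = of_int (int p ^ m)*y" using y(2) by simp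
 have "nm x*nm x' = nm (of_int (int p ^ m))*nm y" unfolding nm_mult[OF x(1) x'(1), symmetric] nm_mult[OF OO_int y(1), symmetric] yy ..
 hence "int p ^ m*int p ^ m = (int p ^ m*int p ^ m)*nm y" unfolding n nm_int power2_eq_square .
 hence "(int p ^ m*int p ^ m)*nm y = (int p ^ m*int p ^ m)*1" by simp
 moreover have "int p ^ m*int p ^ m ~= 0" using no_zero_divisors[OF pm0 pm0] .
 ultimately have "nm y = 1" by (simp only: mult_cancel_left) simp
 moreover have "of_int (int p ^ m)*x' = of_int (int p ^ m)*(y * cnj x)"
 proof -
  have "of_int (int p ^ m)*x' = (x * cnj x)*x'" unfolding nm_eq[OF x(1)] n ..
  also have "... = (x*x') * cnj x" by simp
  also have "... = of_int (int p ^ m)*(y * cnj x)" unfolding yy by simp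
  finally show ?thesis .
 qed
 hence "x' = y * cnj x" using pm0 p(2) by (simp only: mult_cancel_left) simp
 ultimately show ?thesis using y(1) by (auto simp: U_def)
qed

end

section \<open>Power residue symbols and the character values\<close>

lemma fermat_int:
 assumes "prime p" "p > 2" "~ int p dvd a"
 shows "[a^(p - 1) = 1] (mod int p)"
proof -
 have "~ p dvd nat (a mod int p)"
 proof
  assume "p dvd nat (a mod int p)"
  hence "int p dvd int (nat (a mod int p))" by (simp only: of_nat_dvd_iff)
  moreover have "a mod int p \<ge> 0" by (rule pos_mod_sign) (use assms(2) in simp)
  ultimately have "int p dvd a mod int p" by simp
  thus False using assms(3) by (simp add: dvd_mod_iff)
 qed
 hence "[nat (a mod int p)^(p - 1) = 1] (mod p)" using fermat_theorem[OF assms(1)] by blast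
 hence "[int (nat (a mod int p)^(p - 1)) = int 1] (mod int p)" by (simp only: cong_int_iff)
 moreover have "a mod int p \<ge> 0" by (rule pos_mod_sign) (use assms(2) in simp)
 ultimately have "[(a mod int p)^(p - 1) = 1] (mod int p)" by simp
 moreover have "[(a mod int p)^(p - 1) = a^(p - 1)] (mod int p)" by (rule cong_pow) (simp add: cong_def)
 ultimately show ?thesis using cong_sym cong_trans by blast
qed

definition eps_int :: "nat \<Rightarrow> int" where
 "eps_int d = (if d = 1 then 2 else if d mod 8 = 3 then - 1 else 1)"

lemma eps_eq: "eps d = of_int (eps_int d) / of_int 1"
 by (simp add: eps_def eps_int_def)

context split_prime
begin

lemma H_sum: "(\<And>i. i \<in> A ==> f i \<in> Od) ==> H (sum f A) = (\<Sum>i\<in>A. H (f i))"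
 by (induction A rule: infinite_finite_induct) (simp_all add: H_0 H_add OO_sum)

abbreviation w :: nat where "w \<equiv> num_units d"

lemma w_cases: "w = 2 | w = 4 | w = 6" using num_units_eq by auto

context
 assumes p6: "p > 6"
begin

lemma p_not_dvd_w: "~ int p dvd int w"
proof
 assume "int p dvd int w"
 hence "p dvd w" by simp
 hence "p <= w" using w_cases by (intro dvd_imp_le) auto
 thus False using p6 w_cases by auto
qed

text \<open>If z is not 1, then 0 = 1 + z + ... + z^(w-1) reduces to w. This is 2, 4 or 6 and not
  divisible by p > 6, so reduction is injective on units.\<close>

lemma root_unit_1:
 assumes z: "z \<in> U" "[H z = 1] (mod int p)"
 shows "z = 1"
proof (rule ccontr)
 assume n: "z ~= 1"
 have zO: "z \<in> Od" "z^w = 1" using z U_iff by auto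
 have "(\<Sum>i<w. z^i) = 0" using geometric_sum[OF n, of w] zO by simp
 hence "(\<Sum>i<w. H (z^i)) = 0" using H_sum[of "{..<w}" "%i. z^i"] zO H_0 by simp
 moreover have "[(\<Sum>i<w. H (z^i)) = (\<Sum>i<w. 1)] (mod int p)"
 proof (rule cong_sum)
  fix i
  have "[H (z^i) = H z^i] (mod int p)" by (rule H_power[OF zO(1)])
  also have "[H z^i = 1^i] (mod int p)" by (rule cong_pow[OF z(2)])
  finally show "[H (z^i) = 1] (mod int p)" by simp
 qed
 ultimately have "int p dvd int w" by (simp add: cong_iff_dvd_diff)
 thus False using p_not_dvd_w by blast
qed

lemma H_1: "[H 1 = 1] (mod int p)" using H_int[of 1] by simp

lemma root_unit_inj:
 assumes z: "z \<in> U" and y: "y \<in> U" and "[H z = H y] (mod int p)"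
 shows "z = y"
proof -
 have zO: "z \<in> Od" "z^w = 1" "y \<in> Od" "y^w = 1" using z y U_iff by auto
 have w1: "y^(w - 1)*y = 1" using zO(4) w_cases by (metis One_nat_def Suc_diff_1 power_Suc2 zero_less_numeral)
 have "z*y^(w - 1) = 1"
 proof (rule root_unit_1)
  have "(y^(w - 1))^w = 1" using zO(4) by (metis power_mult mult.commute power_one)
  thus "z*y^(w - 1) \<in> U" unfolding U_iff using zO by (simp add: power_mult_distrib)
  have "[H (z*y^(w - 1)) = H z*H (y^(w - 1))] (mod int p)" using zO by (intro H_mult) simp_all
  also have "[H z*H (y^(w - 1)) = H y*H (y^(w - 1))] (mod int p)" by (rule cong_mult[OF assms(3) cong_refl])
  also have "[H y*H (y^(w - 1)) = H (y*y^(w - 1))] (mod int p)" using zO by (intro cong_sym[OF H_mult]) simp_all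
  also have "y*y^(w - 1) = 1" using w1 by (simp add: mult.commute)
  also have "[H 1 = 1] (mod int p)" by (rule H_1)
  finally show "[H (z*y^(w - 1)) = 1] (mod int p)" .
 qed
 hence "z*(y^(w - 1)*y) = y" by (simp only: mult.assoc[symmetric]) simp
 thus ?thesis unfolding w1 by simp
qed

text \<open>The units reduce to w distinct roots of X^w - 1 modulo p, and there are at most w such
  roots.\<close>

lemma root_unit_surj:
 assumes "[t^w = 1] (mod int p)"
 shows "\<exists>z\<in>U. [H z = t] (mod int p)"
proof -
 define S where "S = {x \<in> {..<p}. [x^w = 1] (mod p)}"
 define h where "h z = nat (H z mod int p)" for z
 have m: "a mod int p \<ge> 0" "a mod int p < int p" for a using pos_mod_sign[of "int p" a] pos_mod_bound[of "int p" a] p6 by simp_all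
 have memS: "nat (a mod int p) \<in> S" if "[a^w = 1] (mod int p)" for a
 proof -
  have "[int (nat (a mod int p))^w = a^w] (mod int p)" using m[of a] by (intro cong_pow) (simp add: cong_def)
  hence "[int (nat (a mod int p))^w = 1] (mod int p)" using that cong_trans by blast
  hence "[int (nat (a mod int p)^w) = int 1] (mod int p)" by simp
  hence "[nat (a mod int p)^w = 1] (mod p)" by (simp only: cong_int_iff)
  thus ?thesis using m[of a] by (simp add: S_def nat_less_iff)
 qed
 have sub: "h ` U \<subseteq> S"
 proof
  fix y assume "y \<in> h ` U"
  then obtain z where z: "z \<in> U" "y = h z" by blast
  have "[H z^w = H (z^w)] (mod int p)" using z U_iff by (intro cong_sym[OF H_power]) auto
  hence "[H z^w = 1] (mod int p)" using z U_iff H_1 cong_trans by auto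
  thus "y \<in> S" unfolding z(2) h_def by (rule memS)
 qed
 have inj: "inj_on h U"
 proof (rule inj_onI)
  fix x y assume "x \<in> U" "y \<in> U" "h x = h y"
  moreover from this have "H x mod int p = H y mod int p" using eq_nat_nat_iff[OF m(1)[of "H x"] m(1)[of "H y"]] unfolding h_def by blast
  ultimately show "x = y" using root_unit_inj by (simp add: cong_def)
 qed
 have "card S <= w" unfolding S_def using p(1) w_cases by (intro roots_mod_prime_bound) auto
 moreover have "card (h ` U) = w" unfolding card_image[OF inj] num_units_def Units_eq ..
 moreover have "finite S" by (simp add: S_def)
 ultimately have "h ` U = S" using sub by (intro card_seteq) simp_all
 hence "nat (t mod int p) \<in> h ` U" using memS[OF assms] by simp
 then obtain z where z: "z \<in> U" "nat (t mod int p) = h z" by blast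
 hence "H z mod int p = t mod int p" using eq_nat_nat_iff[OF m(1)[of t] m(1)[of "H z"]] unfolding h_def by simp
 thus ?thesis using z by (auto simp: cong_def)
qed

context
 fixes e :: nat
 assumes we: "w*e = p - 1"
begin

lemma e_eq: "(ideal_norm d Q - 1) div w = e"
 unfolding Q_norm we[symmetric] using w_cases by auto

text \<open>The definition allows any fraction equal to a/b. Cross-multiplication shows that the
  values from two fractions agree modulo \<open>Q\<close>, and units that agree modulo
  \<open>Q\<close> are equal.\<close>

lemma power_residue_eqI:
 assumes ab: "~ int p dvd a" "~ int p dvd b" and z: "z \<in> U" "of_int a^e - z * of_int b^e \<in> Q"
 shows "power_residue d w (of_int a / of_int b) Q = z"
 unfolding power_residue_def e_eq
proof (rule the_equality)
 have "of_int a \<in> Od - Q" "of_int b \<in> Od - Q" using ab Q_int by simp_all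
 thus "z \<in> Od & z^w = 1 & (\<exists>a'\<in>Od - Q. \<exists>b'\<in>Od - Q. of_int a / of_int b = a'/b' & a'^e - z*b'^e \<in> Q)"
  using z U_iff by blast
next
 fix y assume y: "y \<in> Od & y^w = 1 & (\<exists>a'\<in>Od - Q. \<exists>b'\<in>Od - Q. of_int a / of_int b = a'/b' & a'^e - y*b'^e \<in> Q)"
 then obtain a' b' where ab': "a' \<in> Od - Q" "b' \<in> Od - Q" "of_int a / of_int b = a'/b'" "a'^e - y*b'^e \<in> Q" by blast
 have yU: "y \<in> U" using y U_iff by blast
 have O: "y \<in> Od" "z \<in> Od" "a' \<in> Od" "b' \<in> Od" using y z ab' U_iff by auto
 have nz: "of_int b ~= (0::complex)" "b' ~= 0" using ab(2) ab'(2) ideal_plain(2)[OF Q_ideal] by auto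
 have e1: "of_int a*b' = a' * of_int b" using ab'(3) nz by (simp add: field_simps)
 have "b'^e*(of_int a^e - z * of_int b^e) - of_int b^e*(a'^e - y*b'^e) \<in> Q"
  by (intro ideal_plain(5)[OF Q_ideal] ideal_plain(6)[OF Q_ideal] z(2) ab'(4)) (simp_all add: O)
 moreover have "b'^e*(of_int a^e - z * of_int b^e) - of_int b^e*(a'^e - y*b'^e)
   = ((of_int a*b')^e - (a' * of_int b)^e)+(y - z)*(of_int b*b')^e"
  by (simp add: power_mult_distrib algebra_simps)
 ultimately have "(y - z)*(of_int b*b')^e \<in> Q" unfolding e1 by simp
 hence "y - z \<in> Q | (of_int b*b')^e \<in> Q" by (intro Q_prime) (simp_all add: O)
 moreover have "(of_int b*b')^e \<notin> Q"
 proof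
  assume "(of_int b*b')^e \<in> Q"
  hence "of_int b*b' \<in> Q" by (rule Q_power_mem[rotated]) (simp add: O)
  hence "of_int b \<in> Q | b' \<in> Q" by (intro Q_prime) (simp_all add: O)
  thus False using ab(2) ab'(2) Q_int by simp
 qed
 ultimately have "int p dvd H y - H z" using O by (simp add: Q_def H_diff)
 thus "y = z" by (intro root_unit_inj[OF yU z(1)]) (simp add: cong_iff_dvd_diff)
qed

lemma power_residue_ex:
 assumes ab: "~ int p dvd a" "~ int p dvd b"
 shows "\<exists>z\<in>U. of_int a^e - z * of_int b^e \<in> Q"
proof -
 have "coprime b (int p)" using ab(2) prime_imp_coprime[OF pint] coprime_commute by blast
 then obtain b' where b': "[b*b' = 1] (mod int p)" using cong_solve_coprime_int by blast
 have nb: "~ int p dvd b'"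
 proof
  assume "int p dvd b'"
  hence "int p dvd b*b'" by simp
  hence "int p dvd 1" using cong_dvd_iff[OF b'] by blast
  thus False using p6 by (simp add: zdvd1_eq)
 qed
 have "((a*b')^e)^w = (a*b')^(p - 1)" unfolding we[symmetric] by (simp add: power_mult[symmetric] mult.commute)
 moreover have "~ int p dvd a*b'" using ab nb prime_dvd_mult_iff[OF pint] by blast
 ultimately have "[((a*b')^e)^w = 1] (mod int p)" using fermat_int[OF p(1,2)] by simp
 then obtain z where z: "z \<in> U" "[H z = (a*b')^e] (mod int p)" using root_unit_surj by blast
 have zO: "z \<in> Od" using z U_iff by blast
 have "[H (z * of_int (b^e)) = H z*H (of_int (b^e))] (mod int p)" by (rule H_mult[OF zO OO_int])
 also have "[H z*H (of_int (b^e)) = (a*b')^e*b^e] (mod int p)" by (rule cong_mult[OF z(2) H_int])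
 also have "(a*b')^e*b^e = a^e*(b*b')^e" by (simp add: power_mult_distrib)
 also have "[a^e*(b*b')^e = a^e*1^e] (mod int p)" by (rule cong_mult[OF cong_refl cong_pow[OF b']])
 also have "a^e*1^e = a^e" by simp
 also have "[a^e = H (of_int (a^e))] (mod int p)" by (rule cong_sym[OF H_int])
 finally have "int p dvd H (of_int (a^e)) - H (z * of_int (b^e))" by (simp add: cong_iff_dvd_diff dvd_diff_commute)
 hence "of_int (a^e) - z * of_int (b^e) \<in> Q" unfolding Q_def using zO H_diff[of "of_int (a^e)" "z * of_int (b^e)"] OO_int[of "a^e"] OO_int[of "b^e"]
  by (simp del: of_int_power)
 thus ?thesis using z(1) by auto
qed

end

end

text \<open>The quadratic character of the residue field at \<open>Q\<close>; on rational integers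
  it is the Legendre symbol at p.\<close>

definition L :: "complex \<Rightarrow> int" where "L z = Legendre (H z) (int p)"

lemma L_mult: "z \<in> Od ==> y \<in> Od ==> L (z*y) = L z*L y"
 unfolding L_def using Legendre_cong[OF H_mult[of z y]] Legendre_mult[OF p(1)] by simp

lemma L_int: "L (of_int n) = Legendre n (int p)"
 unfolding L_def by (rule Legendre_cong[OF H_int])

lemma L_power: "z \<in> Od ==> L (z^n) = L z^n"
proof (induction n)
 case 0
 show ?case using L_int[of 1] Legendre_one_left[OF p(1)] by simp
qed (simp add: L_mult)

lemma L_unit: "z \<in> U ==> L (cnj z) = L z"
proof -
 assume "z \<in> U"
 hence z: "z \<in> Od" "nm z = 1" by (simp_all add: U_def)
 have "L z*L (cnj z) = L (of_int 1)" using L_mult[of z "cnj z"] nm_eq[OF z(1)] z by simp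
 also have "... = 1" unfolding L_int by (rule Legendre_one_left[OF p(1)])
 finally show ?thesis by (auto simp: zmult_eq_1_iff)
qed

text \<open>The residue symbol is congruent to (a/b)^e modulo \<open>Q\<close>, and a/b has the same
  quadratic character as a b.\<close>

lemma L_residue:
 assumes ab: "~ int p dvd a" "~ int p dvd b" and z: "z \<in> U" "of_int a^e - z * of_int b^e \<in> Q"
 shows "L z = Legendre (a*b) (int p)^e"
proof -
 have zO: "z \<in> Od" using z(1) by (simp add: U_def)
 have "int p dvd H (of_int a^e) - H (z * of_int b^e)" using z(2) zO by (simp add: Q_def H_diff)
 hence "L (of_int a^e) = L (z * of_int b^e)" unfolding L_def by (intro Legendre_cong) (simp add: cong_iff_dvd_diff)
 hence e1: "Legendre a (int p)^e = L z*Legendre b (int p)^e" using zO by (simp add: L_mult L_power L_int)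
 have "Legendre b (int p) ~= 0" using ab(2) Legendre_eq_0_iff by blast
 hence b: "Legendre b (int p) = 1 | Legendre b (int p) = -1" using Legendre_cases[of b "int p"] by blast
 have "Legendre (a*b) (int p)^e = Legendre a (int p)^e*Legendre b (int p)^e"
  unfolding Legendre_mult[OF p(1)] by (simp add: power_mult_distrib)
 also have "... = L z*(Legendre b (int p)*Legendre b (int p))^e" unfolding e1 by (simp add: power_mult_distrib)
 also have "Legendre b (int p)*Legendre b (int p) = 1" using b by auto
 finally show ?thesis by simp
qed

text \<open>The trace of an element of \<open>Q\<close> is congruent to its conjugate modulo
  \<open>Q\<close>. This turns the trace of the product R into a product of conjugates, on which
  \<open>L\<close> is multiplicative; read backwards, it turns the conjugate of \<psi> Q into its
  trace.\<close>

lemma coefficient: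
 assumes p6: "p > 6" and we: "w*e = p - 1"
  and psi: "is_psi d \<psi>" and tw: "is_psi_twist d k \<alpha> \<psi> \<rho>"
  and cop: "coprime (int p) (disc_K d*num_den \<alpha>)"
  and n: "n = (k - 1) div class_number d" "n > 0"
  and x: "\<psi> Q \<in> Od" "\<psi> Q \<in> Q" "\<psi> (split_prime.Q d p (- c)) = cnj (\<psi> Q)"
 shows "\<exists>C. g_coeff d \<alpha> \<rho> p = of_int C & Legendre C (int p) =
  Legendre (ca (\<psi> Q)) (int p)^n*(Legendre (eps_int d) (int p)^e)^n*Legendre (num_den \<alpha>) (int p)^e"
proof -
 interpret cj: split_prime d p "- c" by (rule split_neg)
 obtain a b where qa: "quotient_of \<alpha> = (a, b)" by (cases "quotient_of \<alpha>")
 have al: "\<alpha> = of_int a / of_int b" using qa quotient_of_div by blast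
 have nd: "num_den \<alpha> = a*b" by (simp add: num_den_def qa)
 have nu: "~ int p dvd t" if "coprime (int p) t" for t
  using that p(1) by (metis coprime_common_divisor dvd_refl not_prime_unit pint)
 have cD: "coprime (int p) (disc_K d)" and cn: "coprime (int p) (num_den \<alpha>)" using cop by simp_all
 have ab: "~ int p dvd a" "~ int p dvd b" using nu[OF cn] unfolding nd by auto
 have eps: "~ int p dvd eps_int d"
 proof
  assume "int p dvd eps_int d"
  moreover have "eps_int d ~= 0" by (simp add: eps_int_def)
  ultimately have "\<bar>int p\<bar> <= \<bar>eps_int d\<bar>" by (rule dvd_imp_le_int[rotated])
  thus False using p6 by (simp add: eps_int_def split: if_splits)
 qed
 have one: "~ int p dvd 1" using p6 by (simp add: zdvd1_eq)
 obtain z1 where z1: "z1 \<in> U" "of_int (eps_int d)^e - z1 * of_int 1^e \<in> Q" using power_residue_ex[OF p6 we eps one] by blast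
 obtain z2 where z2: "z2 \<in> U" "of_int a^e - z2 * of_int b^e \<in> Q" using power_residue_ex[OF p6 we ab] by blast
 have cU: "cnj z \<in> U" if "z \<in> U" for z using that coords_cnj[of z] by (simp add: U_def nm_def)
 have cjQ: "of_int a^e - cnj z * of_int b^e \<in> cj.Q" if "z \<in> U" "of_int a^e - z * of_int b^e \<in> Q" for z a b
 proof -
  have "of_int a^e - z * of_int b^e \<in> Od" using that Q_subset by blast
  hence "cnj (of_int a^e - z * of_int b^e) \<in> cj.Q" using cj.cnj_Q[of "of_int a^e - z * of_int b^e"] that(2) by simp
  thus ?thesis by simp
 qed
 have al': "of_rat \<alpha> = (of_int a / of_int b :: complex)" unfolding al by (simp add: of_rat_divide)
 have pr: "power_residue d w (eps d) Q = z1" "power_residue d w (of_rat \<alpha>) Q = z2"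
  "power_residue d w (eps d) cj.Q = cnj z1" "power_residue d w (of_rat \<alpha>) cj.Q = cnj z2"
  unfolding eps_eq al'
  by (rule power_residue_eqI[OF p6 we eps one z1], rule power_residue_eqI[OF p6 we ab z2],
   rule cj.power_residue_eqI[OF p6 we eps one cU[OF z1(1)] cjQ[OF z1]],
   rule cj.power_residue_eqI[OF p6 we ab cU[OF z2(1)] cjQ[OF z2]])
 have cw: "coprime (int p) (int w)" using p_not_dvd_w[OF p6] prime_imp_coprime[OF pint] by blast
 have pt: "ideal_prime_to d Q t" "ideal_prime_to d cj.Q t" if "coprime (int p) t" for t
  using ideal_prime_to_int[OF Q_ideal Q_p that] ideal_prime_to_int[OF cj.Q_ideal cj.Q_p that] by blast+
 define R where "R = \<psi> Q^n*z1^n*z2"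
 have zO: "z1 \<in> Od" "z2 \<in> Od" using z1 z2 by (simp_all add: U_def)
 note tw' = tw[unfolded is_psi_twist_def, THEN conjunct2, rule_format]
 have rQ: "\<rho> Q = R"
  using conjunct2[OF tw'[OF Q_nz(2) conjI[OF pt(1)[OF cop] pt(1)[OF cw]]]] unfolding pr R_def n(1) .
 have "\<rho> cj.Q = cnj (\<psi> Q)^n * cnj z1^n * cnj z2"
  using conjunct2[OF tw'[OF cj.Q_nz(2) conjI[OF pt(2)[OF cop] pt(2)[OF cw]]]] unfolding pr x(3) n(1) .
 hence rcQ: "\<rho> cj.Q = cnj R" by (simp add: R_def)
 have RO: "R \<in> Od" unfolding R_def using x zO by simp
 have "{I \<in> nz_ideals d. ideal_prime_to d I (disc_K d) & ideal_prime_to d I (num_den \<alpha>) & ideal_norm d I = p} = {Q, cj.Q}"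
 proof (intro equalityI subsetI)
  fix I assume "I \<in> {I \<in> nz_ideals d. ideal_prime_to d I (disc_K d) & ideal_prime_to d I (num_den \<alpha>) & ideal_norm d I = p}"
  thus "I \<in> {Q, cj.Q}" using prime_norm_ideals by (auto simp: nz_ideals_def)
 next
  fix I assume "I \<in> {Q, cj.Q}"
  thus "I \<in> {I \<in> nz_ideals d. ideal_prime_to d I (disc_K d) & ideal_prime_to d I (num_den \<alpha>) & ideal_norm d I = p}"
   using Q_nz(1) cj.Q_nz(1) Q_norm cj.Q_norm pt[OF cD] pt[OF cn] by auto
 qed
 hence "g_coeff d \<alpha> \<rho> p = \<rho> Q+\<rho> cj.Q" unfolding g_coeff_def using Q_neg_neq by simp
 also have "... = of_int (ca R)" unfolding rQ rcQ by (rule trace[OF RO])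
 finally have g: "g_coeff d \<alpha> \<rho> p = of_int (ca R)" .
 have tr: "Legendre (ca y) (int p) = L (cnj y)" if "y \<in> Q" for y
 proof -
  have yO: "y \<in> Od" using that Q_subset by blast
  have "H (of_int (ca y)) = H y+H (cnj y)" unfolding trace[OF yO, symmetric] by (rule H_add) (simp_all add: yO)
  hence "[H (of_int (ca y)) = H (cnj y)] (mod int p)" using that by (simp add: Q_def cong_iff_dvd_diff)
  hence "L (of_int (ca y)) = L (cnj y)" unfolding L_def by (rule Legendre_cong)
  thus ?thesis by (simp only: L_int)
 qed
 have "R = (\<psi> Q^(n - 1)*z1^n*z2)*\<psi> Q" unfolding R_def using n(2) by (cases n) simp_all
 hence "R \<in> Q" using ideal_plain(6)[OF Q_ideal x(2), of "\<psi> Q^(n - 1)*z1^n*z2"] x(1) zO by simp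
 hence "Legendre (ca R) (int p) = L (cnj R)" by (rule tr)
 also have "... = L (cnj (\<psi> Q))^n*L (cnj z1)^n*L (cnj z2)" unfolding R_def using x(1) zO by (simp add: L_mult L_power)
 also have "... = Legendre (ca (\<psi> Q)) (int p)^n*(Legendre (eps_int d) (int p)^e)^n*Legendre (num_den \<alpha>) (int p)^e"
  unfolding tr[OF x(2), symmetric] L_unit[OF z1(1)] L_unit[OF z2(1)] L_residue[OF eps one z1] L_residue[OF ab z2] nd by simp
 finally show ?thesis using g by blast
qed

text \<open>The power of \<open>Q\<close> that \<open>psi_generator\<close> generates. For d <= 3
  its clauses prescribe a generator of \<open>Q\<close> itself, so no class number has to be
  computed.\<close>

definition psi_exp :: nat where "psi_exp = (if d <= 3 then 1 else class_number d)"

lemma psi_gen_ideal: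
 assumes "psi_generator d Q x"
 shows "x \<in> Od" "cgenideal (OK d) x = ipow Q psi_exp"
proof -
 show "x \<in> Od" using assms by (simp add: psi_generator_def)
 have "Q \<in> carrier (ideals_set (OK d))" using Q_ideal by (simp add: ideals_set_def)
 hence "ipow Q 1 = Q" by simp
 thus "cgenideal (OK d) x = ipow Q psi_exp"
  using assms d_pos unfolding psi_generator_def psi_exp_def by (auto split: if_splits)
qed

end

section \<open>Normalized generators and the local values of the coefficients\<close>

context split_prime
begin

lemma psi_generator_facts:
 assumes "psi_generator d Q x" "odd (class_number d)"
 shows "x \<in> Od" "x \<in> Q" "~ int p dvd ca x" "odd psi_exp" "4*int p^psi_exp = (ca x)\<^sup>2+int d*(cb x)\<^sup>2"
proof -
 note g = psi_gen_ideal[OF assms(1)]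
 show m: "odd psi_exp" using assms(2) by (simp add: psi_exp_def)
 hence m0: "psi_exp > 0" by (rule odd_pos)
 show "x \<in> Od" by (rule g(1))
 show "x \<in> Q" by (rule generator_power(2)[OF g m0])
 show "~ int p dvd ca x" by (rule generator_power(3)[OF g m0])
 show "4*int p^psi_exp = (ca x)\<^sup>2+int d*(cb x)\<^sup>2" using nm4[OF g(1)] generator_power(1)[OF g m0] by simp
qed

lemma cong_OK_D: "cong_OK d g x r ==> \<exists>y\<in>Od. x - r = y*g"
 unfolding cong_OK_def cgen_eq by blast

text \<open>If x is y^2 modulo the root of -d, then modulo d twice the trace of x is the square of
  the trace of y. For d = 3, x = 1 modulo 3 gives trace 2 and hence 2 T = 1 modulo 3. This fixes the
  sign of T in all the reciprocity arguments.\<close>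

lemma psi_Legendre:
 assumes x: "psi_generator d Q x" and h: "odd (class_number d)" and dp: "prime d" "d mod 4 = 3"
 shows "Legendre (2 * ca x) (int d) = 1"
proof (cases "d = 3")
 case True
 have "cong_OK d 3 x 1" using x True by (simp add: psi_generator_def)
 then obtain y where y: "y \<in> Od" "x - 1 = y*3" using cong_OK_D by blast
 have "2*x = 2+3*(2*y)" using y(2) by (simp add: algebra_simps)
 also have "... = of_int (2+3 * ca y) + of_int (3 * cb y) * s" unfolding OO_coords[OF y(1)] by (simp add: algebra_simps)
 finally have "ca x = 2+3 * ca y" by (rule coordsI)
 hence "[2 * ca x = 1] (mod int d)" using True by (simp add: cong_iff_dvd_diff)
 hence "Legendre (2 * ca x) (int d) = Legendre 1 (int d)" by (rule Legendre_cong)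
 thus ?thesis using dp by simp
next
 case False
 have d12: "d ~= 1" "d ~= 2" using dp by auto
 obtain y where y: "y \<in> Od" "cong_OK d (sqrt_neg d) x (y\<^sup>2)" using x d12 False by (auto simp: psi_generator_def)
 then obtain t where t: "t \<in> Od" "x - y\<^sup>2 = t * s" using cong_OK_D unfolding s_eq by blast
 have "x = y*y+t * s" using t(2) by (simp add: power2_eq_square algebra_simps)
 hence "ca x = ca (y*y) + ca (t * s)" using coords_add[of "y*y" "t * s"] y t by simp
 moreover have "ca s = 0" "cb s = 2" using coordsI[of s 0 2] by simp_all
 ultimately have "2 * ca x = ca y * ca y - int d*(cb y * cb y) - int d*(cb t*2)"
  using coords_mult(1)[OF y(1) y(1)] coords_mult(1)[OF t(1) OO_s] by simp
 hence "2 * ca x - (ca y)\<^sup>2 = int d*(- (cb y * cb y) - cb t*2)" by (simp add: power2_eq_square algebra_simps)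
 hence cg: "[2 * ca x = (ca y)\<^sup>2] (mod int d)" by (simp add: cong_iff_dvd_diff)
 have dint: "prime (int d)" using dp by simp
 have d2: "d > 2" using dp by (metis d12(2) le_neq_implies_less prime_ge_2_nat)
 have n2: "~ int d dvd 2" using d2 by (auto dest!: zdvd_imp_le)
 have "~ int d dvd ca y"
 proof
  assume "int d dvd ca y"
  hence "int d dvd (ca y)\<^sup>2" by (simp add: power2_eq_square)
  hence "int d dvd 2 * ca x" using cong_dvd_iff[OF cg] by blast
  hence "int d dvd ca x" using n2 prime_dvd_mult_iff[OF dint] by blast
  hence "int d dvd (ca x)\<^sup>2+int d*(cb x)\<^sup>2" by (simp add: power2_eq_square)
  hence "int d dvd (2*2)*int p^psi_exp" using psi_generator_facts(5)[OF x h] by simp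
  hence "int d dvd int p^psi_exp" using n2 prime_dvd_mult_iff[OF dint] by blast
  hence "int d dvd int p" by (rule prime_dvd_power[OF dint])
  hence "d dvd p" by simp
  hence "d = p" using dp(1) p(1) primes_dvd_imp_eq by blast
  thus False using p(3) by simp
 qed
 hence "Legendre ((ca y)\<^sup>2) (int d) = 1" by (rule Legendre_square[OF dp(1)])
 thus ?thesis using Legendre_cong[OF cg] by simp
qed

text \<open>A multiple of 4 s changes the rational part by multiples of 8 and the coefficient of
  \<open>s\<close> by multiples of 4; both are doubled in \<open>ca\<close> and
  \<open>cb\<close>.\<close>

lemma psi2_coords:
 assumes x: "psi_generator d Q x" and d2: "d = 2"
 shows "\<exists>r1 r2 A B. (r2 = 0 & (r1 = 1 | r1 = 3) | (r2 = 1 | r2 = 2 | r2 = 3) & (r1 = 5 | r1 = 7)) & ca x = 2 * r1 - 16*B & cb x = 2 * r2+8*A"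
proof -
 have "\<exists>r1 r2 :: int. (r2 = 0 & (r1 = 1 | r1 = 3) | (r2 = 1 | r2 = 2 | r2 = 3) & (r1 = 5 | r1 = 7)) & cong_OK d (4 * s) x (of_int r1 + of_int r2 * s)"
 proof -
  obtain r where r: "r\<in>{1, 3, 5 + sqrt_neg 2, 7 + sqrt_neg 2, 5+2 * sqrt_neg 2, 7+2 * sqrt_neg 2,
       5+3 * sqrt_neg 2, 7+3 * sqrt_neg 2}" "cong_OK d (4 * sqrt_neg 2) x r" using x d2 by (auto simp: psi_generator_def)
  have s2: "sqrt_neg 2 = s" by (rule sym, rule trans[OF s_eq]) (simp only: d2)
  define P where "P r1 r2 \<longleftrightarrow> (r2 = 0 & (r1 = 1 | r1 = 3) | (r2 = 1 | r2 = 2 | r2 = 3) & (r1 = 5 | r1 = 7))" for r1 r2 :: int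
  have wit: "\<exists>r1 r2. P r1 r2 & r = of_int r1 + of_int r2 * s" if "r = of_int a + of_int b * s" "P a b" for a b
   using that by blast
  from r(1) consider "r = of_int 1 + of_int 0 * s" | "r = of_int 3 + of_int 0 * s" | "r = of_int 5 + of_int 1 * s"
   | "r = of_int 7 + of_int 1 * s" | "r = of_int 5 + of_int 2 * s" | "r = of_int 7 + of_int 2 * s" | "r = of_int 5 + of_int 3 * s"
   | "r = of_int 7 + of_int 3 * s" unfolding s2 by auto
  hence "\<exists>r1 r2. P r1 r2 & r = of_int r1 + of_int r2 * s" by cases (rule wit, assumption, simp add: P_def)+
  thus ?thesis using r(2) unfolding s2 P_def by blast
 qed
 then obtain r1 r2 :: int where r: "r2 = 0 & (r1 = 1 | r1 = 3) | (r2 = 1 | r2 = 2 | r2 = 3) & (r1 = 5 | r1 = 7)"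
  "cong_OK d (4 * s) x (of_int r1 + of_int r2 * s)" by blast
 obtain y where y: "y \<in> Od" "x - (of_int r1 + of_int r2 * s) = y*(4 * s)" using cong_OK_D[OF r(2)] by blast
 have f: "4 dvd (ca y)\<^sup>2+2*(cb y)\<^sup>2" using y(1) OO_iff[of y] d2 by simp
 hence "even ((ca y)\<^sup>2+2*(cb y)\<^sup>2)" by (meson dvd_trans even_numeral)
 hence "even (ca y)" by simp
 then obtain A where A: "ca y = 2*A" by blast
 have "2*2 dvd 2*(2*A\<^sup>2+(cb y)\<^sup>2)" using f unfolding A by (simp add: power_mult_distrib)
 hence "2 dvd 2*A\<^sup>2+(cb y)\<^sup>2" by (simp only: dvd_mult_cancel_left) simp
 hence "even (cb y)" by simp
 then obtain B where B: "cb y = 2*B" by blast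
 have "2*x = 2*(x - (of_int r1 + of_int r2 * s))+2*(of_int r1 + of_int r2 * s)" by simp
 also have "... = 4 * s*(2*y)+2*(of_int r1 + of_int r2 * s)" unfolding y(2) by simp
 also have "... = 4 * of_int (cb y)*(s * s)+(of_int (2 * r1) + of_int (2 * r2+4 * ca y) * s)"
  unfolding OO_coords[OF y(1)] by (simp add: algebra_simps)
 also have "... = of_int (2 * r1 - 16*B) + of_int (2 * r2+8*A) * s" unfolding ssd A B unfolding d2 by (simp add: algebra_simps)
 finally have xx: "2*x = of_int (2 * r1 - 16*B) + of_int (2 * r2+8*A) * s" .
 show ?thesis
  by (rule exI[of _ r1], rule exI[of _ r2], rule exI[of _ A], rule exI[of _ B], rule conjI[OF r(1) conjI[OF coordsI[OF xx]]])
qed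

text \<open>The conjugate of x also generates the conjugate ideal power, so it differs from x' by a
  unit, which the normalization forces to be 1: for d = 1, 3 through a modulus of norm above 4 that
  is stable under conjugation, for d = 2 through the list of residues, and otherwise because -1 is a
  nonresidue modulo d.\<close>

lemma psi_conj:
 assumes dd: "d = 1 | d = 2 | prime d & d mod 4 = 3" and h: "odd (class_number d)"
  and x: "psi_generator d Q x" and x': "psi_generator d (split_prime.Q d p (- c)) x'"
 shows "x' = cnj x"
proof -
 interpret cj: split_prime d p "- c" by (rule split_neg)
 have m0: "psi_exp > 0" using psi_generator_facts(4)[OF x h] by (rule odd_pos)
 note g = psi_gen_ideal[OF x] and g' = cj.psi_gen_ideal[OF x']
 obtain u where u: "u \<in> U" "x' = u * cnj x" using generator_conj[OF g m0 g'] by blast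
 have uO: "u \<in> Od" using u by (simp add: U_def)
 have "u = 1"
 proof -
  have cong1: "u = 1" if gg: "gg \<in> Od" "cnj gg = v * gg" "v \<in> Od" "nm gg > 4" "cong_OK d gg x 1" "cong_OK d gg x' 1" for gg v
  proof -
   obtain y where y: "y \<in> Od" "x - 1 = y*gg" using cong_OK_D[OF gg(5)] by blast
   obtain y' where y': "y' \<in> Od" "x' - 1 = y'*gg" using cong_OK_D[OF gg(6)] by blast
   have "cnj x - 1 = cnj (x - 1)" by simp
   also have "... = (cnj y * v)*gg" unfolding y(2) by (simp add: gg(2))
   finally have "u - 1 = (y' - u*(cnj y * v))*gg" using y'(2) unfolding u(2) by (simp add: algebra_simps)
   thus ?thesis using gg y y' uO by (intro unit_eq_1[OF u(1) gg(1), of "y' - u*(cnj y * v)"]) simp_all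
  qed
  consider "d = 1" | "d = 2" | "d = 3" | "d ~= 1" "d ~= 2" "d ~= 3" "prime d" "d mod 4 = 3" using dd by blast
  thus ?thesis
  proof cases
   case 1
   have si: "s = \<i>" by (rule trans[OF s_eq]) (simp add: sqrt_neg_def 1)
   have g2: "2*(2+2*\<i>) = of_int 4 + of_int 4 * s" unfolding si by simp
   have gO: "2+2*\<i> \<in> Od" by (rule OO_I[OF g2]) simp
   have "4*nm (2+2*\<i>) = 32" unfolding nm4[OF gO] coordsI[OF g2] using 1 by simp
   moreover have "- \<i> \<in> Od" using OO_uminus[OF OO_s] unfolding si .
   moreover have "cnj (2+2*\<i>) = - \<i>*(2+2*\<i>)" by (simp add: algebra_simps)
   ultimately show ?thesis using x x' 1 gO by (intro cong1[of "2+2*\<i>" "- \<i>"]) (simp_all add: psi_generator_def)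
  next
   case 3
   have "nm (of_int 3) = 9" unfolding nm_int by simp
   hence "nm 3 = 9" by simp
   moreover have "(3::complex) \<in> Od" using OO_int[of 3] by simp
   ultimately show ?thesis using x x' 3 OO_1 by (intro cong1[of 3 1]) (simp_all add: psi_generator_def)
  next
   case 2
   have "u ~= -1"
   proof
    assume "u = -1"
    hence x'e: "x' = - cnj x" using u by simp
    have "2*x' = - cnj (2*x)" unfolding x'e by simp
    also have "... = of_int (- ca x) + of_int (cb x) * s" unfolding OO_coords[OF g(1)] by simp
    finally have cc: "ca x' = - ca x" "cb x' = cb x" using coordsI by blast+
    obtain r1 r2 A B where r: "r2 = 0 & (r1 = 1 | r1 = 3) | (r2 = 1 | r2 = 2 | r2 = 3) & (r1 = 5 | r1 = 7)"
     "ca x = 2 * r1 - 16*B" "cb x = 2 * r2+8*A" using psi2_coords[OF x 2] by blast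
    obtain q1 q2 A' B' where q: "q2 = 0 & (q1 = 1 | q1 = 3) | (q2 = 1 | q2 = 2 | q2 = 3) & (q1 = 5 | q1 = 7)"
     "ca x' = 2*q1 - 16*B'" "cb x' = 2*q2+8*A'" using cj.psi2_coords[OF x' 2] by blast
    have e2: "q2 - r2 = 4*(A - A')" using cc(2) unfolding r q by simp
    have "\<bar>q2 - r2\<bar> < 4" using r(1) q(1) by auto
    hence "A - A' = 0" using e2 by presburger
    hence qr: "q2 = r2" using e2 by simp
    have e1: "q1 + r1 = 8*(B+B')" using cc(1) unfolding r q by simp
    \<comment> \<open>For equal coefficients of the root, the rational parts both lie in {1, 3} or
      both in {5, 7}, and no such sum is divisible by 8.\<close>
    have "q1 + r1 = 2 | q1 + r1 = 4 | q1 + r1 = 6 | q1 + r1 = 10 | q1 + r1 = 12 | q1 + r1 = 14" using r(1) q(1) qr by auto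
    thus False using e1 by presburger
   qed
   thus ?thesis using U_small[OF _ _ u(1)] 2 by auto
  next
   case 4
   have "u ~= -1"
   proof
    assume "u = -1"
    hence x'e: "x' = - cnj x" using u by simp
    have "2*x' = - cnj (2*x)" unfolding x'e by simp
    also have "... = of_int (- ca x) + of_int (cb x) * s" unfolding OO_coords[OF g(1)] by simp
    finally have "ca x' = - ca x" using coordsI by blast
    moreover interpret ip: inert_prime d by standard (use 4 in auto)
    have "Legendre (2 * ca x) (int d) = 1" "Legendre (2 * ca x') (int d) = 1"
     using psi_Legendre[OF x h 4(4,5)] cj.psi_Legendre[OF x' h 4(4,5)] by simp_all
    ultimately have "Legendre (2 * ca x) (int d) = 1" "Legendre ((-1)*(2 * ca x)) (int d) = 1" by simp_all
    thus False unfolding Legendre_mult[OF 4(4)] ip.Leg_minus_one by simp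
   qed
   thus ?thesis using U_small[OF 4(1,3) u(1)] by auto
  qed
 qed
 thus ?thesis using u by simp
qed

text \<open>All symbols are signs, so only parities of exponents matter in
  \<open>coefficient\<close>: n is even exactly when k is odd, because n h = k - 1 with h odd, and e
  is even exactly when p is 1 modulo 4 (modulo 8 if d = 1).\<close>

lemma local_value:
 assumes dd: "d = 1 | d = 2 | prime d & d mod 4 = 3" and h: "odd (class_number d)"
  and p6: "p > 6" and k: "k \<ge> 2" "[k = 1] (mod class_number d)"
  and psi: "is_psi d \<psi>" and tw: "is_psi_twist d k \<alpha> \<psi> \<rho>"
  and cop: "coprime (int p) (disc_K d*num_den \<alpha>)"
 shows "\<exists>C. g_coeff d \<alpha> \<rho> p = of_int C & ~ int p dvd C
  & (d ~= 1 & odd k \<longrightarrow> Legendre C (int p) = (if p mod 4 = 1 then 1 else Legendre (num_den \<alpha>) (int p)))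
  & (d ~= 1 & even k & p mod 4 = 3 \<longrightarrow> Legendre C (int p) = Legendre (num_den \<alpha>) (int p))
  & (d ~= 1 & even k & p mod 4 = 1 \<longrightarrow>
    2 * of_int (Legendre C (int p)) = gprime_coeff (if d = 2 then theta2 else inert_prime.dtheta d) p)
  & (d = 1 \<longrightarrow> p mod 4 = 1 & Legendre C (int p) = (if p mod 8 = 1 then 1 else Legendre (num_den \<alpha>) (int p)))"
proof -
 interpret cj: split_prime d p "- c" by (rule split_neg)
 have cD: "coprime (int p) (disc_K d)" using cop by simp
 have pt: "ideal_prime_to d Q (disc_K d)" "ideal_prime_to d cj.Q (disc_K d)"
  using ideal_prime_to_int[OF Q_ideal Q_p cD] ideal_prime_to_int[OF cj.Q_ideal cj.Q_p cD] by blast+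
 define x where "x = \<psi> Q"
 have x: "psi_generator d Q x" unfolding x_def
  by (rule psi[unfolded is_psi_def, THEN conjunct2, rule_format, OF Q_nz(2) pt(1), THEN conjunct2])
 have x': "psi_generator d cj.Q (\<psi> cj.Q)" 
  by (rule psi[unfolded is_psi_def, THEN conjunct2, rule_format, OF cj.Q_nz(2) pt(2), THEN conjunct2])
 have cjx: "\<psi> cj.Q = cnj x" by (rule psi_conj[OF dd h x x'])
 note xf = psi_generator_facts[OF x h]
 define h' where "h' = class_number d"
 define n where "n = (k - 1) div h'"
 have "h' dvd k - 1" unfolding h'_def by (rule cong_to_1_nat[OF k(2)])
 hence nh: "n*h' = k - 1" by (simp add: n_def)
 have n0: "n > 0" using nh k(1) by (cases n) auto
 have npar: "even n \<longleftrightarrow> odd k"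
 proof -
  have "even (n*h') \<longleftrightarrow> even n" using h by (simp add: h'_def)
  thus ?thesis unfolding nh using k(1) by simp
 qed
 have op: "odd p" using prime_odd_nat[OF p(1)] p(2) by simp
 define T where "T = ca x"
 define Y where "Y = cb x"
 have TY: "4*int p^psi_exp = T\<^sup>2+int d*Y\<^sup>2" using xf(5) by (simp add: T_def Y_def)
 have pT: "~ int p dvd T" using xf(3) by (simp add: T_def)
 \<comment> \<open>The congruence modulo 2 + 2 i makes the real part of x odd; its imaginary part is
   then even, and p is 1 modulo 4.\<close>
 have gauss: "\<exists>a b. T = 2*a & odd a & int p = a\<^sup>2+b\<^sup>2 & p mod 4 = 1" if "d = 1"
 proof -
  have si: "s = \<i>" by (rule trans[OF s_eq]) (simp add: sqrt_neg_def that)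
  have "cong_OK d (2+2*\<i>) x 1" using x that by (simp add: psi_generator_def)
  then obtain y where y: "y \<in> Od" "x - 1 = y*(2+2 * s)" using cong_OK_D unfolding si by blast
  have ev: "even (ca z) & even (cb z)" if z: "z \<in> Od" for z
  proof -
   have d4: "4 dvd (ca z)\<^sup>2+(cb z)\<^sup>2" using z OO_iff[of z] \<open>d = 1\<close> by simp
   hence e: "even (ca z) \<longleftrightarrow> even (cb z)" using dvd_trans[of 2 4 "(ca z)\<^sup>2+(cb z)\<^sup>2"] by simp
   have "~ odd (ca z)"
   proof
    assume o: "odd (ca z)"
    have "(ca z)\<^sup>2 mod 8 = 1" "(cb z)\<^sup>2 mod 8 = 1" using square_mod_8 o e by blast+
    thus False using d4 by presburger
   qed
   thus ?thesis using e by simp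
  qed
  obtain A B where AB: "ca y = 2*A" "cb y = 2*B" using ev[OF y(1)] by blast
  have "2*x = 2*(x - 1)+2" by simp
  also have "... = (2*y)*(2+2 * s)+2" unfolding y(2) by simp
  also have "... = of_int (2 * ca y+2) + of_int (2 * cb y)*(s * s) + of_int (2 * ca y+2 * cb y) * s"
   unfolding OO_coords[OF y(1)] by (simp add: algebra_simps)
  also have "... = of_int (2 * ca y+2 - 2 * cb y) + of_int (2 * ca y+2 * cb y) * s" unfolding ssd unfolding that by simp
  finally have "ca x = 2 * ca y+2 - 2 * cb y" by (rule coordsI)
  hence T2: "T = 2*(2*A+1 - 2*B)" unfolding T_def AB by simp
  obtain b where b: "Y = 2*b" using ev[OF xf(1)] unfolding Y_def by blast
  define a where "a = 2*A+1 - 2*B"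
  have pe: "psi_exp = 1" unfolding psi_exp_def using that by simp
  have "4*int p = 4*(a\<^sup>2+b\<^sup>2)" using TY unfolding pe unfolding T2 b a_def[symmetric] unfolding that by (simp add: power_mult_distrib)
  hence pab: "int p = a\<^sup>2+b\<^sup>2" by simp
  have oa: "odd a" by (simp add: a_def)
  have "odd (a\<^sup>2+b\<^sup>2)" unfolding pab[symmetric] using op by simp
  hence "even b" using oa by simp
  then obtain b' where b': "b = 2*b'" by blast
  have "b\<^sup>2 = 4*b'\<^sup>2" unfolding b' by (simp add: power_mult_distrib)
  hence "int p = a\<^sup>2+4*b'\<^sup>2" using pab by simp
  moreover have "a\<^sup>2 mod 8 = 1" using square_mod_8 oa by blast
  ultimately have "int p mod 4 = 1" by presburger
  hence "p mod 4 = 1" by presburger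
  thus ?thesis using T2 oa pab unfolding a_def[symmetric] by blast
 qed
 \<comment> \<open>For d = 3 there are six units, and 6 must divide p - 1 for the residue symbol;
   squares modulo 3 give this from 4 p = T^2 + 3 Y^2.\<close>
 have p3: "p mod 3 = 1" if "d = 3"
 proof -
  have pe: "psi_exp = 1" unfolding psi_exp_def using that by simp
  have e: "4*int p = T\<^sup>2+3*Y\<^sup>2" using TY unfolding pe unfolding that by simp
  have "T mod 3 = 0 | T mod 3 = 1 | T mod 3 = 2" by presburger
  then obtain q r where T: "T = 3*q + r" "r = 0 | r = 1 | r = 2" by (metis mult_div_mod_eq)
  have "T\<^sup>2 = 3*(3*q\<^sup>2+2*q * r) + r\<^sup>2" unfolding T(1) by (simp add: power2_eq_square algebra_simps)
  moreover define W where "W = 3*q\<^sup>2+2*q * r+Y\<^sup>2"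
  ultimately have "4*int p = 3*W + r\<^sup>2" using e by (simp add: algebra_simps)
  moreover have "r\<^sup>2 = 0 | r\<^sup>2 = 1 | r\<^sup>2 = 4" using T(2) by auto
  ultimately have "p mod 3 = 0 | p mod 3 = 1" by presburger
  moreover have "p mod 3 ~= 0"
  proof
   assume "p mod 3 = 0"
   hence "3 dvd p" by presburger
   hence "3 = p" using p(1) primes_dvd_imp_eq[of 3 p] by simp
   thus False using p6 by simp
  qed
  ultimately show ?thesis by blast
 qed
 define e where "e = (p - 1) div w"
 have we: "w*e = p - 1"
 proof -
  have "w dvd p - 1"
  proof (cases "d = 1")
   case True
   have "p mod 4 = 1" using gauss[OF True] by blast
   hence "4 dvd p - 1" by presburger
   moreover have "w = 4" using num_units_eq True by argo
   ultimately show ?thesis by (simp only:)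
  next
   case False
   show ?thesis
   proof (cases "d = 3")
    case True
    have "6 dvd p - 1" using p3[OF True] op by presburger
    moreover have "w = 6" using num_units_eq True False by argo
    ultimately show ?thesis by (simp only:)
   next
    case d3: False
    have "2 dvd p - 1" using op by presburger
    moreover have "w = 2" using num_units_eq d3 False by argo
    ultimately show ?thesis by (simp only:)
   qed
  qed
  thus ?thesis by (simp add: e_def)
 qed
 have "\<exists>C. g_coeff d \<alpha> \<rho> p = of_int C & Legendre C (int p) =
  Legendre (ca (\<psi> Q)) (int p)^n*(Legendre (eps_int d) (int p)^e)^n*Legendre (num_den \<alpha>) (int p)^e"
  by (rule coefficient[OF p6 we psi tw cop _ n0 xf(1,2)[unfolded x_def] cjx[unfolded x_def]]) (simp add: n_def h'_def)
 then obtain C where C: "g_coeff d \<alpha> \<rho> p = of_int C" "Legendre C (int p) =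
  Legendre T (int p)^n*(Legendre (eps_int d) (int p)^e)^n*Legendre (num_den \<alpha>) (int p)^e"
  unfolding T_def x_def by blast
 have pm: "Legendre t (int p) = 1 | Legendre t (int p) = -1" if "~ int p dvd t" for t
  using that Legendre_cases[of t "int p"] Legendre_eq_0_iff by blast
 have nu: "~ int p dvd num_den \<alpha>"
 proof
  assume "int p dvd num_den \<alpha>"
  moreover have "coprime (int p) (num_den \<alpha>)" using cop by simp
  ultimately have "is_unit (int p)" by (meson coprime_common_divisor dvd_refl)
  thus False using p6 by simp
 qed
 have eps: "~ int p dvd eps_int d"
 proof
  assume "int p dvd eps_int d"
  moreover have "eps_int d ~= 0" by (simp add: eps_int_def)
  ultimately have "\<bar>int p\<bar> <= \<bar>eps_int d\<bar>" by (rule dvd_imp_le_int[rotated])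
  thus False using p6 by (simp add: eps_int_def split: if_splits)
 qed
 define TL where "TL = Legendre T (int p)"
 define EL where "EL = Legendre (eps_int d) (int p)"
 define NL where "NL = Legendre (num_den \<alpha>) (int p)"
 have pms: "TL = 1 | TL = -1" "EL = 1 | EL = -1" "NL = 1 | NL = -1" unfolding TL_def EL_def NL_def using pm pT eps nu by blast+
 have pw: "t^j = (if even j then 1 else t)" if "t = 1 | t = -1" for t :: int and j :: nat using that by (auto simp: minus_one_power_iff)
 have pw': "t^j = 1 | t^j = -1" if "t = 1 | t = -1" for t :: int and j :: nat using that pw[OF that] by auto
 have C2: "Legendre C (int p) = TL^n*(EL^e)^n*NL^e" using C(2) by (simp add: TL_def EL_def NL_def)
 have nC: "~ int p dvd C"
 proof
  assume "int p dvd C"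
  hence "Legendre C (int p) = 0" by (simp only: Legendre_eq_0_iff)
  thus False unfolding C2 using pms by auto
 qed
 have par: "even e \<longleftrightarrow> p mod 4 = 1" if "d ~= 1"
 proof -
  have "w = 2 | w = 6" using that num_units_eq by argo
  thus ?thesis
  proof
   assume w2: "w = 2"
   have "2*e = p - 1" using we unfolding w2 .
   thus ?thesis using op p6 by presburger
  next
   assume w6: "w = 6"
   have "6*e = p - 1" using we unfolding w6 .
   thus ?thesis using op p6 by presburger
  qed
 qed
 have p43: "p mod 4 = 1 | p mod 4 = 3" using op by presburger
 have odd_case: "Legendre C (int p) = (if p mod 4 = 1 then 1 else NL)" if "d ~= 1" "odd k"
 proof -
  have "even n" using that npar by simp
  hence "TL^n = 1" "(EL^e)^n = 1" using pw[OF pms(1)] pw[OF pw'[OF pms(2)]] by simp_all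
  thus ?thesis unfolding C2 pw[OF pms(3), of e] using par[OF that(1)] by simp
 qed
 \<comment> \<open>For d = 2 the prime is 1 or 3 modulo 8 according to the parity of the coefficient
   of the root, and an odd coefficient leaves only the rational parts 5 and 7.\<close>
 have two: "\<exists>V Z. T = 2*V & odd V & ~ int p dvd V & int p = V\<^sup>2+2*Z\<^sup>2 & (p mod 8 = 1 | p mod 8 = 3) & (p mod 8 = 3 \<longrightarrow> V mod 8 = 5 | V mod 8 = 7)" if d2: "d = 2"
 proof -
  obtain r1 r2 A B where r: "r2 = 0 & (r1 = 1 | r1 = 3) | (r2 = 1 | r2 = 2 | r2 = 3) & (r1 = 5 | r1 = 7)"
   "T = 2 * r1 - 16*B" "Y = 2 * r2+8*A" using psi2_coords[OF x d2] unfolding T_def Y_def by blast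
  define X' where "X' = r1 - 8*B"
  define Z where "Z = r2+4*A"
  have TX: "T = 2*X'" "Y = 2*Z" using r by (simp_all add: X'_def Z_def)
  have oX: "odd X'" using r(1) unfolding X'_def by auto
  have pe: "psi_exp = 1" unfolding psi_exp_def using d2 by simp
  have "4*int p = 4*(X'\<^sup>2+2*Z\<^sup>2)" using TY unfolding pe unfolding TX unfolding d2 by (simp add: power_mult_distrib)
  hence pX: "int p = X'\<^sup>2+2*Z\<^sup>2" by simp
  have x8: "X'\<^sup>2 mod 8 = 1" using square_mod_8[OF oX] .
  have "p mod 8 = (if even Z then 1 else 3)"
  proof (cases "even Z")
   case True
   then obtain b where "Z = 2*b" by blast
   hence "Z\<^sup>2 = 4*b\<^sup>2" by (simp add: power_mult_distrib)
   hence "int p = X'\<^sup>2+8*b\<^sup>2" using pX by simp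
   hence "int p mod 8 = 1" using x8 by presburger
   hence "p mod 8 = 1" by presburger
   thus ?thesis using True by simp
  next
   case False
   hence "Z\<^sup>2 mod 8 = 1" using square_mod_8 by blast
   moreover have "A' mod 8 = 1 ==> B' mod 8 = 1 ==> (A'+2*B') mod 8 = 3" for A' B' :: int by presburger
   ultimately have "int p mod 8 = 3" unfolding pX using x8 by blast
   hence "p mod 8 = 3" by presburger
   thus ?thesis using False by simp
  qed
  moreover have "X' mod 8 = 5 | X' mod 8 = 7" if "odd Z"
  proof -
   have "r2 ~= 0" using that unfolding Z_def by auto
   hence "r1 = 5 | r1 = 7" using r(1) by blast
   thus ?thesis unfolding X'_def by presburger
  qed
  ultimately have "(p mod 8 = 1 | p mod 8 = 3) & (p mod 8 = 3 \<longrightarrow> X' mod 8 = 5 | X' mod 8 = 7)" by (auto split: if_splits)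
  moreover have "~ int p dvd X'" using pT unfolding TX by (metis dvd_mult)
  ultimately show ?thesis using TX oX pX by blast
 qed
 have even_C: "Legendre C (int p) = TL*EL^e*NL^e" if "d ~= 1" "even k"
 proof -
  have "odd n" using that npar by simp
  thus ?thesis unfolding C2 using pw[OF pms(1), of n] pw[OF pw'[OF pms(2), of e], of n] by simp
 qed
 have even3: "Legendre C (int p) = NL" if "d ~= 1" "even k" "p mod 4 = 3"
 proof -
  have oe: "odd e" using par[OF that(1)] that(3) by simp
  \<comment> \<open>This is the purpose of \<open>eps\<close>: it is -1 exactly when d is 3 modulo
    8, and then (T/p) = (2/d) = -1 is cancelled by (-1/p) = -1. In the other cases both symbols are
    1.\<close>
  have "TL*EL = 1"
  proof (cases "d = 2")
   case True
   obtain X' Z where X: "T = 2*X'" "odd X'" "~ int p dvd X'" "int p = X'\<^sup>2+2*Z\<^sup>2" "p mod 8 = 1 | p mod 8 = 3" "p mod 8 = 3 \<longrightarrow> X' mod 8 = 5 | X' mod 8 = 7"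
    using two[OF True] by blast
   have p83: "p mod 8 = 3" using X(5) that(3) by presburger
   have "TL = 1" unfolding TL_def X(1) by (rule Legendre_trace_two_3mod8[OF p(1) p83 X(4,3)]) (use X(6) p83 in blast)
   moreover have "EL = 1" unfolding EL_def eps_int_def using True p(1) by simp
   ultimately show ?thesis by simp
  next
   case False
   hence dp: "prime d" "d mod 4 = 3" using dd that(1) by auto
   interpret ip: inert_prime d by standard (rule dp)+
   have "TL = Legendre 2 (int d)" unfolding TL_def
    by (rule ip.Legendre_trace_3mod4[OF p(1) that(3) xf(4) TY pT psi_Legendre[OF x h dp, folded T_def]])
   also have "... = (if d mod 8 = 3 then -1 else 1)" by (rule ip.Legendre_two)
   finally have "TL = (if d mod 8 = 3 then -1 else 1)" .
   moreover have "EL = (if d mod 8 = 3 then -1 else 1)" unfolding EL_def eps_int_def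
    using that(1) Legendre_minus_one[OF p(1,2)] that(3) p(1) by simp
   ultimately show ?thesis by simp
  qed
  thus ?thesis unfolding even_C[OF that(1,2)] pw[OF pms(2), of e] pw[OF pms(3), of e] using oe by simp
 qed
 have even1: "2 * of_int (Legendre C (int p)) = gprime_coeff (if d = 2 then theta2 else inert_prime.dtheta d) p"
  if "d ~= 1" "even k" "p mod 4 = 1"
 proof -
  have ee: "even e" using par[OF that(1)] that(3) by simp
  have CT: "Legendre C (int p) = TL" unfolding even_C[OF that(1,2)] pw[OF pms(2), of e] pw[OF pms(3), of e] using ee by simp
  show ?thesis
  proof (cases "d = 2")
   case True
   obtain X' Z where X: "T = 2*X'" "odd X'" "~ int p dvd X'" "int p = X'\<^sup>2+2*Z\<^sup>2" "p mod 8 = 1 | p mod 8 = 3"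
    using two[OF True] by blast
   have p81: "p mod 8 = 1" using X(5) that(3) by presburger
   show ?thesis using theta2_eq_Legendre[OF p(1) p81 X(4,2,3)] True unfolding CT TL_def X(1) by simp
  next
   case False
   hence dp: "prime d" "d mod 4 = 3" using dd that(1) by auto
   interpret ip: inert_prime d by standard (rule dp)+
   show ?thesis using ip.dtheta_eq_Legendre[OF p(1) that(3) xf(4) TY pT psi_Legendre[OF x h dp, folded T_def]] False
    unfolding CT TL_def by simp
  qed
 qed
 have one: "p mod 4 = 1 & Legendre C (int p) = (if p mod 8 = 1 then 1 else NL)" if d1: "d = 1"
 proof -
  obtain a b where ab: "T = 2*a" "odd a" "int p = a\<^sup>2+b\<^sup>2" "p mod 4 = 1" using gauss[OF d1] by blast
  have pa: "~ int p dvd a" using pT unfolding ab(1) by (metis dvd_mult)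
  have "TL = Legendre 2 (int p)" unfolding TL_def ab(1) by (rule Legendre_trace_gauss[OF p(1) ab(4,3,2) pa])
  moreover have "EL = Legendre 2 (int p)" unfolding EL_def eps_int_def using d1 by simp
  \<comment> \<open>For d = 1 the value \<open>eps 1 = 2\<close> is chosen to have the same symbol
    as the trace.\<close>
  ultimately have TE: "EL = TL" by simp
  have "w = 4" using num_units_eq d1 by argo
  hence "4*e = p - 1" using we by (simp only:)
  hence ev: "even e \<longleftrightarrow> p mod 8 = 1" using p6 by presburger
  have "TL = 1" if "p mod 8 = 1"
  proof -
   have "Legendre 2 (int p) = jac 2 p" using p(1) by simp
   thus ?thesis using \<open>TL = Legendre 2 (int p)\<close> jac_two[OF op] that by simp
  qed
  hence TE1: "TL^n*(EL^e)^n = 1"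
  proof (cases "p mod 8 = 1")
   case True
   assume "p mod 8 = 1 ==> TL = 1"
   thus ?thesis using True TE by simp
  next
   case False
   have "EL^e = TL" using pw[OF pms(2), of e] ev False TE by simp
   moreover have "TL*TL = 1" using pms(1) by auto
   hence "TL^n*TL^n = 1" by (metis power_mult_distrib power_one)
   ultimately show ?thesis by simp
  qed
  have "Legendre C (int p) = NL^e" unfolding C2 TE1 by simp
  thus ?thesis unfolding pw[OF pms(3), of e] using ev ab(4) by simp
 qed
 show ?thesis
  by (intro exI[of _ C] conjI impI C(1) nC, elim conjE, rule odd_case[unfolded NL_def], assumption+, elim conjE,
   rule even3[unfolded NL_def], assumption+, elim conjE, rule even1, assumption+,
   rule one[unfolded NL_def, THEN conjunct1], assumption, rule one[unfolded NL_def, THEN conjunct2], assumption)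
qed

lemma generator_square_mod:
 assumes psi: "is_psi d \<psi>" and h: "odd (class_number d)" and cop: "coprime (int p) (disc_K d)"
  and r: "prime r" "r > 2" "r dvd d" "d > 3"
 shows "Legendre (int p) (int r) = 1"
proof -
 have pt: "ideal_prime_to d Q (disc_K d)" by (rule ideal_prime_to_int[OF Q_ideal Q_p cop])
 have x: "psi_generator d Q (\<psi> Q)" 
  by (rule psi[unfolded is_psi_def, THEN conjunct2, rule_format, OF Q_nz(2) pt, THEN conjunct2])
 note xf = psi_generator_facts[OF x h]
 have rint: "prime (int r)" using r by simp
 have n2: "~ int r dvd 2" using r by (auto dest!: zdvd_imp_le)
 have rp: "~ int r dvd int p"
 proof
  assume "int r dvd int p"
  hence "r = p" using r(1) p(1) primes_dvd_imp_eq by simp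
  thus False using p(3) r(3) by simp
 qed
 have rd: "int r dvd int d" using r(3) by simp
 have cg: "[2\<^sup>2*int p^psi_exp = (ca (\<psi> Q))\<^sup>2] (mod int r)" using xf(5) rd by (simp add: cong_iff_dvd_diff)
 have nT: "~ int r dvd ca (\<psi> Q)"
 proof
  assume "int r dvd ca (\<psi> Q)"
  hence "int r dvd (ca (\<psi> Q))\<^sup>2" by (simp add: power2_eq_square)
  hence "int r dvd (2*2)*int p^psi_exp" using cong_dvd_iff[OF cg] by simp
  hence "int r dvd int p^psi_exp" using n2 prime_dvd_mult_iff[OF rint] by blast
  thus False using prime_dvd_power[OF rint] rp by blast
 qed
 have "Legendre (2\<^sup>2*int p^psi_exp) (int r) = 1" using Legendre_cong[OF cg] Legendre_square[OF r(1) nT] by simp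
 hence e: "Legendre (int p) (int r)^psi_exp = 1" unfolding Legendre_mult[OF r(1)] Legendre_power[OF r(1), of "int p"] Legendre_square[OF r(1) n2] by simp
 have "Legendre (int p) (int r) ~= -1" using e xf(4) by auto
 thus ?thesis using Legendre_cases[of "int p" "int r"] rp Legendre_eq_0_iff by blast
qed

end

section \<open>Averages over the primes\<close>

text \<open>A mean value over primes in a strong form: the prime sum is A times the full one up to
  O(1). It is linear, insensitive to finitely many primes, and determines A.\<close>

definition avg :: "(nat \<Rightarrow> real) \<Rightarrow> real \<Rightarrow> bool" where
 "avg f A \<longleftrightarrow> (\<forall>s>1. (%p. f p * real p powr -s) summable_on {p. prime p}) \<and>
  (\<exists>B. eventually (%s. \<bar>prime_sum f s - A*prime_sum (%_. 1) s\<bar> <= B) (at_right 1))"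

lemma eventually_gt_1: "eventually (%s::real. s > 1) (at_right 1)"
 by (simp add: eventually_at_right_less)

lemma avg_add:
 assumes "avg f A" "avg g B"
 shows "avg (%p. f p+g p) (A+B)"
proof -
 have sm: "(%p. f p * real p powr -s) summable_on {p. prime p}" "(%p. g p * real p powr -s) summable_on {p. prime p}" if "s > 1" for s
  using assms that unfolding avg_def by simp_all
 obtain B1 where B1: "eventually (%s. \<bar>prime_sum f s - A*prime_sum (%_. 1) s\<bar> <= B1) (at_right 1)"
  using assms(1) unfolding avg_def by blast
 obtain B2 where B2: "eventually (%s. \<bar>prime_sum g s - B*prime_sum (%_. 1) s\<bar> <= B2) (at_right 1)"
  using assms(2) unfolding avg_def by blast
 have "eventually (%s. \<bar>prime_sum (%p. f p+g p) s - (A+B)*prime_sum (%_. 1) s\<bar> <= B1+B2) (at_right 1)"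
  using B1 B2 eventually_gt_1
 proof eventually_elim
  case (elim s)
  have "prime_sum (%p. f p+g p) s = prime_sum f s+prime_sum g s"
   unfolding prime_sum_def distrib_right using sm[OF elim(3)] by (rule infsum_add)
  moreover have "(A+B)*prime_sum (%_. 1) s = A*prime_sum (%_. 1) s+B*prime_sum (%_. 1) s" by (rule distrib_right)
  ultimately show ?case using elim(1,2) by argo
 qed
 moreover have "(%p. (f p+g p) * real p powr -s) summable_on {p. prime p}" if "s > 1" for s
  unfolding distrib_right using sm[OF that] by (rule summable_on_add)
 ultimately show ?thesis unfolding avg_def by blast
qed

lemma avg_cmult:
 assumes "avg f A"
 shows "avg (%p. k * f p) (k*A)"
proof -
 obtain B1 where B1: "eventually (%s. \<bar>prime_sum f s - A*prime_sum (%_. 1) s\<bar> <= B1) (at_right 1)"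
  using assms unfolding avg_def by blast
 have "eventually (%s. \<bar>prime_sum (%p. k * f p) s - (k*A)*prime_sum (%_. 1) s\<bar> <= \<bar>k\<bar>*B1) (at_right 1)"
  using B1
 proof eventually_elim
  case (elim s)
  have "prime_sum (%p. k * f p) s = k*prime_sum f s"
   unfolding prime_sum_def mult.assoc by (rule infsum_cmult_right')
  hence "prime_sum (%p. k * f p) s - (k*A)*prime_sum (%_. 1) s = k*(prime_sum f s - A*prime_sum (%_. 1) s)"
   by (simp add: algebra_simps)
  thus ?case using elim by (simp add: abs_mult mult_left_mono)
 qed
 moreover have "(%p. (k * f p) * real p powr -s) summable_on {p. prime p}" if "s > 1" for s
  unfolding mult.assoc using assms that unfolding avg_def by (intro summable_on_cmult_right) blast
 ultimately show ?thesis unfolding avg_def by blast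
qed

lemma avg_1: "avg (%_. 1) 1"
 unfolding avg_def
proof (intro conjI allI impI exI[of _ 0] always_eventually)
 fix s :: real assume "s > 1"
 thus "(%p. 1 * real p powr -s) summable_on {p. prime p}" by (intro summable_bounded[of _ 1]) simp_all
qed simp_all

lemma avg_finite:
 assumes E: "finite E" and f: "\<And>p. prime p ==> p \<notin> E ==> f p = 0"
 shows "avg f 0"
proof -
 define E' where "E' = E \<inter> {p. prime p}"
 have fE: "finite E'" using E by (simp add: E'_def)
 have sm: "(%p. f p * real p powr -s) summable_on {p. prime p} \<longleftrightarrow> (%p. f p * real p powr -s) summable_on E'" for s
  by (rule summable_on_cong_neutral) (use f in \<open>auto simp: E'_def\<close>)
 have eq: "prime_sum f s = (\<Sum>p\<in>E'. f p * real p powr -s)" for s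
 proof -
  have "prime_sum f s = (\<Sum>\<^sub>\<infinity>p\<in>E'. f p * real p powr -s)"
   unfolding prime_sum_def by (rule infsum_cong_neutral) (use f in \<open>auto simp: E'_def\<close>)
  also have "... = (\<Sum>p\<in>E'. f p * real p powr -s)" using fE by (rule infsum_finite)
  finally show ?thesis .
 qed
 have "eventually (%s. \<bar>prime_sum f s - 0*prime_sum (%_. 1) s\<bar> <= (\<Sum>p\<in>E'. \<bar>f p\<bar>)) (at_right 1)"
  using eventually_gt_1
 proof eventually_elim
  case (elim s)
  have "\<bar>prime_sum f s\<bar> <= (\<Sum>p\<in>E'. \<bar>f p * real p powr -s\<bar>)" unfolding eq by (rule sum_abs)
  also have "... <= (\<Sum>p\<in>E'. \<bar>f p\<bar>)"
  proof (rule sum_mono)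
   fix p assume "p \<in> E'"
   hence "real p \<ge> 1" using prime_ge_1_nat by (auto simp: E'_def)
   hence "real p powr -s <= real p powr 0" using elim by (intro powr_mono) simp_all
   hence "real p powr -s <= 1" using \<open>real p \<ge> 1\<close> by simp
   hence "\<bar>f p\<bar> * real p powr -s <= \<bar>f p\<bar>*1" by (intro mult_left_mono) simp_all
   thus "\<bar>f p * real p powr -s\<bar> <= \<bar>f p\<bar>" by (simp add: abs_mult)
  qed
  finally show ?case by simp
 qed
 thus ?thesis unfolding avg_def sm using fE by (blast intro: summable_on_finite)
qed

lemma avg_cong:
 assumes "avg f A" "finite E" "\<And>p. prime p ==> p \<notin> E ==> g p = f p"
 shows "avg g A"
proof -
 have "avg (%p. g p - f p) 0" using assms(2) by (rule avg_finite) (simp add: assms(3))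
 from avg_add[OF assms(1) this] show ?thesis by simp
qed

text \<open>The mean value of the quadratic character attached to \<beta>, see
  \<open>avg_qchar\<close>.\<close>

definition sq :: "int \<Rightarrow> real" where "sq \<beta> = (if \<exists>c. \<beta> = c\<^sup>2 then 1 else 0)"

lemma avg_qchar:
 assumes "\<beta> ~= 0"
 shows "avg (%p. of_int (qchar \<beta> p)) (sq \<beta>)"
proof (cases "\<exists>c. \<beta> = c\<^sup>2")
 case True
 then obtain c where c: "\<beta> = c\<^sup>2" by blast
 have c0: "c ~= 0" using assms c by auto
 have "avg (%p. of_int (qchar \<beta> p)) 1"
 proof (rule avg_cong[OF avg_1])
  have "finite {p. p dvd nat \<bar>c\<bar>}" by (rule finite_divisors_nat) (use c0 in simp)
  thus "finite ({..2} \<union> {p. p dvd nat \<bar>c\<bar>})" by (rule finite_UnI[OF finite_atMost])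
  fix p assume p: "prime p" "p \<notin> {..2} \<union> {p. p dvd nat \<bar>c\<bar>}"
  hence "~ int p dvd c" by simp
  hence "Legendre \<beta> (int p) = 1" unfolding c by (rule Legendre_square[OF p(1)])
  thus "real_of_int (qchar \<beta> p) = 1" using qchar_prime[OF p(1)] p(2) by simp
 qed
 thus ?thesis using True by (simp add: sq_def)
next
 case False
 have ab: "\<bar>real_of_int (qchar \<beta> n)\<bar> <= 1" for n using qchar_abs_le[of \<beta> n] by (simp add: of_int_abs[symmetric] del: of_int_abs)
 have "\<exists>B. eventually (%s. \<bar>prime_sum (%n. of_int (qchar \<beta> n)) s\<bar> <= B) (at_right 1)"
  by (rule prime_sum_qchar_bounded[OF assms False])
 thus ?thesis using False summable_bounded[OF ab] unfolding avg_def sq_def by simp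
qed

lemma avg_gprime:
 assumes "gauss_char \<theta> M" "\<exists>B. eventually (%s. \<bar>prime_sum (gprime_coeff \<theta>) s\<bar> <= B) (at_right 1)"
 shows "avg (gprime_coeff \<theta>) 0"
proof -
 interpret gauss_char \<theta> M by fact
 show ?thesis using gprime_coeff_has_sum(1) assms(2) unfolding avg_def by simp
qed

text \<open>Linear combinations of characters are kept as lists of coefficients and radicands, so
  that a density is read off by evaluating \<open>sq\<close>.\<close>

lemma avg_linear:
 assumes "\<forall>(k, \<beta>)\<in>set xs. \<beta> ~= 0"
 shows "avg (%p. c0+(\<Sum>(k, \<beta>)\<leftarrow>xs. k * of_int (qchar \<beta> p))) (c0+(\<Sum>(k, \<beta>)\<leftarrow>xs. k * sq \<beta>))"
 using assms
proof (induction xs)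
 case Nil
 show ?case using avg_cmult[OF avg_1, of c0] by simp
next
 case (Cons t xs)
 obtain k \<beta> where t: "t = (k, \<beta>)" by (cases t)
 have "avg (%p. (c0+(\<Sum>(k, \<beta>)\<leftarrow>xs. k * of_int (qchar \<beta> p)))+k * of_int (qchar \<beta> p)) ((c0+(\<Sum>(k, \<beta>)\<leftarrow>xs. k * sq \<beta>))+k * sq \<beta>)"
  by (rule avg_add[OF Cons.IH avg_cmult[OF avg_qchar]]) (use Cons.prems t in simp_all)
 thus ?case unfolding t by (simp add: algebra_simps)
qed

lemma avg_tendsto:
 assumes "avg f A"
 shows "((%s. prime_sum f s/prime_sum (%_. 1) s) \<longlongrightarrow> A) (at_right 1)"
proof -
 define P where "P = prime_sum (%_. 1)"
 obtain B where B: "eventually (%s. \<bar>prime_sum f s - A*P s\<bar> <= B) (at_right 1)"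
  using assms unfolding avg_def P_def by blast
 have top: "filterlim P at_top (at_right 1)" unfolding P_def by (rule prime_sum_at_top)
 have "((%s. B/P s) \<longlongrightarrow> 0) (at_right 1)"
  by (rule tendsto_divide_0[OF tendsto_const filterlim_at_top_imp_at_infinity[OF top]])
 moreover have "eventually (%s. norm (prime_sum f s/P s - A) <= B/P s) (at_right 1)"
  using B filterlim_at_top_dense[THEN iffD1, OF top, rule_format, of 0]
 proof eventually_elim
  case (elim s)
  have "prime_sum f s/P s - A = (prime_sum f s - A*P s)/P s" using elim(2) by (simp add: field_simps)
  hence "norm (prime_sum f s/P s - A) = \<bar>prime_sum f s - A*P s\<bar>/P s" using elim(2) by simp
  thus ?case using elim by (simp add: divide_right_mono)
 qed
 ultimately have "((%s. prime_sum f s/P s - A) \<longlongrightarrow> 0) (at_right 1)" by (rule Lim_null_comparison[rotated])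
 thus ?thesis unfolding P_def by (rule LIM_zero_cancel)
qed

lemma avg_unique: "avg f A ==> avg f B ==> A = B"
 using tendsto_unique[OF trivial_limit_at_right_real avg_tendsto avg_tendsto] by blast

lemma avg_density:
 assumes "avg (%p. if p \<in> S then 1 else 0) A" "\<And>p. p \<in> S ==> prime p"
 shows "has_dirichlet_density S A"
proof -
 have "prime_sum (%p. if p \<in> S then 1 else 0) s = (\<Sum>\<^sub>\<infinity>p\<in>S. real p powr -s)" for s
  unfolding prime_sum_def by (rule infsum_cong_neutral) (use assms(2) in auto)
 moreover have "prime_sum (%_. 1) s = (\<Sum>\<^sub>\<infinity>p\<in>{p. prime p}. real p powr -s)" for s
  unfolding prime_sum_def by simp
 ultimately show ?thesis using avg_tendsto[OF assms(1)] unfolding has_dirichlet_density_def by simp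
qed

section \<open>Square classes and discriminants\<close>

text \<open>Here y is x times the square of z/x. By \<open>square_rat\<close> that quotient is an
  integer, and its square divides the squarefree y.\<close>

lemma squarefree_mult_square:
 fixes x y z :: int
 assumes "squarefree x" "squarefree y" "x*y = z\<^sup>2"
 shows "x = y"
proof (cases "x = 1")
 case True
 hence "y = z\<^sup>2" using assms(3) by simp
 hence "is_unit z" using squarefreeD[OF assms(2), of z] by simp
 hence "z\<^sup>2 = 1" by (auto simp: zdvd1_eq power2_eq_1_iff)
 thus ?thesis using True \<open>y = z\<^sup>2\<close> by simp
next
 case False
 interpret quad x using assms(1) False by unfold_locales
 have x0: "(of_int x :: rat) ~= 0" using \<beta>0 by simp
 have zz: "(of_int z :: rat)\<^sup>2 = of_int x * of_int y" using assms(3) by (metis of_int_mult of_int_power)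
 have "of_int x*(of_int z / of_int x)\<^sup>2 = (of_int y :: rat)" using x0 unfolding power_divide zz by (simp add: power2_eq_square)
 hence "of_int x*(of_int z / of_int x :: rat)\<^sup>2 \<in> \<int>" by (simp only: Ints_of_int)
 hence "(of_int z / of_int x :: rat) \<in> \<int>" by (rule square_rat)
 then obtain w where w: "of_int z / of_int x = (of_int w :: rat)" by (elim Ints_cases)
 hence "(of_int z :: rat) = of_int (w*x)" using x0 by (simp add: field_simps)
 hence z: "z = w*x" by (simp only: of_int_eq_iff)
 have "x*y = x*(w\<^sup>2*x)" using assms(3) unfolding z by (simp add: power2_eq_square mult_ac)
 hence y: "y = w\<^sup>2*x" using \<beta>0 by (simp only: mult_cancel_left) simp
 hence "is_unit w" using squarefreeD[OF assms(2), of w] by simp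
 hence "w\<^sup>2 = 1" by (auto simp: zdvd1_eq power2_eq_1_iff)
 thus ?thesis using y by simp
qed

lemma squarefree_decomposition:
 fixes n :: int
 assumes "n ~= 0"
 shows "\<exists>\<beta> q. squarefree \<beta> & q ~= 0 & n = \<beta>*q\<^sup>2"
 using assms
proof (induction "nat \<bar>n\<bar>" arbitrary: n rule: less_induct)
 case less
 show ?case
 proof (cases "squarefree n")
  case True
  thus ?thesis by (intro exI[of _ n] exI[of _ 1]) simp
 next
  case False
  then obtain x where x: "x\<^sup>2 dvd n" "~ is_unit x" unfolding squarefree_def by blast
  then obtain m where m: "n = x\<^sup>2 * m" by blast
  have x0: "x ~= 0" "m ~= 0" using m less.prems by auto
  have "\<bar>x\<bar> > 1" using x(2) x0(1) by (auto simp: zdvd1_eq)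
  hence "1 < \<bar>x\<bar>\<^sup>2" by (rule one_less_power) simp
  hence "\<bar>m\<bar>*1 < \<bar>m\<bar>*x\<^sup>2" using x0 by (intro mult_strict_left_mono) simp_all
  hence "\<bar>m\<bar> < \<bar>n\<bar>" unfolding m by (simp add: abs_mult mult.commute)
  hence "nat \<bar>m\<bar> < nat \<bar>n\<bar>" by simp
  then obtain \<beta> q where "squarefree \<beta>" "q ~= 0" "m = \<beta>*q\<^sup>2" using less.hyps x0 by blast
  thus ?thesis using x0 m by (intro exI[of _ \<beta>] exI[of _ "x*q"]) (simp add: power_mult_distrib)
 qed
qed

lemma sq_scaled:
 assumes "squarefree \<gamma>" "squarefree \<beta>" "q ~= 0"
 shows "sq (\<gamma>*(\<beta>*q\<^sup>2)) = (if \<beta> = \<gamma> then 1 else 0)"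
proof -
 have "(\<exists>c. \<gamma>*(\<beta>*q\<^sup>2) = c\<^sup>2) \<longleftrightarrow> \<beta> = \<gamma>"
 proof
  assume "\<exists>c. \<gamma>*(\<beta>*q\<^sup>2) = c\<^sup>2"
  then obtain c where c: "(\<gamma>*\<beta>)*q\<^sup>2 = c\<^sup>2" by (auto simp: mult.assoc)
  hence "q\<^sup>2 dvd c\<^sup>2" by (metis dvd_triv_right)
  hence "q dvd c" by (simp add: pow_divides_pow_iff)
  then obtain t where "c = q*t" by blast
  hence "(\<gamma>*\<beta>)*q\<^sup>2 = t\<^sup>2*q\<^sup>2" using c by (simp add: power_mult_distrib mult.commute)
  hence "\<gamma>*\<beta> = t\<^sup>2" using assms(3) by simp
  thus "\<beta> = \<gamma>" using squarefree_mult_square[OF assms(1,2)] by simp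
 next
  assume "\<beta> = \<gamma>"
  thus "\<exists>c. \<gamma>*(\<beta>*q\<^sup>2) = c\<^sup>2" by (intro exI[of _ "\<gamma>*q"]) (simp add: power2_eq_square)
 qed
 thus ?thesis by (simp add: sq_def)
qed

definition disc_of :: "int \<Rightarrow> int" where "disc_of \<beta> = (if \<beta> mod 4 = 1 then \<beta> else 4*\<beta>)"

text \<open>The value modulo 4 tells which branch was taken. Injectivity turns conditions on
  D(\<alpha>) into conditions on the squarefree part \<beta>.\<close>

lemma disc_of_inj: "disc_of \<beta> = disc_of \<gamma> \<longleftrightarrow> \<beta> = \<gamma>"
proof
 assume "disc_of \<beta> = disc_of \<gamma>"
 thus "\<beta> = \<gamma>" unfolding disc_of_def by (auto split: if_splits)
qed simp

text \<open>Numerator times denominator lies in the same square class as the fraction.\<close>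

lemma quad_disc_of:
 assumes "\<alpha> ~= 0" "squarefree \<beta>" "q ~= 0" "num_den \<alpha> = \<beta>*q\<^sup>2"
 shows "quad_disc \<alpha> = disc_of \<beta>"
proof -
 obtain a b where qa: "quotient_of \<alpha> = (a, b)" by (cases "quotient_of \<alpha>")
 have al: "\<alpha> = of_int a / of_int b" "b > 0" using qa quotient_of_div quotient_of_denom_pos by blast+
 have nd: "a*b = \<beta>*q\<^sup>2" using assms(4) by (simp add: num_den_def qa)
 have "\<alpha> = of_int (a*b)/(of_int b)\<^sup>2" unfolding al(1) using al(2) by (simp add: power2_eq_square)
 hence e: "\<alpha> = of_int \<beta>*(of_int q / of_int b)\<^sup>2" unfolding nd by (simp add: power_divide)
 show ?thesis
 proof (cases "\<beta> = 1")
  case True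
  hence "\<alpha> = (of_int q / of_int b)\<^sup>2" using e by simp
  hence "\<exists>r. \<alpha> = r\<^sup>2" by blast
  thus ?thesis using True by (simp add: quad_disc_def disc_of_def)
 next
  case False
  interpret quad \<beta> using assms(2) False by unfold_locales
  have "quad_disc \<alpha> = disc" by (rule quad_disc_eq[OF _ e]) (use assms(3) al(2) in simp)
  thus ?thesis by (simp add: disc_def disc_of_def)
 qed
qed

lemma (in Kd) disc_K_eq: "disc_K d = disc_of (- int d)"
proof -
 have "quad_disc (- of_nat d) = disc" by (rule quad_disc_eq[of 1]) simp_all
 thus ?thesis by (simp add: disc_K_def disc_def disc_of_def)
qed

section \<open>Densities\<close>

lemma nonzero_mod_int: "nonzero_mod (of_int C) p \<longleftrightarrow> ~ int p dvd C"
 unfolding nonzero_mod_def by auto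

lemma nonzero_power_mod_2: "nonzero_power_mod 2 (of_int C) p \<longleftrightarrow> Legendre C (int p) = 1"
proof -
 have "nonzero_power_mod 2 (of_int C) p \<longleftrightarrow> ~ int p dvd C & QuadRes (int p) C"
  unfolding nonzero_power_mod_def QuadRes_def by auto
 also have "... \<longleftrightarrow> Legendre C (int p) = 1" unfolding Legendre_def by (simp add: cong_0_iff)
 finally show ?thesis .
qed

definition value_of :: "nat \<Rightarrow> nat \<Rightarrow> (gint \<Rightarrow> complex) \<Rightarrow> int \<Rightarrow> nat \<Rightarrow> int \<Rightarrow> bool" where
 "value_of d k \<theta> \<nu> p C \<longleftrightarrow>
  (d ~= 1 & odd k \<longrightarrow> Legendre C (int p) = (if p mod 4 = 1 then 1 else Legendre \<nu> (int p)))
  & (d ~= 1 & even k & p mod 4 = 3 \<longrightarrow> Legendre C (int p) = Legendre \<nu> (int p))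
  & (d ~= 1 & even k & p mod 4 = 1 \<longrightarrow> 2 * of_int (Legendre C (int p)) = gprime_coeff \<theta> p)
  & (d = 1 \<longrightarrow> p mod 4 = 1 & Legendre C (int p) = (if p mod 8 = 1 then 1 else Legendre \<nu> (int p)))"

context Kd
begin

lemma ex_split_prime:
 assumes "prime p" "p > 2" "~ p dvd d" "Legendre (- int d) (int p) = 1"
 shows "\<exists>c. split_prime d p c"
proof -
 have "QuadRes (int p) (- int d)" using assms(4) unfolding Legendre_def by (auto split: if_splits)
 then obtain c where "[c\<^sup>2 = - int d] (mod int p)" unfolding QuadRes_def by blast
 hence "int p dvd c\<^sup>2+int d" by (simp add: cong_iff_dvd_diff)
 hence "split_prime d p c" using assms by unfold_locales
 thus ?thesis by blast
qed

lemma good_prime: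
 assumes p: "prime p" "p > 6" "~ int p dvd 4*int d*\<nu>"
 shows "~ p dvd d" "~ int p dvd \<nu>" "coprime (int p) (disc_K d*\<nu>)" "coprime (int p) (disc_K d)"
  "Legendre (- int d) (int p) = 1 | Legendre (- int d) (int p) = -1"
  "Legendre \<nu> (int p) = 1 | Legendre \<nu> (int p) = -1"
proof -
 have pint: "prime (int p)" using p by simp
 show nd: "~ p dvd d"
 proof
  assume "p dvd d"
  hence "int p dvd int d" by simp
  hence "int p dvd 4*int d*\<nu>" by simp
  thus False using p(3) by blast
 qed
 show nn: "~ int p dvd \<nu>" using p(3) by auto
 have "~ int p dvd disc_K d"
 proof
  assume "int p dvd disc_K d"
  hence "int p dvd 4*int d" unfolding disc_K_eq disc_of_def by (auto split: if_splits)
  hence "int p dvd 4*int d*\<nu>" by simp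
  thus False using p(3) by blast
 qed
 thus c: "coprime (int p) (disc_K d)" using prime_imp_coprime[OF pint] by blast
 have "coprime (int p) \<nu>" using nn prime_imp_coprime[OF pint] by blast
 thus "coprime (int p) (disc_K d*\<nu>)" using c by simp
 have "~ int p dvd - int d" using nd by simp
 thus "Legendre (- int d) (int p) = 1 | Legendre (- int d) (int p) = -1"
  using Legendre_cases[of "- int d" "int p"] Legendre_eq_0_iff by blast
 show "Legendre \<nu> (int p) = 1 | Legendre \<nu> (int p) = -1"
  using nn Legendre_cases[of \<nu> "int p"] Legendre_eq_0_iff by blast
qed

lemma finite_bad: "\<nu> ~= 0 ==> finite {p. p <= 6 | int p dvd 4*int d*\<nu>}"
proof -
 assume n: "\<nu> ~= 0"
 have "finite {p. p dvd nat \<bar>4*int d*\<nu>\<bar>}" by (rule finite_divisors_nat) (use n d_pos in simp)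
 hence "finite ({..6} \<union> {p. p dvd nat \<bar>4*int d*\<nu>\<bar>})" by (rule finite_UnI[OF finite_atMost])
 moreover have "{p. p <= 6 | int p dvd 4*int d*\<nu>} \<subseteq> {..6} \<union> {p. p dvd nat \<bar>4*int d*\<nu>\<bar>}"
  by (auto simp: int_dvd_int_iff[symmetric] simp del: int_dvd_int_iff)
 ultimately show ?thesis by (rule finite_subset[rotated])
qed

lemma sq_neg: "n > 0 ==> sq (- int n) = 0"
proof -
 assume n: "n > 0"
 have "~ (\<exists>c. - int n = c\<^sup>2)"
 proof
  assume "\<exists>c. - int n = c\<^sup>2"
  then obtain c where "- int n = c\<^sup>2" by blast
  moreover have "0 <= c\<^sup>2" by simp
  ultimately show False using n by linarith
 qed
 thus ?thesis by (simp add: sq_def)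
qed

text \<open>A prime that splits has \<open>4 p ^ m = T\<^sup>2+d Y\<^sup>2\<close> with \<open>m\<close> odd, so it is a square modulo
 every odd prime divisor \<open>r\<close> of \<open>d\<close>; comparing densities forces \<open>d = r\<close>.\<close>

lemma d_cases:
 assumes psi: "is_psi d \<psi>" and h: "odd (class_number d)"
 shows "d = 1 | d = 2 | prime d & d mod 4 = 3"
proof (cases "d <= 3")
 case True
 hence "d = 1 | d = 2 | d = 3" using d_pos by auto
 thus ?thesis by auto
next
 case False
 hence d3: "d > 3" by simp
 have "\<exists>r. prime r & r > 2 & r dvd d"
 proof -
  have ex: "\<exists>r. prime r & r > 2 & r dvd m" if "odd m" "m > 1" for m :: nat
  proof -
   obtain r where r: "prime r" "r dvd m" using prime_factor_nat[of m] \<open>m > 1\<close> by auto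
   have "r ~= 2" using r(2) \<open>odd m\<close> by auto
   hence "r > 2" using prime_ge_2_nat[OF r(1)] by simp
   thus ?thesis using r by blast
  qed
  show ?thesis
  proof (cases "odd d")
   case True
   thus ?thesis using ex[of d] d3 by simp
  next
   case False
   then obtain m where m: "d = 2 * m" by blast
   have "odd m"
   proof
    assume "even m"
    hence "2\<^sup>2 dvd d" unfolding m by (simp add: power2_eq_square)
    hence "(2::nat) dvd 1" using squarefreeD[OF sqfree_d] by blast
    thus False by simp
   qed
   moreover have "m > 1" using d3 m by simp
   ultimately obtain r where "prime r" "r > 2" "r dvd m" using ex by blast
   thus ?thesis unfolding m by auto
  qed
 qed
 then obtain r where r: "prime r" "r > 2" "r dvd d" by blast
 \<comment> \<open>The sign makes (rs/p) = (p/r) for every odd prime p different from r, whatever p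
   is modulo 4.\<close>
 define rs where "rs = (if r mod 4 = 1 then int r else - int r)"
 have r4: "r mod 4 = 1 | r mod 4 = 3" using prime_odd_nat[OF r(1,2)] by presburger
 have rs0: "rs ~= 0" using r(2) by (simp add: rs_def)
 have rec: "Legendre rs (int p) = Legendre (int p) (int r)" if p: "prime p" "p > 2" "p ~= r" for p
 proof (cases "r mod 4 = 1")
  case True
  thus ?thesis using Legendre_reciprocity[OF p(1,2) r(1,2) p(3)] by (simp add: rs_def)
 next
  case False
  have "rs = (-1)*int r" using False by (simp add: rs_def)
  hence e1: "Legendre rs (int p) = Legendre (-1) (int p)*Legendre (int r) (int p)" by (simp only: Legendre_mult[OF p(1)])
  have r3: "r mod 4 = 3" using False r4 by blast
  have "p mod 4 = 1 | p mod 4 = 3" using prime_odd_nat[OF p(1,2)] by presburger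
  thus ?thesis
  proof
   assume p4: "p mod 4 = 1"
   hence "Legendre (int p) (int r) = Legendre (int r) (int p)" using Legendre_reciprocity[OF p(1,2) r(1,2) p(3)] by simp
   thus ?thesis unfolding e1 Legendre_minus_one[OF p(1,2)] using p4 by simp
  next
   assume p4: "p mod 4 = 3"
   hence "Legendre (int p) (int r) = - Legendre (int r) (int p)" using Legendre_reciprocity[OF p(1,2) r(1,2) p(3)] r3 by simp
   thus ?thesis unfolding e1 Legendre_minus_one[OF p(1,2)] using p4 by simp
  qed
 qed
 have sqrs: "sq rs = 0"
 proof (cases "r mod 4 = 1")
  case True
  have "~ (\<exists>c. int r = c\<^sup>2)"
  proof
   assume "\<exists>c. int r = c\<^sup>2"
   then obtain c where c: "int r = c\<^sup>2" by blast
   have sf: "squarefree (int r)" using r(1) by (intro squarefree_prime) simp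
   have "c\<^sup>2 dvd int r" using c by simp
   hence "c dvd 1" by (rule squarefreeD[OF sf])
   hence "c\<^sup>2 = 1" by (auto simp: zdvd1_eq power2_eq_1_iff)
   thus False using c r(2) by simp
  qed
  thus ?thesis using True by (simp add: rs_def sq_def)
 next
  case False
  thus ?thesis using sq_neg[of r] r(2) by (simp add: rs_def)
 qed
 \<comment> \<open>Up to finitely many primes, four times the indicator of (-d/p) = 1 and (rs/p) =
   -1. Since almost no prime satisfies both, the mean of f is 0; computed from characters it is
   \<open>1 - sq (- int d * rs)\<close>, so the product is a square.\<close>
 define f where "f p = (1 + real_of_int (qchar (- int d) p))*(1 - real_of_int (qchar rs p))" for p
 have "avg (%p. 1+(\<Sum>(k, \<beta>)\<leftarrow>[(1, - int d), (-1, rs), (-1, - int d * rs)]. k * of_int (qchar \<beta> p)))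
   (1+(\<Sum>(k, \<beta>)\<leftarrow>[(1, - int d), (-1, rs), (-1, - int d * rs)]. k * sq \<beta>))"
  by (rule avg_linear) (use rs0 d_pos in auto)
 hence av: "avg (%p. 1+(\<Sum>(k, \<beta>)\<leftarrow>[(1, - int d), (-1, rs), (-1, - int d * rs)]. k * of_int (qchar \<beta> p))) (1 - sq (- int d * rs))"
  using sqrs sq_neg[OF d_pos] by simp
 have fin: "finite {p. p <= 6 | int p dvd 4*int d*1}" by (rule finite_bad) simp
 have av1: "avg f (1 - sq (- int d * rs))"
 proof (rule avg_cong[OF av fin])
  fix p assume p: "prime p" "p \<notin> {p. p <= 6 | int p dvd 4*int d*1}"
  hence p2: "p > 2" by simp
  show "f p = 1+(\<Sum>(k, \<beta>)\<leftarrow>[(1, - int d), (-1, rs), (-1, - int d * rs)]. k * of_int (qchar \<beta> p))"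
   unfolding f_def
   by (simp only: list.map sum_list.Cons sum_list.Nil prod.case qchar_prime[OF p(1) p2] Legendre_mult[OF p(1)] of_int_mult)
    (simp add: algebra_simps)
 qed
 have av0: "avg f 0"
 proof (rule avg_finite[OF fin])
  fix p assume p: "prime p" "p \<notin> {p. p <= 6 | int p dvd 4*int d*1}"
  hence p6: "p > 6" "~ int p dvd 4*int d*1" and p2: "p > 2" by auto
  note gp = good_prime[OF p(1) p6]
  show "f p = 0"
  proof (cases "Legendre (- int d) (int p) = 1")
   case True
   obtain c where "split_prime d p c" using ex_split_prime[OF p(1) p2 gp(1) True] by blast
   then interpret S: split_prime d p c .
   have "Legendre (int p) (int r) = 1" by (rule S.generator_square_mod[OF psi h gp(4) r d3])
   moreover have "p ~= r" using gp(1) r(3) by blast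
   ultimately show ?thesis unfolding f_def qchar_prime[OF p(1) p2] using rec[OF p(1) p2] by simp
  next
   case False
   thus ?thesis unfolding f_def qchar_prime[OF p(1) p2] using gp(5) by auto
  qed
 qed
 have "sq (- int d * rs) = 1" using avg_unique[OF av1 av0] by simp
 then obtain c where c: "- int d * rs = c\<^sup>2" unfolding sq_def by (auto split: if_splits)
 have dr0: "0 < int d*int r" using d_pos r(2) by simp
 have r3: "r mod 4 = 3"
 proof (rule ccontr)
  assume "r mod 4 ~= 3"
  hence "- (int d*int r) = c\<^sup>2" using c r4 by (simp add: rs_def)
  moreover have "0 <= c\<^sup>2" by simp
  ultimately show False using dr0 by linarith
 qed
 hence "int d*int r = c\<^sup>2" using c by (simp add: rs_def)
 moreover have "squarefree (int r)" using r(1) by (intro squarefree_prime) simp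
 ultimately have "int d = int r" using squarefree_mult_square[OF squarefree_int_of_nat[OF sqfree_d]] by blast
 hence "d = r" by simp
 thus ?thesis using r(1) r3 by simp
qed

end

theorem theorem3p3:
  fixes d k N :: nat and \<alpha> :: rat
    and f :: "complex \<Rightarrow> complex" and a :: "nat \<Rightarrow> complex"
  assumes "d > 0" and "squarefree d" and "odd (class_number d)"
    and "k \<ge> 2" and "[k = 1] (mod class_number d)"
    and "\<alpha> \<noteq> 0"
    and "is_f_alpha d k \<alpha> N f a"
  shows "(d \<noteq> 1 \<and> even k \<longrightarrow>
            has_delta 2 a (if quad_disc \<alpha> \<in> {1, disc_K d} then 3 / 4
                           else if quad_disc \<alpha> \<in> {- 4, 4 * int d} then 1 / 4 else 1 / 2))
       \<and> (d \<noteq> 1 \<and> odd k \<longrightarrow>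
            has_delta 2 a (if quad_disc \<alpha> \<in> {1, disc_K d} then 1
                           else if quad_disc \<alpha> \<in> {- 4, 4 * int d} then 1 / 2 else 3 / 4))
       \<and> (d = 1 \<longrightarrow>
            has_delta 2 a (if quad_disc \<alpha> \<in> {1, - 4} then 1
                           else if quad_disc \<alpha> \<in> {8, - 8} then 1 / 2 else 3 / 4))"
proof -
 interpret Kd d using assms(1,2) by unfold_locales
 obtain \<psi> \<rho> where psi: "is_psi d \<psi>" and tw: "is_psi_twist d k \<alpha> \<psi> \<rho>"
  and an: "\<forall>n>0. coprime (int n) (disc_K d*num_den \<alpha>) \<longrightarrow> a n = g_coeff d \<alpha> \<rho> n"
  using assms(7) unfolding is_f_alpha_def by (elim conjE exE)
 have dd: "d = 1 | d = 2 | prime d & d mod 4 = 3" by (rule d_cases[OF psi assms(3)])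
 define \<nu> where "\<nu> = num_den \<alpha>"
 have n0: "\<nu> ~= 0"
 proof -
  obtain u v where q: "quotient_of \<alpha> = (u, v)" by (cases "quotient_of \<alpha>")
  have "v > 0" "\<alpha> = of_int u / of_int v" using q quotient_of_denom_pos quotient_of_div by blast+
  hence "u ~= 0" "v ~= 0" using assms(6) by auto
  thus ?thesis by (simp add: \<nu>_def num_den_def q)
 qed
 obtain \<beta> q where bq: "squarefree \<beta>" "q ~= 0" "\<nu> = \<beta>*q\<^sup>2" using squarefree_decomposition[OF n0] by blast
 have qd: "quad_disc \<alpha> = disc_of \<beta>" by (rule quad_disc_of[OF assms(6) bq(1,2)]) (use bq(3) in \<open>simp add: \<nu>_def\<close>)
 define E where "E = {p. p <= 6 | int p dvd 4*int d*\<nu>}"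
 have finE: "finite E" unfolding E_def by (rule finite_bad[OF n0])
 define S1 where "S1 = {p. prime p & [p = 1] (mod 2) & nonzero_mod (a p) p}"
 define S2 where "S2 = {p. prime p & [p = 1] (mod 2) & nonzero_power_mod 2 (a p) p}"
 define \<theta> where "\<theta> = (if d = 2 then theta2 else inert_prime.dtheta d)"
 have good: "p > 6" "~ int p dvd 4*int d*\<nu>" "[p = 1] (mod 2)" if p: "prime p" "p \<notin> E" for p
 proof -
  show "p > 6" "~ int p dvd 4*int d*\<nu>" using p by (auto simp: E_def)
  hence "odd p" using prime_odd_nat[OF p(1)] by simp
  thus "[p = 1] (mod 2)" unfolding cong_def by presburger
 qed
 have ap: "a p = g_coeff d \<alpha> \<rho> p" if p: "prime p" "p \<notin> E" for p
  using an good_prime(3)[OF p(1) good(1,2)[OF p]] prime_gt_0_nat[OF p(1)] unfolding \<nu>_def by blast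
 \<comment> \<open>Above a prime that does not split there is no ideal of norm p, so the sum
   defining the coefficient is empty.\<close>
 have inert: "p \<notin> S1 & p \<notin> S2" if p: "prime p" "p \<notin> E" "Legendre (- int d) (int p) = -1" for p
 proof -
  note g = good[OF p(1,2)] and gp = good_prime[OF p(1) good(1,2)[OF p(1,2)]]
  have "p > 2" using g(1) by simp
  hence emp: "{I. I \<in> nz_ideals d & ideal_prime_to d I (disc_K d) & ideal_prime_to d I (num_den \<alpha>) & ideal_norm d I = p} = {}"
   using no_ideal_inert[OF p(1) _ gp(1) p(3)] by (auto simp: nz_ideals_def)
  have "a p = of_int 0" unfolding ap[OF p(1,2)] g_coeff_def emp by simp
  hence "~ nonzero_mod (a p) p & ~ nonzero_power_mod 2 (a p) p"
   by (simp only: nonzero_mod_int nonzero_power_mod_2 Legendre_eq_0_iff[of 0 "int p", THEN iffD2, OF dvd_0_right]) simp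
  thus ?thesis by (simp add: S1_def S2_def)
 qed
 have split: "p \<in> S1 & (\<exists>C. (p \<in> S2 \<longleftrightarrow> Legendre C (int p) = 1) \<and>
   (Legendre C (int p) = 1 | Legendre C (int p) = -1) & value_of d k \<theta> \<nu> p C)"
  if p: "prime p" "p \<notin> E" "Legendre (- int d) (int p) = 1" for p
 proof -
  note g = good[OF p(1,2)] and gp = good_prime[OF p(1) good(1,2)[OF p(1,2)]]
  have p2: "p > 2" using g(1) by simp
  obtain c where "split_prime d p c" using ex_split_prime[OF p(1) p2 gp(1) p(3)] by blast
  then interpret S: split_prime d p c .
  have "\<exists>C. g_coeff d \<alpha> \<rho> p = of_int C & ~ int p dvd C & value_of d k \<theta> \<nu> p C"
   using S.local_value[OF dd assms(3) g(1) assms(4,5) psi tw gp(3)[unfolded \<nu>_def]]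
   unfolding value_of_def \<theta>_def \<nu>_def .
  then obtain C where C: "g_coeff d \<alpha> \<rho> p = of_int C" "~ int p dvd C" "value_of d k \<theta> \<nu> p C" by blast
  have aC: "a p = of_int C" using ap[OF p(1,2)] C(1) by simp
  have h1: "p \<in> S1" using p(1) g(3) C(2) by (simp add: S1_def aC nonzero_mod_int)
  have h2: "p \<in> S2 \<longleftrightarrow> Legendre C (int p) = 1" using p(1) g(3) by (simp add: S2_def aC nonzero_power_mod_2)
  have h3: "Legendre C (int p) = 1 | Legendre C (int p) = -1"
   using C(2) Legendre_cases[of C "int p"] Legendre_eq_0_iff by blast
  show ?thesis
   using h1 h2 h3 C(3) by blast
 qed
 have sqd: "sq (- int d) = 0" by (rule sq_neg[OF d_pos])
 have sqm: "sq (-1) = 0" using sq_neg[of 1] by simp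
 \<comment> \<open>Half of the primes split, and at almost all of them the coefficient is nonzero
   modulo p. The denominator is therefore 1/2.\<close>
 have delta: "has_delta 2 a \<delta>" if A: "avg (%p. if p \<in> S2 then 1 else 0) A" "\<delta> = A/(1/2)" for A \<delta>
 proof -
  have "avg (%p. 1/2+(\<Sum>(k, \<beta>)\<leftarrow>[(1/2, - int d)]. k * of_int (qchar \<beta> p))) (1/2+(\<Sum>(k, \<beta>)\<leftarrow>[(1/2, - int d)]. k * sq \<beta>))"
   by (rule avg_linear) (use d_pos in simp)
  hence av: "avg (%p. 1/2+1/2 * of_int (qchar (- int d) p)) (1/2)" using sqd by simp
  have "avg (%p. if p \<in> S1 then 1 else 0) (1/2)"
  proof (rule avg_cong[OF av finE])
   fix p assume p: "prime p" "p \<notin> E"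
   have p2: "p > 2" using good(1)[OF p] by simp
   have "Legendre (- int d) (int p) = 1 | Legendre (- int d) (int p) = -1" by (rule good_prime(5)[OF p(1) good(1,2)[OF p]])
   thus "(if p \<in> S1 then 1 else 0) = 1/2+1/2 * real_of_int (qchar (- int d) p)"
    unfolding qchar_prime[OF p(1) p2] using inert[OF p, THEN conjunct1] split[OF p, THEN conjunct1] by auto
  qed
  hence "has_dirichlet_density S1 (1/2)" by (rule avg_density) (simp add: S1_def)
  moreover have "has_dirichlet_density S2 A" using A(1) by (rule avg_density) (simp add: S2_def)
  ultimately show ?thesis unfolding has_delta_def S1_def[symmetric] S2_def[symmetric] using A(2) by (intro exI[of _ A] exI[of _ "1/2"]) simp
 qed
 have sfd: "squarefree (int d)" by (rule squarefree_int_of_nat[OF sqfree_d])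
 have sf2: "squarefree (2::int)" by (intro squarefree_prime) simp
 \<comment> \<open>Each twist of \<nu> is a square for exactly one squarefree \<beta>; this is how
   the exceptional discriminants arise.\<close>
 have sqn: "sq \<nu> = (if \<beta> = 1 then 1 else 0)" "sq (- \<nu>) = (if \<beta> = -1 then 1 else 0)"
  "sq (int d*\<nu>) = (if \<beta> = int d then 1 else 0)" "sq (- (int d*\<nu>)) = (if \<beta> = - int d then 1 else 0)"
  "sq (2*\<nu>) = (if \<beta> = 2 then 1 else 0)" "sq (- (2*\<nu>)) = (if \<beta> = -2 then 1 else 0)"
  using sq_scaled[of 1 \<beta> q] sq_scaled[of "-1" \<beta> q] sq_scaled[of "int d" \<beta> q] sq_scaled[of "- int d" \<beta> q]
   sq_scaled[of 2 \<beta> q] sq_scaled[of "-2" \<beta> q] bq(1,2) sfd sf2 unfolding bq(3) by simp_all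
 have L: "qchar (int d) p = Legendre (-1) (int p)*Legendre (- int d) (int p)"
  "qchar (- \<nu>) p = Legendre (-1) (int p)*Legendre \<nu> (int p)"
  "qchar (int d*\<nu>) p = Legendre (-1) (int p)*Legendre (- int d) (int p)*Legendre \<nu> (int p)"
  "qchar (- (int d*\<nu>)) p = Legendre (- int d) (int p)*Legendre \<nu> (int p)"
  "qchar (2*\<nu>) p = Legendre 2 (int p)*Legendre \<nu> (int p)"
  "qchar (- (2*\<nu>)) p = Legendre (-1) (int p)*Legendre 2 (int p)*Legendre \<nu> (int p)"
  "qchar (- 2) p = Legendre (-1) (int p)*Legendre 2 (int p)"
  "qchar (-1) p = Legendre (-1) (int p)" "qchar \<nu> p = Legendre \<nu> (int p)" "qchar (- int d) p = Legendre (- int d) (int p)"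
  "qchar 2 p = Legendre 2 (int p)"
  if "prime p" "p > 2" for p
  unfolding qchar_prime[OF that] Legendre_mult[OF that(1), symmetric] by simp_all
 have m: "Legendre (-1) (int p) = (if p mod 4 = 1 then 1 else -1)" "p mod 4 = 1 | p mod 4 = 3" if "prime p" "p > 2" for p
 proof -
  show "Legendre (-1) (int p) = (if p mod 4 = 1 then 1 else -1)" by (rule Legendre_minus_one[OF that])
  show "p mod 4 = 1 | p mod 4 = 3" using prime_odd_nat[OF that] by presburger
 qed
 have qK: "quad_disc \<alpha> \<in> {1, disc_K d} \<longleftrightarrow> \<beta> = 1 | \<beta> = - int d"
 proof -
  have one: "disc_of 1 = 1" by (simp add: disc_of_def)
  have "disc_of \<beta> = 1 \<longleftrightarrow> \<beta> = 1" using disc_of_inj[of \<beta> 1] unfolding one .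
  thus ?thesis unfolding qd disc_K_eq using disc_of_inj[of \<beta> "- int d"] by simp
 qed
 have q4: "quad_disc \<alpha> \<in> {- 4, 4*int d} \<longleftrightarrow> \<beta> = -1 | \<beta> = int d" if "d ~= 1"
 proof -
  have "d mod 4 = 2 | d mod 4 = 3" using dd that by auto
  hence "int d mod 4 ~= 1" by presburger
  hence e: "disc_of (-1) = -4" "disc_of (int d) = 4*int d" by (simp_all add: disc_of_def)
  have "disc_of \<beta> = -4 \<longleftrightarrow> \<beta> = -1" "disc_of \<beta> = 4*int d \<longleftrightarrow> \<beta> = int d"
   using disc_of_inj[of \<beta> "-1"] disc_of_inj[of \<beta> "int d"] unfolding e .
  thus ?thesis unfolding qd by simp
 qed
 have p2: "p > 2" if "prime p" "p \<notin> E" for p using good(1)[OF that] by simp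
 have odd_case: "has_delta 2 a (if quad_disc \<alpha> \<in> {1, disc_K d} then 1 else if quad_disc \<alpha> \<in> {- 4, 4*int d} then 1/2 else 3/4)"
  if dk: "d ~= 1" "odd k"
 proof (rule delta)
  \<comment> \<open>Write D = (-d/p), m = (-1/p), N = (\<nu>/p). The list expands (1 + D)/2 times (3
    + m + N - m N)/4, the indicator that p splits and is 1 modulo 4 or has N = 1.\<close>
  define xs where "xs = [(1/8 :: real, -1), (1/8, \<nu>), (- 1/8, - \<nu>), (3/8, - int d), (1/8, int d), (1/8, - (int d*\<nu>)), (- 1/8, int d*\<nu>)]"
  have av: "avg (%p. 3/8+(\<Sum>(k, \<beta>)\<leftarrow>xs. k * of_int (qchar \<beta> p))) (3/8+(\<Sum>(k, \<beta>)\<leftarrow>xs. k * sq \<beta>))"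
   by (rule avg_linear) (use d_pos n0 in \<open>simp add: xs_def\<close>)
  show "avg (%p. if p \<in> S2 then 1 else 0) (3/8+(\<Sum>(k, \<beta>)\<leftarrow>xs. k * sq \<beta>))"
  proof (rule avg_cong[OF av finE])
   fix p assume p: "prime p" "p \<notin> E"
   have D: "Legendre (- int d) (int p) = 1 | Legendre (- int d) (int p) = -1" "Legendre \<nu> (int p) = 1 | Legendre \<nu> (int p) = -1"
    using good_prime(5,6)[OF p(1) good(1,2)[OF p]] by blast+
   have "p \<in> S2 \<longleftrightarrow> Legendre (- int d) (int p) = 1 & (p mod 4 = 1 | Legendre \<nu> (int p) = 1)"
   proof (cases "Legendre (- int d) (int p) = 1")
    case True
    obtain C where C: "p \<in> S2 \<longleftrightarrow> Legendre C (int p) = 1" "Legendre C (int p) = 1 | Legendre C (int p) = -1"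
     "value_of d k \<theta> \<nu> p C" using split[OF p True] by blast
    have "Legendre C (int p) = (if p mod 4 = 1 then 1 else Legendre \<nu> (int p))" using C(3) dk unfolding value_of_def by blast
    thus ?thesis using C(1) True by simp
   next
    case False
    thus ?thesis using inert[OF p] D(1) by blast
   qed
   thus "(if p \<in> S2 then 1 else 0) = 3/8+(\<Sum>(k, \<beta>)\<leftarrow>xs. k * of_int (qchar \<beta> p))"
    unfolding xs_def using D m[OF p(1) p2[OF p]] by (auto simp: L[OF p(1) p2[OF p]])
  qed
  have sd: "sq (int d) = 0"
  proof -
   have "sq (int d*(1*1\<^sup>2)) = (if 1 = int d then 1 else 0)" by (rule sq_scaled[OF sfd]) simp_all
   thus ?thesis using dk(1) by simp
  qed
  show "(if quad_disc \<alpha> \<in> {1, disc_K d} then 1 else if quad_disc \<alpha> \<in> {- 4, 4*int d} then 1/2 else 3/4) = (3/8+(\<Sum>(k, \<beta>)\<leftarrow>xs. k * sq \<beta>))/(1/2)"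
   unfolding qK q4[OF dk(1)] xs_def using dk(1) d_pos by (auto simp: sqn sqm sqd sd)
 qed
 have even_case: "has_delta 2 a (if quad_disc \<alpha> \<in> {1, disc_K d} then 3/4 else if quad_disc \<alpha> \<in> {- 4, 4*int d} then 1/4 else 1/2)"
  if dk: "d ~= 1" "even k"
 proof (rule delta)
  \<comment> \<open>With D, m, N as in the odd case, this expands (1 + D)(1 - m)(1 + N)/8 for p = 3
    modulo 4 plus (1 + D)(1 + m)/8 for p = 1 modulo 4. In the latter case the symbol of the
    coefficient adds a quarter of the Hecke coefficient, whose mean is 0.\<close>
  define xs where "xs = [(1/4 :: real, - int d), (1/8, \<nu>), (- 1/8, - \<nu>), (1/8, - (int d*\<nu>)), (- 1/8, int d*\<nu>)]"
  have th: "avg (gprime_coeff \<theta>) 0"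
  proof (cases "d = 2")
   case True
   show ?thesis unfolding \<theta>_def using True avg_gprime[OF th2.gauss_char_axioms theta2_sum_bounded] by simp
  next
   case False
   interpret ip: inert_prime d using dd dk(1) False by unfold_locales auto
   show ?thesis unfolding \<theta>_def using False avg_gprime[OF ip.dth.gauss_char_axioms ip.dtheta_sum_bounded] by simp
  qed
  \<comment> \<open>The Hecke term enters the formula at every prime, so it has to vanish unless p
    splits and is 1 modulo 4.\<close>
  have th0: "gprime_coeff \<theta> p = 0" if p: "prime p" "p \<notin> E" "Legendre (- int d) (int p) = -1 | p mod 4 = 3" for p
  proof (cases "d = 2")
   case True
   show ?thesis
   proof (cases "p mod 4 = 3")
    case p3: True
    thus ?thesis unfolding \<theta>_def using True th2.gprime_coeff_inert by simp
   next
    case False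
    hence p41: "p mod 4 = 1" and Lm: "Legendre (- int d) (int p) = -1" using p m(2)[OF p(1) p2[OF p(1,2)]] by auto
    have op: "odd p" using prime_odd_nat[OF p(1) p2[OF p(1,2)]] .
    have "p mod 8 ~= 1"
    proof
     assume p81: "p mod 8 = 1"
     have "Legendre 2 (int p) = jac 2 p" using p(1) by simp
     hence "Legendre 2 (int p) = 1" using jac_two[OF op] p81 by simp
     moreover have "Legendre (- int d) (int p) = Legendre (-1) (int p)*Legendre 2 (int p)"
      unfolding Legendre_mult[OF p(1), symmetric] using True by simp
     ultimately show False using Lm m(1)[OF p(1) p2[OF p(1,2)]] p41 by simp
    qed
    hence "p mod 8 = 5" using p41 by presburger
    thus ?thesis unfolding \<theta>_def using True theta2_nonsplit[OF p(1)] by simp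
   qed
  next
   case False
   interpret ip: inert_prime d using dd dk(1) False by unfold_locales auto
   have "gprime_coeff ip.dtheta p = 0"
    using ip.dth.gprime_coeff_inert[of p] ip.dtheta_nonsplit[OF p(1)] p(3) m(2)[OF p(1) p2[OF p(1,2)]] by blast
   thus ?thesis unfolding \<theta>_def using False by simp
  qed
  have av: "avg (%p. 1/4+(\<Sum>(k, \<beta>)\<leftarrow>xs. k * of_int (qchar \<beta> p))) (1/4+(\<Sum>(k, \<beta>)\<leftarrow>xs. k * sq \<beta>))"
   by (rule avg_linear) (use d_pos n0 in \<open>simp add: xs_def\<close>)
  note av2 = avg_add[OF av avg_cmult[OF th, of "1/4"]]
  have "avg (%p. if p \<in> S2 then 1 else 0) (1/4+(\<Sum>(k, \<beta>)\<leftarrow>xs. k * sq \<beta>)+1/4*0)"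
  proof (rule avg_cong[OF av2 finE])
   fix p assume p: "prime p" "p \<notin> E"
   have D: "Legendre (- int d) (int p) = 1 | Legendre (- int d) (int p) = -1" "Legendre \<nu> (int p) = 1 | Legendre \<nu> (int p) = -1"
    using good_prime(5,6)[OF p(1) good(1,2)[OF p]] by blast+
   note Lp = L[OF p(1) p2[OF p]] and mp = m[OF p(1) p2[OF p]]
   consider "Legendre (- int d) (int p) = -1" | "Legendre (- int d) (int p) = 1" "p mod 4 = 3" | "Legendre (- int d) (int p) = 1" "p mod 4 = 1"
    using D mp(2) by blast
   thus "(if p \<in> S2 then 1 else 0) = 1/4+(\<Sum>(k, \<beta>)\<leftarrow>xs. k * of_int (qchar \<beta> p))+1/4*gprime_coeff \<theta> p"
   proof cases
    case 1
    hence "p \<notin> S2" "gprime_coeff \<theta> p = 0" using inert[OF p] th0[OF p] by auto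
    thus ?thesis unfolding xs_def using 1 D(2) mp by (auto simp: Lp)
   next
    case 2
    obtain C where C: "p \<in> S2 \<longleftrightarrow> Legendre C (int p) = 1" "Legendre C (int p) = 1 | Legendre C (int p) = -1"
     "value_of d k \<theta> \<nu> p C" using split[OF p 2(1)] by blast
    have "Legendre C (int p) = Legendre \<nu> (int p)" using C(3) dk 2(2) unfolding value_of_def by blast
    hence "p \<in> S2 \<longleftrightarrow> Legendre \<nu> (int p) = 1" using C(1) by simp
    moreover have "gprime_coeff \<theta> p = 0" using th0[OF p] 2(2) by blast
    ultimately show ?thesis unfolding xs_def using 2 D(2) mp by (auto simp: Lp)
   next
    case 3
    obtain C where C: "p \<in> S2 \<longleftrightarrow> Legendre C (int p) = 1" "Legendre C (int p) = 1 | Legendre C (int p) = -1"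
     "value_of d k \<theta> \<nu> p C" using split[OF p 3(1)] by blast
    have C5: "2 * of_int (Legendre C (int p)) = gprime_coeff \<theta> p" using C(3) dk 3(2) unfolding value_of_def by blast
    show ?thesis unfolding xs_def C5[symmetric] using C(1,2) 3 D(2) mp by (auto simp: Lp)
   qed
  qed
  thus "avg (%p. if p \<in> S2 then 1 else 0) (1/4+(\<Sum>(k, \<beta>)\<leftarrow>xs. k * sq \<beta>))" by simp
  show "(if quad_disc \<alpha> \<in> {1, disc_K d} then 3/4 else if quad_disc \<alpha> \<in> {- 4, 4*int d} then 1/4 else 1/2) = (1/4+(\<Sum>(k, \<beta>)\<leftarrow>xs. k * sq \<beta>))/(1/2)"
   unfolding qK q4[OF dk(1)] xs_def using dk(1) d_pos by (auto simp: sqn sqm sqd)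
 qed
 have one_case: "has_delta 2 a (if quad_disc \<alpha> \<in> {1, - 4} then 1 else if quad_disc \<alpha> \<in> {8, - 8} then 1/2 else 3/4)"
  if d1: "d = 1"
 proof (rule delta)
  \<comment> \<open>With t = (2/p), this expands (1 + m)/2 times (3 + t + N - t N)/4: p is 1 modulo
    4, and t = 1 or N = 1.\<close>
  define xs where "xs = [(1/8 :: real, 2), (1/8, \<nu>), (- 1/8, 2*\<nu>), (3/8, -1), (1/8, -2), (1/8, - \<nu>), (- 1/8, - (2*\<nu>))]"
  have av: "avg (%p. 3/8+(\<Sum>(k, \<beta>)\<leftarrow>xs. k * of_int (qchar \<beta> p))) (3/8+(\<Sum>(k, \<beta>)\<leftarrow>xs. k * sq \<beta>))"
   by (rule avg_linear) (use n0 in \<open>simp add: xs_def\<close>)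
  show "avg (%p. if p \<in> S2 then 1 else 0) (3/8+(\<Sum>(k, \<beta>)\<leftarrow>xs. k * sq \<beta>))"
  proof (rule avg_cong[OF av finE])
   fix p assume p: "prime p" "p \<notin> E"
   note Lp = L[OF p(1) p2[OF p]] and mp = m[OF p(1) p2[OF p]]
   have op: "odd p" using prime_odd_nat[OF p(1) p2[OF p]] .
   have D: "Legendre \<nu> (int p) = 1 | Legendre \<nu> (int p) = -1" using good_prime(6)[OF p(1) good(1,2)[OF p]] .
   have dm: "Legendre (- int d) (int p) = Legendre (-1) (int p)" using d1 by simp
   have "Legendre 2 (int p) = jac 2 p" using p(1) by simp
   hence t: "Legendre 2 (int p) = (if p mod 8 = 1 then 1 else -1)" if "p mod 4 = 1"
   proof -
    have "p mod 8 = 1 | p mod 8 = 5" using that by presburger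
    thus ?thesis using \<open>Legendre 2 (int p) = jac 2 p\<close> jac_two[OF op] by auto
   qed
   have "~ int p dvd 2" using p2[OF p] by (auto dest!: zdvd_imp_le)
   hence t2: "Legendre 2 (int p) = 1 | Legendre 2 (int p) = -1" using Legendre_cases[of 2 "int p"] Legendre_eq_0_iff by blast
   show "(if p \<in> S2 then 1 else 0) = 3/8+(\<Sum>(k, \<beta>)\<leftarrow>xs. k * of_int (qchar \<beta> p))"
   proof (cases "p mod 4 = 1")
    case True
    have L1: "Legendre (- int d) (int p) = 1" using dm mp(1) True by simp
    obtain C where C: "p \<in> S2 \<longleftrightarrow> Legendre C (int p) = 1" "Legendre C (int p) = 1 | Legendre C (int p) = -1"
     "value_of d k \<theta> \<nu> p C" using split[OF p L1] by blast
    have "Legendre C (int p) = (if p mod 8 = 1 then 1 else Legendre \<nu> (int p))" using C(3) d1 unfolding value_of_def by blast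
    hence "p \<in> S2 \<longleftrightarrow> Legendre 2 (int p) = 1 | Legendre \<nu> (int p) = 1" using C(1) t[OF True] by auto
    thus ?thesis unfolding xs_def using D t2 mp(1) True by (auto simp: Lp)
   next
    case False
    hence "Legendre (- int d) (int p) = -1" using dm mp(1) by simp
    hence "p \<notin> S2" using inert[OF p] by blast
    thus ?thesis unfolding xs_def using D t2 mp(1) False by (auto simp: Lp)
   qed
  qed
  have e: "disc_of 1 = 1" "disc_of (-1) = -4" "disc_of 2 = 8" "disc_of (-2) = -8" by (simp_all add: disc_of_def)
  have "disc_of \<beta> = 1 \<longleftrightarrow> \<beta> = 1" "disc_of \<beta> = -4 \<longleftrightarrow> \<beta> = -1" "disc_of \<beta> = 8 \<longleftrightarrow> \<beta> = 2" "disc_of \<beta> = -8 \<longleftrightarrow> \<beta> = -2"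
   using disc_of_inj[of \<beta> 1] disc_of_inj[of \<beta> "-1"] disc_of_inj[of \<beta> 2] disc_of_inj[of \<beta> "-2"] unfolding e .
  hence q: "quad_disc \<alpha> \<in> {1, - 4} \<longleftrightarrow> \<beta> = 1 | \<beta> = -1" "quad_disc \<alpha> \<in> {8, - 8} \<longleftrightarrow> \<beta> = 2 | \<beta> = -2"
   unfolding qd by simp_all
  have s2: "sq 2 = 0" "sq (- 2) = 0"
  proof -
   have "sq (2*(1*1\<^sup>2)) = (if (1::int) = 2 then 1 else 0)" by (rule sq_scaled[OF sf2]) simp_all
   thus "sq 2 = 0" by simp
   show "sq (- 2) = 0" using sq_neg[of 2] by simp
  qed
  show "(if quad_disc \<alpha> \<in> {1, - 4} then 1 else if quad_disc \<alpha> \<in> {8, - 8} then 1/2 else 3/4) = (3/8+(\<Sum>(k, \<beta>)\<leftarrow>xs. k * sq \<beta>))/(1/2)"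
   unfolding q xs_def by (auto simp: sqn sqm s2)
 qed
 show ?thesis
  by (intro conjI impI, elim conjE, rule even_case, assumption+, elim conjE, rule odd_case, assumption+, rule one_case, assumption)
qed

end
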